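(* Let $0\le k\le n$, let $\gamma$ be a radially symmetric Gaussian measure on $\mathbb R^n$ centered at the origin with density $\rho$ (a positive constant multiple of $e^{-A|x|^2}$ for some $A>0$), and let $X\subset\mathbb R^n$ be a non-empty $k$-dimensional smooth properly embedded submanifold that is $\rho$-critical. Then for all $t>0$ $$\gamma(X+t)\ \ge\ \gamma(\mathbb R^k+t).$$
   Context: A smooth submanifold $X\subset\mathbb R^n$ is properly embedded if it is an embedded submanifold without boundary that is a closed subset of $\mathbb R^n$. A $k$-dimensional submanifold $X$ is $\rho$-critical if it is a critical point of the $\rho$-weighted $k$-dimensional Riemannian volume $\int_X\rho\,d\mathrm{vol}_k$, i.e. the first variation of this functional vanishes for every compactly supported smooth variation of $X$. For a set $Y\subset\mathbb R^n$, $Y+t$ denotes its $t$-neighborhood in the Euclidean metric (points at distance at most $t$ from $Y$). $\mathbb R^k\subset\mathbb R^n$ denotes any $k$-dimensional linear subspace. *)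

theory Defs
  imports "HOL-Analysis.Analysis"
begin

section \<open>Smooth maps\<close>

text \<open>
  On an open set of a finite-dimensional space the following is the class \<open>C\<^sup>m\<close>: a map is \<open>C\<^sup>m\<^sup>+\<^sup>1\<close>
  iff it is differentiable and all its directional derivatives are \<open>C\<^sup>m\<close>.
\<close>

primrec times_differentiable_on ::
    "nat \<Rightarrow> 'a::real_normed_vector set \<Rightarrow> ('a \<Rightarrow> 'b::real_normed_vector) \<Rightarrow> bool" where
  "times_differentiable_on 0 S f \<longleftrightarrow> continuous_on S f"
| "times_differentiable_on (Suc m) S f \<longleftrightarrow>
     (\<forall>x\<in>S. f differentiable (at x)) \<and>
     (\<forall>v. times_differentiable_on m S (\<lambda>x. frechet_derivative f (at x) v))"

definition smooth_on_open ::
    "'a::euclidean_space set \<Rightarrow> ('a \<Rightarrow> 'b::euclidean_space) \<Rightarrow> bool" where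
  "smooth_on_open U f \<longleftrightarrow> open U \<and> (\<forall>m. times_differentiable_on m U f)"

text \<open>Smoothness on an arbitrary subset: local extendability to a smooth map of the ambient space.\<close>

definition smooth_map_on ::
    "'a::euclidean_space set \<Rightarrow> ('a \<Rightarrow> 'b::euclidean_space) \<Rightarrow> bool" where
  "smooth_map_on S f \<longleftrightarrow>
     (\<forall>p\<in>S. \<exists>U g. p \<in> U \<and> smooth_on_open U g \<and> (\<forall>x\<in>S \<inter> U. f x = g x))"


section \<open>Embedded submanifolds\<close>

text \<open>
  The model of \<open>\<real>\<^sup>k\<close> is a coordinate subspace \<^term>\<open>span I\<close> with \<open>I \<subseteq> Basis\<close>, \<open>card I = k\<close>; in this way
  \<open>k\<close> is an ordinary natural number, which may be \<open>0\<close>. A slice chart is a diffeomorphism \<open>\<Phi> : U \<rightarrow> V\<close>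
  of open sets, with inverse \<open>\<Psi>\<close>, that carries \<open>U \<inter> X\<close> onto \<open>V \<inter> span I\<close>.
\<close>

definition slice_chart ::
    "nat \<Rightarrow> 'a::euclidean_space set \<Rightarrow> 'a set \<Rightarrow> 'a set \<Rightarrow> 'a set \<Rightarrow> ('a \<Rightarrow> 'a) \<Rightarrow> ('a \<Rightarrow> 'a) \<Rightarrow> bool" where
  "slice_chart k X I U V \<Phi> \<Psi> \<longleftrightarrow>
     I \<subseteq> Basis \<and> card I = k \<and>
     homeomorphism U V \<Phi> \<Psi> \<and> smooth_on_open U \<Phi> \<and> smooth_on_open V \<Psi> \<and>
     \<Phi> ` (U \<inter> X) = V \<inter> span I"

definition embedded_submanifold :: "nat \<Rightarrow> 'a::euclidean_space set \<Rightarrow> bool" where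
  "embedded_submanifold k X \<longleftrightarrow> (\<forall>p\<in>X. \<exists>I U V \<Phi> \<Psi>. p \<in> U \<and> slice_chart k X I U V \<Phi> \<Psi>)"

definition properly_embedded_submanifold :: "nat \<Rightarrow> 'a::euclidean_space set \<Rightarrow> bool" where
  "properly_embedded_submanifold k X \<longleftrightarrow> embedded_submanifold k X \<and> closed X"


section \<open>Riemannian volume\<close>

text \<open>
  Lebesgue measure of the coordinate subspace \<^term>\<open>span I\<close>, as a Borel measure on the whole space;
  compare the definition of \<^const>\<open>lborel\<close>. For \<open>I = {}\<close> it is the unit mass at \<open>0\<close>.
\<close>

definition lborel_on :: "'a::euclidean_space set \<Rightarrow> 'a measure" where
  "lborel_on I = distr (\<Pi>\<^sub>M b\<in>I. lborel) borel (\<lambda>f. \<Sum>b\<in>I. f b *\<^sub>R b)"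

text \<open>Leibniz formula for the determinant of the Gram matrix of the vectors \<open>v i\<close>, \<open>i \<in> I\<close>.\<close>

definition gram_det :: "'i set \<Rightarrow> ('i \<Rightarrow> 'a::real_inner) \<Rightarrow> real" where
  "gram_det I v = (\<Sum>p | p permutes I. of_int (sign p) * (\<Prod>i\<in>I. v i \<bullet> v (p i)))"

text \<open>
  The Riemannian volume of \<open>U \<inter> X\<close> in the parametrization \<open>\<Psi>\<close> by \<open>V \<inter> span I\<close>: the push-forward of
  \<open>sqrt (det g) dy\<close>, where \<open>g\<close> is the matrix of the induced metric. The value \<open>0\<close> outside \<open>V\<close> is
  immaterial, the density vanishes there.
\<close>

definition chart_volume :: "'a::euclidean_space set \<Rightarrow> 'a set \<Rightarrow> ('a \<Rightarrow> 'a) \<Rightarrow> 'a measure" where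
  "chart_volume I V \<Psi> =
     distr
       (density (lborel_on I)
         (\<lambda>y. indicator V y * ennreal (sqrt (gram_det I (\<lambda>b. frechet_derivative \<Psi> (at y) b)))))
       borel (\<lambda>y. if y \<in> V then \<Psi> y else 0)"

text \<open>
  The chart volumes agree on overlaps of charts. Gluing them is taking their supremum in the complete
  lattice of measures: the least Borel measure that dominates the volume in each chart is
  concentrated on \<open>X\<close> and coincides on each \<open>U\<close> with the volume in that chart.
\<close>

definition riemannian_volume :: "nat \<Rightarrow> 'a::euclidean_space set \<Rightarrow> 'a measure" where
  "riemannian_volume k X = Sup {chart_volume I V \<Psi> | I U V \<Phi> \<Psi>. slice_chart k X I U V \<Phi> \<Psi>}"


section \<open>Critical points of the weighted volume\<close>

text \<open>
  A smooth variation \<open>F s\<close>, \<open>\<bar>s\<bar> < \<epsilon>\<close>, of \<open>X\<close> through embedded submanifolds, supported in the compact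
  set \<open>K \<subseteq> X\<close>.
\<close>

definition compactly_supported_variation ::
    "nat \<Rightarrow> 'a::euclidean_space set \<Rightarrow> real \<Rightarrow> 'a set \<Rightarrow> (real \<Rightarrow> 'a \<Rightarrow> 'a) \<Rightarrow> bool" where
  "compactly_supported_variation k X \<epsilon> K F \<longleftrightarrow>
     \<epsilon> > 0 \<and> compact K \<and> K \<subseteq> X \<and>
     smooth_map_on ({-\<epsilon><..<\<epsilon>} \<times> X) (\<lambda>(s, x). F s x) \<and>
     (\<forall>x\<in>X. F 0 x = x) \<and>
     (\<forall>s\<in>{-\<epsilon><..<\<epsilon>}. (\<forall>x\<in>X - K. F s x = x) \<and> inj_on (F s) X \<and> embedded_submanifold k (F s ` X))"

text \<open>
  The weighted volume of \<open>X\<close> may be infinite. As usual, the first variation is that of the volume of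
  the part \<open>F s ` K\<close>, outside of which nothing moves.
\<close>

definition weighted_critical :: "nat \<Rightarrow> ('a::euclidean_space \<Rightarrow> real) \<Rightarrow> 'a set \<Rightarrow> bool" where
  "weighted_critical k \<rho> X \<longleftrightarrow>
     (\<forall>\<epsilon> K F. compactly_supported_variation k X \<epsilon> K F \<longrightarrow>
        ((\<lambda>s. LINT x:F s ` K|riemannian_volume k (F s ` X). \<rho> x) has_real_derivative 0) (at 0))"


section \<open>Gaussian measures and neighborhoods\<close>

definition gaussian_density :: "real \<Rightarrow> real \<Rightarrow> 'a::euclidean_space \<Rightarrow> real" where
  "gaussian_density c A x = c * exp (- A * (norm x)\<^sup>2)"

definition gaussian_measure :: "real \<Rightarrow> real \<Rightarrow> 'a::euclidean_space measure" where
  "gaussian_measure c A = density lborel (\<lambda>x. ennreal (gaussian_density c A x))"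

text \<open>Used for nonempty \<open>Y\<close> only, since \<^term>\<open>infdist x {} = 0\<close>.\<close>

definition neighborhood :: "'a::metric_space set \<Rightarrow> real \<Rightarrow> 'a set" where
  "neighborhood Y t = {x. infdist x Y \<le> t}"

end

theory Submission
  imports Defs "HOL-Probability.Distributions"
begin

text \<open>
  Let \<open>u y = (infdist y X)\<^sup>2 / 2\<close> and \<open>N = n - k\<close>, and let \<open>L f = \<Delta> f - 2 A \<langle>x, \<nabla> f\<rangle>\<close> be the operator that is
  symmetric with respect to the Gaussian measure. The proof compares the distributions, under the Gaussian
  measure, of \<open>u\<close> and of the corresponding function for the subspace.

  Let \<open>p\<close> be a point of \<open>X\<close> nearest to \<open>y\<close>. Then \<open>v = y - p\<close> is normal to \<open>X\<close>. The function
  \<open>y' \<mapsto> (norm (y' - p'))\<^sup>2 / 2\<close>, where \<open>p'\<close> is the point of \<open>X\<close> reached from \<open>p\<close> by following the tangential part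
  of \<open>y' - y\<close>, touches \<open>u\<close> from above at \<open>y\<close>. Its Laplacian is \<open>N - \<langle>H, v\<rangle>\<close> with the mean curvature vector
  \<open>H\<close> at \<open>p\<close>, and criticality says that \<open>H\<close> is \<open>- 2 A\<close> times the normal part of \<open>p\<close>
  (\<open>critical_mean_curvature\<close>). Therefore \<open>L u \<le> N + 2 A \<langle>p, v\<rangle> - 2 A \<langle>y, v\<rangle> = N - 4 A u\<close> in the sense of upper
  barriers, while \<open>\<bar>\<nabla> u\<bar>\<^sup>2 = 2 u\<close> (\<open>infdist_critical_supersolution\<close>). For a subspace \<open>u\<close> is a quadratic
  polynomial and equality holds (\<open>infdist_subspace_solution\<close>).

  For an increasing \<open>h\<close> it follows that \<open>L (h \<circ> u) \<le> 2 u h'' + (N - 4 A u) h'\<close>, with equality for the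
  subspace. The integral of \<open>L f\<close> vanishes for smooth \<open>f\<close> of moderate growth; for \<open>f = h \<circ> u\<close>, which need not be
  differentiable, the integral of the barrier bound is nonnegative (\<open>drift_laplacian_integral_nonneg\<close>): replace
  \<open>L\<close> by a symmetric difference operator, whose integral is exactly zero, and apply Fatou's lemma. The cut
  locus of \<open>X\<close> thus never enters. Solving \<open>2 s h'' + (N - 4 A s) h' = p\<close> for suitable \<open>p\<close> shows that the density
  of the distribution of \<open>u\<close> relative to the distribution for the subspace is nonincreasing
  (\<open>bump_comparison\<close>). Both distributions have the same total mass, so that \<open>{u \<le> t\<^sup>2 / 2}\<close>, which is the
  \<open>t\<close>-neighborhood of \<open>X\<close>, has at least the measure of the \<open>t\<close>-neighborhood of the subspace
  (\<open>sublevel_comparison\<close>). In codimension \<open>0\<close> the submanifold is the whole space.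

  The equation for \<open>H\<close> has to be extracted from the definition of criticality. The supremum of all chart
  volumes restricts to the chart volume on the domain of each chart (\<open>emeasure_riemannian_volume\<close>), by the change
  of variables formula for transition maps. A chart is then sheared in a direction transversal to the coordinate
  subspace by a bump function; this is a variation of \<open>X\<close> through submanifolds, whose weighted area is an
  explicit integral over the coordinate subspace (\<open>weighted_area\<close>). Differentiating under the integral and
  integrating by parts gives the Euler-Lagrange equation, which is evaluated in a chart that is isometric at the
  given point (\<open>exists_isometric_chart\<close>), where all metric terms disappear.
\<close>

section \<open>Calculus of maps of class \<open>C\<^sup>m\<close>\<close>

lemma frechet_derivative_worksI:
  "f differentiable net \<Longrightarrow> (f has_derivative frechet_derivative f net) net"
  by (simp add: frechet_derivative_works)

lemma times_differentiable_on_cong: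
  assumes "open S" "\<And>x. x \<in> S \<Longrightarrow> f x = g x"
  shows "times_differentiable_on m S f \<longleftrightarrow> times_differentiable_on m S g"
proof -
  have "times_differentiable_on m S g" if "times_differentiable_on m S f" "\<And>x. x \<in> S \<Longrightarrow> f x = g x"
    for f g :: "'a \<Rightarrow> 'b"
    using that
  proof (induction m arbitrary: f g)
    case 0
    then show ?case using continuous_on_cong[of S S f g] by simp
  next
    case (Suc m)
    have d: "(g has_derivative frechet_derivative f (at x)) (at x)" if x: "x \<in> S" for x
      by (rule has_derivative_transform_within_open[where f = f, OF _ \<open>open S\<close> x])
         (use Suc.prems x frechet_derivative_worksI in auto)
    then have eq: "frechet_derivative g (at x) = frechet_derivative f (at x)" if "x \<in> S" for x
      using frechet_derivative_at that by metis
    have "times_differentiable_on m S (\<lambda>x. frechet_derivative g (at x) v)" for v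
      by (rule Suc.IH[of "\<lambda>x. frechet_derivative f (at x) v"]) (use Suc.prems eq in auto)
    then show ?case using d unfolding times_differentiable_on.simps differentiable_def by blast
  qed
  then show ?thesis using assms by metis
qed

lemma times_differentiable_on_subset:
  "times_differentiable_on m S f \<Longrightarrow> T \<subseteq> S \<Longrightarrow> times_differentiable_on m T f"
  by (induction m arbitrary: f) (auto intro: continuous_on_subset)

lemma times_differentiable_on_SucD:
  "times_differentiable_on (Suc m) S f \<Longrightarrow> times_differentiable_on m S f"
proof (induction m arbitrary: f)
  case 0
  then show ?case
    by (auto intro!: continuous_at_imp_continuous_on differentiable_imp_continuous_within)
next
  case (Suc m)
  then show ?case by (metis times_differentiable_on.simps(2))
qed

lemma times_differentiable_on_le:
  "times_differentiable_on m S f \<Longrightarrow> l \<le> m \<Longrightarrow> times_differentiable_on l S f"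
  by (induction m) (auto simp: le_Suc_eq dest: times_differentiable_on_SucD simp del: times_differentiable_on.simps)

lemma times_differentiable_on_SucI:
  assumes "open S" "\<And>x. x \<in> S \<Longrightarrow> (f has_derivative f' x) (at x)"
    and "\<And>v. times_differentiable_on m S (\<lambda>x. f' x v)"
  shows "times_differentiable_on (Suc m) S f"
proof -
  have eq: "frechet_derivative f (at x) = f' x" if "x \<in> S" for x
    using assms(2)[OF that] frechet_derivative_at by metis
  have "times_differentiable_on m S (\<lambda>x. frechet_derivative f (at x) v)" for v
    using times_differentiable_on_cong[OF assms(1), of "\<lambda>x. f' x v" "\<lambda>x. frechet_derivative f (at x) v" m]
      assms(3)[of v] eq by simp
  then show ?thesis using assms(2) unfolding times_differentiable_on.simps differentiable_def by blast
qed

lemma times_differentiable_on_has_derivative: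
  assumes "times_differentiable_on m S f" "1 \<le> m" "x \<in> S"
  shows "(f has_derivative frechet_derivative f (at x)) (at x)"
  using assms by (cases m) (auto simp: frechet_derivative_works)

lemma times_differentiable_on_derivative:
  assumes "times_differentiable_on m S f" "Suc l \<le> m"
  shows "times_differentiable_on l S (\<lambda>x. frechet_derivative f (at x) v)"
  using times_differentiable_on_le[OF assms] by simp

lemma times_differentiable_on_continuous:
  "times_differentiable_on m S f \<Longrightarrow> continuous_on S f"
  using times_differentiable_on_le[of m S f 0] by simp

lemma times_differentiable_on_const:
  assumes "open S" shows "times_differentiable_on m S (\<lambda>x. c)"
proof (induction m arbitrary: c)
  case (Suc m)
  then show ?case
    by (intro times_differentiable_on_SucI[OF assms, where f' = "\<lambda>x v. 0"]) auto
qed simp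

lemma times_differentiable_on_bounded_linear:
  assumes "open S" "bounded_linear L" shows "times_differentiable_on m S L"
proof (cases m)
  case 0
  then show ?thesis
    using assms(2) by (simp add: linear_continuous_on)
next
  case (Suc l)
  then show ?thesis
    using assms
    by (auto intro!: times_differentiable_on_SucI[where f' = "\<lambda>x. L"] times_differentiable_on_const
        bounded_linear_imp_has_derivative simp del: times_differentiable_on.simps)
qed

lemma times_differentiable_on_ident:
  "open S \<Longrightarrow> times_differentiable_on m S (\<lambda>x. x)"
  by (rule times_differentiable_on_bounded_linear) auto

lemma times_differentiable_on_add:
  assumes "open S" "times_differentiable_on m S f" "times_differentiable_on m S g"
  shows "times_differentiable_on m S (\<lambda>x. f x + g x)"
  using assms(2,3)
proof (induction m arbitrary: f g)
  case 0
  then show ?case by (auto intro: continuous_intros)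
next
  case (Suc m)
  show ?case
    by (rule times_differentiable_on_SucI[OF assms(1)], rule has_derivative_add)
       (use Suc in \<open>auto simp: frechet_derivative_works\<close>)
qed

lemma times_differentiable_on_sum:
  assumes "open S" "\<And>i. i \<in> I \<Longrightarrow> times_differentiable_on m S (f i)"
  shows "times_differentiable_on m S (\<lambda>x. \<Sum>i\<in>I. f i x)"
  using assms(2)
  by (induction I rule: infinite_finite_induct)
     (auto intro!: times_differentiable_on_add times_differentiable_on_const assms(1))

lemma times_differentiable_on_bilinear:
  assumes "open S" "bounded_bilinear B"
    and "times_differentiable_on m S f" "times_differentiable_on m S g"
  shows "times_differentiable_on m S (\<lambda>x. B (f x) (g x))"
  using assms(3,4)
proof (induction m arbitrary: f g)
  case 0
  then show ?case by (auto intro: bounded_bilinear.continuous_on[OF assms(2)])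
next
  case (Suc m)
  show ?case
  proof (rule times_differentiable_on_SucI[OF assms(1)])
    fix x assume "x \<in> S"
    then show "((\<lambda>x. B (f x) (g x)) has_derivative
        (\<lambda>h. B (f x) (frechet_derivative g (at x) h) + B (frechet_derivative f (at x) h) (g x))) (at x)"
      using Suc.prems by (intro bounded_bilinear.FDERIV[OF assms(2)]) (auto simp: frechet_derivative_works)
  next
    fix v
    show "times_differentiable_on m S
       (\<lambda>x. B (f x) (frechet_derivative g (at x) v) + B (frechet_derivative f (at x) v) (g x))"
      using Suc.prems Suc.prems[THEN times_differentiable_on_SucD]
      by (intro times_differentiable_on_add assms(1) Suc.IH) auto
  qed
qed

lemmas times_differentiable_on_scaleR =
    times_differentiable_on_bilinear[OF _ bounded_bilinear_scaleR]
  and times_differentiable_on_mult =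
    times_differentiable_on_bilinear[OF _ bounded_bilinear_mult]
  and times_differentiable_on_inner =
    times_differentiable_on_bilinear[OF _ bounded_bilinear_inner]

lemma times_differentiable_on_prod:
  fixes f :: "'i \<Rightarrow> 'a::real_normed_vector \<Rightarrow> real"
  assumes "open S" "\<And>i. i \<in> I \<Longrightarrow> times_differentiable_on m S (f i)"
  shows "times_differentiable_on m S (\<lambda>x. \<Prod>i\<in>I. f i x)"
  using assms(2)
  by (induction I rule: infinite_finite_induct)
     (auto intro!: times_differentiable_on_mult times_differentiable_on_const assms(1))

text \<open>
  The derivative of \<open>g \<circ> f\<close> in direction \<open>v\<close> is the sum of the coordinates of \<open>f' v\<close> times the partial
  derivatives of \<open>g\<close> composed with \<open>f\<close>; this is what the induction on the order of differentiability
  can use.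
\<close>

lemma times_differentiable_on_compose:
  fixes f :: "'a::real_normed_vector \<Rightarrow> 'b::euclidean_space" and g :: "'b \<Rightarrow> 'c::real_normed_vector"
  assumes "open S" and "f ` S \<subseteq> T"
    and "times_differentiable_on m S f" "times_differentiable_on m T g"
  shows "times_differentiable_on m S (\<lambda>x. g (f x))"
  using assms(3,4)
proof (induction m arbitrary: g)
  case 0
  then show ?case using continuous_on_compose2[of T g S f] assms(2) by auto
next
  case (Suc m)
  have df: "(f has_derivative frechet_derivative f (at x)) (at x)" if "x \<in> S" for x
    using Suc.prems that by (auto simp: frechet_derivative_works)
  have dg: "(g has_derivative frechet_derivative g (at y)) (at y)" if "y \<in> T" for y
    using Suc.prems that by (auto simp: frechet_derivative_works)
  show ?case
  proof (rule times_differentiable_on_SucI[OF assms(1)])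
    fix x assume x: "x \<in> S"
    have lin: "linear (frechet_derivative g (at (f x)))"
      using dg assms(2) x by (meson has_derivative_linear image_subset_iff)
    have "((\<lambda>x. g (f x)) has_derivative (\<lambda>v. frechet_derivative g (at (f x)) (frechet_derivative f (at x) v))) (at x)"
      using has_derivative_compose[OF df[OF x]] dg assms(2) x by blast
    also have "(\<lambda>v. frechet_derivative g (at (f x)) (frechet_derivative f (at x) v)) =
      (\<lambda>v. \<Sum>b\<in>Basis. (frechet_derivative f (at x) v \<bullet> b) *\<^sub>R frechet_derivative g (at (f x)) b)"
      (is "?l = ?r")
    proof
      fix v
      have "?l v = frechet_derivative g (at (f x)) (\<Sum>b\<in>Basis. (frechet_derivative f (at x) v \<bullet> b) *\<^sub>R b)"
        by (simp add: euclidean_representation)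
      also have "\<dots> = ?r v" by (simp add: linear_sum[OF lin] linear_scale[OF lin])
      finally show "?l v = ?r v" .
    qed
    finally show "((\<lambda>x. g (f x)) has_derivative ?r) (at x)" .
  next
    fix v
    have "times_differentiable_on m S (\<lambda>x. frechet_derivative g (at (f x)) b)" for b
      using Suc.prems by (intro Suc.IH times_differentiable_on_SucD[OF Suc.prems(1)]) auto
    moreover have "times_differentiable_on m S (\<lambda>x. frechet_derivative f (at x) v \<bullet> b)" for b
      using Suc.prems by (intro times_differentiable_on_inner times_differentiable_on_const assms(1)) auto
    ultimately show "times_differentiable_on m S
        (\<lambda>x. \<Sum>b\<in>Basis. (frechet_derivative f (at x) v \<bullet> b) *\<^sub>R frechet_derivative g (at (f x)) b)"
      by (intro times_differentiable_on_sum times_differentiable_on_scaleR assms(1))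
  qed
qed

lemma times_differentiable_on_linear_compose:
  assumes "open S" "bounded_linear L" "times_differentiable_on m S f"
  shows "times_differentiable_on m S (\<lambda>x. L (f x))"
  using assms(3)
proof (induction m arbitrary: f)
  case 0
  then show ?case using bounded_linear.continuous_on[OF assms(2)] by auto
next
  case (Suc m)
  show ?case
    by (rule times_differentiable_on_SucI[OF assms(1)], rule bounded_linear.has_derivative[OF assms(2)])
       (use Suc in \<open>auto simp: frechet_derivative_works\<close>)
qed

lemma times_differentiable_on_Pair:
  assumes "open S" "times_differentiable_on m S f" "times_differentiable_on m S g"
  shows "times_differentiable_on m S (\<lambda>x. (f x, g x))"
proof -
  have "bounded_linear (\<lambda>x. (x, 0))" "bounded_linear (\<lambda>y. (0, y))"
    by (intro bounded_linear_Pair bounded_linear_ident bounded_linear_zero)+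
  then have "times_differentiable_on m S (\<lambda>x. (f x, 0) + (0, g x))"
    by (intro times_differentiable_on_add times_differentiable_on_linear_compose[where L = "\<lambda>x. (x, 0)"]
        times_differentiable_on_linear_compose[where L = "\<lambda>x. (0, x)"] assms)
  then show ?thesis by simp
qed

lemma times_differentiable_on_fst:
  "open S \<Longrightarrow> times_differentiable_on m S (\<lambda>x. fst x)"
  and times_differentiable_on_snd:
  "open S \<Longrightarrow> times_differentiable_on m S (\<lambda>x. snd x)"
  by (auto intro: times_differentiable_on_bounded_linear bounded_linear_fst bounded_linear_snd)

lemma times_differentiable_on_real_derivative:
  fixes f :: "real \<Rightarrow> real"
  assumes "open S" "\<And>x. x \<in> S \<Longrightarrow> (f has_real_derivative f' x) (at x)" "times_differentiable_on m S f'"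
  shows "times_differentiable_on (Suc m) S f"
  by (rule times_differentiable_on_SucI[where f' = "\<lambda>x v. f' x * v"])
     (use assms in \<open>auto simp: has_field_derivative_def intro!: times_differentiable_on_mult times_differentiable_on_const\<close>)

lemma times_differentiable_on_exp:
  "open S \<Longrightarrow> times_differentiable_on m S (exp :: real \<Rightarrow> real)"
proof (induction m)
  case (Suc m)
  then show ?case by (intro times_differentiable_on_real_derivative[where f' = exp]) auto
qed (auto intro: continuous_intros)

lemma times_differentiable_on_powr:
  "times_differentiable_on m {0<..} (\<lambda>x::real. x powr a)"
proof (induction m arbitrary: a)
  case (Suc m)
  then show ?case
    by (intro times_differentiable_on_real_derivative[where f' = "\<lambda>x. a * x powr (a - 1)"]
        times_differentiable_on_mult times_differentiable_on_const)
      (auto intro!: derivative_eq_intros)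
qed (auto intro!: continuous_intros)

text \<open>The family is closed under differentiation up to linear combinations, hence consists of
  \<open>C\<^sup>\<infinity>\<close> functions; the member with \<open>j = 0\<close> is the standard ingredient of bump functions.\<close>

definition flat_exp :: "nat \<Rightarrow> real \<Rightarrow> real" where
  "flat_exp j x = (if x > 0 then exp (- 1 / x) / x ^ j else 0)"

lemma flat_exp_nonneg: "flat_exp j x \<ge> 0"
  by (simp add: flat_exp_def)

text \<open>One term of the exponential series at \<open>1 / x\<close> bounds \<open>(1 / x) ^ (j + 2)\<close> by \<open>fact (j + 2) * exp (1 / x)\<close>. The
  quadratic bound shows that all members are differentiable at \<open>0\<close> with derivative \<open>0\<close>.\<close>

lemma flat_exp_le: "flat_exp j x \<le> fact (j + 2) * x ^ 2" if "x > 0"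
proof -
  define y where "y = 1 / x"
  have y: "y > 0" using that by (simp add: y_def)
  have "y ^ (j + 2) / fact (j + 2) \<le> exp y"
    using exp_lower_Taylor_quadratic y
  proof -
    have "(\<Sum>n\<in>{j + 2}. y ^ n /\<^sub>R fact n) \<le> suminf (\<lambda>n. y ^ n /\<^sub>R fact n)"
      by (rule sum_le_suminf) (use y summable_exp_generic[of y] in auto)
    then show ?thesis by (simp add: exp_def divide_inverse mult.commute)
  qed
  then have "exp (- y) * y ^ (j + 2) \<le> fact (j + 2)"
    by (simp add: exp_minus divide_simps del: fact_Suc power_Suc add_2_eq_Suc') (simp add: mult_ac)
  then have "exp (- 1 / x) / x ^ (j + 2) \<le> fact (j + 2)"
    by (simp add: y_def power_divide)
  then have "exp (- 1 / x) / x ^ (j + 2) * x ^ 2 \<le> fact (j + 2) * x ^ 2"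
    by (rule mult_right_mono) simp
  moreover have "exp (- 1 / x) / x ^ (j + 2) * x ^ 2 = flat_exp j x"
    using that by (simp add: flat_exp_def power_add power2_eq_square)
  ultimately show ?thesis by simp
qed

lemma flat_exp_has_derivative:
  "(flat_exp j has_real_derivative flat_exp (j + 2) x - real j * flat_exp (j + 1) x) (at x)"
proof -
  consider "x > 0" | "x < 0" | "x = 0" by linarith
  then show ?thesis
  proof cases
    case 1
    have d1: "((\<lambda>x. exp (- inverse x)) has_real_derivative exp (- inverse x) * (inverse x)\<^sup>2) (at x)"
      using 1 by (auto intro!: derivative_eq_intros simp: power2_eq_square)
    have d2: "((\<lambda>x. inverse x ^ j) has_real_derivative real j * inverse x ^ (j - 1) * (- ((inverse x)\<^sup>2))) (at x)"
      using \<open>x > 0\<close> by (auto intro!: derivative_eq_intros simp: power2_eq_square)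
    have "((\<lambda>x. exp (- inverse x) * inverse x ^ j) has_real_derivative flat_exp (j + 2) x - real j * flat_exp (j + 1) x) (at x)"
    proof (rule DERIV_cong[OF DERIV_mult[OF d1 d2]])
      have "real j * inverse x ^ (j - 1) * (inverse x)\<^sup>2 = real j * inverse x ^ (j + 1)"
        by (cases j) (simp_all add: power2_eq_square)
      then have "real j * inverse x ^ (j - 1) * (- ((inverse x)\<^sup>2)) * exp (- inverse x) =
          - (real j * inverse x ^ (j + 1) * exp (- inverse x))" by simp
      moreover have "flat_exp i x = exp (- inverse x) * inverse x ^ i" for i
        using \<open>x > 0\<close> by (simp add: flat_exp_def divide_inverse power_inverse)
      ultimately show "exp (- inverse x) * (inverse x)\<^sup>2 * inverse x ^ j +
          real j * inverse x ^ (j - 1) * (- ((inverse x)\<^sup>2)) * exp (- inverse x) =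
          flat_exp (j + 2) x - real j * flat_exp (j + 1) x"
        by (simp add: power2_eq_square)
    qed
    then show ?thesis
      by (rule has_field_derivative_transform_within_open[where S = "{0<..}"])
         (use \<open>x > 0\<close> in \<open>auto simp: flat_exp_def divide_inverse power_inverse\<close>)
  next
    case 2
    have "((\<lambda>x. 0) has_real_derivative 0) (at x)" by simp
    then have "(flat_exp j has_real_derivative 0) (at x)"
      by (rule has_field_derivative_transform_within_open[where S = "{..<0}"])
         (use 2 in \<open>auto simp: flat_exp_def\<close>)
    then show ?thesis using 2 by (simp add: flat_exp_def)
  next
    case 3
    have "((\<lambda>h. flat_exp j h / h) \<longlongrightarrow> 0) (at 0)"
    proof (rule Lim_null_comparison)
      have "norm (flat_exp j h / h) \<le> \<bar>fact (j + 2) * h\<bar>" if "h \<noteq> 0" for h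
      proof (cases "h > 0")
        case True
        then show ?thesis using flat_exp_le[OF True, of j] flat_exp_nonneg[of j h]
          by (simp add: field_simps power2_eq_square)
      qed (simp add: flat_exp_def)
      then show "\<forall>\<^sub>F h in at 0. norm (flat_exp j h / h) \<le> \<bar>fact (j + 2) * h\<bar>"
        by (simp add: eventually_at_filter)
      show "((\<lambda>h. \<bar>fact (j + 2) * h\<bar>) \<longlongrightarrow> 0) (at (0::real))"
        by (auto intro!: tendsto_eq_intros)
    qed
    then have "(flat_exp j has_real_derivative 0) (at 0)"
      by (simp add: DERIV_def flat_exp_def)
    then show ?thesis using 3 by (simp add: flat_exp_def)
  qed
qed

lemma times_differentiable_on_flat_exp:
  "times_differentiable_on m UNIV (flat_exp j)"
proof (induction m arbitrary: j)
  case 0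
  show ?case
    using flat_exp_has_derivative DERIV_continuous continuous_at_imp_continuous_on
    by (metis times_differentiable_on.simps(1))
next
  case (Suc m)
  have "times_differentiable_on m UNIV (\<lambda>x. flat_exp (j + 2) x + (- real j) * flat_exp (j + 1) x)"
    by (intro times_differentiable_on_add times_differentiable_on_mult times_differentiable_on_const Suc) auto
  then show ?case
    by (intro times_differentiable_on_real_derivative) (use flat_exp_has_derivative in auto)
qed

subsection \<open>Symmetry of the second derivative\<close>

text \<open>The second difference over a small parallelogram is \<open>h\<^sup>2\<close> times a value of either mixed derivative nearby, and
  both are continuous.\<close>

lemma second_derivative_symmetric_real:
  fixes f :: "'a::real_normed_vector \<Rightarrow> real"
  assumes S: "open S" "x \<in> S"
    and f: "times_differentiable_on 2 S f"
  shows "frechet_derivative (\<lambda>y. frechet_derivative f (at y) u) (at x) v =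
         frechet_derivative (\<lambda>y. frechet_derivative f (at y) v) (at x) u"
proof -
  define D where "D = (\<lambda>u y. frechet_derivative f (at y) u)"
  define DD where "DD = (\<lambda>u v y. frechet_derivative (D u) (at y) v)"
  have df: "(f has_derivative (\<lambda>u. D u y)) (at y)" if "y \<in> S" for y
    using times_differentiable_on_has_derivative[OF f _ that] by (simp add: D_def)
  have D1: "times_differentiable_on 1 S (D u)" for u
    unfolding D_def by (rule times_differentiable_on_derivative[OF f]) simp
  have dD: "(D u has_derivative (\<lambda>v. DD u v y)) (at y)" if "y \<in> S" for y u
    using times_differentiable_on_has_derivative[OF D1 _ that] by (simp add: DD_def)
  have DDc: "continuous_on S (DD u v)" for u v
    using times_differentiable_on_derivative[OF D1, of 0] unfolding DD_def by simp
  \<comment> \<open>the second difference, evaluated by the mean value theorem in two orders\<close>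
  have key: "\<exists>s\<in>{0<..<h}. \<exists>t\<in>{0<..<h}. f (x + h *\<^sub>R u + h *\<^sub>R v) - f (x + h *\<^sub>R u) - f (x + h *\<^sub>R v) + f x
      = h * h * DD u v (x + s *\<^sub>R u + t *\<^sub>R v)"
    if h: "h > 0" and sub: "\<And>s t. s \<in> {0..h} \<Longrightarrow> t \<in> {0..h} \<Longrightarrow> x + s *\<^sub>R u + t *\<^sub>R v \<in> S" for h u v
  proof -
    define \<phi> where "\<phi> = (\<lambda>s. f (x + s *\<^sub>R u + h *\<^sub>R v) - f (x + s *\<^sub>R u))"
    have d\<phi>: "(\<phi> has_real_derivative D u (x + s *\<^sub>R u + h *\<^sub>R v) - D u (x + s *\<^sub>R u)) (at s)"
      if "s \<in> {0..h}" for s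
    proof -
      have 1: "((\<lambda>s. f (x + s *\<^sub>R u + t *\<^sub>R v)) has_derivative (\<lambda>w. D (w *\<^sub>R u) (x + s *\<^sub>R u + t *\<^sub>R v))) (at s)"
        if "t \<in> {0..h}" for t
        by (rule has_derivative_compose[OF _ df, where f = "\<lambda>s. x + s *\<^sub>R u + t *\<^sub>R v"])
           (use sub[OF \<open>s \<in> {0..h}\<close> that] in \<open>auto intro!: derivative_eq_intros\<close>)
      have 2: "D (w *\<^sub>R u) (x + s *\<^sub>R u + t *\<^sub>R v) = w * D u (x + s *\<^sub>R u + t *\<^sub>R v)" if "t \<in> {0..h}" for t w
        using has_derivative_linear[OF df[OF sub[OF \<open>s \<in> {0..h}\<close> that]]] linear_scale
        by fastforce
      have "(\<phi> has_derivative (\<lambda>w. D (w *\<^sub>R u) (x + s *\<^sub>R u + h *\<^sub>R v) - D (w *\<^sub>R u) (x + s *\<^sub>R u + 0 *\<^sub>R v))) (at s)"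
        unfolding \<phi>_def using has_derivative_diff[OF 1[of h] 1[of 0]] h by simp
      then show ?thesis
        using 2[of h] 2[of 0] h
        unfolding has_field_derivative_def
        by (elim has_derivative_eq_rhs) (simp add: fun_eq_iff algebra_simps)
    qed
    obtain s where s: "0 < s" "s < h" "\<phi> h - \<phi> 0 = (h - 0) * (D u (x + s *\<^sub>R u + h *\<^sub>R v) - D u (x + s *\<^sub>R u))"
    proof -
      have "\<exists>s>0. s < h \<and> \<phi> h - \<phi> 0 = (h - 0) * (D u (x + s *\<^sub>R u + h *\<^sub>R v) - D u (x + s *\<^sub>R u))"
        by (rule MVT2[OF h]) (rule d\<phi>, simp)
      then show ?thesis using that by blast
    qed
    define \<psi> where "\<psi> = (\<lambda>t. D u (x + s *\<^sub>R u + t *\<^sub>R v))"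
    have d\<psi>: "(\<psi> has_real_derivative DD u v (x + s *\<^sub>R u + t *\<^sub>R v)) (at t)" if "t \<in> {0..h}" for t
    proof -
      have m: "x + s *\<^sub>R u + t *\<^sub>R v \<in> S" using sub[of s t] s that by auto
      have 1: "(\<psi> has_derivative (\<lambda>w. DD u (w *\<^sub>R v) (x + s *\<^sub>R u + t *\<^sub>R v))) (at t)"
        unfolding \<psi>_def
        by (rule has_derivative_compose[OF _ dD, where f = "\<lambda>t. x + s *\<^sub>R u + t *\<^sub>R v"])
           (use m in \<open>auto intro!: derivative_eq_intros\<close>)
      have 2: "DD u (w *\<^sub>R v) (x + s *\<^sub>R u + t *\<^sub>R v) = w * DD u v (x + s *\<^sub>R u + t *\<^sub>R v)" for w
        using has_derivative_linear[OF dD[OF m]] linear_scale by fastforce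
      show ?thesis using 1 unfolding 2 by (simp add: has_field_derivative_def mult_commute_abs)
    qed
    obtain t where t: "0 < t" "t < h" "\<psi> h - \<psi> 0 = (h - 0) * DD u v (x + s *\<^sub>R u + t *\<^sub>R v)"
    proof -
      have "\<exists>t>0. t < h \<and> \<psi> h - \<psi> 0 = (h - 0) * DD u v (x + s *\<^sub>R u + t *\<^sub>R v)"
        by (rule MVT2[OF h]) (rule d\<psi>, simp)
      then show ?thesis using that by blast
    qed
    show ?thesis
      apply (rule bexI[of _ s], rule bexI[of _ t])
      using s t by (auto simp: \<phi>_def \<psi>_def algebra_simps)
  qed
  have lim: "((\<lambda>h. (f (x + h *\<^sub>R u + h *\<^sub>R v) - f (x + h *\<^sub>R u) - f (x + h *\<^sub>R v) + f x) / (h * h))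
      \<longlongrightarrow> DD u v x) (at_right 0)" for u v
  proof (rule tendstoI)
    fix e :: real assume e: "e > 0"
    obtain d where d: "d > 0" "ball x d \<subseteq> S" using S openE by blast
    obtain d' where d': "d' > 0" "\<And>y. y \<in> S \<Longrightarrow> dist y x < d' \<Longrightarrow> dist (DD u v y) (DD u v x) < e"
      using DDc[of u v] S e unfolding continuous_on_iff by metis
    have nz: "norm u + norm v + 1 > 0"
      using norm_ge_zero[of u] norm_ge_zero[of v] by linarith
    define h0 where "h0 = min d d' / (norm u + norm v + 1)"
    have h0: "h0 > 0" using d d' nz by (simp add: h0_def)
    have near: "dist (x + s *\<^sub>R u + t *\<^sub>R v) x < min d d'" if "0 \<le> s" "s \<le> h" "0 \<le> t" "t \<le> h" "0 < h" "h < h0" for s t h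
    proof -
      have "dist (x + s *\<^sub>R u + t *\<^sub>R v) x \<le> norm (s *\<^sub>R u) + norm (t *\<^sub>R v)"
        by (simp add: dist_norm norm_triangle_ineq add.assoc del: norm_scaleR)
      also have "\<dots> \<le> h * norm u + h * norm v"
        using that by (auto intro!: add_mono mult_right_mono)
      also have "\<dots> < h * (norm u + norm v + 1)" using that by (simp add: algebra_simps)
      also have "\<dots> \<le> h0 * (norm u + norm v + 1)" using that by (intro mult_right_mono) auto
      also have "\<dots> = min d d'" 
        using nz by (simp add: h0_def)
      finally show ?thesis .
    qed
    have "dist ((f (x + h *\<^sub>R u + h *\<^sub>R v) - f (x + h *\<^sub>R u) - f (x + h *\<^sub>R v) + f x) / (h * h)) (DD u v x) < e"
      if h: "0 < h" "h < h0" for h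
    proof -
      have sub: "x + s *\<^sub>R u + t *\<^sub>R v \<in> S" if "s \<in> {0..h}" "t \<in> {0..h}" for s t
        using near[of s h t] that h d by (auto simp: subset_eq dist_commute)
      from key[OF h(1) sub] obtain s t where st: "s \<in> {0<..<h}" "t \<in> {0<..<h}"
        "f (x + h *\<^sub>R u + h *\<^sub>R v) - f (x + h *\<^sub>R u) - f (x + h *\<^sub>R v) + f x
           = h * h * DD u v (x + s *\<^sub>R u + t *\<^sub>R v)" by blast
      then show ?thesis
        using d'(2)[OF sub[of s t]] near[of s h t] h by auto
    qed
    then show "\<forall>\<^sub>F h in at_right 0. dist ((f (x + h *\<^sub>R u + h *\<^sub>R v) - f (x + h *\<^sub>R u) - f (x + h *\<^sub>R v) + f x) / (h * h)) (DD u v x) < e"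
      using h0 by (auto simp: eventually_at_right_field)
  qed
  have "DD u v x = DD v u x"
  proof (rule tendsto_unique[OF _ lim[of u v]])
    have swap: "f (x + h *\<^sub>R v + h *\<^sub>R u) - f (x + h *\<^sub>R v) - f (x + h *\<^sub>R u) + f x =
        f (x + h *\<^sub>R u + h *\<^sub>R v) - f (x + h *\<^sub>R u) - f (x + h *\<^sub>R v) + f x" for h
      by (simp add: add.assoc add.commute[of "h *\<^sub>R v"])
    show "((\<lambda>h. (f (x + h *\<^sub>R u + h *\<^sub>R v) - f (x + h *\<^sub>R u) - f (x + h *\<^sub>R v) + f x) / (h * h))
        \<longlongrightarrow> DD v u x) (at_right 0)"
      using lim[of v u] unfolding swap .
  qed simp
  then show ?thesis by (simp add: DD_def D_def)
qed

lemma second_derivative_symmetric: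
  fixes f :: "'a::real_normed_vector \<Rightarrow> 'b::euclidean_space"
  assumes S: "open S" "x \<in> S"
    and f: "times_differentiable_on 2 S f"
  shows "frechet_derivative (\<lambda>y. frechet_derivative f (at y) u) (at x) v =
         frechet_derivative (\<lambda>y. frechet_derivative f (at y) v) (at x) u"
proof (rule euclidean_eqI)
  fix b :: 'b assume "b \<in> Basis"
  define g where "g = (\<lambda>y. f y \<bullet> b)"
  have g: "times_differentiable_on 2 S g"
    unfolding g_def by (intro times_differentiable_on_inner times_differentiable_on_const f S(1))
  have D1: "times_differentiable_on 1 S (\<lambda>y. frechet_derivative f (at y) u)" for u
    by (rule times_differentiable_on_derivative[OF f]) simp
  have 1: "frechet_derivative g (at y) u = frechet_derivative f (at y) u \<bullet> b" if "y \<in> S" for y u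
  proof -
    have "(g has_derivative (\<lambda>u. frechet_derivative f (at y) u \<bullet> b)) (at y)"
      unfolding g_def using times_differentiable_on_has_derivative[OF f _ that]
      by (auto intro: has_derivative_inner_left)
    then show ?thesis using frechet_derivative_at by metis
  qed
  have 2: "frechet_derivative (\<lambda>y. frechet_derivative g (at y) u) (at x) v =
      frechet_derivative (\<lambda>y. frechet_derivative f (at y) u) (at x) v \<bullet> b" for u v
  proof -
    have "((\<lambda>y. frechet_derivative f (at y) u \<bullet> b) has_derivative
       (\<lambda>v. frechet_derivative (\<lambda>y. frechet_derivative f (at y) u) (at x) v \<bullet> b)) (at x)"
      using times_differentiable_on_has_derivative[OF D1 _ S(2)]
      by (auto intro: has_derivative_inner_left)
    then have "((\<lambda>y. frechet_derivative g (at y) u) has_derivative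
       (\<lambda>v. frechet_derivative (\<lambda>y. frechet_derivative f (at y) u) (at x) v \<bullet> b)) (at x)"
      by (rule has_derivative_transform_within_open[OF _ S]) (simp add: 1)
    then show ?thesis using frechet_derivative_at by metis
  qed
  show "frechet_derivative (\<lambda>y. frechet_derivative f (at y) u) (at x) v \<bullet> b =
         frechet_derivative (\<lambda>y. frechet_derivative f (at y) v) (at x) u \<bullet> b"
    using second_derivative_symmetric_real[OF S g, of u v] 2 by simp
qed

section \<open>Gaussian integrals and translations\<close>

lemma gaussian_exp_integrable:
  assumes "B > 0"
  shows "integrable lborel (\<lambda>y::'a::euclidean_space. exp (- B * (norm y)\<^sup>2))"
proof -
  define \<sigma> where "\<sigma> = sqrt (1 / (2 * B))"
  have \<sigma>: "\<sigma> > 0" "\<sigma>\<^sup>2 = 1 / (2 * B)" using assms by (auto simp: \<sigma>_def)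
  have "integrable lborel (\<lambda>x. sqrt (2 * pi * \<sigma>\<^sup>2) * normal_density 0 \<sigma> x)"
    using integrable_normal_density[OF \<sigma>(1), of 0] by simp
  also have "(\<lambda>x. sqrt (2 * pi * \<sigma>\<^sup>2) * normal_density 0 \<sigma> x) = (\<lambda>x. exp (- B * x\<^sup>2))"
    using assms by (auto simp: normal_density_def \<sigma>(2) fun_eq_iff)
  finally have 1: "(\<integral>\<^sup>+x. ennreal (exp (- B * x\<^sup>2)) \<partial>lborel) < \<infinity>"
    by (simp add: integrable_iff_bounded)
  have "- B * (norm y)\<^sup>2 = (\<Sum>b\<in>Basis. - B * (y \<bullet> b)\<^sup>2)" for y :: 'a
    unfolding power2_norm_eq_inner euclidean_inner[of y y] by (simp add: power2_eq_square sum_distrib_left sum_negf)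
  then have "exp (- B * (norm y)\<^sup>2) = (\<Prod>b\<in>Basis. exp (- B * (y \<bullet> b)\<^sup>2))" for y :: 'a
    by (simp only: exp_sum[OF finite_Basis])
  then have "ennreal (exp (- B * (norm y)\<^sup>2)) = (\<Prod>b\<in>Basis. ennreal (exp (- B * (y \<bullet> b)\<^sup>2)))" for y :: 'a
    by (simp only: prod_ennreal[OF exp_ge_zero])
  then have "(\<integral>\<^sup>+y. ennreal (exp (- B * (norm (y::'a))\<^sup>2)) \<partial>lborel) =
      (\<integral>\<^sup>+y. (\<Prod>b\<in>(Basis :: 'a set). ennreal (exp (- B * (y \<bullet> b)\<^sup>2))) \<partial>lborel)"
    by (simp only:)
  also have "\<dots> = (\<Prod>b\<in>(Basis::'a set). \<integral>\<^sup>+x. ennreal (exp (- B * x\<^sup>2)) \<partial>lborel)"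
    by (rule nn_integral_lborel_prod) auto
  also have "\<dots> < \<infinity>" using 1 by (simp add: power_less_top_ennreal)
  finally show ?thesis by (simp add: integrable_iff_bounded)
qed

lemma gaussian_density_integrable:
  "A > 0 \<Longrightarrow> integrable lborel (gaussian_density c A :: 'a::euclidean_space \<Rightarrow> real)"
  unfolding gaussian_density_def by (intro integrable_mult_right gaussian_exp_integrable)

lemma gaussian_density_nonneg: "c > 0 \<Longrightarrow> gaussian_density c A x \<ge> 0"
  by (simp add: gaussian_density_def)

lemma gaussian_density_borel [measurable]:
  "(gaussian_density c A :: 'a::euclidean_space \<Rightarrow> real) \<in> borel_measurable borel"
  unfolding gaussian_density_def by measurable

lemma integrable_bounded_times_gaussian:
  fixes f :: "'a::euclidean_space \<Rightarrow> real"
  assumes "A > 0" "c > 0" and [measurable]: "f \<in> borel_measurable borel" and "\<And>x. \<bar>f x\<bar> \<le> M"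
  shows "integrable lborel (\<lambda>x. f x * gaussian_density c A x)"
proof (rule Bochner_Integration.integrable_bound)
  show "integrable lborel (\<lambda>x::'a. M * gaussian_density c A x)"
    by (intro integrable_mult_right gaussian_density_integrable assms(1))
  show "AE x in lborel. norm (f x * gaussian_density c A x) \<le> norm (M * gaussian_density c A x)"
    using assms(4) gaussian_density_nonneg[OF assms(2)]
    by (intro AE_I2) (auto simp: abs_mult intro!: mult_right_mono order_trans[OF assms(4)])
qed simp

lemma gaussian_density_translate_integrable:
  "A > 0 \<Longrightarrow> integrable lborel (\<lambda>y::'a::euclidean_space. gaussian_density c A (y + w))"
  using integrable_distr_eq[of "(+) w" lborel borel "gaussian_density c A :: 'a \<Rightarrow> real"]
    gaussian_density_integrable[of A c, where 'a = 'a]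
  by (simp add: lborel_distr_plus add.commute)

text \<open>The substitution \<open>y \<mapsto> y - w\<close> turns \<open>f y w\<close> into \<open>- f y (- w)\<close>, because the weight is taken at the midpoint of
  the two points at which \<open>g\<close> is evaluated.\<close>

lemma symmetric_difference_integral_zero:
  fixes g :: "'a::euclidean_space \<Rightarrow> real"
  assumes A: "A > 0" "c > 0" and [measurable]: "g \<in> borel_measurable borel" and bd: "\<And>x. \<bar>g x\<bar> \<le> M"
  defines "f \<equiv> \<lambda>y w. (g (y + w) - g y) * gaussian_density c A (y + w /\<^sub>R 2)"
  shows "integrable lborel (\<lambda>y. f y w)" "(LINT y|lborel. f y w + f y (- w)) = 0"
proof -
  have int1: "integrable lborel (\<lambda>y. g (y + v) * gaussian_density c A (y + z))" for v z
  proof (rule Bochner_Integration.integrable_bound)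
    show "integrable lborel (\<lambda>y::'a. M * gaussian_density c A (y + z))"
      by (intro integrable_mult_right gaussian_density_translate_integrable A(1))
    show "AE x in lborel. norm (g (x + v) * gaussian_density c A (x + z)) \<le> norm (M * gaussian_density c A (x + z))"
      using gaussian_density_nonneg[OF A(2)]
      by (intro AE_I2) (auto simp: abs_mult intro!: mult_right_mono order_trans[OF bd])
  qed simp
  have feq: "f y w = g (y + w) * gaussian_density c A (y + w /\<^sub>R 2) - g (y + 0) * gaussian_density c A (y + w /\<^sub>R 2)" for y w
    by (simp add: f_def algebra_simps)
  show int: "integrable lborel (\<lambda>y. f y w)" for w
    unfolding feq by (intro Bochner_Integration.integrable_diff int1)
  have shift: "(LINT y|lborel. g (y + w) * gaussian_density c A (y + w /\<^sub>R 2)) =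
      (LINT y|lborel. g y * gaussian_density c A (y - w /\<^sub>R 2))" for w
  proof -
    have "(LINT y|lborel. g y * gaussian_density c A (y - w /\<^sub>R 2)) =
        (LINT y|distr lborel borel ((+) w). g y * gaussian_density c A (y - w /\<^sub>R 2))"
      by (simp add: lborel_distr_plus)
    also have "\<dots> = (LINT y|lborel. g (w + y) * gaussian_density c A (w + y - w /\<^sub>R 2))"
      by (subst integral_distr) auto
    also have "(\<lambda>y. g (w + y) * gaussian_density c A (w + y - w /\<^sub>R 2)) =
        (\<lambda>y. g (y + w) * gaussian_density c A (y + w /\<^sub>R 2))"
    proof
      fix y
      have "w /\<^sub>R 2 + w /\<^sub>R 2 = w" by (simp flip: scaleR_add_left)
      then have "w + y - w /\<^sub>R 2 = y + w /\<^sub>R 2"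
        by (subst (asm) eq_diff_eq[symmetric]) (simp add: algebra_simps)
      then show "g (w + y) * gaussian_density c A (w + y - w /\<^sub>R 2) = g (y + w) * gaussian_density c A (y + w /\<^sub>R 2)"
        by (simp only: add.commute[of w y])
    qed
    finally show ?thesis by simp
  qed
  have "(LINT y|lborel. f y w) = (LINT y|lborel. g y * gaussian_density c A (y - w /\<^sub>R 2)) -
      (LINT y|lborel. g y * gaussian_density c A (y + w /\<^sub>R 2))" for w
  proof -
    have "(LINT y|lborel. f y w) = (LINT y|lborel. g (y + w) * gaussian_density c A (y + w /\<^sub>R 2)) -
        (LINT y|lborel. g (y + 0) * gaussian_density c A (y + w /\<^sub>R 2))"
      unfolding feq by (intro Bochner_Integration.integral_diff int1)
    then show ?thesis by (simp only: shift add_0_right)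
  qed
  from this[of w] this[of "- w"] show "(LINT y|lborel. f y w + f y (- w)) = 0"
    by (subst Bochner_Integration.integral_add) (auto intro: int)
qed

section \<open>One-sided second order expansions\<close>

text \<open>One half of a second order Taylor expansion at \<open>0\<close>, with slope \<open>a\<close> and second derivative \<open>b\<close>. It passes to
  every function that touches \<open>f\<close> from below at \<open>0\<close>, and is therefore available for distance functions at points
  where these are not differentiable.\<close>

definition upper_expansion :: "(real \<Rightarrow> real) \<Rightarrow> real \<Rightarrow> real \<Rightarrow> bool" where
  "upper_expansion f a b \<longleftrightarrow> (\<forall>e>0. \<forall>\<^sub>F \<epsilon> in at 0. f \<epsilon> \<le> f 0 + a * \<epsilon> + (b / 2 + e) * \<epsilon>\<^sup>2)"

lemma upper_expansion_le:
  assumes "upper_expansion f a b" "\<forall>\<^sub>F \<epsilon> in at 0. g \<epsilon> \<le> f \<epsilon>" "g 0 = f 0"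
  shows "upper_expansion g a b"
  unfolding upper_expansion_def
proof (intro allI impI)
  fix e :: real assume "e > 0"
  with assms(1) have "\<forall>\<^sub>F \<epsilon> in at 0. f \<epsilon> \<le> f 0 + a * \<epsilon> + (b / 2 + e) * \<epsilon>\<^sup>2"
    by (simp add: upper_expansion_def)
  with assms(2) show "\<forall>\<^sub>F \<epsilon> in at 0. g \<epsilon> \<le> g 0 + a * \<epsilon> + (b / 2 + e) * \<epsilon>\<^sup>2"
    by eventually_elim (use assms(3) in auto)
qed

lemma upper_expansion_second_derivative:
  assumes d1: "\<forall>\<^sub>F x in nhds 0. (f has_real_derivative f' x) (at x)"
    and d2: "(f' has_real_derivative c) (at 0)"
  shows "upper_expansion f (f' 0) c"
  unfolding upper_expansion_def
proof (intro allI impI)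
  fix e :: real assume e: "e > 0"
  obtain d where d: "d > 0" "\<And>x. \<bar>x\<bar> < d \<Longrightarrow> (f has_real_derivative f' x) (at x)"
    using d1 by (auto simp: eventually_nhds_metric)
  have "((\<lambda>h. (f' h - f' 0) / h) \<longlongrightarrow> c) (at 0)"
    using d2 by (simp add: DERIV_def)
  then have "\<forall>\<^sub>F h in at 0. dist ((f' h - f' 0) / h) c < e"
    using e by (rule tendstoD)
  then obtain d' where d': "d' > 0" "\<And>h. h \<noteq> 0 \<Longrightarrow> \<bar>h\<bar> < d' \<Longrightarrow> \<bar>(f' h - f' 0) / h - c\<bar> < e"
    by (auto simp: eventually_at dist_real_def)
  have bound: "\<bar>f' h - f' 0 - c * h\<bar> \<le> e * \<bar>h\<bar>" if "\<bar>h\<bar> < d'" for h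
  proof (cases "h = 0")
    case False
    have "\<bar>f' h - f' 0 - c * h\<bar> = \<bar>(f' h - f' 0) / h - c\<bar> * \<bar>h\<bar>"
      using False by (simp add: field_simps flip: abs_mult)
    also have "\<dots> \<le> e * \<bar>h\<bar>"
      using d'(2)[OF False that] by (intro mult_right_mono) auto
    finally show ?thesis .
  qed simp
  define R where "R = (\<lambda>x. f x - f' 0 * x - c / 2 * x\<^sup>2)"
  have dR: "(R has_real_derivative f' x - f' 0 - c * x) (at x)" if "\<bar>x\<bar> < d" for x
    unfolding R_def by (auto intro!: derivative_eq_intros d(2) that)
  have "f x \<le> f 0 + f' 0 * x + (c / 2 + e) * x\<^sup>2" if x: "x \<noteq> 0" "\<bar>x\<bar> < min d d'" for x
  proof -
    have "\<bar>R x - R 0\<bar> \<le> (e * \<bar>x\<bar>) * \<bar>x - 0\<bar>"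
    proof (rule field_differentiable_bound[of "closed_segment 0 x" R "\<lambda>x. f' x - f' 0 - c * x" "e * \<bar>x\<bar>" x 0, unfolded real_norm_def])
      fix z assume "z \<in> closed_segment 0 x"
      then have z: "\<bar>z\<bar> \<le> \<bar>x\<bar>" by (auto simp: closed_segment_eq_real_ivl split: if_splits)
      show "(R has_real_derivative f' z - f' 0 - c * z) (at z within closed_segment 0 x)"
        by (rule has_field_derivative_at_within[OF dR]) (use z x in linarith)
      have "e * \<bar>z\<bar> \<le> e * \<bar>x\<bar>" using z e by simp
      then show "\<bar>f' z - f' 0 - c * z\<bar> \<le> e * \<bar>x\<bar>"
        using bound[of z] z x by linarith
    qed auto
    then have "R x \<le> R 0 + e * x\<^sup>2" by (simp add: power2_eq_square abs_le_iff mult.assoc)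
    then show ?thesis by (simp add: R_def algebra_simps)
  qed
  then show "\<forall>\<^sub>F x in at 0. f x \<le> f 0 + f' 0 * x + (c / 2 + e) * x\<^sup>2"
    using d(1) d'(1) unfolding eventually_at by (intro exI[of _ "min d d'"]) auto
qed

lemma upper_expansion_compose_quadratic:
  assumes h: "\<And>s. (h has_real_derivative \<psi> s) (at s)" "\<And>s. (\<psi> has_real_derivative \<psi>' s) (at s)"
  shows "upper_expansion (\<lambda>\<epsilon>. h (u + a * \<epsilon> + b / 2 * \<epsilon>\<^sup>2)) (\<psi> u * a) (\<psi> u * b + \<psi>' u * a\<^sup>2)"
proof -
  have "upper_expansion (\<lambda>\<epsilon>. h (u + a * \<epsilon> + b / 2 * \<epsilon>\<^sup>2))
     ((\<lambda>\<epsilon>. \<psi> (u + a * \<epsilon> + b / 2 * \<epsilon>\<^sup>2) * (a + b * \<epsilon>)) 0) (\<psi> u * b + \<psi>' u * a\<^sup>2)"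
  proof (rule upper_expansion_second_derivative)
    have "((\<lambda>\<epsilon>. h (u + a * \<epsilon> + b / 2 * \<epsilon>\<^sup>2)) has_real_derivative
        \<psi> (u + a * \<epsilon> + b / 2 * \<epsilon>\<^sup>2) * (a + b * \<epsilon>)) (at \<epsilon>)" for \<epsilon>
      by (rule DERIV_chain2[OF h(1)]) (auto intro!: derivative_eq_intros)
    then show "\<forall>\<^sub>F \<epsilon> in nhds 0. ((\<lambda>\<epsilon>. h (u + a * \<epsilon> + b / 2 * \<epsilon>\<^sup>2)) has_real_derivative
        \<psi> (u + a * \<epsilon> + b / 2 * \<epsilon>\<^sup>2) * (a + b * \<epsilon>)) (at \<epsilon>)"
      by simp
    have "((\<lambda>\<epsilon>. \<psi> (u + a * \<epsilon> + b / 2 * \<epsilon>\<^sup>2)) has_real_derivative \<psi>' (u + a * 0 + b / 2 * 0\<^sup>2) * a) (at 0)"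
      by (rule DERIV_chain2[OF h(2)]) (auto intro!: derivative_eq_intros)
    then have "((\<lambda>\<epsilon>. \<psi> (u + a * \<epsilon> + b / 2 * \<epsilon>\<^sup>2) * (a + b * \<epsilon>)) has_real_derivative
        \<psi>' (u + a * 0 + b / 2 * 0\<^sup>2) * a * (a + b * 0) + b * \<psi> (u + a * 0 + b / 2 * 0\<^sup>2)) (at 0)"
      by (intro DERIV_mult) (auto intro!: derivative_eq_intros)
    then show "((\<lambda>\<epsilon>. \<psi> (u + a * \<epsilon> + b / 2 * \<epsilon>\<^sup>2) * (a + b * \<epsilon>)) has_real_derivative
        \<psi> u * b + \<psi>' u * a\<^sup>2) (at 0)"
      by (simp add: power2_eq_square algebra_simps)
  qed
  then show ?thesis by simp
qed

text \<open>The outer function has to be increasing, since \<open>f\<close> is only bounded above.\<close>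

lemma upper_expansion_compose_mono:
  assumes h: "\<And>s. (h has_real_derivative \<psi> s) (at s)" "\<And>s. (\<psi> has_real_derivative \<psi>' s) (at s)"
    and pos: "\<And>s. \<psi> s \<ge> 0"
    and f: "upper_expansion f a b"
  shows "upper_expansion (\<lambda>\<epsilon>. h (f \<epsilon>)) (\<psi> (f 0) * a) (\<psi> (f 0) * b + \<psi>' (f 0) * a\<^sup>2)"
  unfolding upper_expansion_def
proof (intro allI impI)
  fix e :: real assume e: "e > 0"
  have mono: "s \<le> t \<Longrightarrow> h s \<le> h t" for s t
    using DERIV_nonneg_imp_nondecreasing[of s t h] h(1) pos by blast
  define e' where "e' = e / (2 * (\<psi> (f 0) + 1))"
  have p1: "\<psi> (f 0) + 1 > 0" using pos[of "f 0"] by linarith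
  have e': "e' > 0" "\<psi> (f 0) * e' \<le> e / 2"
    using e p1 by (auto simp: e'_def field_simps)
  have "\<forall>\<^sub>F \<epsilon> in at 0. f \<epsilon> \<le> f 0 + a * \<epsilon> + (b + 2 * e') / 2 * \<epsilon>\<^sup>2"
    using f e'(1) unfolding upper_expansion_def by (auto simp: add_divide_distrib)
  moreover have "\<forall>\<^sub>F \<epsilon> in at 0. h (f 0 + a * \<epsilon> + (b + 2 * e') / 2 * \<epsilon>\<^sup>2) \<le> h (f 0) + \<psi> (f 0) * a * \<epsilon> +
       ((\<psi> (f 0) * (b + 2 * e') + \<psi>' (f 0) * a\<^sup>2) / 2 + e / 2) * \<epsilon>\<^sup>2"
    using upper_expansion_compose_quadratic[OF h, of "f 0" a "b + 2 * e'"] e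
    unfolding upper_expansion_def by (auto dest!: spec[of _ "e / 2"])
  ultimately show "\<forall>\<^sub>F \<epsilon> in at 0. h (f \<epsilon>) \<le> h (f 0) + \<psi> (f 0) * a * \<epsilon> +
       ((\<psi> (f 0) * b + \<psi>' (f 0) * a\<^sup>2) / 2 + e) * \<epsilon>\<^sup>2"
  proof eventually_elim
    case (elim \<epsilon>)
    have "((\<psi> (f 0) * (b + 2 * e') + \<psi>' (f 0) * a\<^sup>2) / 2 + e / 2) * \<epsilon>\<^sup>2 \<le>
        ((\<psi> (f 0) * b + \<psi>' (f 0) * a\<^sup>2) / 2 + e) * \<epsilon>\<^sup>2"
      using e'(2) by (intro mult_right_mono) (auto simp: field_simps)
    then show ?case using mono[OF elim(1)] elim(2) by linarith
  qed
qed

section \<open>Integrating the drift Laplacian\<close>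

lemma exp_diff_exp_minus_le:
  fixes \<tau> :: real shows "\<bar>exp \<tau> - exp (- \<tau>)\<bar> \<le> 2 * \<bar>\<tau>\<bar> * exp \<bar>\<tau>\<bar>"
proof -
  have pos: "exp x - exp (- x) \<le> 2 * x * exp x" "exp x \<ge> exp (- x)" if "x \<ge> 0" for x :: real
  proof -
    have "1 - exp (- (2 * x)) \<le> 2 * x" using exp_ge_add_one_self[of "- (2 * x)"] by linarith
    then have "exp x * (1 - exp (- (2 * x))) \<le> exp x * (2 * x)" by (rule mult_left_mono) simp
    moreover have "exp x * exp (- (2 * x)) = exp (- x)" by (simp flip: exp_add)
    ultimately show "exp x - exp (- x) \<le> 2 * x * exp x" by (simp add: algebra_simps)
  qed (use that in simp)
  show ?thesis using pos[of \<tau>] pos[of "- \<tau>"] by (cases "\<tau> \<ge> 0") auto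
qed

text \<open>From \<open>1 + r \<le> exp r\<close>, and \<open>(2 + A) r - A r\<^sup>2 / 2 \<le> (2 + A)\<^sup>2 / (2 A)\<close> by completing the square.\<close>

lemma polynomial_times_gaussian_le:
  fixes r A :: real assumes "A > 0" "r \<ge> 0"
  shows "(1 + r)\<^sup>2 * exp (A * r) * exp (- A * r\<^sup>2) \<le> exp ((2 + A)\<^sup>2 / (2 * A)) * exp (- (A / 2) * r\<^sup>2)"
proof -
  have "(1 + r)\<^sup>2 \<le> (exp r)\<^sup>2"
    using assms by (intro power_mono) (auto simp: add.commute)
  then have "(1 + r)\<^sup>2 * exp (A * r) * exp (- A * r\<^sup>2) \<le> (exp r)\<^sup>2 * exp (A * r) * exp (- A * r\<^sup>2)"
    by (intro mult_right_mono) auto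
  also have "\<dots> = exp (2 * r + A * r - A * r\<^sup>2)"
    by (simp flip: exp_add exp_double)
  also have "\<dots> \<le> exp ((2 + A)\<^sup>2 / (2 * A) - (A / 2) * r\<^sup>2)"
  proof -
    have "(2 + A)\<^sup>2 / (2 * A) - (A / 2) * r\<^sup>2 - (2 * r + A * r - A * r\<^sup>2) = (A * r - (2 + A))\<^sup>2 / (2 * A)"
      using assms(1) by (simp add: field_simps power2_eq_square)
    also have "\<dots> \<ge> 0" using assms(1) by simp
    finally show ?thesis by simp
  qed
  also have "\<dots> = exp ((2 + A)\<^sup>2 / (2 * A)) * exp (- (A / 2) * r\<^sup>2)"
    by (simp flip: exp_add)
  finally show ?thesis .
qed

text \<open>
  If \<open>g\<close> is bounded above by its second order expansions at every point, then the integral of the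
  resulting bound for \<open>\<Delta> g - 2 A \<langle>x, \<nabla> g\<rangle>\<close>, the generator for which the Gaussian
  measure is invariant, is nonnegative. Symmetric difference quotients have integral exactly zero;
  Fatou's lemma passes to the limit, and so no derivative of \<open>g\<close> has to exist anywhere.
\<close>

lemma drift_laplacian_integral_nonneg:
  fixes g :: "'a::euclidean_space \<Rightarrow> real"
  assumes A: "A > 0" "c > 0" and gm: "continuous_on UNIV g" and bd: "\<And>x. \<bar>g x\<bar> \<le> M"
    and L: "L \<ge> 0"
    and lip: "\<And>y w. norm w \<le> 1 \<Longrightarrow> \<bar>g (y + w) - g y\<bar> \<le> L * (1 + norm y) * norm w"
    and conc: "\<And>y w. norm w \<le> 1 \<Longrightarrow> g (y + w) + g (y - w) - 2 * g y \<le> L * (1 + norm y)\<^sup>2 * (norm w)\<^sup>2"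
    and expand: "\<And>y b. b \<in> Basis \<Longrightarrow> upper_expansion (\<lambda>\<epsilon>. g (y + \<epsilon> *\<^sub>R b)) (a y b) (q y b)"
    and trace: "\<And>y. (\<Sum>b\<in>Basis. q y b - 2 * A * (y \<bullet> b) * a y b) \<le> \<kappa> y"
    and \<kappa>: "integrable lborel (\<lambda>y. \<kappa> y * gaussian_density c A y)"
  shows "0 \<le> (LINT y|lborel. \<kappa> y * gaussian_density c A y)"
proof -
  let ?\<rho> = "gaussian_density c A :: 'a \<Rightarrow> real"
  define f where "f = (\<lambda>y w. (g (y + w) - g y) * ?\<rho> (y + w /\<^sub>R 2))"
  define \<epsilon> where "\<epsilon> = (\<lambda>n. 1 / real (Suc n))"
  have \<epsilon>: "0 < \<epsilon> n" "\<epsilon> n \<le> 1" for n by (auto simp: \<epsilon>_def)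
  have \<epsilon>lim: "filterlim \<epsilon> (at 0) sequentially"
    unfolding filterlim_at using LIMSEQ_Suc[OF lim_1_over_n[where 'a = real]]
    by (auto simp: \<epsilon>_def)
  define D where "D = (\<lambda>n y. \<Sum>b\<in>Basis. (f y (\<epsilon> n *\<^sub>R b) + f y (- (\<epsilon> n *\<^sub>R b))) / (\<epsilon> n)\<^sup>2)"
  have [measurable]: "g \<in> borel_measurable borel" using gm by (rule borel_measurable_continuous_onI)
  have fz: "integrable lborel (\<lambda>y. f y w)" "(LINT y|lborel. f y w + f y (- w)) = 0" for w
    unfolding f_def
    using symmetric_difference_integral_zero(1)[OF A \<open>g \<in> borel_measurable borel\<close> bd, of w]
      symmetric_difference_integral_zero(2)[OF A \<open>g \<in> borel_measurable borel\<close> bd, of w]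
    by simp_all
  have int: "integrable lborel (\<lambda>y. (f y (\<epsilon> n *\<^sub>R b) + f y (- (\<epsilon> n *\<^sub>R b))) / (\<epsilon> n)\<^sup>2)" for b n
    using Bochner_Integration.integrable_add[OF fz(1)[of "\<epsilon> n *\<^sub>R b"] fz(1)[of "- (\<epsilon> n *\<^sub>R b)"]] by simp
  have Dint: "integrable lborel (D n)" for n
    unfolding D_def by (rule Bochner_Integration.integrable_sum[OF int])
  have D0: "(LINT y|lborel. D n y) = 0" for n
    unfolding D_def Bochner_Integration.integral_sum[OF int] integral_divide_zero fz(2) by simp
  \<comment> \<open>An integrable bound for the difference operator from above, as Fatou's lemma needs: the first order terms in the two weights nearly cancel.\<close>
  define C where "C = real (DIM('a)) * (c * L * (1 + 2 * A) * exp ((2 + A)\<^sup>2 / (2 * A)))"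
  define W where "W = (\<lambda>y::'a. C * exp (- (A / 2) * (norm y)\<^sup>2))"
  have Wint: "integrable lborel W" unfolding W_def using A by (intro integrable_mult_right gaussian_exp_integrable) auto
  have DW: "D n y \<le> W y" for n y
  proof -
    have "(f y (e *\<^sub>R b) + f y (- (e *\<^sub>R b))) / e\<^sup>2 \<le>
       (c * L * (1 + 2 * A) * exp ((2 + A)\<^sup>2 / (2 * A))) * exp (- (A / 2) * (norm y)\<^sup>2)"
      if b: "b \<in> Basis" and e: "0 < e" "e \<le> 1" for e and b :: 'a
    proof -
      define \<alpha> where "\<alpha> = g (y + e *\<^sub>R b) - g y"
      define \<beta> where "\<beta> = g (y - e *\<^sub>R b) - g y"
      define \<tau> where "\<tau> = A * e * (y \<bullet> b)"
      have \<rho>: "?\<rho> (y + s *\<^sub>R b) = c * exp (- A * (norm y)\<^sup>2) * exp (- A * s\<^sup>2) * exp (- (2 * A * s * (y \<bullet> b)))" for s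
        using b unfolding gaussian_density_def power2_norm_eq_inner
        by (simp add: inner_add_left inner_add_right inner_commute[of b y] algebra_simps power2_eq_square flip: exp_add)
      have \<rho>1: "?\<rho> (y + (e *\<^sub>R b) /\<^sub>R 2) = c * exp (- A * (norm y)\<^sup>2) * exp (- A * e\<^sup>2 / 4) * exp (- \<tau>)"
        using \<rho>[of "e / 2"] by (simp add: \<tau>_def power_divide algebra_simps)
      have \<rho>2: "?\<rho> (y + (- (e *\<^sub>R b)) /\<^sub>R 2) = c * exp (- A * (norm y)\<^sup>2) * exp (- A * e\<^sup>2 / 4) * exp \<tau>"
        using \<rho>[of "- e / 2"] by (simp add: \<tau>_def power_divide algebra_simps)
      have \<tau>b: "\<bar>\<tau>\<bar> \<le> A * e * norm y"
        using Basis_le_norm[OF b, of y] A e unfolding \<tau>_def abs_mult by (intro mult_mono) auto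
      then have \<tau>b': "\<bar>\<tau>\<bar> \<le> A * norm y"
        using e A by (smt (verit) mult_left_le mult_right_mono norm_ge_zero mult.commute mult_le_cancel_left_pos)
      have ab: "\<alpha> + \<beta> \<le> L * (1 + norm y)\<^sup>2 * e\<^sup>2"
        using conc[of "e *\<^sub>R b" y] b e by (simp add: \<alpha>_def \<beta>_def)
      have bb: "\<bar>\<beta>\<bar> \<le> L * (1 + norm y) * e"
        using lip[of "- (e *\<^sub>R b)" y] b e by (simp add: \<beta>_def)
      have t1: "(\<alpha> + \<beta>) * exp (- \<tau>) \<le> L * (1 + norm y)\<^sup>2 * e\<^sup>2 * exp (A * norm y)"
        using ab \<tau>b' L A by (intro mult_mono) (auto intro!: mult_nonneg_nonneg)
      have t2: "\<beta> * (exp \<tau> - exp (- \<tau>)) \<le> (L * (1 + norm y) * e) * (2 * (A * e * norm y) * exp (A * norm y))"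
      proof -
        have "\<beta> * (exp \<tau> - exp (- \<tau>)) \<le> \<bar>\<beta>\<bar> * \<bar>exp \<tau> - exp (- \<tau>)\<bar>"
          by (metis abs_ge_self abs_mult)
        also have "\<dots> \<le> (L * (1 + norm y) * e) * (2 * (A * e * norm y) * exp (A * norm y))"
        proof (intro mult_mono bb)
          have "2 * \<bar>\<tau>\<bar> * exp \<bar>\<tau>\<bar> \<le> 2 * (A * e * norm y) * exp (A * norm y)"
            using \<tau>b \<tau>b' A e by (intro mult_mono) auto
          then show "\<bar>exp \<tau> - exp (- \<tau>)\<bar> \<le> 2 * (A * e * norm y) * exp (A * norm y)"
            using exp_diff_exp_minus_le[of \<tau>] by linarith
        qed (use L A e in auto)
        finally show ?thesis .
      qed
      also have "\<dots> \<le> 2 * A * L * (1 + norm y)\<^sup>2 * e\<^sup>2 * exp (A * norm y)"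
      proof -
        have "norm y * (1 + norm y) \<le> (1 + norm y)\<^sup>2" by (simp add: power2_eq_square algebra_simps)
        then have "(2 * A * L * e\<^sup>2 * exp (A * norm y)) * (norm y * (1 + norm y)) \<le>
            (2 * A * L * e\<^sup>2 * exp (A * norm y)) * (1 + norm y)\<^sup>2"
          using A L by (intro mult_left_mono) auto
        then show ?thesis by (simp add: mult_ac power2_eq_square[of e])
      qed
      finally have sum: "\<alpha> * exp (- \<tau>) + \<beta> * exp \<tau> \<le> (1 + 2 * A) * L * (1 + norm y)\<^sup>2 * e\<^sup>2 * exp (A * norm y)"
        using t1 by (simp add: algebra_simps)
      have "f y (e *\<^sub>R b) + f y (- (e *\<^sub>R b)) =
          (c * exp (- A * (norm y)\<^sup>2)) * (exp (- A * e\<^sup>2 / 4) * (\<alpha> * exp (- \<tau>) + \<beta> * exp \<tau>))"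
        unfolding f_def \<rho>1 \<rho>2 by (simp add: \<alpha>_def \<beta>_def algebra_simps)
      also have "\<dots> \<le> (c * exp (- A * (norm y)\<^sup>2)) * (1 * ((1 + 2 * A) * L * (1 + norm y)\<^sup>2 * e\<^sup>2 * exp (A * norm y)))"
      proof (intro mult_left_mono)
        have "exp (- A * e\<^sup>2 / 4) * (\<alpha> * exp (- \<tau>) + \<beta> * exp \<tau>) \<le>
            exp (- A * e\<^sup>2 / 4) * ((1 + 2 * A) * L * (1 + norm y)\<^sup>2 * e\<^sup>2 * exp (A * norm y))"
          using sum by (rule mult_left_mono) simp
        also have "\<dots> \<le> 1 * ((1 + 2 * A) * L * (1 + norm y)\<^sup>2 * e\<^sup>2 * exp (A * norm y))"
          using A L by (intro mult_right_mono) auto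
        finally show "exp (- A * e\<^sup>2 / 4) * (\<alpha> * exp (- \<tau>) + \<beta> * exp \<tau>) \<le>
            1 * ((1 + 2 * A) * L * (1 + norm y)\<^sup>2 * e\<^sup>2 * exp (A * norm y))" .
      qed (use A in auto)
      also have "\<dots> = (c * (1 + 2 * A) * L * e\<^sup>2) * ((1 + norm y)\<^sup>2 * exp (A * norm y) * exp (- A * (norm y)\<^sup>2))"
        by (simp add: mult_ac)
      also have "\<dots> \<le> (c * (1 + 2 * A) * L * e\<^sup>2) * (exp ((2 + A)\<^sup>2 / (2 * A)) * exp (- (A / 2) * (norm y)\<^sup>2))"
        using A L by (intro mult_left_mono polynomial_times_gaussian_le) auto
      finally show ?thesis using e by (simp add: divide_le_eq mult_ac)
    qed
    then have "D n y \<le> (\<Sum>b\<in>(Basis::'a set). (c * L * (1 + 2 * A) * exp ((2 + A)\<^sup>2 / (2 * A))) * exp (- (A / 2) * (norm y)\<^sup>2))"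
      unfolding D_def using \<epsilon> by (intro sum_mono) auto
    then show ?thesis by (simp add: W_def C_def)
  qed
  \<comment> \<open>The derivative of the weight at the midpoint produces the drift term in the limit.\<close>
  have lim: "\<forall>\<^sub>F n in sequentially. D n y \<le> \<kappa> y * ?\<rho> y + e" if e: "e > 0" for y e
  proof -
    define e' where "e' = e / (4 * (real DIM('a) * ?\<rho> y + 1))"
    have \<rho>0: "?\<rho> z \<ge> 0" for z using gaussian_density_nonneg[OF A(2)] .
    have dp: "real DIM('a) * ?\<rho> y + 1 > 0"
      using \<rho>0[of y] by (smt (verit) mult_nonneg_nonneg of_nat_0_le_iff)
    have e': "e' > 0" "2 * real DIM('a) * ?\<rho> y * e' < e"
    proof -
      show "e' > 0" using e dp by (simp add: e'_def)
      have "2 * real DIM('a) * ?\<rho> y * e' = e * (real DIM('a) * ?\<rho> y) / (2 * (real DIM('a) * ?\<rho> y + 1))"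
        using dp by (simp add: e'_def field_simps)
      also have "\<dots> < e" proof -
        have "e * (real DIM('a) * ?\<rho> y) \<le> e * (real DIM('a) * ?\<rho> y + 1)" using e by simp
        also have "\<dots> < e * (2 * (real DIM('a) * ?\<rho> y + 1))" using dp e by simp
        finally show ?thesis using dp by (simp add: pos_divide_less_eq)
      qed
      finally show "2 * real DIM('a) * ?\<rho> y * e' < e" .
    qed
    define r where "r = (\<lambda>b s. ?\<rho> (y + (s *\<^sub>R b) /\<^sub>R 2))"
    define U where "U = (\<lambda>b s. a y b * ((r b s - r b (- s)) / s) + (q y b / 2 + e') * (r b s + r b (- s)))"
    have le: "\<forall>\<^sub>F s in at 0. (f y (s *\<^sub>R b) + f y (- (s *\<^sub>R b))) / s\<^sup>2 \<le> U b s" if b: "b \<in> Basis" for b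
    proof -
      have 1: "\<forall>\<^sub>F s in at 0. g (y + s *\<^sub>R b) \<le> g y + a y b * s + (q y b / 2 + e') * s\<^sup>2"
        using expand[OF b, of y] e'(1) by (auto simp: upper_expansion_def)
      have 2: "\<forall>\<^sub>F s in at 0. g (y + (- s) *\<^sub>R b) \<le> g y + a y b * (- s) + (q y b / 2 + e') * (- s)\<^sup>2"
        by (rule eventually_compose_filterlim[OF 1])
           (auto simp: filterlim_at eventually_at_filter intro!: tendsto_eq_intros)
      have "\<forall>\<^sub>F s in at (0::real). s \<noteq> 0" by (simp add: eventually_at_filter)
      with 1 2 show ?thesis
      proof eventually_elim
        case (elim s)
        have "f y (s *\<^sub>R b) + f y (- (s *\<^sub>R b)) \<le> (a y b * s + (q y b / 2 + e') * s\<^sup>2) * r b s +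
            (- (a y b * s) + (q y b / 2 + e') * s\<^sup>2) * r b (- s)"
        proof -
          have "(g (y + s *\<^sub>R b) - g y) * r b s \<le> (a y b * s + (q y b / 2 + e') * s\<^sup>2) * r b s"
            using elim(1) \<rho>0 by (intro mult_right_mono) (auto simp: r_def)
          moreover have "(g (y + (- s) *\<^sub>R b) - g y) * r b (- s) \<le> (- (a y b * s) + (q y b / 2 + e') * s\<^sup>2) * r b (- s)"
            using elim(2) \<rho>0 by (intro mult_right_mono) (auto simp: r_def)
          ultimately show ?thesis by (simp add: f_def r_def)
        qed
        also have "\<dots> = U b s * s\<^sup>2"
          using elim(3) by (simp add: U_def field_simps power2_eq_square)
        finally show ?case using elim(3) by (simp add: divide_le_eq)
      qed
    qed
    have Ulim: "(U b \<longlongrightarrow> a y b * (- 2 * A * (y \<bullet> b) * ?\<rho> y) + (q y b / 2 + e') * (2 * ?\<rho> y)) (at 0)"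
      if b: "b \<in> Basis" for b
    proof -
      have rr: "r b s = c * exp (- A * ((norm y)\<^sup>2 + s * (y \<bullet> b) + s\<^sup>2 / 4))" for s
      proof -
        have "(norm (y + (s *\<^sub>R b) /\<^sub>R 2))\<^sup>2 = (norm y)\<^sup>2 + s * (y \<bullet> b) + s\<^sup>2 / 4"
          using b unfolding power2_norm_eq_inner
          by (simp add: inner_add_left inner_add_right inner_commute[of b y] algebra_simps power2_eq_square)
        then show ?thesis by (simp add: r_def gaussian_density_def)
      qed
      have r0: "r b 0 = ?\<rho> y" by (simp add: r_def)
      have dr: "(r b has_real_derivative - A * (y \<bullet> b) * ?\<rho> y) (at 0)"
        unfolding rr[abs_def] gaussian_density_def
        by (auto intro!: derivative_eq_intros simp: algebra_simps)
      then have "((\<lambda>s. r b (- s)) has_real_derivative A * (y \<bullet> b) * ?\<rho> y) (at 0)"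
        using DERIV_mirror[of "r b" "- A * (y \<bullet> b) * ?\<rho> y" 0] dr by simp
      from DERIV_diff[OF dr this] have "((\<lambda>s. (r b s - r b (- s)) / s) \<longlongrightarrow> - 2 * A * (y \<bullet> b) * ?\<rho> y) (at 0)"
        by (simp add: DERIV_def mult.assoc)
      moreover have cont: "isCont (r b) 0" "isCont (\<lambda>s. r b (- s)) 0"
        using dr \<open>((\<lambda>s. r b (- s)) has_real_derivative _) _\<close> by (auto intro: DERIV_isCont)
      then have "((\<lambda>s. r b s + r b (- s)) \<longlongrightarrow> 2 * ?\<rho> y) (at 0)"
        using tendsto_add[OF cont[unfolded isCont_def]] by (simp add: r0)
      ultimately show ?thesis unfolding U_def by (intro tendsto_intros)
    qed
    have "((\<lambda>s. \<Sum>b\<in>Basis. U b s) \<longlongrightarrow> (\<Sum>b\<in>Basis. a y b * (- 2 * A * (y \<bullet> b) * ?\<rho> y) + (q y b / 2 + e') * (2 * ?\<rho> y))) (at 0)"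
      by (intro tendsto_sum Ulim)
    moreover have "(\<Sum>b\<in>Basis. a y b * (- 2 * A * (y \<bullet> b) * ?\<rho> y) + (q y b / 2 + e') * (2 * ?\<rho> y)) < \<kappa> y * ?\<rho> y + e"
    proof -
      have "(\<Sum>b\<in>Basis. a y b * (- 2 * A * (y \<bullet> b) * ?\<rho> y) + (q y b / 2 + e') * (2 * ?\<rho> y)) =
          (\<Sum>b\<in>Basis. (q y b - 2 * A * (y \<bullet> b) * a y b) * ?\<rho> y + 2 * e' * ?\<rho> y)"
        by (intro sum.cong) (auto simp: algebra_simps)
      also have "\<dots> = (\<Sum>b\<in>Basis. q y b - 2 * A * (y \<bullet> b) * a y b) * ?\<rho> y + 2 * real DIM('a) * ?\<rho> y * e'"
        by (simp add: sum.distrib sum_distrib_right)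
      also have "\<dots> < \<kappa> y * ?\<rho> y + e"
        using mult_right_mono[OF trace[of y] \<rho>0[of y]] e'(2) by linarith
      finally show ?thesis .
    qed
    ultimately have "\<forall>\<^sub>F s in at 0. (\<Sum>b\<in>Basis. U b s) < \<kappa> y * ?\<rho> y + e"
      by (rule order_tendstoD(2))
    moreover have "\<forall>\<^sub>F s in at 0. \<forall>b\<in>Basis. (f y (s *\<^sub>R b) + f y (- (s *\<^sub>R b))) / s\<^sup>2 \<le> U b s"
      using le by (intro eventually_ball_finite) auto
    ultimately have "\<forall>\<^sub>F s in at 0. (\<Sum>b\<in>Basis. (f y (s *\<^sub>R b) + f y (- (s *\<^sub>R b))) / s\<^sup>2) \<le> \<kappa> y * ?\<rho> y + e"
    proof eventually_elim
      case (elim s)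
      then show ?case using sum_mono[of Basis "\<lambda>b. (f y (s *\<^sub>R b) + f y (- (s *\<^sub>R b))) / s\<^sup>2" "\<lambda>b. U b s"] by force
    qed
    from eventually_compose_filterlim[OF this \<epsilon>lim] show ?thesis by (simp add: D_def)
  qed
  \<comment> \<open>Fatou's lemma for the nonnegative functions \<open>W - D n\<close>.\<close>
  have "(\<integral>\<^sup>+y. ennreal (W y - \<kappa> y * ?\<rho> y) \<partial>lborel) \<le> (\<integral>\<^sup>+y. liminf (\<lambda>n. ennreal (W y - D n y)) \<partial>lborel)"
  proof (rule nn_integral_mono, rule ennreal_le_epsilon)
    fix y and e :: real assume e: "0 < e"
    have "ennreal (W y - \<kappa> y * ?\<rho> y - e) \<le> liminf (\<lambda>n. ennreal (W y - D n y))"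
      using lim[OF e, of y] by (intro Liminf_bounded) (auto elim!: eventually_mono intro!: ennreal_leI)
    then have "ennreal (W y - \<kappa> y * ?\<rho> y - e) + ennreal e \<le> liminf (\<lambda>n. ennreal (W y - D n y)) + ennreal e"
      by (rule add_right_mono)
    moreover have "ennreal (W y - \<kappa> y * ?\<rho> y) \<le> ennreal (W y - \<kappa> y * ?\<rho> y - e) + ennreal e"
    proof (cases "W y - \<kappa> y * ?\<rho> y - e \<ge> 0")
      case True
      then show ?thesis using e by (simp flip: ennreal_plus)
    next
      case False
      then have "ennreal (W y - \<kappa> y * ?\<rho> y) \<le> ennreal e" by (intro ennreal_leI) simp
      then show ?thesis by (rule order_trans) simp
    qed
    ultimately show "ennreal (W y - \<kappa> y * ?\<rho> y) \<le> liminf (\<lambda>n. ennreal (W y - D n y)) + ennreal e"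
      by (rule order_trans[rotated])
  qed
  also have "\<dots> \<le> liminf (\<lambda>n. \<integral>\<^sup>+y. ennreal (W y - D n y) \<partial>lborel)"
    using Dint Wint by (intro nn_integral_liminf) auto
  also have "(\<lambda>n. \<integral>\<^sup>+y. ennreal (W y - D n y) \<partial>lborel) = (\<lambda>n. ennreal (LINT y|lborel. W y))"
    using DW Dint Wint D0 by (intro ext, subst nn_integral_eq_integral) auto
  finally have le: "(\<integral>\<^sup>+y. ennreal (W y - \<kappa> y * ?\<rho> y) \<partial>lborel) \<le> ennreal (LINT y|lborel. W y)"
    by (simp add: Liminf_const)
  have W0: "(LINT y|lborel. W y) \<ge> 0"
    using A L by (intro Bochner_Integration.integral_nonneg) (auto simp: W_def C_def)
  have "(LINT y|lborel. W y - \<kappa> y * ?\<rho> y) \<le> (LINT y|lborel. W y)"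
  proof -
    have "(LINT y|lborel. W y - \<kappa> y * ?\<rho> y) \<le> enn2real (\<integral>\<^sup>+y. ennreal (W y - \<kappa> y * ?\<rho> y) \<partial>lborel)"
      using Wint \<kappa> by (subst real_lebesgue_integral_def) auto
    also have "\<dots> \<le> (LINT y|lborel. W y)"
      using le W0 by (metis enn2real_ennreal enn2real_mono ennreal_less_top)
    finally show ?thesis .
  qed
  then show ?thesis using Wint \<kappa> by simp
qed

section \<open>Comparison of sublevel sets\<close>

lemma compose_second_difference_le:
  fixes h :: "real \<Rightarrow> real"
  assumes h: "\<And>s. (h has_real_derivative \<psi> s) (at s)" "\<And>s. (\<psi> has_real_derivative \<psi>' s) (at s)"
    and M: "\<And>s. \<bar>\<psi>' s\<bar> \<le> M"
  shows "h s \<le> h t + \<psi> t * (s - t) + M * (s - t)\<^sup>2"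
proof -
  have lip: "\<bar>\<psi> z - \<psi> t\<bar> \<le> M * \<bar>z - t\<bar>" for z
    using field_differentiable_bound[of UNIV \<psi> \<psi>' M z t] h(2) M by simp
  define R where "R = (\<lambda>z. h z - \<psi> t * z)"
  have "\<bar>R s - R t\<bar> \<le> (M * \<bar>s - t\<bar>) * \<bar>s - t\<bar>"
  proof (rule field_differentiable_bound[of "closed_segment t s" R "\<lambda>z. \<psi> z - \<psi> t" "M * \<bar>s - t\<bar>" s t, unfolded real_norm_def])
    fix z assume z: "z \<in> closed_segment t s"
    show "(R has_real_derivative \<psi> z - \<psi> t) (at z within closed_segment t s)"
      unfolding R_def by (auto intro!: derivative_eq_intros has_field_derivative_at_within[OF h(1)])
    have "\<bar>z - t\<bar> \<le> \<bar>s - t\<bar>" using z by (auto simp: closed_segment_eq_real_ivl split: if_splits)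
    moreover have "M \<ge> 0" using M[of 0] by linarith
    ultimately have "M * \<bar>z - t\<bar> \<le> M * \<bar>s - t\<bar>" by (rule mult_left_mono)
    then show "\<bar>\<psi> z - \<psi> t\<bar> \<le> M * \<bar>s - t\<bar>" using lip[of z] by linarith
  qed auto
  then have "R s - R t \<le> M * (s - t)\<^sup>2"
    by (simp add: power2_eq_square mult.assoc abs_mult_self_eq flip: abs_mult)
  then show ?thesis by (simp add: R_def algebra_simps)
qed

text \<open>By the chain rule the drift Laplacian of \<open>h \<circ> u\<close> is at most \<open>2 u \<psi>' + (N - 4 A u) \<psi>\<close>. The sign of \<open>\<psi>\<close> is left
  open, and the one-sided hypotheses on \<open>u\<close> are multiplied by \<open>\<psi> (u y)\<close>, so that the lemma serves increasing
  functions of a supersolution as well as decreasing functions of a solution.\<close>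

lemma drift_laplacian_compose:
  fixes u :: "'a::euclidean_space \<Rightarrow> real"
  assumes A: "A > 0" "c > 0" and cont: "continuous_on UNIV u" and u0: "\<And>y. u y \<ge> 0" and L: "L \<ge> 0"
    and lip: "\<And>y w. norm w \<le> 1 \<Longrightarrow> \<bar>u (y + w) - u y\<bar> \<le> L * (1 + norm y) * norm w"
    and h: "\<And>s. (h has_real_derivative \<psi> s) (at s)" "\<And>s. (\<psi> has_real_derivative \<psi>' s) (at s)"
    and M: "\<And>s. \<bar>h s\<bar> \<le> M" "\<And>s. \<bar>\<psi> s\<bar> \<le> M" "\<And>s. \<bar>\<psi>' s\<bar> \<le> M"
    and conc: "\<And>y w. \<psi> (u y) * (u (y + w) + u (y - w) - 2 * u y) \<le> M * (norm w)\<^sup>2"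
    and expand: "\<And>y b. b \<in> Basis \<Longrightarrow> upper_expansion (\<lambda>\<epsilon>. h (u (y + \<epsilon> *\<^sub>R b)))
        (\<psi> (u y) * a y b) (\<psi> (u y) * q y b + \<psi>' (u y) * (a y b)\<^sup>2)"
    and grad: "\<And>y. (\<Sum>b\<in>Basis. (a y b)\<^sup>2) = 2 * u y"
    and trace: "\<And>y. \<psi> (u y) * (\<Sum>b\<in>Basis. q y b - 2 * A * (y \<bullet> b) * a y b) \<le> \<psi> (u y) * (N - 4 * A * u y)"
    and ode: "\<And>s. s \<ge> 0 \<Longrightarrow> 2 * s * \<psi>' s + \<psi> s * (N - 4 * A * s) = p s"
    and p: "p \<in> borel_measurable borel" "\<And>s. \<bar>p s\<bar> \<le> P"
  shows "0 \<le> (LINT y|lborel. p (u y) * gaussian_density c A y)"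
proof -
  have M0: "M \<ge> 0" using M(1)[of 0] by linarith
  have "continuous_on UNIV h" using h(1) by (meson DERIV_isCont continuous_at_imp_continuous_on)
  then have gc: "continuous_on UNIV (\<lambda>y. h (u y))"
    using cont by (metis continuous_on_compose2 subset_UNIV)
  have um: "u \<in> borel_measurable borel" using cont by (rule borel_measurable_continuous_onI)
  define L' where "L' = M * L + M + 2 * M * L\<^sup>2"
  have L': "L' \<ge> 0" using M0 L by (simp add: L'_def)
  show ?thesis
  proof (rule drift_laplacian_integral_nonneg[OF A gc, where M = M and L = L'
        and a = "\<lambda>y b. \<psi> (u y) * a y b" and q = "\<lambda>y b. \<psi> (u y) * q y b + \<psi>' (u y) * (a y b)\<^sup>2"])
    show "\<bar>h (u x)\<bar> \<le> M" for x by (rule M)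
    show "L' \<ge> 0" by fact
  next
    fix y w :: 'a assume w: "norm w \<le> 1"
    have "\<bar>h (u (y + w)) - h (u y)\<bar> \<le> M * \<bar>u (y + w) - u y\<bar>"
      using field_differentiable_bound[of UNIV h \<psi> M "u (y + w)" "u y"] h(1) M(2) by simp
    also have "\<dots> \<le> M * (L * (1 + norm y) * norm w)"
      using lip[OF w, of y] M0 by (intro mult_left_mono)
    also have "\<dots> = (M * L) * ((1 + norm y) * norm w)" by simp
    also have "\<dots> \<le> L' * ((1 + norm y) * norm w)"
      using M0 L by (intro mult_right_mono) (auto simp: L'_def)
    finally show "\<bar>h (u (y + w)) - h (u y)\<bar> \<le> L' * (1 + norm y) * norm w" by (simp add: mult.assoc)
    have sq: "(u (y + v) - u y)\<^sup>2 \<le> L\<^sup>2 * ((1 + norm y)\<^sup>2 * (norm w)\<^sup>2)" if "norm v = norm w" for v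
    proof -
      have "\<bar>u (y + v) - u y\<bar> \<le> \<bar>L * (1 + norm y) * norm w\<bar>"
        using lip[of v y] that w L by simp
      then have "(u (y + v) - u y)\<^sup>2 \<le> (L * (1 + norm y) * norm w)\<^sup>2"
        by (rule iffD1[OF abs_le_square_iff])
      then show ?thesis by (simp add: power_mult_distrib mult.assoc)
    qed
    have "h (u (y + w)) + h (u (y - w)) - 2 * h (u y) \<le>
        \<psi> (u y) * (u (y + w) + u (y - w) - 2 * u y) + M * (u (y + w) - u y)\<^sup>2 + M * (u (y + (- w)) - u y)\<^sup>2"
      using compose_second_difference_le[OF h M(3), of "u (y + w)" "u y"]
        compose_second_difference_le[OF h M(3), of "u (y - w)" "u y"]
      by (simp add: algebra_simps)
    also have "\<dots> \<le> M * (norm w)\<^sup>2 + M * (L\<^sup>2 * ((1 + norm y)\<^sup>2 * (norm w)\<^sup>2)) + M * (L\<^sup>2 * ((1 + norm y)\<^sup>2 * (norm w)\<^sup>2))"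
      using conc[of y w] sq[of w] sq[of "- w"] M0 by (intro add_mono mult_left_mono) auto
    also have "\<dots> \<le> M * ((1 + norm y)\<^sup>2 * (norm w)\<^sup>2) + M * (L\<^sup>2 * ((1 + norm y)\<^sup>2 * (norm w)\<^sup>2)) + M * (L\<^sup>2 * ((1 + norm y)\<^sup>2 * (norm w)\<^sup>2))"
    proof -
      have "1 * (norm w)\<^sup>2 \<le> (1 + norm y)\<^sup>2 * (norm w)\<^sup>2"
        by (intro mult_right_mono) (auto intro!: one_le_power)
      then show ?thesis using M0 by (intro add_right_mono mult_left_mono) auto
    qed
    also have "\<dots> = (M + 2 * M * L\<^sup>2) * ((1 + norm y)\<^sup>2 * (norm w)\<^sup>2)"
      by (simp add: distrib_right)
    also have "\<dots> \<le> L' * ((1 + norm y)\<^sup>2 * (norm w)\<^sup>2)"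
      using M0 L by (intro mult_right_mono) (auto simp: L'_def)
    finally show "h (u (y + w)) + h (u (y - w)) - 2 * h (u y) \<le> L' * (1 + norm y)\<^sup>2 * (norm w)\<^sup>2"
      by (simp add: mult.assoc)
  next
    fix y b :: 'a assume b: "b \<in> Basis"
    then show "upper_expansion (\<lambda>\<epsilon>. h (u (y + \<epsilon> *\<^sub>R b))) (\<psi> (u y) * a y b)
        (\<psi> (u y) * q y b + \<psi>' (u y) * (a y b)\<^sup>2)"
      using expand by simp
  next
    fix y :: 'a
    have "(\<Sum>b\<in>Basis. \<psi> (u y) * q y b + \<psi>' (u y) * (a y b)\<^sup>2 - 2 * A * (y \<bullet> b) * (\<psi> (u y) * a y b)) =
        \<psi> (u y) * (\<Sum>b\<in>Basis. q y b - 2 * A * (y \<bullet> b) * a y b) + \<psi>' (u y) * (\<Sum>b\<in>Basis. (a y b)\<^sup>2)"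
      unfolding sum_distrib_left sum.distrib[symmetric]
      by (intro sum.cong) (auto simp: algebra_simps)
    also have "\<dots> \<le> p (u y)"
      using trace[of y] ode[OF u0[of y]] by (simp add: grad mult_ac)
    finally show "(\<Sum>b\<in>Basis. \<psi> (u y) * q y b + \<psi>' (u y) * (a y b)\<^sup>2 - 2 * A * (y \<bullet> b) * (\<psi> (u y) * a y b)) \<le> p (u y)" .
  next
    show "integrable lborel (\<lambda>y. p (u y) * gaussian_density c A y)"
      using measurable_compose[OF um p(1)] p(2) by (intro integrable_bounded_times_gaussian[OF A, where M = P]) auto
  qed
qed

text \<open>
  Modelled on half the squared distance to a set of codimension \<open>N\<close>: supersolutions and solutions of
  \<open>\<Delta> u - 2 A \<langle>x, \<nabla> u\<rangle> = N - 4 A u\<close> with \<open>\<bar>\<nabla> u\<bar>\<^sup>2 = 2 u\<close>, where \<open>a y b\<close> and \<open>q y b\<close> play the role of the first and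
  second derivatives in the direction \<open>b\<close>. The growth condition provides an integrable bound for difference
  quotients. The solutions in question are convex quadratic polynomials, which is why their expansions are exact.
\<close>

definition drift_growth :: "('a::euclidean_space \<Rightarrow> real) \<Rightarrow> bool" where
  "drift_growth u \<longleftrightarrow> continuous_on UNIV u \<and> (\<forall>y. u y \<ge> 0) \<and>
     (\<exists>L\<ge>0. \<forall>y w. norm w \<le> 1 \<longrightarrow> \<bar>u (y + w) - u y\<bar> \<le> L * (1 + norm y) * norm w) \<and>
     (\<forall>y w. u (y + w) + u (y - w) - 2 * u y \<le> (norm w)\<^sup>2)"

definition drift_supersolution :: "real \<Rightarrow> real \<Rightarrow> ('a::euclidean_space \<Rightarrow> real) \<Rightarrow> bool" where
  "drift_supersolution A N u \<longleftrightarrow> drift_growth u \<and>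
     (\<exists>a q. (\<forall>y. \<forall>b\<in>Basis. upper_expansion (\<lambda>\<epsilon>. u (y + \<epsilon> *\<^sub>R b)) (a y b) (q y b)) \<and>
        (\<forall>y. (\<Sum>b\<in>Basis. (a y b)\<^sup>2) = 2 * u y \<and>
          (\<Sum>b\<in>Basis. q y b - 2 * A * (y \<bullet> b) * a y b) \<le> N - 4 * A * u y))"

definition drift_solution :: "real \<Rightarrow> real \<Rightarrow> ('a::euclidean_space \<Rightarrow> real) \<Rightarrow> bool" where
  "drift_solution A N u \<longleftrightarrow> drift_growth u \<and>
     (\<forall>y w. u (y + w) + u (y - w) - 2 * u y \<ge> 0) \<and>
     (\<exists>a q. (\<forall>y \<epsilon>. \<forall>b\<in>Basis. u (y + \<epsilon> *\<^sub>R b) = u y + a y b * \<epsilon> + q y b / 2 * \<epsilon>\<^sup>2) \<and>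
        (\<forall>y. (\<Sum>b\<in>Basis. (a y b)\<^sup>2) = 2 * u y \<and>
          (\<Sum>b\<in>Basis. q y b - 2 * A * (y \<bullet> b) * a y b) = N - 4 * A * u y))"

text \<open>
  For \<open>u\<close> as above and \<open>\<psi> = h'\<close> the drift Laplacian of \<open>h \<circ> u\<close> is bounded by \<open>2 u \<psi>' + (N - 4 A u) \<psi>\<close>. These are the
  functions \<open>p\<close> for which \<open>p \<circ> u\<close> is of this form with an increasing \<open>h\<close>, bounded together with its derivatives.
\<close>

definition radially_solvable :: "real \<Rightarrow> real \<Rightarrow> (real \<Rightarrow> real) \<Rightarrow> bool" where
  "radially_solvable A N p \<longleftrightarrow> p \<in> borel_measurable borel \<and> (\<exists>P. \<forall>s. \<bar>p s\<bar> \<le> P) \<and>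
     (\<exists>h \<psi> \<psi>' M. (\<forall>s. (h has_real_derivative \<psi> s) (at s)) \<and> (\<forall>s. (\<psi> has_real_derivative \<psi>' s) (at s)) \<and>
        (\<forall>s. \<psi> s \<ge> 0 \<and> \<bar>h s\<bar> \<le> M \<and> \<bar>\<psi> s\<bar> \<le> M \<and> \<bar>\<psi>' s\<bar> \<le> M) \<and>
        (\<forall>s\<ge>0. 2 * s * \<psi>' s + \<psi> s * (N - 4 * A * s) = p s))"

lemma supersolution_integral_nonneg:
  fixes u :: "'a::euclidean_space \<Rightarrow> real"
  assumes A: "A > 0" "c > 0" and u: "drift_supersolution A N u" and p: "radially_solvable A N p"
  shows "0 \<le> (LINT y|lborel. p (u y) * gaussian_density c A y)"
proof -
  obtain h \<psi> \<psi>' M P where pm: "p \<in> borel_measurable borel" and P: "\<And>s. \<bar>p s\<bar> \<le> P"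
    and h: "\<And>s. (h has_real_derivative \<psi> s) (at s)" "\<And>s. (\<psi> has_real_derivative \<psi>' s) (at s)"
    and M: "\<And>s. \<psi> s \<ge> 0" "\<And>s. \<bar>h s\<bar> \<le> M" "\<And>s. \<bar>\<psi> s\<bar> \<le> M" "\<And>s. \<bar>\<psi>' s\<bar> \<le> M"
    and ode: "\<And>s. s \<ge> 0 \<Longrightarrow> 2 * s * \<psi>' s + \<psi> s * (N - 4 * A * s) = p s"
    using p unfolding radially_solvable_def by metis
  obtain L a q where cont: "continuous_on UNIV u" and u0: "\<And>y. u y \<ge> 0" and L: "L \<ge> 0"
    and lip: "\<And>y w. norm w \<le> 1 \<Longrightarrow> \<bar>u (y + w) - u y\<bar> \<le> L * (1 + norm y) * norm w"
    and semi: "\<And>y w. u (y + w) + u (y - w) - 2 * u y \<le> (norm w)\<^sup>2"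
    and ex: "\<And>y b. b \<in> Basis \<Longrightarrow> upper_expansion (\<lambda>\<epsilon>. u (y + \<epsilon> *\<^sub>R b)) (a y b) (q y b)"
    and grad: "\<And>y. (\<Sum>b\<in>Basis. (a y b)\<^sup>2) = 2 * u y"
    and tr: "\<And>y. (\<Sum>b\<in>Basis. q y b - 2 * A * (y \<bullet> b) * a y b) \<le> N - 4 * A * u y"
    using u unfolding drift_supersolution_def drift_growth_def by blast
  show ?thesis
  proof (rule drift_laplacian_compose[OF A cont u0 L _ h M(2-4)])
    fix y w
    have "\<psi> (u y) * (u (y + w) + u (y - w) - 2 * u y) \<le> \<psi> (u y) * (norm w)\<^sup>2"
      by (rule mult_left_mono[OF semi M(1)])
    also have "\<dots> \<le> M * (norm w)\<^sup>2"
      using M(3)[of "u y"] by (intro mult_right_mono) auto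
    finally show "\<psi> (u y) * (u (y + w) + u (y - w) - 2 * u y) \<le> M * (norm w)\<^sup>2" .
  next
    fix y b :: 'a assume "b \<in> Basis"
    from upper_expansion_compose_mono[OF h M(1) ex[OF this, of y]]
    show "upper_expansion (\<lambda>\<epsilon>. h (u (y + \<epsilon> *\<^sub>R b)))
        (\<psi> (u y) * a y b) (\<psi> (u y) * q y b + \<psi>' (u y) * (a y b)\<^sup>2)"
      by simp
  next
    fix y
    show "\<psi> (u y) * (\<Sum>b\<in>Basis. q y b - 2 * A * (y \<bullet> b) * a y b) \<le> \<psi> (u y) * (N - 4 * A * u y)"
      by (rule mult_left_mono[OF tr M(1)])
  qed (use lip grad ode pm P in auto)
qed

text \<open>For a solution the argument applies to both \<open>h \<circ> u\<close> and \<open>- h \<circ> u\<close>.\<close>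

lemma solution_integral_zero:
  fixes u :: "'a::euclidean_space \<Rightarrow> real"
  assumes A: "A > 0" "c > 0" and u: "drift_solution A N u" and p: "radially_solvable A N p"
  shows "(LINT y|lborel. p (u y) * gaussian_density c A y) = 0"
proof -
  obtain h \<psi> \<psi>' M P where pm: "p \<in> borel_measurable borel" and P: "\<And>s. \<bar>p s\<bar> \<le> P"
    and h: "\<And>s. (h has_real_derivative \<psi> s) (at s)" "\<And>s. (\<psi> has_real_derivative \<psi>' s) (at s)"
    and M: "\<And>s. \<psi> s \<ge> 0" "\<And>s. \<bar>h s\<bar> \<le> M" "\<And>s. \<bar>\<psi> s\<bar> \<le> M" "\<And>s. \<bar>\<psi>' s\<bar> \<le> M"
    and ode: "\<And>s. s \<ge> 0 \<Longrightarrow> 2 * s * \<psi>' s + \<psi> s * (N - 4 * A * s) = p s"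
    using p unfolding radially_solvable_def by metis
  obtain L a q where cont: "continuous_on UNIV u" and u0: "\<And>y. u y \<ge> 0" and L: "L \<ge> 0"
    and lip: "\<And>y w. norm w \<le> 1 \<Longrightarrow> \<bar>u (y + w) - u y\<bar> \<le> L * (1 + norm y) * norm w"
    and semi: "\<And>y w. u (y + w) + u (y - w) - 2 * u y \<le> (norm w)\<^sup>2" "\<And>y w. u (y + w) + u (y - w) - 2 * u y \<ge> 0"
    and ex: "\<And>y \<epsilon> b. b \<in> Basis \<Longrightarrow> u (y + \<epsilon> *\<^sub>R b) = u y + a y b * \<epsilon> + q y b / 2 * \<epsilon>\<^sup>2"
    and grad: "\<And>y. (\<Sum>b\<in>Basis. (a y b)\<^sup>2) = 2 * u y"
    and tr: "\<And>y. (\<Sum>b\<in>Basis. q y b - 2 * A * (y \<bullet> b) * a y b) = N - 4 * A * u y"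
    using u unfolding drift_solution_def drift_growth_def by blast
  have "drift_supersolution A N u"
    unfolding drift_supersolution_def
  proof (rule conjI[OF _ exI[of _ a, OF exI[of _ q]]])
    show "drift_growth u" using u by (simp add: drift_solution_def)
    have "upper_expansion (\<lambda>\<epsilon>. u (y + \<epsilon> *\<^sub>R b)) (a y b) (q y b)" if b: "b \<in> Basis" for y b
      unfolding upper_expansion_def using ex[OF b]
      by (auto simp: algebra_simps intro!: always_eventually)
    then show "(\<forall>y. \<forall>b\<in>Basis. upper_expansion (\<lambda>\<epsilon>. u (y + \<epsilon> *\<^sub>R b)) (a y b) (q y b)) \<and>
        (\<forall>y. (\<Sum>b\<in>Basis. (a y b)\<^sup>2) = 2 * u y \<and>
          (\<Sum>b\<in>Basis. q y b - 2 * A * (y \<bullet> b) * a y b) \<le> N - 4 * A * u y)"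
      by (simp add: grad tr)
  qed
  then have 1: "0 \<le> (LINT y|lborel. p (u y) * gaussian_density c A y)"
    by (rule supersolution_integral_nonneg[OF A _ p])
  have "0 \<le> (LINT y|lborel. - p (u y) * gaussian_density c A y)"
  proof (rule drift_laplacian_compose[OF A cont u0 L, where h = "\<lambda>s. - h s" and \<psi> = "\<lambda>s. - \<psi> s"
        and \<psi>' = "\<lambda>s. - \<psi>' s" and p = "\<lambda>s. - p s" and M = M and P = P])
    show "((\<lambda>s. - h s) has_real_derivative - \<psi> s) (at s)" "((\<lambda>s. - \<psi> s) has_real_derivative - \<psi>' s) (at s)" for s
      using h by (auto intro: DERIV_minus)
    show "- \<psi> (u y) * (u (y + w) + u (y - w) - 2 * u y) \<le> M * (norm w)\<^sup>2" for y w
    proof -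
      have "\<psi> (u y) * (u (y + w) + u (y - w) - 2 * u y) \<ge> 0" using M(1) semi(2) by (intro mult_nonneg_nonneg) auto
      moreover have "M * (norm w)\<^sup>2 \<ge> 0" using M(2)[of 0] by (intro mult_nonneg_nonneg) auto
      ultimately show ?thesis by linarith
    qed
    fix y b :: 'a assume b: "b \<in> Basis"
    have "upper_expansion (\<lambda>\<epsilon>. - h (u y + a y b * \<epsilon> + q y b / 2 * \<epsilon>\<^sup>2))
        (- \<psi> (u y) * a y b) (- \<psi> (u y) * q y b + - \<psi>' (u y) * (a y b)\<^sup>2)"
      by (rule upper_expansion_compose_quadratic) (use h in \<open>auto intro: DERIV_minus\<close>)
    then show "upper_expansion (\<lambda>\<epsilon>. - h (u (y + \<epsilon> *\<^sub>R b)))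
        (- \<psi> (u y) * a y b) (- \<psi> (u y) * q y b + - \<psi>' (u y) * (a y b)\<^sup>2)"
      by (simp add: ex[OF b])
  next
    show "\<bar>u (y + w) - u y\<bar> \<le> L * (1 + norm y) * norm w" if "norm w \<le> 1" for y w
      by (rule lip[OF that])
    show "2 * s * - \<psi>' s + - \<psi> s * (N - 4 * A * s) = - p s" if "s \<ge> 0" for s
      using ode[OF that] by (simp add: algebra_simps)
  qed (use M grad tr pm P in auto)
  then show ?thesis using 1 by simp
qed

subsection \<open>Solving the radial equation\<close>

text \<open>The integrating factor \<open>m\<close> of the radial equation, which reads \<open>(2 s m \<psi>)' = m p\<close>. Up to a constant factor it is the
  density of half the squared norm of a random vector in dimension \<open>N\<close> with density proportional to
  \<open>exp (- A * (norm x)\<^sup>2)\<close>.\<close>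

definition radial_weight :: "real \<Rightarrow> real \<Rightarrow> real \<Rightarrow> real" where
  "radial_weight A N s = s powr (N / 2 - 1) * exp (- 2 * A * s)"

lemma has_derivative_zero_of_locally_zero:
  fixes f :: "real \<Rightarrow> real"
  assumes "open S" "s \<in> S" "\<And>x. x \<in> S \<Longrightarrow> f x = k"
  shows "(f has_real_derivative 0) (at s)"
  by (rule has_field_derivative_transform_within_open[of "\<lambda>_. k" 0 s S]) (use assms in auto)

lemma bounded_of_compact_support:
  fixes f :: "real \<Rightarrow> real"
  assumes "continuous_on {a..b} f" "\<And>s. s \<notin> {a..b} \<Longrightarrow> f s = 0"
  shows "\<exists>M. \<forall>s. \<bar>f s\<bar> \<le> M"
proof -
  have "bounded (f ` {a..b})" using assms(1) compact_continuous_image compact_imp_bounded by blast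
  then obtain M where M: "\<And>s. s \<in> {a..b} \<Longrightarrow> \<bar>f s\<bar> \<le> M" unfolding bounded_iff real_norm_def by blast
  have "\<bar>f s\<bar> \<le> max M 0" for s using M[of s] assms(2)[of s] by (cases "s \<in> {a..b}") auto
  then show ?thesis by blast
qed

lemma antiderivative:
  fixes f :: "real \<Rightarrow> real"
  assumes f: "continuous_on UNIV f" "\<And>s. s \<le> e \<Longrightarrow> f s = 0" and e: "e > 0"
  shows "((\<lambda>s. integral {0..s} f) has_real_derivative f s) (at s)"
proof (cases "s > 0")
  case True
  have "((\<lambda>s. integral {0..s} f) has_real_derivative f s) (at s within {0..s + 1})"
    using True by (intro integral_has_real_derivative continuous_on_subset[OF f(1)]) auto
  then show ?thesis using True at_within_interior[of s "{0..s + 1}"] by auto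
next
  case False
  have "integral {0..x} f = 0" if "x < e" for x
    using that f(2) by (intro integral_unique has_integral_is_0) auto
  then have "((\<lambda>s. integral {0..s} f) has_real_derivative 0) (at s)"
    using False e by (intro has_derivative_zero_of_locally_zero[of "{..<e}" s _ 0]) auto
  then show ?thesis using f(2)[of s] False e by simp
qed

text \<open>The solution is \<open>\<psi> = G / (2 s m)\<close> with the primitive \<open>G\<close> of \<open>m p\<close>, so the sign of \<open>\<psi>\<close> is that of \<open>G\<close>, and \<open>\<psi>\<close> has
  compact support in the positive half-line if \<open>G\<close> has.\<close>

lemma radially_solvableI:
  assumes p: "continuous_on UNIV p" "\<And>s. s \<le> e \<Longrightarrow> p s = 0" "\<And>s. s \<ge> R \<Longrightarrow> p s = 0" and e: "0 < e"
    and G: "\<And>s. integral {0..s} (\<lambda>s. radial_weight A N s * p s) \<ge> 0"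
      "\<And>s. s \<ge> R \<Longrightarrow> integral {0..s} (\<lambda>s. radial_weight A N s * p s) = 0"
  shows "radially_solvable A N p"
proof -
  define m where "m = radial_weight A N"
  define G where "G = (\<lambda>s. integral {0..s} (\<lambda>s. m s * p s))"
  have mc: "continuous_on {0<..} m" unfolding m_def radial_weight_def by (intro continuous_intros) auto
  have mpc: "continuous_on UNIV (\<lambda>s. m s * p s)"
  proof -
    have "continuous_on ({0<..} \<union> {..<e}) (\<lambda>s. m s * p s)"
    proof (intro continuous_on_open_Un)
      show "continuous_on {0<..} (\<lambda>s. m s * p s)"
        by (intro continuous_intros mc continuous_on_subset[OF p(1)]) auto
      show "continuous_on {..<e} (\<lambda>s. m s * p s)"
        by (rule continuous_on_eq[of _ "\<lambda>s. 0"]) (use p(2) in auto)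
    qed auto
    moreover have "{0<..} \<union> {..<e} = UNIV" using e by auto
    ultimately show ?thesis by simp
  qed
  have dG: "(G has_real_derivative m s * p s) (at s)" for s
    unfolding G_def by (rule antiderivative[OF mpc _ e]) (use p(2) in auto)
  have G0: "G s = 0" if "s \<le> e" for s
    unfolding G_def using that p(2) by (intro integral_unique has_integral_is_0) auto
  have Gpos: "G s \<ge> 0" and GR: "s \<ge> R \<Longrightarrow> G s = 0" for s
    using assms(5)[of s] assms(6)[of s] by (auto simp: G_def m_def)
  have Gc: "continuous_on UNIV G" using dG by (meson DERIV_isCont continuous_at_imp_continuous_on)
  \<comment> \<open>The function \<open>1 / (2 s m)\<close>.\<close>
  define k where "k = (\<lambda>s. exp (2 * A * s) * s powr (- (N / 2)) / 2)"
  define k' where "k' = (\<lambda>s. (2 * A - N / (2 * s)) * k s)"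
  have dk: "(k has_real_derivative k' s) (at s)" if "s > 0" for s
  proof -
    have "s powr (- (N / 2) - 1) = s powr (- (N / 2)) / s"
      using that by (simp add: powr_diff)
    then show ?thesis unfolding k_def k'_def using that
      by (auto intro!: derivative_eq_intros simp: field_simps)
  qed
  have kc: "continuous_on {0<..} k" "continuous_on {0<..} k'"
    unfolding k'_def k_def by (auto intro!: continuous_intros)
  define \<psi> where "\<psi> = (\<lambda>s. G s * k s)"
  define \<psi>' where "\<psi>' = (\<lambda>s. m s * p s * k s + G s * k' s)"
  have d\<psi>: "(\<psi> has_real_derivative \<psi>' s) (at s)" for s
  proof (cases "s > 0")
    case True
    then show ?thesis unfolding \<psi>_def \<psi>'_def
      using DERIV_mult[OF dG dk[OF True]] by (simp add: algebra_simps)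
  next
    case False
    then have "(\<psi> has_real_derivative 0) (at s)"
      using e G0 by (intro has_derivative_zero_of_locally_zero[of "{..<e}" s _ 0]) (auto simp: \<psi>_def)
    then show ?thesis using False e G0[of s] p(2)[of s] by (simp add: \<psi>'_def)
  qed
  have \<psi>c: "continuous_on UNIV \<psi>" using d\<psi> by (meson DERIV_isCont continuous_at_imp_continuous_on)
  have \<psi>0: "\<psi> s = 0" if "s \<le> e \<or> R \<le> s" for s using that G0 GR by (auto simp: \<psi>_def)
  have \<psi>'0: "\<psi>' s = 0" if "s \<le> e \<or> R \<le> s" for s using that G0 GR p by (auto simp: \<psi>'_def)
  have \<psi>'c: "continuous_on {e..R} \<psi>'"
    unfolding \<psi>'_def using e
    by (intro continuous_intros continuous_on_subset[OF mpc] continuous_on_subset[OF kc(1)]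
        continuous_on_subset[OF kc(2)] continuous_on_subset[OF Gc]) auto
  define h where "h = (\<lambda>s. integral {0..s} \<psi>)"
  have dh: "(h has_real_derivative \<psi> s) (at s)" for s
    unfolding h_def by (rule antiderivative[OF \<psi>c _ e]) (use \<psi>0 in auto)
  have hc: "continuous_on UNIV h" using dh by (meson DERIV_isCont continuous_at_imp_continuous_on)
  obtain M1 where M1: "\<And>s. \<bar>\<psi> s\<bar> \<le> M1"
    using bounded_of_compact_support[of e R \<psi>] \<psi>0 continuous_on_subset[OF \<psi>c] by (metis atLeastAtMost_iff linear subset_UNIV)
  obtain M2 where M2: "\<And>s. \<bar>\<psi>' s\<bar> \<le> M2"
    using bounded_of_compact_support[of e R \<psi>'] \<psi>'0 \<psi>'c by (metis atLeastAtMost_iff linear)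
  obtain M3 where M3: "\<And>s. \<bar>h s\<bar> \<le> M3"
  proof -
    define f where "f = (\<lambda>s. if s \<in> {0..max R 0} then h s else 0)"
    have "continuous_on {0..max R 0} f"
      by (rule continuous_on_eq[OF continuous_on_subset[OF hc]]) (auto simp: f_def)
    then obtain M where M: "\<And>s. \<bar>f s\<bar> \<le> M"
      using bounded_of_compact_support[of 0 "max R 0" f] by (metis f_def)
    have "\<bar>h s\<bar> \<le> M" for s
    proof -
      have "s < 0 \<or> s \<in> {0..max R 0} \<or> s \<ge> max R 0" by auto
      then show ?thesis
      proof (elim disjE)
        assume "s < 0"
        then show ?thesis using M[of s] by (simp add: h_def f_def)
      next
        assume "s \<in> {0..max R 0}"
        then show ?thesis using M[of s] by (simp add: f_def)
      next
        assume s: "s \<ge> max R 0"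
        have "h s = h (max R 0)"
        proof (rule DERIV_isconst2[of "max R 0" "s + 1" h s])
          show "continuous_on {max R 0..s + 1} h" by (rule continuous_on_subset[OF hc]) auto
          show "DERIV h x :> 0" if "max R 0 < x" "x < s + 1" for x
            using dh[of x] \<psi>0[of x] that by auto
        qed (use s in auto)
        then show ?thesis using M[of "max R 0"] by (simp add: f_def)
      qed
    qed
    then show ?thesis using that by blast
  qed
  obtain P where P: "\<And>s. \<bar>p s\<bar> \<le> P"
    using bounded_of_compact_support[of e R p] p continuous_on_subset[OF p(1)] by (metis atLeastAtMost_iff linear subset_UNIV)
  have ode: "2 * s * \<psi>' s + \<psi> s * (N - 4 * A * s) = p s" if "s \<ge> 0" for s
  proof (cases "s > 0")
    case True
    have "2 * s * m s * k s = s * s powr (N / 2 - 1) * s powr (- (N / 2)) * (exp (- 2 * A * s) * exp (2 * A * s))"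
      by (simp add: m_def radial_weight_def k_def mult_ac)
    also have "s * s powr (N / 2 - 1) * s powr (- (N / 2)) = 1"
      using True by (simp add: powr_diff powr_minus)
    also have "exp (- 2 * A * s) * exp (2 * A * s) = 1" by (simp flip: exp_add)
    finally have mk: "2 * s * m s * k s = 1" by simp
    have "2 * s * \<psi>' s + \<psi> s * (N - 4 * A * s) = p s * (2 * s * m s * k s) +
        G s * k s * (2 * s * (2 * A - N / (2 * s)) + (N - 4 * A * s))"
      by (simp add: \<psi>_def \<psi>'_def k'_def algebra_simps)
    also have "2 * s * (2 * A - N / (2 * s)) + (N - 4 * A * s) = 0"
      using True by (simp add: field_simps)
    finally show ?thesis by (simp add: mk)
  qed (use that G0[of s] p(2)[of s] e in \<open>auto simp: \<psi>_def\<close>)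
  have "\<psi> s \<ge> 0" for s using Gpos by (simp add: \<psi>_def k_def)
  moreover have "\<bar>h s\<bar> \<le> M1 + M2 + M3 \<and> \<bar>\<psi> s\<bar> \<le> M1 + M2 + M3 \<and> \<bar>\<psi>' s\<bar> \<le> M1 + M2 + M3" for s
    using M1[of s] M2[of s] M3[of s] by linarith
  ultimately show ?thesis unfolding radially_solvable_def
    using borel_measurable_continuous_onI[OF p(1)] P dh d\<psi> ode by metis
qed

subsection \<open>Comparing the distributions of a supersolution and a solution\<close>

definition trapezoid :: "real \<Rightarrow> real \<Rightarrow> real \<Rightarrow> real \<Rightarrow> real" where
  "trapezoid m a b s = max 0 (min 1 (m * min (s - a) (b - s)))"

lemma trapezoid_props:
  assumes "m > 0"
  shows "0 \<le> trapezoid m a b s" "trapezoid m a b s \<le> 1" "s \<le> a \<Longrightarrow> trapezoid m a b s = 0"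
    "s \<ge> b \<Longrightarrow> trapezoid m a b s = 0" "continuous_on S (trapezoid m a b)"
proof -
  show "0 \<le> trapezoid m a b s" "trapezoid m a b s \<le> 1" by (auto simp: trapezoid_def)
  have "m * min (s - a) (b - s) \<le> 0" if "s \<le> a \<or> s \<ge> b"
    using that assms by (intro mult_nonneg_nonpos) auto
  then show "s \<le> a \<Longrightarrow> trapezoid m a b s = 0" "s \<ge> b \<Longrightarrow> trapezoid m a b s = 0"
    by (auto simp: trapezoid_def)
  show "continuous_on S (trapezoid m a b)"
    unfolding trapezoid_def by (intro continuous_intros)
qed

lemma radial_weight_nonneg: "radial_weight A N s \<ge> 0"
  by (simp add: radial_weight_def)

text \<open>
  For a bump \<open>p\<close> to the left and a bump \<open>q\<close> to the right of \<open>\<tau>\<close>, with factors that give both the same mass with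
  respect to the radial weight, the primitive of the weighted difference vanishes at both ends and is nonnegative
  in between. The difference is therefore an admissible right-hand side of the radial equation: its integral is
  nonnegative along \<open>u\<close> and zero along \<open>v\<close>. Eliminating the factors leaves a monotonicity of the likelihood
  ratio of \<open>u\<close> and \<open>v\<close>.
\<close>

lemma bump_comparison:
  fixes u v :: "'a::euclidean_space \<Rightarrow> real"
  assumes A: "A > 0" "c > 0" and u: "drift_supersolution A N u" and v: "drift_solution A N v"
    and p: "continuous_on UNIV p" "\<And>s. p s \<ge> 0" "\<And>s. s \<le> e \<Longrightarrow> p s = 0" "\<And>s. s \<ge> \<tau> \<Longrightarrow> p s = 0"
    and q: "continuous_on UNIV q" "\<And>s. q s \<ge> 0" "\<And>s. s \<le> \<tau> \<Longrightarrow> q s = 0" "\<And>s. s \<ge> R \<Longrightarrow> q s = 0"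
    and e: "0 < e" "e \<le> \<tau>" "\<tau> \<le> R"
  defines "E \<equiv> \<lambda>f (w :: 'a \<Rightarrow> real). LINT y|lborel. f (w y) * gaussian_density c A y"
  shows "E q u * E p v \<le> E p u * E q v"
proof -
  define m where "m = radial_weight A N"
  have m0: "m s \<ge> 0" for s by (simp add: m_def radial_weight_nonneg)
  have int: "(\<lambda>s. m s * f s) integrable_on {0..b}" if "continuous_on UNIV f" "\<And>s. s \<le> e \<Longrightarrow> f s = 0" for f b
  proof -
    have "continuous_on {e..b} (\<lambda>s. m s * f s)"
      unfolding m_def radial_weight_def using e
      by (intro continuous_intros continuous_on_subset[OF that(1)]) auto
    then have 1: "(\<lambda>s. m s * f s) integrable_on {e..b}" by (rule integrable_continuous_interval)
    have 2: "(\<lambda>s. m s * f s) integrable_on {0..min e b}"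
      by (rule integrable_eq[OF integrable_0]) (use that(2) in auto)
    show ?thesis
    proof (cases "e \<le> b")
      case True
      then show ?thesis using 1 2 e by (intro Henstock_Kurzweil_Integration.integrable_combine[where a = 0 and c = e and b = b]) (auto simp: min_def)
    qed (use 2 in \<open>auto simp: min_def\<close>)
  qed
  have qe: "s \<le> e \<Longrightarrow> q s = 0" for s using q(3) e by auto
  define P where "P = (\<lambda>b. integral {0..b} (\<lambda>s. m s * p s))"
  define Q where "Q = (\<lambda>b. integral {0..b} (\<lambda>s. m s * q s))"
  have mono: "integral {0..a} (\<lambda>s. m s * f s) \<le> integral {0..b} (\<lambda>s. m s * f s)"
    if "a \<le> b" "continuous_on UNIV f" "\<And>s. s \<le> e \<Longrightarrow> f s = 0" "\<And>s. f s \<ge> 0" for f a b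
    using that m0 by (intro integral_subset_le int) auto
  have nn: "integral {0..b} (\<lambda>s. m s * f s) \<ge> 0" if "\<And>s. f s \<ge> 0" for f b
  proof (cases "(\<lambda>s. m s * f s) integrable_on {0..b}")
    case True
    then show ?thesis using that m0 by (intro Henstock_Kurzweil_Integration.integral_nonneg) auto
  qed (simp add: not_integrable_integral)
  have const: "integral {0..b} (\<lambda>s. m s * f s) = integral {0..a} (\<lambda>s. m s * f s)"
    if "a \<le> b" "0 \<le> a" "continuous_on UNIV f" "\<And>s. s \<le> e \<Longrightarrow> f s = 0" "\<And>s. s \<ge> a \<Longrightarrow> f s = 0" for f a b
  proof -
    have "integral {a..b} (\<lambda>s. m s * f s) = 0"
      using that(5) by (intro integral_unique has_integral_is_0) auto
    then show ?thesis
      using Henstock_Kurzweil_Integration.integral_combine[where a = 0 and c = a and b = b and f = "\<lambda>s. m s * f s"] that int[where f = f and b = b] by simp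
  qed
  have Qz: "Q b = 0" if "b \<le> \<tau>" for b
    unfolding Q_def using that q(3) by (intro integral_unique has_integral_is_0) auto
  define \<kappa>1 where "\<kappa>1 = P \<tau>"
  define \<kappa>2 where "\<kappa>2 = Q R"
  have \<kappa>: "\<kappa>1 \<ge> 0" "\<kappa>2 \<ge> 0" unfolding \<kappa>1_def \<kappa>2_def P_def Q_def using nn p q by auto
  have P\<tau>: "P b = \<kappa>1" if "b \<ge> \<tau>" for b
    unfolding \<kappa>1_def P_def using that p e by (intro const) auto
  have QR: "Q b = \<kappa>2" if "b \<ge> R" for b
    unfolding \<kappa>2_def Q_def using that q qe e by (intro const) auto
  have Ple: "P b \<le> \<kappa>1" for b
    using mono[where a = b and b = "max b \<tau>" and f = p] p P\<tau>[of "max b \<tau>"] by (auto simp: P_def)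
  have Qle: "Q b \<le> \<kappa>2" for b
    using mono[where a = b and b = "max b R" and f = q] q qe QR[of "max b R"] by (auto simp: Q_def)
  have lin: "integral {0..b} (\<lambda>s. m s * (\<alpha> * p s - \<beta> * q s)) = \<alpha> * P b - \<beta> * Q b" for \<alpha> \<beta> b
  proof -
    have "integral {0..b} (\<lambda>s. \<alpha> * (m s * p s) - \<beta> * (m s * q s)) = \<alpha> * P b - \<beta> * Q b"
      unfolding P_def Q_def
      using int[where f = p and b = b] int[where f = q and b = b] p q qe
      by (subst Henstock_Kurzweil_Integration.integral_diff) (auto intro!: integrable_on_mult_right)
    then show ?thesis by (simp add: algebra_simps)
  qed
  have meas: "w \<in> borel_measurable borel" if "w \<in> {u, v}" for w
    using that u v borel_measurable_continuous_onI
    by (auto simp: drift_supersolution_def drift_solution_def drift_growth_def)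
  have bnd: "\<exists>M. \<forall>s. \<bar>f s\<bar> \<le> M" if "continuous_on UNIV f" "\<And>s. s \<le> e \<Longrightarrow> f s = 0" "\<And>s. s \<ge> R \<Longrightarrow> f s = 0" for f :: "real \<Rightarrow> real"
    by (rule bounded_of_compact_support[of e R]) (use that continuous_on_subset[OF that(1)] in auto)
  have inte: "integrable lborel (\<lambda>y. f (w y) * gaussian_density c A y)" if "f \<in> {p, q}" "w \<in> {u, v}" for f w
  proof -
    have "continuous_on UNIV f" "\<exists>M. \<forall>s. \<bar>f s\<bar> \<le> M"
      using that(1) p(1) q(1) bnd[OF p(1)] bnd[OF q(1)] p(3,4) q(4) qe e(3) by (auto dest: order_trans)
    then show ?thesis
      using measurable_compose[OF meas[OF that(2)] borel_measurable_continuous_onI[of f]]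
      by (auto intro!: integrable_bounded_times_gaussian A)
  qed
  have Elin: "(LINT y|lborel. (\<alpha> * p (w y) - \<beta> * q (w y)) * gaussian_density c A y) = \<alpha> * E p w - \<beta> * E q w"
    if "w \<in> {u, v}" for \<alpha> \<beta> w
  proof -
    have "(LINT y|lborel. \<alpha> * (p (w y) * gaussian_density c A y) - \<beta> * (q (w y) * gaussian_density c A y)) = \<alpha> * E p w - \<beta> * E q w"
      unfolding E_def using inte that
      by (subst Bochner_Integration.integral_diff) auto
    then show ?thesis by (simp add: algebra_simps)
  qed
  have Epos: "E f w \<ge> 0" if "f \<in> {p, q}" for f w
    unfolding E_def using that p(2) q(2)
    by (intro Bochner_Integration.integral_nonneg mult_nonneg_nonneg gaussian_density_nonneg A(2)) auto
  have solv: "radially_solvable A N (\<lambda>s. \<alpha> * p s - \<beta> * q s)"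
    if "\<And>b. \<alpha> * P b - \<beta> * Q b \<ge> 0" "\<And>b. b \<ge> R \<Longrightarrow> \<alpha> * P b - \<beta> * Q b = 0" for \<alpha> \<beta>
    by (rule radially_solvableI[where e = e and R = R])
       (use that p q qe e lin in \<open>auto simp: m_def intro!: continuous_intros\<close>)
  show ?thesis
  proof (cases "\<kappa>1 = 0")
    case True
    have "P b = 0" for b using Ple[of b] nn[where f = p and b = b] p(2) True unfolding P_def by fastforce
    then have "radially_solvable A N (\<lambda>s. 1 * p s - 0 * q s)" by (intro solv) auto
    from solution_integral_zero[OF A v this] have "E p v = 0" by (simp add: E_def)
    then show ?thesis using Epos by simp
  next
    case False
    with \<kappa> have \<kappa>1: "\<kappa>1 > 0" by simp
    have s: "radially_solvable A N (\<lambda>s. \<kappa>2 * p s - \<kappa>1 * q s)"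
    proof (rule solv)
      fix b
      show "\<kappa>2 * P b - \<kappa>1 * Q b \<ge> 0"
      proof (cases "b \<le> \<tau>")
        case True
        then show ?thesis using Qz[OF True] \<kappa> nn[where f = p and b = b] p(2) by (simp add: P_def)
      next
        case False
        then show ?thesis using P\<tau>[of b] Qle[of b] \<kappa>1 by (simp add: mult.commute)
      qed
      show "\<kappa>2 * P b - \<kappa>1 * Q b = 0" if "b \<ge> R"
        using that P\<tau>[of b] QR[of b] e by simp
    qed
    have 1: "\<kappa>1 * E q u \<le> \<kappa>2 * E p u"
      using supersolution_integral_nonneg[OF A u s] Elin[of u] by simp
    have 2: "\<kappa>2 * E p v = \<kappa>1 * E q v"
      using solution_integral_zero[OF A v s] Elin[of v] by simp
    have "\<kappa>1 * (E q u * E p v) \<le> \<kappa>2 * E p u * E p v"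
      using mult_right_mono[OF 1 Epos[of p v]] by (simp add: mult_ac)
    also have "\<dots> = \<kappa>1 * (E p u * E q v)" using 2 by (metis mult.assoc mult.commute)
    finally show ?thesis using \<kappa>1 by simp
  qed
qed

text \<open>Let the bumps increase to the indicators of \<open>{0<..\<tau>}\<close> and \<open>{\<tau><..}\<close>. If \<open>a\<close> and \<open>b\<close> are the measures of the two
  sublevel sets and \<open>T\<close> is the total mass, the comparison of bumps becomes \<open>(T - a) b \<le> a (T - b)\<close>. That \<open>u\<close> may
  vanish on a set of positive measure only helps.\<close>

theorem sublevel_comparison:
  fixes u v :: "'a::euclidean_space \<Rightarrow> real"
  assumes A: "A > 0" "c > 0" and u: "drift_supersolution A N u" and v: "drift_solution A N v"
    and null: "AE y in lborel. v y \<noteq> 0" and \<tau>: "\<tau> > 0"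
  shows "(LINT y|lborel. indicator {..\<tau>} (v y) * gaussian_density c A y) \<le>
         (LINT y|lborel. indicator {..\<tau>} (u y) * gaussian_density c A y)"
proof -
  define E where "E = (\<lambda>f (w :: 'a \<Rightarrow> real). LINT y|lborel. f (w y) * gaussian_density c A y)"
  define \<delta> where "\<delta> = (\<lambda>n. 1 / real (Suc n))"
  have \<delta>: "0 < \<delta> n" "\<delta> n \<le> 1" for n by (auto simp: \<delta>_def)
  have \<delta>0: "\<delta> \<longlonglongrightarrow> 0" unfolding \<delta>_def using LIMSEQ_Suc[OF lim_1_over_n[where 'a = real]] by simp
  have ninf: "filterlim (\<lambda>n. real (Suc n)) at_top sequentially"
    by (rule filterlim_compose[OF filterlim_real_sequentially filterlim_Suc])
  define m where "m = (\<lambda>n. (real (Suc n))\<^sup>2)"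
  have m0: "m n > 0" for n by (simp add: m_def)
  define p where "p = (\<lambda>n. trapezoid (m n) (min \<tau> (\<delta> n)) (\<tau> + \<delta> n))"
  define q where "q = (\<lambda>n. trapezoid (m n) (\<tau> + \<delta> n) (\<tau> + 1 + real n))"
  have one: "\<forall>\<^sub>F n in sequentially. trapezoid (m n) (a n) (b n) s = 1"
    if "\<forall>\<^sub>F n in sequentially. s - a n \<ge> \<delta> n" "\<forall>\<^sub>F n in sequentially. b n - s \<ge> \<delta> n" for a b s
    using that
  proof eventually_elim
    case (elim n)
    have "m n * \<delta> n \<le> m n * min (s - a n) (b n - s)" using elim m0[of n] by (intro mult_left_mono) auto
    moreover have "m n * \<delta> n \<ge> 1" by (simp add: m_def \<delta>_def power2_eq_square)
    ultimately show ?case by (simp add: trapezoid_def)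
  qed
  have small: "\<forall>\<^sub>F n in sequentially. \<delta> n < x" if "x > 0" for x
    using order_tendstoD(2)[OF \<delta>0 that] .
  have large: "\<forall>\<^sub>F n in sequentially. real n > x" for x
    using filterlim_real_sequentially by (simp add: filterlim_at_top_dense)
  have plim: "(\<lambda>n. p n s) \<longlonglongrightarrow> indicator {0<..\<tau>} s" if "s \<ge> 0" for s
  proof -
    have "\<forall>\<^sub>F n in sequentially. p n s = indicator {0<..\<tau>} s"
    proof -
      consider "s = 0" | "0 < s" "s \<le> \<tau>" | "s > \<tau>" using \<open>s \<ge> 0\<close> by linarith
      then show ?thesis
      proof cases
        case 1
        have "p n s = 0" for n
          unfolding p_def by (rule trapezoid_props(3)[OF m0]) (use 1 \<delta>(1)[of n] \<tau> in auto)
        then show ?thesis using 1 by simp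
      next
        case 2
        have "\<forall>\<^sub>F n in sequentially. p n s = 1"
          unfolding p_def
        proof (rule one)
          show "\<forall>\<^sub>F n in sequentially. s - min \<tau> (\<delta> n) \<ge> \<delta> n"
            using small[of "s / 2"] 2 by (auto elim!: eventually_mono)
        qed (use 2 in auto)
        then show ?thesis using 2 by simp
      next
        case 3
        then show ?thesis using small[of "s - \<tau>"] m0 by (auto elim!: eventually_mono simp: p_def trapezoid_props)
      qed
    qed
    then show ?thesis by (rule tendsto_eventually)
  qed
  have qlim: "(\<lambda>n. q n s) \<longlonglongrightarrow> indicator {\<tau><..} s" for s
  proof -
    have "\<forall>\<^sub>F n in sequentially. q n s = indicator {\<tau><..} s"
    proof (cases "s \<le> \<tau>")
      case True
      then have "q n s = 0" for n using \<delta>(1)[of n] m0 by (auto simp: q_def trapezoid_props)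
      then show ?thesis using True by simp
    next
      case False
      have "\<forall>\<^sub>F n in sequentially. q n s = 1"
        unfolding q_def
      proof (rule one)
        show "\<forall>\<^sub>F n in sequentially. s - (\<tau> + \<delta> n) \<ge> \<delta> n"
          using small[of "(s - \<tau>) / 2"] False by (auto elim!: eventually_mono)
        show "\<forall>\<^sub>F n in sequentially. \<tau> + 1 + real n - s \<ge> \<delta> n"
          using large[of "s - \<tau>"] \<delta>(2) by (auto elim!: eventually_mono simp: add.commute) (smt (verit) \<delta>(2))
      qed
      then show ?thesis using False by simp
    qed
    then show ?thesis by (rule tendsto_eventually)
  qed
  have w: "w \<in> borel_measurable borel" "\<And>y. w y \<ge> 0" if "w \<in> {u, v}" for w
    using that u v borel_measurable_continuous_onI
    by (auto simp: drift_supersolution_def drift_solution_def drift_growth_def)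
  have conv: "(\<lambda>n. E (f n) w) \<longlonglongrightarrow> E g w"
    if w': "w \<in> {u, v}" and f: "\<And>n. continuous_on UNIV (f n)" "\<And>n s. \<bar>f n s\<bar> \<le> 1"
      and g: "g \<in> borel_measurable borel" "\<And>s. s \<ge> 0 \<Longrightarrow> (\<lambda>n. f n s) \<longlonglongrightarrow> g s" for f g w
    unfolding E_def
  proof (rule integral_dominated_convergence[where w = "gaussian_density c A"])
    show "(\<lambda>y. g (w y) * gaussian_density c A y) \<in> borel_measurable lborel"
      using measurable_compose[OF w(1)[OF w'] g(1)] by measurable
    show "(\<lambda>y. f n (w y) * gaussian_density c A y) \<in> borel_measurable lborel" for n
      using measurable_compose[OF w(1)[OF w'] borel_measurable_continuous_onI[OF f(1)]] by measurable
    show "AE y in lborel. (\<lambda>n. f n (w y) * gaussian_density c A y) \<longlonglongrightarrow> g (w y) * gaussian_density c A y"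
      using g(2) w(2)[OF w'] by (intro AE_I2 tendsto_mult tendsto_const) auto
    show "AE y in lborel. norm (f n (w y) * gaussian_density c A y) \<le> gaussian_density c A y" for n
    proof (rule AE_I2)
      fix y
      have "norm (f n (w y) * gaussian_density c A y) = \<bar>f n (w y)\<bar> * gaussian_density c A y"
        by (simp add: abs_mult gaussian_density_nonneg[OF A(2)])
      also have "\<dots> \<le> gaussian_density c A y"
        by (intro mult_left_le_one_le f(2) gaussian_density_nonneg A(2)) auto
      finally show "norm (f n (w y) * gaussian_density c A y) \<le> gaussian_density c A y" .
    qed
  qed (rule gaussian_density_integrable[OF A(1)])
  have cp: "continuous_on UNIV (p n)" "\<bar>p n s\<bar> \<le> 1" and cq: "continuous_on UNIV (q n)" "\<bar>q n s\<bar> \<le> 1" for n s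
    unfolding p_def q_def
    using trapezoid_props(1,2)[OF m0[of n], of "min \<tau> (\<delta> n)" "\<tau> + \<delta> n" s]
      trapezoid_props(1,2)[OF m0[of n], of "\<tau> + \<delta> n" "\<tau> + 1 + real n" s]
    by (simp_all add: trapezoid_props(5)[OF m0])
  have bumps: "E (q n) u * E (p n) v \<le> E (p n) u * E (q n) v" for n
    unfolding E_def
    by (rule bump_comparison[OF A u v, where e = "min \<tau> (\<delta> n)" and \<tau> = "\<tau> + \<delta> n" and R = "\<tau> + 1 + real n"])
       (use cp cq m0 \<delta>[of n] \<tau> in \<open>auto simp: p_def q_def trapezoid_props\<close>)
  have ind: "(indicator {0<..\<tau>} :: real \<Rightarrow> real) \<in> borel_measurable borel" "(indicator {\<tau><..} :: real \<Rightarrow> real) \<in> borel_measurable borel"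
    by simp_all
  have main: "E (indicator {\<tau><..}) u * E (indicator {0<..\<tau>}) v \<le> E (indicator {0<..\<tau>}) u * E (indicator {\<tau><..}) v"
  proof (rule LIMSEQ_le)
    show "(\<lambda>n. E (q n) u * E (p n) v) \<longlonglongrightarrow> E (indicator {\<tau><..}) u * E (indicator {0<..\<tau>}) v"
      by (intro tendsto_mult conv cp cq ind plim qlim) auto
    show "(\<lambda>n. E (p n) u * E (q n) v) \<longlonglongrightarrow> E (indicator {0<..\<tau>}) u * E (indicator {\<tau><..}) v"
      by (intro tendsto_mult conv cp cq ind plim qlim) auto
  qed (use bumps in auto)
  have inte: "integrable lborel (\<lambda>y. indicator S (w y) * gaussian_density c A y)" if "w \<in> {u, v}" "S \<in> sets borel" for w and S :: "real set"
    using w[OF that(1)] that(2)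
    by (intro integrable_bounded_times_gaussian[OF A, where M = 1]) (auto split: split_indicator)
  define T where "T = (LINT y::'a|lborel. gaussian_density c A y)"
  have compl: "E (indicator {\<tau><..}) w = T - E (indicator {..\<tau>}) w" if "w \<in> {u, v}" for w
  proof -
    have "E (indicator {\<tau><..}) w = (LINT y|lborel. gaussian_density c A y - indicator {..\<tau>} (w y) * gaussian_density c A y)"
      unfolding E_def by (intro Bochner_Integration.integral_cong) (auto split: split_indicator)
    also have "\<dots> = T - E (indicator {..\<tau>}) w"
      unfolding E_def T_def using inte[OF that, of "{..\<tau>}"] gaussian_density_integrable[OF A(1)]
      by (subst Bochner_Integration.integral_diff) auto
    finally show ?thesis .
  qed
  have v0: "E (indicator {0<..\<tau>}) v = E (indicator {..\<tau>}) v"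
    unfolding E_def
  proof (rule integral_cong_AE)
    show "AE y in lborel. indicator {0<..\<tau>} (v y) * gaussian_density c A y = indicator {..\<tau>} (v y) * gaussian_density c A y"
      using null w(2)[of v] by (auto elim!: eventually_mono split: split_indicator simp: less_le)
  qed (use inte[of v] in auto)
  have u0: "E (indicator {0<..\<tau>}) u \<le> E (indicator {..\<tau>}) u"
    unfolding E_def using inte[of u] gaussian_density_nonneg[OF A(2)]
    by (intro integral_mono) (auto split: split_indicator)
  have T: "T > 0"
  proof -
    have "T \<noteq> 0"
    proof
      assume "T = 0"
      then have "AE y in lborel. gaussian_density c A (y::'a) = 0"
        unfolding T_def using gaussian_density_integrable[OF A(1)] gaussian_density_nonneg[OF A(2)]
        by (subst (asm) integral_nonneg_eq_0_iff_AE) auto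
      then have "AE y in (lborel :: 'a measure). False" using A by (simp add: gaussian_density_def)
      then show False by (simp add: AE_iff_null null_sets_def)
    qed
    moreover have "T \<ge> 0" unfolding T_def using gaussian_density_nonneg[OF A(2)] by (intro Bochner_Integration.integral_nonneg) auto
    ultimately show ?thesis by simp
  qed
  define a where "a = E (indicator {..\<tau>}) u"
  define b where "b = E (indicator {..\<tau>}) v"
  have "b \<le> T"
    unfolding b_def E_def T_def using inte[of v "{..\<tau>}"] gaussian_density_integrable[OF A(1)] gaussian_density_nonneg[OF A(2)]
    by (intro integral_mono) (auto split: split_indicator)
  have "(T - a) * b \<le> E (indicator {0<..\<tau>}) u * (T - b)"
    using main compl[of u] compl[of v] v0 by (simp add: a_def b_def)
  also have "\<dots> \<le> a * (T - b)"
    using u0 \<open>b \<le> T\<close> by (intro mult_right_mono) (auto simp: a_def)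
  finally have "T * b \<le> T * a" by (simp add: algebra_simps)
  then show ?thesis using T by (simp add: a_def b_def E_def)
qed

section \<open>Lebesgue measure of coordinate subspaces\<close>

definition coord_proj :: "'a::euclidean_space set \<Rightarrow> 'a \<Rightarrow> 'a" where
  "coord_proj I y = (\<Sum>b\<in>I. (y \<bullet> b) *\<^sub>R b)"

definition coord_slab :: "'a::euclidean_space set \<Rightarrow> 'a set" where
  "coord_slab I = {y. \<forall>b\<in>Basis - I. y \<bullet> b \<in> {0..1}}"

lemma coord_proj_inner:
  assumes "I \<subseteq> Basis" "b \<in> Basis"
  shows "coord_proj I y \<bullet> b = (if b \<in> I then y \<bullet> b else 0)"
proof -
  have "coord_proj I y \<bullet> b = (\<Sum>c\<in>I. if c = b then y \<bullet> b else 0)"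
    unfolding coord_proj_def inner_sum_left
    using assms by (intro sum.cong) (auto simp: inner_Basis)
  then show ?thesis using finite_subset[OF assms(1)] by simp
qed

lemma bounded_linear_coord_proj: "bounded_linear (coord_proj I)"
  unfolding coord_proj_def [abs_def] by (intro bounded_linear_intros)

lemmas linear_coord_proj = bounded_linear.linear[OF bounded_linear_coord_proj]

lemma coord_proj_borel [measurable]: "coord_proj I \<in> borel_measurable borel"
  using bounded_linear_coord_proj by (intro borel_measurable_continuous_onI linear_continuous_on)

lemma coord_proj_in_span: "coord_proj I y \<in> span I"
  unfolding coord_proj_def by (intro span_sum span_scale span_base)

lemma coord_proj_of_span:
  assumes "I \<subseteq> Basis" "y \<in> span I" shows "coord_proj I y = y"
  using assms by (auto intro!: euclidean_eqI[where 'a = 'a] simp: coord_proj_inner span_substd_basis)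

lemma coord_slab_borel [measurable]: "coord_slab I \<in> sets borel"
proof -
  have "closed (coord_slab I)"
  proof -
    have "coord_slab I = (\<Inter>b\<in>Basis - I. {y. 0 \<le> y \<bullet> b} \<inter> {y. y \<bullet> b \<le> 1})"
      by (auto simp: coord_slab_def)
    then show ?thesis
      by (auto intro!: closed_INT closed_Int closed_Collect_le continuous_intros)
  qed
  then show ?thesis by simp
qed

text \<open>The slab has unit extent in the remaining coordinates, so projecting it preserves measure.\<close>

lemma lborel_on_eq_distr_slab:
  assumes I: "I \<subseteq> (Basis :: 'a::euclidean_space set)"
  shows "lborel_on I = distr (density lborel (indicator (coord_slab I))) borel (coord_proj I)"
proof -
  interpret product_sigma_finite "\<lambda>_::'a. lborel :: real measure" by standard
  have fI: "finite I" using I finite_Basis finite_subset by blast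
  define Q where "Q = (\<Pi>\<^sub>M b\<in>(Basis :: 'a set). (lborel :: real measure))"
  define D :: "('a \<Rightarrow> real) \<Rightarrow> ennreal" where "D = (\<lambda>f. \<Prod>b\<in>Basis - I. indicator {0..1} (f b))"
  have comp [measurable]: "(\<lambda>f. f b) \<in> borel_measurable Q" if "b \<in> Basis" for b
    using measurable_component_singleton[OF that, of "\<lambda>_. lborel :: real measure"] unfolding Q_def by simp
  have Dm [measurable]: "D \<in> borel_measurable Q"
    unfolding D_def by (intro borel_measurable_prod_ennreal) measurable
  have rm: "(\<lambda>f. restrict f I) \<in> measurable Q (\<Pi>\<^sub>M b\<in>I. lborel)"
    unfolding Q_def by (rule measurable_restrict_subset[OF I])
  have 1: "distr (density Q D) (\<Pi>\<^sub>M b\<in>I. lborel) (\<lambda>f. restrict f I) = (\<Pi>\<^sub>M b\<in>I. lborel)"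
  proof (rule PiM_eqI[OF fI])
    fix A :: "'a \<Rightarrow> real set" assume A: "\<And>i. i \<in> I \<Longrightarrow> A i \<in> sets lborel"
    define A' where "A' = (\<lambda>b. if b \<in> I then A b else {0..1})"
    have PA: "Pi\<^sub>E I A \<in> sets (\<Pi>\<^sub>M b\<in>I. lborel)" using A fI by (intro sets_PiM_I_finite) auto
    have PA': "Pi\<^sub>E Basis A' \<in> sets Q" unfolding Q_def using A by (intro sets_PiM_I_finite) (auto simp: A'_def)
    have "emeasure (distr (density Q D) (\<Pi>\<^sub>M b\<in>I. lborel) (\<lambda>f. restrict f I)) (Pi\<^sub>E I A) =
        (\<integral>\<^sup>+f. D f * indicator ((\<lambda>f. restrict f I) -` Pi\<^sub>E I A \<inter> space Q) f \<partial>Q)"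
      using rm PA by (simp add: emeasure_distr emeasure_density measurable_sets)
    also have "\<dots> = (\<integral>\<^sup>+f. indicator (Pi\<^sub>E Basis A') f \<partial>Q)"
    proof (rule nn_integral_cong)
      fix f assume f: "f \<in> space Q"
      then have ext: "f \<in> extensional Basis" by (simp add: Q_def space_PiM PiE_def)
      have "D f = indicator {f. \<forall>b\<in>Basis - I. f b \<in> {0..1}} f"
        unfolding D_def by (auto simp: indicator_def prod_eq_1_iff)
      moreover have "f \<in> Pi\<^sub>E Basis A' \<longleftrightarrow> (\<forall>b\<in>Basis - I. f b \<in> {0..1}) \<and> restrict f I \<in> Pi\<^sub>E I A"
      proof
        assume "f \<in> Pi\<^sub>E Basis A'"
        then have *: "f b \<in> A' b" if "b \<in> Basis" for b using that by auto
        show "(\<forall>b\<in>Basis - I. f b \<in> {0..1}) \<and> restrict f I \<in> Pi\<^sub>E I A"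
        proof
          show "\<forall>b\<in>Basis - I. f b \<in> {0..1}"
          proof
            fix b assume "b \<in> Basis - I"
            then show "f b \<in> {0..1}" using *[of b] by (simp add: A'_def)
          qed
          show "restrict f I \<in> Pi\<^sub>E I A"
            unfolding restrict_PiE_iff
          proof
            fix b assume "b \<in> I"
            then show "f b \<in> A b" using *[of b] I by (auto simp: A'_def)
          qed
        qed
      next
        assume *: "(\<forall>b\<in>Basis - I. f b \<in> {0..1}) \<and> restrict f I \<in> Pi\<^sub>E I A"
        have "f b \<in> A' b" if "b \<in> Basis" for b
          using * PiE_mem[of "restrict f I" I A b] that by (cases "b \<in> I") (auto simp: A'_def)
        then show "f \<in> Pi\<^sub>E Basis A'" using ext by (auto simp: PiE_def)
      qed
      ultimately show "D f * indicator ((\<lambda>f. restrict f I) -` Pi\<^sub>E I A \<inter> space Q) f = indicator (Pi\<^sub>E Basis A') f"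
        using f by (auto split: split_indicator)
    qed
    also have "\<dots> = emeasure Q (Pi\<^sub>E Basis A')" using PA' by simp
    also have "\<dots> = (\<Prod>b\<in>Basis. emeasure lborel (A' b))"
      unfolding Q_def using A by (intro emeasure_PiM) (auto simp: A'_def)
    also have "\<dots> = (\<Prod>b\<in>Basis - I. emeasure lborel (A' b)) * (\<Prod>b\<in>I. emeasure lborel (A' b))"
      by (rule prod.subset_diff[OF I finite_Basis])
    also have "\<dots> = (\<Prod>b\<in>I. emeasure lborel (A b))" by (simp add: A'_def)
    finally show "emeasure (distr (density Q D) (\<Pi>\<^sub>M b\<in>I. lborel) (\<lambda>f. restrict f I)) (Pi\<^sub>E I A) =
        (\<Prod>b\<in>I. emeasure lborel (A b))" .
  qed simp
  have Tm: "(\<lambda>f. \<Sum>b\<in>J. f b *\<^sub>R b) \<in> borel_measurable (\<Pi>\<^sub>M b\<in>J. lborel)" if "J \<subseteq> Basis" for J :: "'a set"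
    using measurable_component_singleton[of _ J "\<lambda>_. lborel :: real measure"]
    by (intro borel_measurable_sum borel_measurable_scaleR) auto
  have lhs: "lborel_on I = distr (density Q D) borel (\<lambda>f. \<Sum>b\<in>I. f b *\<^sub>R b)"
  proof -
    have "lborel_on I = distr (distr (density Q D) (\<Pi>\<^sub>M b\<in>I. lborel) (\<lambda>f. restrict f I)) borel (\<lambda>f. \<Sum>b\<in>I. f b *\<^sub>R b)"
      unfolding lborel_on_def 1 ..
    also have "\<dots> = distr (density Q D) borel ((\<lambda>f. \<Sum>b\<in>I. f b *\<^sub>R b) \<circ> (\<lambda>f. restrict f I))"
      using rm by (intro distr_distr Tm I) (simp cong: measurable_cong_sets)
    also have "(\<lambda>f. \<Sum>b\<in>I. f b *\<^sub>R b) \<circ> (\<lambda>f. restrict f I) = (\<lambda>f. \<Sum>b\<in>I. f b *\<^sub>R b)"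
      by (auto simp: fun_eq_iff)
    finally show ?thesis .
  qed
  define T where "T = (\<lambda>f :: 'a \<Rightarrow> real. \<Sum>b\<in>Basis. f b *\<^sub>R b)"
  have TQ: "T \<in> borel_measurable Q" unfolding T_def Q_def by (rule Tm) simp
  have Tb: "T f \<bullet> b = f b" if "b \<in> Basis" for f b
    using that by (simp add: T_def inner_sum_left inner_Basis if_distrib cong: if_cong)
  have "density lborel (indicator (coord_slab I)) = density (distr Q borel T) (indicator (coord_slab I))"
    unfolding lborel_eq[where 'a = 'a] Q_def T_def ..
  also have "\<dots> = distr (density Q (\<lambda>f. indicator (coord_slab I) (T f))) borel T"
    using TQ by (intro density_distr) auto
  also have "(\<lambda>f. indicator (coord_slab I) (T f)) = D"
    by (auto simp: fun_eq_iff D_def coord_slab_def Tb indicator_def prod_eq_1_iff)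
  finally have "distr (density lborel (indicator (coord_slab I))) borel (coord_proj I) =
      distr (density Q D) borel (coord_proj I \<circ> T)"
    using TQ by (simp add: distr_distr cong: measurable_cong_sets)
  also have "coord_proj I \<circ> T = (\<lambda>f. \<Sum>b\<in>I. f b *\<^sub>R b)"
    using I by (auto simp: fun_eq_iff coord_proj_def intro!: sum.cong Tb)
  finally show ?thesis using lhs by simp
qed

lemma sets_lborel_on [simp, measurable_cong]: "sets (lborel_on I) = sets borel"
  by (simp add: lborel_on_def)

lemma space_lborel_on [simp]: "space (lborel_on I) = UNIV"
  by (simp add: lborel_on_def)

lemma nn_integral_lborel_on:
  assumes "I \<subseteq> Basis" and [measurable]: "f \<in> borel_measurable borel"
  shows "(\<integral>\<^sup>+y. f y \<partial>lborel_on I) = (\<integral>\<^sup>+y. indicator (coord_slab I) y * f (coord_proj I y) \<partial>lborel)"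
  unfolding lborel_on_eq_distr_slab[OF assms(1)]
  by (simp add: nn_integral_distr nn_integral_density)

lemma AE_lborel_on_span:
  assumes "I \<subseteq> Basis" shows "AE y in lborel_on I. y \<in> span I"
  unfolding lborel_on_eq_distr_slab[OF assms]
  by (subst AE_distr_iff) (auto simp: coord_proj_in_span closed_subspace intro!: borel_closed)

lemma lborel_on_translate:
  assumes I: "I \<subseteq> Basis" and b: "b \<in> span I"
  shows "distr (lborel_on I) borel (\<lambda>y. y + b) = lborel_on I"
proof (rule measure_eqI)
  fix B assume "B \<in> sets (distr (lborel_on I) borel (\<lambda>y. y + b))"
  then have B [measurable]: "B \<in> sets borel" by simp
  have pb: "coord_proj I (y + b) = coord_proj I y + b" for y
    using coord_proj_of_span[OF I b] linear_add[OF linear_coord_proj, of I y b] by simp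
  have sb: "y + b \<in> coord_slab I \<longleftrightarrow> y \<in> coord_slab I" for y
    using b I by (auto simp: coord_slab_def inner_add_left span_substd_basis)
  have "emeasure (distr (lborel_on I) borel (\<lambda>y. y + b)) B =
      (\<integral>\<^sup>+y. indicator B y \<partial>distr (lborel_on I) borel (\<lambda>y. y + b))"
    by simp
  also have "\<dots> = (\<integral>\<^sup>+y. indicator B (y + b) \<partial>lborel_on I)"
    by (rule nn_integral_distr) auto
  also have "\<dots> = (\<integral>\<^sup>+y. indicator (coord_slab I) y * indicator B (coord_proj I y + b) \<partial>lborel)"
    by (rule nn_integral_lborel_on[OF I]) simp
  also have "\<dots> = (\<integral>\<^sup>+y. indicator (coord_slab I) (b + y) * indicator B (coord_proj I (b + y)) \<partial>lborel)"
    by (simp only: add.commute[of b] pb) (simp add: sb indicator_def)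
  also have "\<dots> = (\<integral>\<^sup>+y. indicator (coord_slab I) y * indicator B (coord_proj I y) \<partial>distr lborel borel ((+) b))"
    by (subst nn_integral_distr) auto
  also have "\<dots> = (\<integral>\<^sup>+y. indicator B y \<partial>lborel_on I)"
    unfolding lborel_distr_plus by (rule nn_integral_lborel_on[OF I, symmetric]) simp
  also have "\<dots> = emeasure (lborel_on I) B" by simp
  finally show "emeasure (distr (lborel_on I) borel (\<lambda>y. y + b)) B = emeasure (lborel_on I) B" .
qed simp

lemma emeasure_lborel_on_bounded:
  assumes I: "I \<subseteq> (Basis :: 'a::euclidean_space set)" and B: "B \<in> sets borel" "bounded B"
  shows "emeasure (lborel_on I) B < \<infinity>"
proof -
  obtain M where M: "\<And>y. y \<in> B \<Longrightarrow> norm y \<le> M" using B(2) by (auto simp: bounded_iff)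
  define R where "R = (\<Sum>b\<in>(Basis :: 'a set). max M 1)"
  have sub: "norm y \<le> R" if "y \<in> coord_slab I" "coord_proj I y \<in> B" for y
  proof -
    have "norm y \<le> (\<Sum>b\<in>Basis. \<bar>y \<bullet> b\<bar>)" by (rule norm_le_l1)
    also have "\<dots> \<le> R" unfolding R_def
    proof (rule sum_mono)
      fix b :: 'a assume b: "b \<in> Basis"
      show "\<bar>y \<bullet> b\<bar> \<le> max M 1"
      proof (cases "b \<in> I")
        case True
        then have "\<bar>y \<bullet> b\<bar> = \<bar>coord_proj I y \<bullet> b\<bar>" using coord_proj_inner[OF I b] by simp
        also have "\<dots> \<le> M" using M[OF that(2)] Basis_le_norm[OF b, of "coord_proj I y"] by simp
        finally show ?thesis by simp
      qed (use that(1) b in \<open>auto simp: coord_slab_def le_max_iff_disj\<close>)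
    qed
    finally show ?thesis .
  qed
  have [measurable]: "B \<in> sets borel" by fact
  have "emeasure (lborel_on I) B = (\<integral>\<^sup>+y. indicator B y \<partial>lborel_on I)" using B by simp
  also have "\<dots> = (\<integral>\<^sup>+y. indicator (coord_slab I) y * indicator B (coord_proj I y) \<partial>lborel)"
    by (rule nn_integral_lborel_on[OF I]) simp
  also have "\<dots> \<le> (\<integral>\<^sup>+y. indicator (cball 0 R) y \<partial>(lborel :: 'a measure))"
    using sub by (intro nn_integral_mono) (auto split: split_indicator)
  also have "\<dots> < \<infinity>" using emeasure_lborel_cball_finite[of "0::'a" R] by simp
  finally show ?thesis .
qed

text \<open>Shifted by \<open>1/2\<close> in the remaining coordinates, the center lies in the interior of the slab.\<close>

lemma emeasure_lborel_on_ball_pos: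
  assumes I: "I \<subseteq> (Basis :: 'a::euclidean_space set)" and q: "q \<in> span I" and r: "r > 0"
  shows "emeasure (lborel_on I) (ball q r) > 0"
proof -
  define z where "z = q + (\<Sum>b\<in>Basis - I. (1/2) *\<^sub>R b)"
  have zb: "z \<bullet> b = (if b \<in> I then q \<bullet> b else 1/2)" if b: "b \<in> Basis" for b
  proof -
    have "(\<Sum>c\<in>Basis - I. (1/2) *\<^sub>R c) \<bullet> b = (\<Sum>c\<in>Basis - I. if c = b then 1/2 else 0)"
      unfolding inner_sum_left using b by (intro sum.cong) (auto simp: inner_Basis)
    then show ?thesis using b q I by (auto simp: z_def inner_add_left span_substd_basis)
  qed
  have pz: "coord_proj I z = q"
    using q I zb by (intro euclidean_eqI[where 'a = 'a]) (auto simp: coord_proj_inner span_substd_basis)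
  have "isCont (coord_proj I) z" using bounded_linear_coord_proj linear_continuous_at by blast
  then obtain d where d: "d > 0" "\<And>y. dist y z < d \<Longrightarrow> dist (coord_proj I y) q < r"
    using r unfolding continuous_at_eps_delta pz by blast
  have sub: "y \<in> coord_slab I" if "dist y z < 1/2" for y
  proof -
    have "y \<bullet> b \<in> {0..1}" if b: "b \<in> Basis - I" for b
    proof -
      have "\<bar>(y - z) \<bullet> b\<bar> \<le> norm (y - z)" using b by (intro Basis_le_norm) auto
      then show ?thesis using \<open>dist y z < 1/2\<close> zb[of b] b by (auto simp: dist_norm inner_diff_left abs_le_iff)
    qed
    then show ?thesis by (simp add: coord_slab_def)
  qed
  have "0 < emeasure lborel (ball z (min d (1/2)))"
    using d(1) content_ball_pos[of "min d (1/2)" z] by (auto simp: zero_less_iff_neq_zero measure_def)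
  also have "\<dots> = (\<integral>\<^sup>+y. indicator (ball z (min d (1/2))) y \<partial>lborel)" by simp
  also have "\<dots> \<le> (\<integral>\<^sup>+y. indicator (coord_slab I) y * indicator (ball q r) (coord_proj I y) \<partial>lborel)"
    using d sub by (intro nn_integral_mono) (auto split: split_indicator simp: dist_commute)
  also have "\<dots> = emeasure (lborel_on I) (ball q r)"
  proof -
    have "(\<integral>\<^sup>+y. indicator (coord_slab I) y * indicator (ball q r) (coord_proj I y) \<partial>lborel) =
        (\<integral>\<^sup>+y. indicator (ball q r) y \<partial>lborel_on I)"
      by (intro nn_integral_lborel_on[OF I, symmetric] borel_measurable_indicator borel_open open_ball)
    then show ?thesis by simp
  qed
  finally show ?thesis .
qed

section \<open>Determinants over finite index sets\<close>

definition index_det :: "'i set \<Rightarrow> ('i \<Rightarrow> 'i \<Rightarrow> real) \<Rightarrow> real" where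
  "index_det I G = (\<Sum>p | p permutes I. of_int (sign p) * (\<Prod>i\<in>I. G i (p i)))"

lemma gram_det_eq_index_det: "gram_det I v = index_det I (\<lambda>i j. v i \<bullet> v j)"
  by (simp add: gram_det_def index_det_def)

lemma det_eq_index_det: "det (A :: real^'n^'n) = index_det UNIV (\<lambda>i j. A $ i $ j)"
  by (simp add: det_def index_det_def)

lemma index_det_reindex:
  assumes f: "bij_betw f I J" and "finite I"
  shows "index_det J G = index_det I (\<lambda>i j. G (f i) (f j))"
proof -
  have inj: "inj_on f I" and J: "f ` I = J" using f by (auto simp: bij_betw_def)
  have bij: "bij_betw (map_permutation I f) {p. p permutes I} {p. p permutes J}"
  proof (rule bij_betw_byWitness[where f' = "map_permutation J (inv_into I f)"])
    have f': "bij_betw (inv_into I f) J I" by (rule bij_betw_inv_into[OF f])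
    show "\<forall>p\<in>{p. p permutes I}. map_permutation J (inv_into I f) (map_permutation I f p) = p"
      using map_permutation_compose_inv[OF f] inv_into_f_f[OF inj] by blast
    show "\<forall>q\<in>{q. q permutes J}. map_permutation I f (map_permutation J (inv_into I f) q) = q"
      using map_permutation_compose_inv[OF f'] f_inv_into_f[of _ f I] J by blast
    show "map_permutation I f ` {p. p permutes I} \<subseteq> {p. p permutes J}"
      using map_permutation_permutes[OF f] by blast
    show "map_permutation J (inv_into I f) ` {p. p permutes J} \<subseteq> {p. p permutes I}"
      using map_permutation_permutes[OF f'] by blast
  qed
  show ?thesis
    unfolding index_det_def
  proof (subst sum.reindex_bij_betw[OF bij, symmetric], rule sum.cong)
    fix p assume "p \<in> {p. p permutes I}"
    then have p: "p permutes I" by simp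
    have "sign (map_permutation I f p) = sign p"
      using sign_map_permutation[OF inj p] assms by auto
    moreover have "(\<Prod>j\<in>J. G j (map_permutation I f p j)) = (\<Prod>i\<in>I. G (f i) (f (p i)))"
      unfolding J[symmetric] prod.reindex[OF inj] o_def
      using inj by (intro prod.cong) (auto simp: map_permutation_apply)
    ultimately show "of_int (sign (map_permutation I f p)) * (\<Prod>j\<in>J. G j (map_permutation I f p j)) =
        of_int (sign p) * (\<Prod>i\<in>I. G (f i) (f (p i)))" by simp
  qed simp
qed

lemma index_det_extend:
  assumes "finite K" "I \<subseteq> K"
  shows "index_det K (\<lambda>i j. if i \<in> I \<and> j \<in> I then G i j else if i = j then 1 else 0) = index_det I G"
proof -
  let ?H = "\<lambda>i j. if i \<in> I \<and> j \<in> I then G i j else if i = j then 1 else 0"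
  have "(\<Sum>p | p permutes I. of_int (sign p) * (\<Prod>i\<in>I. G i (p i))) =
      (\<Sum>p | p permutes K. of_int (sign p) * (\<Prod>i\<in>K. ?H i (p i)))"
  proof (rule sum.mono_neutral_cong_left)
    show "finite {p. p permutes K}" using assms by (simp add: finite_permutations)
    show "{p. p permutes I} \<subseteq> {p. p permutes K}" using assms permutes_subset by blast
    show "\<forall>p\<in>{p. p permutes K} - {p. p permutes I}. of_int (sign p) * (\<Prod>i\<in>K. ?H i (p i)) = 0"
    proof
      fix p assume "p \<in> {p. p permutes K} - {p. p permutes I}"
      then have p: "p permutes K" "\<not> p permutes I" by auto
      have "\<exists>i\<in>K - I. p i \<noteq> i"
      proof (rule ccontr)
        assume "\<not> (\<exists>i\<in>K - I. p i \<noteq> i)"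
        then have "p permutes I" using permutes_superset[OF p(1)] by auto
        then show False using p by simp
      qed
      then obtain i where "i \<in> K" "?H i (p i) = 0" by auto
      then have "(\<Prod>i\<in>K. ?H i (p i)) = 0" by (intro prod_zero assms(1)) blast
      then show "of_int (sign p) * (\<Prod>i\<in>K. ?H i (p i)) = 0" by simp
    qed
  next
    fix p assume "p \<in> {p. p permutes I}"
    then have p: "p permutes I" by simp
    have "(\<Prod>i\<in>K. ?H i (p i)) = (\<Prod>i\<in>K - I. ?H i (p i)) * (\<Prod>i\<in>I. ?H i (p i))"
      by (rule prod.subset_diff[OF assms(2,1)])
    also have "(\<Prod>i\<in>K - I. ?H i (p i)) = 1" using p by (intro prod.neutral) (auto simp: permutes_not_in)
    also have "(\<Prod>i\<in>I. ?H i (p i)) = (\<Prod>i\<in>I. G i (p i))"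
      using p by (intro prod.cong) (auto simp: permutes_in_image)
    finally show "of_int (sign p) * (\<Prod>i\<in>I. G i (p i)) = of_int (sign p) * (\<Prod>i\<in>K. ?H i (p i))" by simp
  qed
  then show ?thesis by (simp add: index_det_def)
qed

text \<open>The Gram determinant of a family indexed by a part of the basis is a full determinant: complete
  the Gram matrix by an identity block.\<close>

lemma gram_det_eq_det:
  fixes v :: "real^'n \<Rightarrow> 'b::real_inner"
  assumes "I \<subseteq> Basis"
  shows "gram_det I v = det (\<chi> i j. if axis i 1 \<in> I \<and> axis j 1 \<in> I then v (axis i 1) \<bullet> v (axis j 1)
     else if i = j then 1 else 0 :: real^'n^'n)"
proof -
  have bij: "bij_betw (\<lambda>i::'n. axis i 1 :: real^'n) UNIV Basis"
    by (auto simp: bij_betw_def inj_on_def axis_eq_axis Basis_vec_def)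
  have axis_inj: "(axis i 1 :: real^'n) = axis j 1 \<longleftrightarrow> i = j" for i j
    using axis_eq_axis[of i "1::real" j 1] by simp
  show ?thesis
    unfolding gram_det_eq_index_det index_det_extend[OF finite_Basis assms, symmetric]
      index_det_reindex[OF bij finite] det_eq_index_det
    by (simp add: index_det_def axis_inj cong: if_cong)
qed

section \<open>Change of variables\<close>

text \<open>
  The change of variables formula is first obtained over index types with a well-order. A copy of an arbitrary
  finite type, ordered through an enumeration, transfers it to every \<open>real^'n\<close>.
\<close>

typedef 'a enumerated = "UNIV :: 'a set" morphisms unenum enum ..

lemma unenum_bij: "bij unenum"
  by (metis bijI' enum_inverse UNIV_I unenum_inject)

definition enum_index :: "'a::finite enumerated \<Rightarrow> nat" where
  "enum_index x = (SOME f :: 'a \<Rightarrow> nat. inj f) (unenum x)"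

lemma enum_index_inject: "enum_index x = enum_index y \<longleftrightarrow> x = y"
proof -
  have "\<exists>f :: 'a \<Rightarrow> nat. inj f" using finite_imp_inj_to_nat_seg[of "UNIV :: 'a set"] by auto
  then have "inj (SOME f :: 'a \<Rightarrow> nat. inj f)" by (rule someI_ex)
  then show ?thesis by (simp add: enum_index_def inj_eq unenum_inject)
qed

instance enumerated :: (finite) finite
proof
  have "finite (range (enum :: 'a \<Rightarrow> 'a enumerated))" by simp
  moreover have "range enum = (UNIV :: 'a enumerated set)" by (metis surjI unenum_inverse)
  ultimately show "finite (UNIV :: 'a enumerated set)" by simp
qed

instantiation enumerated :: (finite) wellorder
begin

definition less_eq_enumerated :: "'a enumerated \<Rightarrow> 'a enumerated \<Rightarrow> bool" where
  "x \<le> y \<longleftrightarrow> enum_index x \<le> enum_index y"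

definition less_enumerated :: "'a enumerated \<Rightarrow> 'a enumerated \<Rightarrow> bool" where
  "x < y \<longleftrightarrow> enum_index x < enum_index y"

instance
proof
  fix x y z :: "'a enumerated" and P :: "'a enumerated \<Rightarrow> bool"
  show "x < y \<longleftrightarrow> x \<le> y \<and> \<not> y \<le> x" by (auto simp: less_eq_enumerated_def less_enumerated_def)
  show "x \<le> x" by (simp add: less_eq_enumerated_def)
  show "x \<le> z" if "x \<le> y" "y \<le> z" using that by (simp add: less_eq_enumerated_def)
  show "x = y" if "x \<le> y" "y \<le> x" using that by (simp add: less_eq_enumerated_def enum_index_inject[symmetric])
  show "x \<le> y \<or> y \<le> x" by (auto simp: less_eq_enumerated_def)
  show "P x" if "\<And>x. (\<And>y. y < x \<Longrightarrow> P y) \<Longrightarrow> P x"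
  proof (induction x rule: measure_induct_rule[of enum_index])
    case (less x)
    show ?case by (rule that, rule less) (simp add: less_enumerated_def)
  qed
qed

end

text \<open>If the right-hand side is finite, both sides are Henstock-Kurzweil integrals and the formula for
  diffeomorphisms applies.\<close>

lemma nn_integral_change_of_variables_wellorder:
  fixes f :: "real^'n::{finite,wellorder} \<Rightarrow> real" and g :: "real^'n::_ \<Rightarrow> real^'n::_"
  assumes T: "T \<in> sets borel" and f: "f \<in> borel_measurable borel" "\<And>x. f x \<ge> 0"
    and dg: "\<And>x. x \<in> S \<Longrightarrow> (g has_derivative g' x) (at x)"
    and dh: "\<And>y. y \<in> T \<Longrightarrow> (h has_derivative h' y) (at y)"
    and gh: "\<And>x. x \<in> S \<Longrightarrow> g x \<in> T \<and> h (g x) = x" "\<And>y. y \<in> T \<Longrightarrow> h y \<in> S \<and> g (h y) = y"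
    and inv: "\<And>y. y \<in> T \<Longrightarrow> h' y \<circ> g' (h y) = id"
  shows "(\<integral>\<^sup>+x. indicator S x * ennreal (\<bar>det (matrix (g' x))\<bar> * f (g x)) \<partial>lborel) \<le> (\<integral>\<^sup>+y. f y \<partial>lborel)"
proof (cases "(\<integral>\<^sup>+y. indicator T y * ennreal (f y) \<partial>lborel) = \<infinity>")
  case True
  have "(\<integral>\<^sup>+y. indicator T y * ennreal (f y) \<partial>lborel) \<le> (\<integral>\<^sup>+y. f y \<partial>lborel)"
    by (intro nn_integral_mono) (auto split: split_indicator)
  then show ?thesis using True by (simp add: top_unique)
next
  case False
  define F where "F = (\<lambda>y. indicator T y * f y)"
  have F: "F \<in> borel_measurable borel" "\<And>y. F y \<ge> 0" using T f by (auto simp: F_def)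
  have Feq: "(\<integral>\<^sup>+y. ennreal (F y) \<partial>lborel) = (\<integral>\<^sup>+y. indicator T y * ennreal (f y) \<partial>lborel)"
    by (intro nn_integral_cong) (auto simp: F_def split: split_indicator)
  then obtain r where r: "(\<integral>\<^sup>+y. ennreal (F y) \<partial>lborel) = ennreal r" "r \<ge> 0"
    using False by (metis ennreal_cases infinity_ennreal_def)
  have "(F has_integral r) UNIV" by (rule nn_integral_has_integral[OF F r])
  moreover have "F = (\<lambda>y. if y \<in> T then f y else 0)" by (auto simp: F_def fun_eq_iff)
  ultimately have "(f has_integral r) T" by (simp add: has_integral_restrict_UNIV)
  then have "((\<lambda>x. \<bar>det (matrix (g' x))\<bar> * f (g x)) has_integral r) S"
    by (subst cov_invertible_nonneg_eq[where T = T and h = h and h' = h'])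
       (use dg dh f gh inv in \<open>auto intro: has_derivative_at_withinI\<close>)
  then have "(\<integral>\<^sup>+x. ennreal (indicator S x * (\<bar>det (matrix (g' x))\<bar> * f (g x))) \<partial>lborel) = ennreal r"
    by (rule nn_integral_has_integral_lebesgue[rotated]) (use f in auto)
  also have "(\<lambda>x. ennreal (indicator S x * (\<bar>det (matrix (g' x))\<bar> * f (g x)))) =
      (\<lambda>x. indicator S x * ennreal (\<bar>det (matrix (g' x))\<bar> * f (g x)))"
    by (auto simp: fun_eq_iff split: split_indicator)
  also have "ennreal r = (\<integral>\<^sup>+y. indicator T y * ennreal (f y) \<partial>lborel)" using r Feq by simp
  also have "\<dots> \<le> (\<integral>\<^sup>+y. f y \<partial>lborel)"
    by (intro nn_integral_mono) (auto split: split_indicator)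
  finally show ?thesis .
qed

definition to_enum :: "real^('n::finite) \<Rightarrow> real^('n::finite) enumerated" where
  "to_enum x = (\<chi> i. x $ unenum i)"

definition of_enum :: "real^('n::finite) enumerated \<Rightarrow> real^'n" where
  "of_enum x = (\<chi> i. x $ enum i)"

lemma to_of_enum [simp]: "to_enum (of_enum x) = x" "of_enum (to_enum y) = y"
  by (simp_all add: to_enum_def of_enum_def vec_eq_iff unenum_inverse enum_inverse)

lemma linear_to_enum: "linear to_enum" and linear_of_enum: "linear of_enum"
  by (auto intro!: linearI simp: to_enum_def of_enum_def vec_eq_iff)

lemma bounded_linear_to_enum: "bounded_linear to_enum" and bounded_linear_of_enum: "bounded_linear of_enum"
  using linear_to_enum linear_of_enum by (simp_all add: linear_linear)

lemma to_enum_borel [measurable]: "to_enum \<in> borel_measurable borel"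
  and of_enum_borel [measurable]: "of_enum \<in> borel_measurable borel"
  using borel_measurable_continuous_onI[OF linear_continuous_on[OF bounded_linear_to_enum]]
    borel_measurable_continuous_onI[OF linear_continuous_on[OF bounded_linear_of_enum]] by simp_all

lemma lborel_to_enum: "distr lborel borel to_enum = (lborel :: (real^('n::finite) enumerated) measure)"
proof (rule lborel_eqI[symmetric])
  fix l u :: "real^('n::finite) enumerated" assume lu: "\<And>b. b \<in> Basis \<Longrightarrow> l \<bullet> b \<le> u \<bullet> b"
  have lu': "l $ i \<le> u $ i" for i 
  proof -
    have "(axis i 1 :: real^'n enumerated) \<in> Basis" by (auto simp: Basis_vec_def)
    from lu[OF this] show ?thesis by (simp add: inner_axis)
  qed
  have pre: "to_enum -` box l u = box (of_enum l) (of_enum u)"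
  proof -
    have all_enum: "(\<forall>i. P i) \<longleftrightarrow> (\<forall>j. P (enum j))" for P :: "'n enumerated \<Rightarrow> bool"
      by (metis unenum_inverse)
    show ?thesis
      unfolding set_eq_iff vimage_eq mem_box_cart all_enum
      by (simp add: to_enum_def of_enum_def enum_inverse)
  qed
  have "emeasure (distr lborel borel to_enum) (box l u) = emeasure lborel (box (of_enum l) (of_enum u))"
    by (simp add: emeasure_distr pre)
  also have "\<dots> = (\<Prod>b\<in>Basis. (of_enum u - of_enum l) \<bullet> b)"
  proof (rule emeasure_lborel_box)
    fix b :: "real^'n" assume "b \<in> Basis"
    then obtain i where "b = axis i 1" by (auto simp: Basis_vec_def)
    then show "of_enum l \<bullet> b \<le> of_enum u \<bullet> b" using lu' by (simp add: inner_axis of_enum_def)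
  qed
  also have "(\<Prod>b\<in>Basis. (of_enum u - of_enum l) \<bullet> b) = (\<Prod>i\<in>UNIV. (of_enum u - of_enum l) $ i)"
    by (rule prod.reindex_cong[of "\<lambda>i. axis i 1"]) (auto simp: inj_on_def axis_eq_axis Basis_vec_def inner_axis)
  also have "\<dots> = (\<Prod>i\<in>UNIV. (u - l) $ i)"
    by (rule prod.reindex_bij_betw[OF unenum_bij, symmetric, THEN trans]) (simp add: of_enum_def unenum_inverse)
  also have "\<dots> = (\<Prod>b\<in>Basis. (u - l) \<bullet> b)"
    by (rule prod.reindex_cong[of "\<lambda>i. axis i 1", symmetric]) (auto simp: inj_on_def axis_eq_axis Basis_vec_def inner_axis)
  finally show "emeasure (distr lborel borel to_enum) (box l u) = (\<Prod>b\<in>Basis. (u - l) \<bullet> b)" .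
qed simp

lemma det_to_enum: "det (matrix (to_enum \<circ> f \<circ> of_enum)) = det (matrix f)" for f :: "real^'n \<Rightarrow> real^'n"
proof -
  have ax: "of_enum (axis j 1) = axis (unenum j) 1" for j :: "('n::finite) enumerated"
    by (auto simp: of_enum_def vec_eq_iff axis_def enum_inverse unenum_inverse)
  have "det (matrix f) = index_det UNIV (\<lambda>i j. matrix f $ unenum i $ unenum j)"
    unfolding det_eq_index_det by (rule index_det_reindex[OF unenum_bij]) simp
  moreover have "($) (vec_lambda h) = h" for h :: "'n enumerated \<Rightarrow> real"
    by (simp add: fun_eq_iff)
  ultimately show ?thesis
    unfolding det_eq_index_det by (simp add: matrix_def to_enum_def ax)
qed

lemma nn_integral_change_of_variables:
  fixes f :: "real^'n \<Rightarrow> real" and g :: "real^'n \<Rightarrow> real^'n"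
  assumes T: "T \<in> sets borel" and f: "f \<in> borel_measurable borel" "\<And>x. f x \<ge> 0"
    and dg: "\<And>x. x \<in> S \<Longrightarrow> (g has_derivative g' x) (at x)"
    and dh: "\<And>y. y \<in> T \<Longrightarrow> (h has_derivative h' y) (at y)"
    and gh: "\<And>x. x \<in> S \<Longrightarrow> g x \<in> T \<and> h (g x) = x" "\<And>y. y \<in> T \<Longrightarrow> h y \<in> S \<and> g (h y) = y"
    and inv: "\<And>y. y \<in> T \<Longrightarrow> h' y \<circ> g' (h y) = id"
    and meas: "(\<lambda>x. indicator S x * ennreal (\<bar>det (matrix (g' x))\<bar> * f (g x))) \<in> borel_measurable borel"
  shows "(\<integral>\<^sup>+x. indicator S x * ennreal (\<bar>det (matrix (g' x))\<bar> * f (g x)) \<partial>lborel) \<le> (\<integral>\<^sup>+y. f y \<partial>lborel)"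
proof -
  have conj: "((\<lambda>x. to_enum (F (of_enum x))) has_derivative (to_enum \<circ> F' \<circ> of_enum)) (at x)"
    if "(F has_derivative F') (at (of_enum x))" for F F' and x :: "real^('n::finite) enumerated"
    using bounded_linear.has_derivative[OF bounded_linear_to_enum
        has_derivative_compose[where f = of_enum and g = F,
          OF bounded_linear_imp_has_derivative[OF bounded_linear_of_enum] that]]
    by (simp add: o_def)
  have "(\<integral>\<^sup>+x. indicator (of_enum -` S) x *
      ennreal (\<bar>det (matrix (to_enum \<circ> g' (of_enum x) \<circ> of_enum))\<bar> * f (of_enum (to_enum (g (of_enum x))))) \<partial>lborel)
      \<le> (\<integral>\<^sup>+y. f (of_enum y) \<partial>lborel)"
  proof (rule nn_integral_change_of_variables_wellorder[where T = "of_enum -` T" and g = "\<lambda>x. to_enum (g (of_enum x))"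
        and f = "\<lambda>y. f (of_enum y)"
        and h = "\<lambda>x. to_enum (h (of_enum x))" and h' = "\<lambda>y. to_enum \<circ> h' (of_enum y) \<circ> of_enum"])
    show "of_enum -` T \<in> sets borel" using measurable_sets[OF of_enum_borel, of T] T by simp
    show "(\<lambda>y. f (of_enum y)) \<in> borel_measurable borel" using f(1) by measurable
  next
    fix y assume "y \<in> of_enum -` T"
    then have "h' (of_enum y) \<circ> g' (h (of_enum y)) = id" using inv by simp
    then show "to_enum \<circ> h' (of_enum y) \<circ> of_enum \<circ> (to_enum \<circ> g' (of_enum (to_enum (h (of_enum y)))) \<circ> of_enum) = id"
      by (auto simp: fun_eq_iff)
  qed (use f(2) gh in \<open>auto intro: conj dg dh\<close>)
  also have "(\<integral>\<^sup>+x. indicator (of_enum -` S) x *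
      ennreal (\<bar>det (matrix (to_enum \<circ> g' (of_enum x) \<circ> of_enum))\<bar> * f (of_enum (to_enum (g (of_enum x))))) \<partial>lborel) =
      (\<integral>\<^sup>+x. indicator S (of_enum x) * ennreal (\<bar>det (matrix (g' (of_enum x)))\<bar> * f (g (of_enum x))) \<partial>distr lborel borel to_enum)"
    unfolding lborel_to_enum det_to_enum by (simp add: indicator_def)
  also have "\<dots> = (\<integral>\<^sup>+x. indicator S x * ennreal (\<bar>det (matrix (g' x))\<bar> * f (g x)) \<partial>lborel)"
    using measurable_compose[OF of_enum_borel meas] by (subst nn_integral_distr) auto
  also have "(\<integral>\<^sup>+y. f (of_enum y) \<partial>lborel) = (\<integral>\<^sup>+y. f (of_enum y) \<partial>distr lborel borel to_enum)"
    unfolding lborel_to_enum ..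
  also have "\<dots> = (\<integral>\<^sup>+y. f y \<partial>lborel)"
    using f(1) by (subst nn_integral_distr) auto
  finally show ?thesis .
qed

section \<open>The Riemannian volume in a chart\<close>

lemma slice_chartD:
  assumes "slice_chart k X I U V \<Phi> \<Psi>"
  shows "I \<subseteq> Basis" "card I = k" "open U" "open V"
    and "\<And>x. x \<in> U \<Longrightarrow> \<Phi> x \<in> V" "\<And>x. x \<in> U \<Longrightarrow> \<Psi> (\<Phi> x) = x"
    and "\<And>y. y \<in> V \<Longrightarrow> \<Psi> y \<in> U" "\<And>y. y \<in> V \<Longrightarrow> \<Phi> (\<Psi> y) = y"
    and "\<And>y. y \<in> V \<Longrightarrow> \<Psi> y \<in> X \<longleftrightarrow> y \<in> span I"
    and "\<And>m. times_differentiable_on m U \<Phi>" "\<And>m. times_differentiable_on m V \<Psi>"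
    and "continuous_on U \<Phi>" "continuous_on V \<Psi>"
    and "\<And>x. x \<in> U \<Longrightarrow> (\<Phi> has_derivative frechet_derivative \<Phi> (at x)) (at x)"
    and "\<And>y. y \<in> V \<Longrightarrow> (\<Psi> has_derivative frechet_derivative \<Psi> (at y)) (at y)"
proof -
  note c = assms[unfolded slice_chart_def smooth_on_open_def homeomorphism_def]
  show "I \<subseteq> Basis" "card I = k" "open U" "open V" "\<And>m. times_differentiable_on m U \<Phi>"
    "\<And>m. times_differentiable_on m V \<Psi>" "continuous_on U \<Phi>" "continuous_on V \<Psi>"
    using c by auto
  show f1: "\<And>x. x \<in> U \<Longrightarrow> \<Phi> x \<in> V" and f2: "\<And>x. x \<in> U \<Longrightarrow> \<Psi> (\<Phi> x) = x"
    and f3: "\<And>y. y \<in> V \<Longrightarrow> \<Psi> y \<in> U" and f4: "\<And>y. y \<in> V \<Longrightarrow> \<Phi> (\<Psi> y) = y"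
    using c by auto
  have im: "\<Phi> ` (U \<inter> X) = V \<inter> span I" using c by auto
  show "\<And>y. y \<in> V \<Longrightarrow> \<Psi> y \<in> X \<longleftrightarrow> y \<in> span I"
  proof
    fix y assume y: "y \<in> V"
    show "y \<in> span I" if "\<Psi> y \<in> X"
    proof -
      have "\<Phi> (\<Psi> y) \<in> \<Phi> ` (U \<inter> X)" using that f3[OF y] by blast
      then show ?thesis using im f4[OF y] by simp
    qed
    show "\<Psi> y \<in> X" if "y \<in> span I"
    proof -
      have "y \<in> \<Phi> ` (U \<inter> X)" using that y im by simp
      then show ?thesis using f2 by auto
    qed
  qed
  show "\<And>x. x \<in> U \<Longrightarrow> (\<Phi> has_derivative frechet_derivative \<Phi> (at x)) (at x)"
    "\<And>y. y \<in> V \<Longrightarrow> (\<Psi> has_derivative frechet_derivative \<Psi> (at y)) (at y)"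
    using times_differentiable_on_has_derivative[of 1 U \<Phi>] times_differentiable_on_has_derivative[of 1 V \<Psi>] c by auto
qed

definition chart_density :: "'a::euclidean_space set \<Rightarrow> ('a \<Rightarrow> 'a) \<Rightarrow> 'a \<Rightarrow> real" where
  "chart_density I \<Psi> y = sqrt (gram_det I (\<lambda>b. frechet_derivative \<Psi> (at y) b))"

lemma chart_density_continuous:
  assumes "times_differentiable_on 1 V \<Psi>"
  shows "continuous_on V (chart_density I \<Psi>)"
proof -
  have "continuous_on V (\<lambda>y. frechet_derivative \<Psi> (at y) b)" for b
    using assms by simp
  then show ?thesis unfolding chart_density_def [abs_def] gram_det_def by (intro continuous_intros)
qed

lemma chart_map_measurable:
  fixes \<Psi> :: "'a::euclidean_space \<Rightarrow> 'a"
  assumes "open V" "continuous_on V \<Psi>"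
  shows "(\<lambda>y. if y \<in> V then \<Psi> y else 0) \<in> borel_measurable borel"
proof -
  have "(\<lambda>y. indicator V y *\<^sub>R \<Psi> y) \<in> borel_measurable borel"
    using assms by (intro borel_measurable_continuous_on_indicator) auto
  also have "(\<lambda>y. indicator V y *\<^sub>R \<Psi> y) = (\<lambda>y. if y \<in> V then \<Psi> y else 0)" by auto
  finally show ?thesis .
qed

lemma chart_density_measurable:
  assumes "open V" "times_differentiable_on 1 V \<Psi>"
  shows "(\<lambda>y. indicator V y * ennreal (chart_density I \<Psi> y)) \<in> borel_measurable borel"
proof -
  have "(\<lambda>y. indicator V y *\<^sub>R chart_density I \<Psi> y) \<in> borel_measurable borel"
    using assms chart_density_continuous by (intro borel_measurable_continuous_on_indicator) auto
  then have "(\<lambda>y. ennreal (indicator V y *\<^sub>R chart_density I \<Psi> y)) \<in> borel_measurable borel"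
    by measurable
  also have "(\<lambda>y. ennreal (indicator V y *\<^sub>R chart_density I \<Psi> y)) = (\<lambda>y. indicator V y * ennreal (chart_density I \<Psi> y))"
    by (auto split: split_indicator)
  finally show ?thesis .
qed

lemma chart_volume_eq:
  "chart_volume I V \<Psi> = distr (density (lborel_on I) (\<lambda>y. indicator V y * ennreal (chart_density I \<Psi> y)))
     borel (\<lambda>y. if y \<in> V then \<Psi> y else 0)"
  unfolding chart_volume_def chart_density_def ..

lemma sets_chart_volume [simp]: "sets (chart_volume I V \<Psi>) = sets borel"
  by (simp add: chart_volume_def)

lemma vimage_chart_measurable:
  fixes \<Psi> :: "'a::euclidean_space \<Rightarrow> 'a"
  assumes "open V" "continuous_on V \<Psi>" "B \<in> sets borel"
  shows "{y \<in> V. \<Psi> y \<in> B} \<in> sets borel"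
proof -
  have "(\<lambda>y. if y \<in> V then \<Psi> y else 0) -` B \<inter> space borel \<in> sets borel"
    by (rule measurable_sets[OF chart_map_measurable[OF assms(1,2)] assms(3)])
  then have "V \<inter> ((\<lambda>y. if y \<in> V then \<Psi> y else 0) -` B) \<in> sets borel"
    using assms(1) by (intro sets.Int) auto
  also have "V \<inter> ((\<lambda>y. if y \<in> V then \<Psi> y else 0) -` B) = {y \<in> V. \<Psi> y \<in> B}" by auto
  finally show ?thesis .
qed

lemma emeasure_chart_volume:
  assumes c: "slice_chart k X I U V \<Phi> \<Psi>" and B: "B \<in> sets borel"
  shows "emeasure (chart_volume I V \<Psi>) B =
     (\<integral>\<^sup>+y. indicator (coord_slab I) y *
        (indicator {y \<in> V. \<Psi> y \<in> B} (coord_proj I y) * ennreal (chart_density I \<Psi> (coord_proj I y))) \<partial>lborel)"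
    (is "?lhs = ?rhs")
    and "(\<lambda>y. indicator {y \<in> V. \<Psi> y \<in> B} y * ennreal (chart_density I \<Psi> y)) \<in> borel_measurable borel"
proof -
  note D = slice_chartD[OF c]
  note m1 [measurable] = chart_map_measurable[OF D(4) D(13)]
  note m2 [measurable] = chart_density_measurable[OF D(4) D(11)[of 1], of I]
  note m3 [measurable] = vimage_chart_measurable[OF D(4) D(13) B]
  note B [measurable]
  have eq: "indicator {y \<in> V. \<Psi> y \<in> B} y * ennreal (chart_density I \<Psi> y) =
      indicator {y \<in> V. \<Psi> y \<in> B} y * (indicator V y * ennreal (chart_density I \<Psi> y))" for y
    by (auto split: split_indicator)
  show m: "(\<lambda>y. indicator {y \<in> V. \<Psi> y \<in> B} y * ennreal (chart_density I \<Psi> y)) \<in> borel_measurable borel"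
    unfolding eq by measurable
  have "?lhs = (\<integral>\<^sup>+x. indicator B x \<partial>chart_volume I V \<Psi>)" using B by simp
  also have "\<dots> = (\<integral>\<^sup>+y. indicator B (if y \<in> V then \<Psi> y else 0)
      \<partial>density (lborel_on I) (\<lambda>y. indicator V y * ennreal (chart_density I \<Psi> y)))"
    unfolding chart_volume_eq by (rule nn_integral_distr) auto
  also have "\<dots> = (\<integral>\<^sup>+y. (indicator V y * ennreal (chart_density I \<Psi> y)) * indicator B (if y \<in> V then \<Psi> y else 0) \<partial>lborel_on I)"
    by (rule nn_integral_density) auto
  also have "\<dots> = (\<integral>\<^sup>+y. indicator {y \<in> V. \<Psi> y \<in> B} y * ennreal (chart_density I \<Psi> y) \<partial>lborel_on I)"
    by (intro nn_integral_cong) (auto split: split_indicator)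
  also have "\<dots> = ?rhs" by (rule nn_integral_lborel_on[OF D(1) m])
  finally show "?lhs = ?rhs" .
qed

text \<open>Used for transition maps, which carry the coordinate subspace of one chart into that of the other.\<close>

lemma derivative_in_span:
  assumes I: "I \<subseteq> (Basis :: 'a::euclidean_space set)" and W: "open W" "y \<in> W"
    and d: "(\<tau> has_derivative \<tau>') (at y)"
    and \<tau>: "\<And>z. z \<in> W \<Longrightarrow> z \<in> S \<Longrightarrow> \<tau> z \<in> span I"
    and S: "subspace S" "y \<in> S" "w \<in> S"
  shows "\<tau>' w \<in> span I"
proof -
  have "\<tau>' w \<bullet> c = 0" if c: "c \<in> Basis" "c \<notin> I" for c
  proof -
    have d1: "((\<lambda>t::real. y + t *\<^sub>R w) has_derivative (\<lambda>t. t *\<^sub>R w)) (at 0)"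
      by (auto intro!: derivative_eq_intros)
    have "((\<lambda>t. \<tau> (y + t *\<^sub>R w)) has_derivative (\<lambda>t. \<tau>' (t *\<^sub>R w))) (at 0)"
      by (rule has_derivative_compose[OF d1]) (use d in simp)
    then have "((\<lambda>t. \<tau> (y + t *\<^sub>R w) \<bullet> c) has_derivative (\<lambda>t. \<tau>' (t *\<^sub>R w) \<bullet> c)) (at 0)"
      by (rule has_derivative_inner_left)
    moreover have "((\<lambda>t. \<tau> (y + t *\<^sub>R w) \<bullet> c) has_derivative (\<lambda>t. 0)) (at 0)"
    proof (rule has_derivative_transform_within_open[where f = "\<lambda>t. 0"])
      show "open ((\<lambda>t. y + t *\<^sub>R w) -` W)"
        by (intro open_vimage W continuous_intros)
      show "0 \<in> (\<lambda>t. y + t *\<^sub>R w) -` W" using W by simp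
      fix t assume "t \<in> (\<lambda>t. y + t *\<^sub>R w) -` W"
      then have "\<tau> (y + t *\<^sub>R w) \<in> span I"
        using S by (intro \<tau>) (auto intro: subspace_add subspace_scale)
      then show "0 = \<tau> (y + t *\<^sub>R w) \<bullet> c" using c I by (simp add: span_substd_basis)
    qed simp
    ultimately have "(\<lambda>t. \<tau>' (t *\<^sub>R w) \<bullet> c) = (\<lambda>t. 0)" by (rule has_derivative_unique)
    from fun_cong[OF this, of 1] show ?thesis by simp
  qed
  then show ?thesis using I by (simp add: span_substd_basis)
qed

text \<open>
  A transition map of \<open>k\<close>-dimensional coordinate subspaces is extended to the ambient space by a linear
  map \<open>L\<close> of the complements, so that the change of variables theorem in full dimension applies.
\<close>

definition lift_transition :: "'a::euclidean_space set \<Rightarrow> ('a \<Rightarrow> 'a) \<Rightarrow> ('a \<Rightarrow> 'a) \<Rightarrow> 'a \<Rightarrow> 'a" where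
  "lift_transition I L \<tau> y = \<tau> (coord_proj I y) + L (y - coord_proj I y)"

definition transition_derivative ::
    "('a::euclidean_space \<Rightarrow> 'a) \<Rightarrow> ('a \<Rightarrow> 'a) \<Rightarrow> 'a \<Rightarrow> 'a \<Rightarrow> 'a" where
  "transition_derivative \<Phi> \<Psi> y w = frechet_derivative \<Phi> (at (\<Psi> y)) (frechet_derivative \<Psi> (at y) w)"

lemma lift_transition_props:
  fixes X :: "'a::euclidean_space set"
  assumes c1: "slice_chart k X I1 U1 V1 \<Phi>1 \<Psi>1" and c2: "slice_chart k X I2 U2 V2 \<Phi>2 \<Psi>2"
    and L: "linear L" "\<And>y. coord_proj I1 (L (y - coord_proj I2 y)) = 0" "\<And>y. L' (L y) = y"
    and y: "coord_proj I2 y \<in> V2" "\<Psi>2 (coord_proj I2 y) \<in> U1"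
  defines "g \<equiv> lift_transition I2 L (\<lambda>y. \<Phi>1 (\<Psi>2 y))" and "h \<equiv> lift_transition I1 L' (\<lambda>y. \<Phi>2 (\<Psi>1 y))"
  shows "coord_proj I1 (g y) = \<Phi>1 (\<Psi>2 (coord_proj I2 y))"
    and "g y - coord_proj I1 (g y) = L (y - coord_proj I2 y)"
    and "coord_proj I1 (g y) \<in> V1" and "\<Psi>1 (coord_proj I1 (g y)) = \<Psi>2 (coord_proj I2 y)"
    and "\<Psi>1 (coord_proj I1 (g y)) \<in> U2" and "h (g y) = y"
    and "(g has_derivative lift_transition I2 L (transition_derivative \<Phi>1 \<Psi>2 (coord_proj I2 y))) (at y)"
    and "w \<in> span I2 \<Longrightarrow> transition_derivative \<Phi>1 \<Psi>2 (coord_proj I2 y) w \<in> span I1"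
    and "frechet_derivative \<Psi>1 (at (coord_proj I1 (g y))) (transition_derivative \<Phi>1 \<Psi>2 (coord_proj I2 y) w) =
        frechet_derivative \<Psi>2 (at (coord_proj I2 y)) w"
proof -
  note D1 = slice_chartD[OF c1] and D2 = slice_chartD[OF c2]
  let ?y = "coord_proj I2 y"
  have span: "\<Phi>1 (\<Psi>2 z) \<in> span I1" if "z \<in> V2" "\<Psi>2 z \<in> U1" "z \<in> span I2" for z
  proof -
    have "\<Psi>2 z \<in> X" using D2(9) that by simp
    then have "\<Psi>1 (\<Phi>1 (\<Psi>2 z)) \<in> X" using D1(6) that by simp
    then show ?thesis using D1(9) D1(5) that by simp
  qed
  have ys: "?y \<in> span I2" by (rule coord_proj_in_span)
  show p: "coord_proj I1 (g y) = \<Phi>1 (\<Psi>2 ?y)"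
    using coord_proj_of_span[OF D1(1) span[OF y ys]]
    unfolding g_def lift_transition_def linear_add[OF linear_coord_proj] L(2) by simp
  then show r: "g y - coord_proj I1 (g y) = L (y - ?y)" by (simp add: g_def lift_transition_def)
  show v1: "coord_proj I1 (g y) \<in> V1" and e: "\<Psi>1 (coord_proj I1 (g y)) = \<Psi>2 ?y" and "\<Psi>1 (coord_proj I1 (g y)) \<in> U2"
    using p D1(5,6)[OF y(2)] D2(7)[OF y(1)] by auto
  show "h (g y) = y"
    unfolding h_def lift_transition_def r e using D2(8)[OF y(1)] L(3) by simp
  have d\<tau>: "((\<lambda>y. \<Phi>1 (\<Psi>2 y)) has_derivative transition_derivative \<Phi>1 \<Psi>2 ?y) (at ?y)"
    unfolding transition_derivative_def [abs_def]
    by (rule has_derivative_compose[OF D2(15)[OF y(1)] D1(14)[OF y(2)]])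
  have dP: "(coord_proj I2 has_derivative coord_proj I2) (at y)"
    by (rule bounded_linear_imp_has_derivative[OF bounded_linear_coord_proj])
  show "(g has_derivative lift_transition I2 L (transition_derivative \<Phi>1 \<Psi>2 ?y)) (at y)"
  proof -
    have "(L has_derivative L) (at z)" for z
      using L(1) by (intro bounded_linear_imp_has_derivative) (simp add: linear_linear)
    then have "((\<lambda>y. L (y - coord_proj I2 y)) has_derivative (\<lambda>w. L (w - coord_proj I2 w))) (at y)"
      using has_derivative_compose[OF has_derivative_diff[OF has_derivative_ident dP]] by blast
    from has_derivative_add[OF has_derivative_compose[OF dP d\<tau>] this]
    show ?thesis by (simp add: g_def lift_transition_def [abs_def])
  qed
  show "transition_derivative \<Phi>1 \<Psi>2 ?y w \<in> span I1" if "w \<in> span I2"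
  proof (rule derivative_in_span[OF D1(1) _ _ d\<tau> _ subspace_span ys that])
    show "open (V2 \<inter> \<Psi>2 -` U1)"
      using continuous_open_preimage[OF D2(13) D2(4) D1(3)] .
  qed (use y span in auto)
  have "((\<lambda>z. \<Psi>1 (\<Phi>1 z)) has_derivative (\<lambda>w. frechet_derivative \<Psi>1 (at (\<Phi>1 (\<Psi>2 ?y))) (frechet_derivative \<Phi>1 (at (\<Psi>2 ?y)) w))) (at (\<Psi>2 ?y))"
    by (rule has_derivative_compose[OF D1(14)[OF y(2)] D1(15)[OF D1(5)[OF y(2)]]])
  moreover have "((\<lambda>z. \<Psi>1 (\<Phi>1 z)) has_derivative (\<lambda>w. w)) (at (\<Psi>2 ?y))"
    by (rule has_derivative_transform_within_open[OF has_derivative_ident D1(3) y(2)]) (simp add: D1(6))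
  ultimately have "(\<lambda>w. frechet_derivative \<Psi>1 (at (\<Phi>1 (\<Psi>2 ?y))) (frechet_derivative \<Phi>1 (at (\<Psi>2 ?y)) w)) = (\<lambda>w. w)"
    by (rule has_derivative_unique)
  from fun_cong[OF this] show "frechet_derivative \<Psi>1 (at (coord_proj I1 (g y))) (transition_derivative \<Phi>1 \<Psi>2 ?y w) = frechet_derivative \<Psi>2 (at ?y) w"
    unfolding p transition_derivative_def by simp
qed

definition basis_map :: "('a \<Rightarrow> 'a) \<Rightarrow> 'a::euclidean_space \<Rightarrow> 'a" where
  "basis_map \<pi> y = (\<Sum>b\<in>Basis. (y \<bullet> b) *\<^sub>R \<pi> b)"

lemma basis_map_isometry:
  assumes \<pi>: "\<forall>b\<in>Basis. \<forall>c\<in>Basis. \<pi> b \<bullet> \<pi> c = (if b = c then 1 else 0)"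
  shows "linear (basis_map \<pi>)" "basis_map \<pi> x \<bullet> basis_map \<pi> y = x \<bullet> (y :: 'a::euclidean_space)"
    "b \<in> Basis \<Longrightarrow> basis_map \<pi> y \<bullet> \<pi> b = y \<bullet> b"
proof -
  show "linear (basis_map \<pi>)" unfolding basis_map_def [abs_def] by (intro linear_compose_sum ballI linear_compose_scale_right) (auto intro!: linearI simp: inner_add_left scaleR_add_left)
  show Lb: "basis_map \<pi> y \<bullet> \<pi> b = y \<bullet> b" if b: "b \<in> Basis" for b y
  proof -
    have "basis_map \<pi> y \<bullet> \<pi> b = (\<Sum>c\<in>Basis. if c = b then y \<bullet> b else 0)"
      unfolding basis_map_def inner_sum_left using b by (intro sum.cong) (auto simp: \<pi>)
    then show ?thesis using b by simp
  qed
  show "basis_map \<pi> x \<bullet> basis_map \<pi> y = x \<bullet> y"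
  proof -
    have "basis_map \<pi> x \<bullet> basis_map \<pi> y = (\<Sum>b\<in>Basis. (y \<bullet> b) * (basis_map \<pi> x \<bullet> \<pi> b))"
      by (subst (2) basis_map_def) (simp add: inner_sum_right)
    also have "\<dots> = (\<Sum>b\<in>Basis. (x \<bullet> b) * (y \<bullet> b))" by (simp add: Lb mult.commute)
    also have "\<dots> = x \<bullet> y" by (rule euclidean_inner[symmetric])
    finally show ?thesis .
  qed
qed

lemma basis_bijection_orthonormal:
  assumes "bij_betw \<pi> (Basis :: 'a::euclidean_space set) Basis"
  shows "\<forall>b\<in>Basis. \<forall>c\<in>Basis. \<pi> b \<bullet> \<pi> c = (if b = c then 1 else 0)"
proof (intro ballI)
  fix b c :: 'a assume "b \<in> Basis" "c \<in> Basis"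
  then have "\<pi> b \<in> Basis" "\<pi> c \<in> Basis" "\<pi> b = \<pi> c \<longleftrightarrow> b = c"
    using assms by (auto simp: bij_betw_def inj_on_def)
  then show "\<pi> b \<bullet> \<pi> c = (if b = c then 1 else 0)" by (simp add: inner_Basis)
qed

text \<open>The completed Gram matrix represents the induced metric on the coordinate subspace plus the Euclidean metric
  on its orthogonal complement. In this form its behavior under changes of coordinates can be read off.\<close>

lemma gram_matrix_form:
  fixes D :: "real^'n \<Rightarrow> real^'n"
  assumes I: "I \<subseteq> Basis" and D: "linear D"
  defines "G \<equiv> (\<chi> i j. if axis i 1 \<in> I \<and> axis j 1 \<in> I then D (axis i 1) \<bullet> D (axis j 1)
     else if i = j then 1 else 0) :: real^'n^'n"
  shows "x \<bullet> (G *v y) = D (coord_proj I x) \<bullet> D (coord_proj I y) + (x - coord_proj I x) \<bullet> (y - coord_proj I y)"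
proof -
  let ?e = "\<lambda>i. axis i 1 :: real^'n"
  have Dp: "D (coord_proj I x) = (\<Sum>i\<in>UNIV. if ?e i \<in> I then (x $ i) *\<^sub>R D (?e i) else 0)" for x
  proof -
    have "coord_proj I x $ i = (if ?e i \<in> I then x $ i else 0)" for i
    proof -
      have "?e i \<in> Basis" by (auto simp: Basis_vec_def)
      from coord_proj_inner[OF I this, of x] show ?thesis by (auto simp: inner_axis)
    qed
    then have "coord_proj I x = (\<Sum>i\<in>UNIV. (if ?e i \<in> I then x $ i else 0) *\<^sub>R ?e i)"
      using basis_expansion[of "coord_proj I x"] by (simp add: scalar_mult_eq_scaleR)
    then have "D (coord_proj I x) = D (\<Sum>i\<in>UNIV. (if ?e i \<in> I then x $ i else 0) *\<^sub>R ?e i)"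
      by (rule arg_cong)
    also have "\<dots> = (\<Sum>i\<in>UNIV. (if ?e i \<in> I then x $ i else 0) *\<^sub>R D (?e i))"
      by (simp only: linear_sum[OF D] linear_scale[OF D])
    also have "\<dots> = (\<Sum>i\<in>UNIV. if ?e i \<in> I then (x $ i) *\<^sub>R D (?e i) else 0)"
      by (intro sum.cong) auto
    finally show ?thesis .
  qed
  have rest: "(x - coord_proj I x) $ i = (if ?e i \<in> I then 0 else x $ i)" for x i
  proof -
    have "?e i \<in> Basis" by (auto simp: Basis_vec_def)
    from coord_proj_inner[OF I this, of x] show ?thesis by (auto simp: inner_axis)
  qed
  have "x \<bullet> (G *v y) = (\<Sum>i\<in>UNIV. \<Sum>j\<in>UNIV. x $ i * (G $ i $ j * y $ j))"
    by (simp add: inner_vec_def matrix_vector_mult_def sum_distrib_left)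
  also have "\<dots> = (\<Sum>i\<in>UNIV. \<Sum>j\<in>UNIV. (if ?e i \<in> I \<and> ?e j \<in> I then x $ i * y $ j * (D (?e i) \<bullet> D (?e j)) else 0) +
      (if i = j then (if ?e i \<in> I then 0 else x $ i * y $ i) else 0))"
    by (intro sum.cong) (auto simp: G_def)
  also have "\<dots> = (\<Sum>i\<in>UNIV. \<Sum>j\<in>UNIV. if ?e i \<in> I \<and> ?e j \<in> I then x $ i * y $ j * (D (?e i) \<bullet> D (?e j)) else 0) +
      (\<Sum>i\<in>UNIV. if ?e i \<in> I then 0 else x $ i * y $ i)"
    by (simp add: sum.distrib)
  also have "(\<Sum>i\<in>UNIV. if ?e i \<in> I then 0 else x $ i * y $ i) = (x - coord_proj I x) \<bullet> (y - coord_proj I y)"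
    unfolding inner_vec_def rest by (intro sum.cong) auto
  also have "(\<Sum>i\<in>UNIV. \<Sum>j\<in>UNIV. if ?e i \<in> I \<and> ?e j \<in> I then x $ i * y $ j * (D (?e i) \<bullet> D (?e j)) else 0) =
      D (coord_proj I x) \<bullet> D (coord_proj I y)"
  proof -
    have "(\<Sum>i\<in>UNIV. f i) \<bullet> (\<Sum>j\<in>UNIV. h j) = (\<Sum>i\<in>UNIV. \<Sum>j\<in>UNIV. f i \<bullet> h j)" for f h :: "'n \<Rightarrow> real^'n"
      by (subst inner_sum_left, rule sum.cong[OF refl], rule inner_sum_right)
    then show ?thesis unfolding Dp by (auto intro!: sum.cong)
  qed
  finally show ?thesis .
qed

text \<open>The derivative \<open>g'\<close> of the lifted transition map pulls the form of \<open>gram_matrix_form\<close> for one chart back to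
  that for the other, since \<open>L\<close> is isometric on the complements; take determinants in
  \<open>G\<^sub>2 = transpose g' ** G\<^sub>1 ** g'\<close>.\<close>

lemma chart_density_transition:
  fixes X :: "(real^'n) set"
  assumes c1: "slice_chart k X I1 U1 V1 \<Phi>1 \<Psi>1" and c2: "slice_chart k X I2 U2 V2 \<Phi>2 \<Psi>2"
    and L: "linear L" "\<And>y. coord_proj I1 (L (y - coord_proj I2 y)) = 0" "\<And>y. L' (L y) = y"
    and iso: "\<And>x y. L x \<bullet> L y = x \<bullet> y"
    and y: "coord_proj I2 y \<in> V2" "\<Psi>2 (coord_proj I2 y) \<in> U1"
  defines "g \<equiv> lift_transition I2 L (\<lambda>y. \<Phi>1 (\<Psi>2 y))"
  shows "\<bar>det (matrix (lift_transition I2 L (transition_derivative \<Phi>1 \<Psi>2 (coord_proj I2 y))))\<bar> * chart_density I1 \<Psi>1 (coord_proj I1 (g y)) =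
      chart_density I2 \<Psi>2 (coord_proj I2 y)"
proof -
  note D1 = slice_chartD[OF c1] and D2 = slice_chartD[OF c2]
  note lp = lift_transition_props[OF c1 c2 L y, folded g_def]
  let ?y = "coord_proj I2 y" and ?z = "coord_proj I1 (g y)"
  define d1 where "d1 = frechet_derivative \<Psi>1 (at ?z)"
  define d2 where "d2 = frechet_derivative \<Psi>2 (at ?y)"
  define g' where "g' = lift_transition I2 L (transition_derivative \<Phi>1 \<Psi>2 ?y)"
  have lin: "linear d1" "linear d2" "linear g'"
    unfolding d1_def d2_def g'_def
    using has_derivative_linear[OF D1(15)[OF lp(3)]] has_derivative_linear[OF D2(15)[OF y(1)]]
      has_derivative_linear[OF lp(7)] by simp_all
  define G1 where "G1 = (\<chi> i j. if axis i 1 \<in> I1 \<and> axis j 1 \<in> I1 then d1 (axis i 1) \<bullet> d1 (axis j 1)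
     else if i = j then 1 else 0 :: real^'n^'n)"
  define G2 where "G2 = (\<chi> i j. if axis i 1 \<in> I2 \<and> axis j 1 \<in> I2 then d2 (axis i 1) \<bullet> d2 (axis j 1)
     else if i = j then 1 else 0 :: real^'n^'n)"
  have form1: "x \<bullet> (G1 *v x') = d1 (coord_proj I1 x) \<bullet> d1 (coord_proj I1 x') + (x - coord_proj I1 x) \<bullet> (x' - coord_proj I1 x')" for x x'
    unfolding G1_def by (rule gram_matrix_form[OF D1(1) lin(1)])
  have form2: "x \<bullet> (G2 *v x') = d2 (coord_proj I2 x) \<bullet> d2 (coord_proj I2 x') + (x - coord_proj I2 x) \<bullet> (x' - coord_proj I2 x')" for x x'
    unfolding G2_def by (rule gram_matrix_form[OF D2(1) lin(2)])
  have pg: "coord_proj I1 (g' x) = transition_derivative \<Phi>1 \<Psi>2 ?y (coord_proj I2 x)" for x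
    using coord_proj_of_span[OF D1(1) lp(8)[OF coord_proj_in_span]]
    unfolding g'_def lift_transition_def linear_add[OF linear_coord_proj] L(2) by simp
  have rg: "g' x - coord_proj I1 (g' x) = L (x - coord_proj I2 x)" for x
    unfolding pg by (simp add: g'_def lift_transition_def)
  have pull: "g' x \<bullet> (G1 *v g' x') = x \<bullet> (G2 *v x')" for x x'
    unfolding form1 form2 rg iso unfolding pg using lp(9) by (simp add: d1_def d2_def)
  have "G2 = transpose (matrix g') ** (G1 ** matrix g')"
  proof -
    have "(transpose (matrix g') ** (G1 ** matrix g')) *v x = G2 *v x" for x
    proof -
      have "z \<bullet> ((transpose (matrix g') ** (G1 ** matrix g')) *v x) = z \<bullet> (G2 *v x)" for z
      proof -
        have "z \<bullet> ((transpose (matrix g') ** (G1 ** matrix g')) *v x) =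
            z \<bullet> (transpose (matrix g') *v (G1 *v (matrix g' *v x)))"
          by (simp only: matrix_vector_mul_assoc)
        also have "\<dots> = (matrix g' *v z) \<bullet> (G1 *v (matrix g' *v x))"
          by (metis dot_lmul_matrix inner_commute transpose_matrix_vector)
        also have "\<dots> = z \<bullet> (G2 *v x)"
          using pull[of z x] by (simp add: matrix_works[OF lin(3)[folded linear_matrix_vector_mul_eq]])
        finally show ?thesis .
      qed
      then show ?thesis using vector_eq_ldot by blast
    qed
    then show ?thesis by (metis matrix_eq)
  qed
  then have "det G2 = (det (matrix g'))\<^sup>2 * det G1"
    by (simp add: det_mul det_transpose power2_eq_square)
  moreover have "gram_det I1 d1 = det G1" "gram_det I2 d2 = det G2"
    unfolding G1_def G2_def by (rule gram_det_eq_det[OF D1(1)], rule gram_det_eq_det[OF D2(1)])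
  ultimately show ?thesis
    unfolding chart_density_def d1_def[symmetric] d2_def[symmetric] g'_def[symmetric]
    by (simp add: real_sqrt_mult)
qed

lemma exists_basis_bijection:
  assumes "I1 \<subseteq> (Basis :: 'a::euclidean_space set)" "I2 \<subseteq> Basis" "card I1 = card I2"
  shows "\<exists>\<pi>. bij_betw \<pi> (Basis :: 'a set) Basis \<and> \<pi> ` I2 = I1 \<and> \<pi> ` (Basis - I2) = Basis - I1"
proof -
  have fin: "finite I1" "finite I2" using assms finite_subset[OF _ finite_Basis] by auto
  obtain f where f: "bij_betw f I2 I1" using finite_same_card_bij[OF fin(2,1)] assms(3) by auto
  have "card (Basis - I2) = card (Basis - I1)" using assms by (simp add: card_Diff_subset fin)
  then obtain g where g: "bij_betw g (Basis - I2) (Basis - I1)"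
    using finite_same_card_bij[of "Basis - I2" "Basis - I1"] by auto
  define \<pi> where "\<pi> = (\<lambda>b. if b \<in> I2 then f b else g b)"
  have 1: "bij_betw \<pi> I2 I1" using f by (subst bij_betw_cong[where g = f]) (auto simp: \<pi>_def)
  have 2: "bij_betw \<pi> (Basis - I2) (Basis - I1)" using g by (subst bij_betw_cong[where g = g]) (auto simp: \<pi>_def)
  have "bij_betw \<pi> (I2 \<union> (Basis - I2)) (I1 \<union> (Basis - I1))"
    by (rule bij_betw_combine[OF 1 2]) auto
  moreover have "I2 \<union> (Basis - I2) = Basis" "I1 \<union> (Basis - I1) = Basis" using assms by auto
  ultimately show ?thesis using 1 2 by (auto simp: bij_betw_def intro!: exI[of _ \<pi>])
qed

text \<open>Both volumes are integrals over slabs in the ambient space. A permutation of the basis that matches the two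
  coordinate subspaces serves as the linear part of the lifted transition map, which then carries one slab into
  the other and has the quotient of the densities as its Jacobian.\<close>

lemma chart_volume_le:
  fixes X :: "(real^'n) set"
  assumes c1: "slice_chart k X I1 U1 V1 \<Phi>1 \<Psi>1" and c2: "slice_chart k X I2 U2 V2 \<Phi>2 \<Psi>2"
    and B: "B \<in> sets borel" "B \<subseteq> U1" "B \<subseteq> U2"
  shows "emeasure (chart_volume I2 V2 \<Psi>2) B \<le> emeasure (chart_volume I1 V1 \<Psi>1) B"
proof -
  note D1 = slice_chartD[OF c1] and D2 = slice_chartD[OF c2]
  obtain \<pi> where \<pi>: "bij_betw \<pi> (Basis :: (real^'n) set) Basis" "\<pi> ` I2 = I1" "\<pi> ` (Basis - I2) = Basis - I1"
    using exists_basis_bijection[OF D1(1) D2(1)] D1(2) D2(2) by auto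
  define L where "L = basis_map \<pi>"
  note L = basis_map_isometry[OF basis_bijection_orthonormal[OF \<pi>(1)], folded L_def]
  define \<pi>' where "\<pi>' = inv_into Basis \<pi>"
  have \<pi>': "bij_betw \<pi>' Basis Basis" unfolding \<pi>'_def by (rule bij_betw_inv_into[OF \<pi>(1)])
  have \<pi>\<pi>': "\<pi> (\<pi>' b) = b" "\<pi>' (\<pi> b) = b" "\<pi> b \<in> Basis" "\<pi>' b \<in> Basis" if "b \<in> Basis" for b
    using that \<pi>(1) \<pi>' bij_betw_inv_into_left[OF \<pi>(1)] bij_betw_inv_into_right[OF \<pi>(1)]
    by (auto simp: \<pi>'_def bij_betw_def)
  define L' where "L' = basis_map \<pi>'"
  note L' = basis_map_isometry[OF basis_bijection_orthonormal[OF \<pi>'], folded L'_def]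
  have LL': "L' (L y) = y" "L (L' y) = y" for y
  proof -
    show "L' (L y) = y"
    proof (rule euclidean_eqI)
      fix b :: "real^'n" assume b: "b \<in> Basis"
      have "L' (L y) \<bullet> \<pi>' (\<pi> b) = L y \<bullet> \<pi> b" by (rule L'(3)) (use \<pi>\<pi>' b in auto)
      then show "L' (L y) \<bullet> b = y \<bullet> b" using L(3)[OF b] \<pi>\<pi>' b by simp
    qed
    show "L (L' y) = y"
    proof (rule euclidean_eqI)
      fix b :: "real^'n" assume b: "b \<in> Basis"
      have "L (L' y) \<bullet> \<pi> (\<pi>' b) = L' y \<bullet> \<pi>' b" by (rule L(3)) (use \<pi>\<pi>' b in auto)
      then show "L (L' y) \<bullet> b = y \<bullet> b" using L'(3)[OF b] \<pi>\<pi>' b by simp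
    qed
  qed
  have \<pi>I: "b \<in> I2 \<longleftrightarrow> \<pi> b \<in> I1" if "b \<in> Basis" for b
    using inj_on_image_mem_iff[of \<pi> Basis b I2] \<pi> that D2(1) by (simp add: bij_betw_def)
  have \<pi>I': "b \<in> I1 \<longleftrightarrow> \<pi>' b \<in> I2" if "b \<in> Basis" for b using \<pi>I[of "\<pi>' b"] \<pi>\<pi>' that by simp
  have L0: "coord_proj I1 (L (y - coord_proj I2 y)) = 0" for y
  proof (rule euclidean_eqI)
    fix b :: "real^'n" assume b: "b \<in> Basis"
    have "L (y - coord_proj I2 y) \<bullet> \<pi> (\<pi>' b) = (y - coord_proj I2 y) \<bullet> \<pi>' b" by (rule L(3)) (use \<pi>\<pi>' b in auto)
    then show "coord_proj I1 (L (y - coord_proj I2 y)) \<bullet> b = 0 \<bullet> b"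
      using b \<pi>\<pi>' \<pi>I'[OF b] by (simp add: coord_proj_inner D1(1) D2(1) inner_diff_left)
  qed
  have L0': "coord_proj I2 (L' (y - coord_proj I1 y)) = 0" for y
  proof (rule euclidean_eqI)
    fix b :: "real^'n" assume b: "b \<in> Basis"
    have "L' (y - coord_proj I1 y) \<bullet> \<pi>' (\<pi> b) = (y - coord_proj I1 y) \<bullet> \<pi> b" by (rule L'(3)) (use \<pi>\<pi>' b in auto)
    then show "coord_proj I2 (L' (y - coord_proj I1 y)) \<bullet> b = 0 \<bullet> b"
      using b \<pi>\<pi>' \<pi>I[OF b] by (simp add: coord_proj_inner D1(1) D2(1) inner_diff_left)
  qed
  define g where "g = lift_transition I2 L (\<lambda>y. \<Phi>1 (\<Psi>2 y))"
  define h where "h = lift_transition I1 L' (\<lambda>y. \<Phi>2 (\<Psi>1 y))"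
  define g' where "g' = (\<lambda>y. lift_transition I2 L (transition_derivative \<Phi>1 \<Psi>2 (coord_proj I2 y)))"
  define h' where "h' = (\<lambda>y. lift_transition I1 L' (transition_derivative \<Phi>2 \<Psi>1 (coord_proj I1 y)))"
  define E2 where "E2 = {y. coord_proj I2 y \<in> V2 \<and> \<Psi>2 (coord_proj I2 y) \<in> U1}"
  define E1 where "E1 = {y. coord_proj I1 y \<in> V1 \<and> \<Psi>1 (coord_proj I1 y) \<in> U2}"
  note G = lift_transition_props[OF c1 c2 L(1) L0 LL'(1), folded g_def h_def g'_def]
  note H = lift_transition_props[OF c2 c1 L'(1) L0' LL'(2), folded g_def h_def h'_def]
  have dens: "\<bar>det (matrix (g' y))\<bar> * chart_density I1 \<Psi>1 (coord_proj I1 (g y)) = chart_density I2 \<Psi>2 (coord_proj I2 y)"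
    if "y \<in> E2" for y
    using chart_density_transition[OF c1 c2 L(1) L0 LL'(1) L(2)] that unfolding g_def g'_def E2_def by blast
  have gE: "g y \<in> E1 \<and> h (g y) = y" if "y \<in> E2" for y
    using that G(3,5,6) by (auto simp: E1_def E2_def)
  have hE: "h y \<in> E2 \<and> g (h y) = y" if "y \<in> E1" for y
    using that H(3,5,6) by (auto simp: E1_def E2_def)
  have slab_g: "g y \<in> coord_slab I1" if "y \<in> E2" "y \<in> coord_slab I2" for y
  proof -
    have "g y \<bullet> c \<in> {0..1}" if c: "c \<in> Basis - I1" for c
    proof -
      have c': "\<pi>' c \<in> Basis" "\<pi>' c \<notin> I2" using c \<pi>\<pi>'(4)[of c] \<pi>I'[of c] by auto
      have "g y \<bullet> c = (g y - coord_proj I1 (g y)) \<bullet> c"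
        using c by (simp add: inner_diff_left coord_proj_inner D1(1))
      also have "\<dots> = L (y - coord_proj I2 y) \<bullet> \<pi> (\<pi>' c)"
        using G(2) \<open>y \<in> E2\<close> c \<pi>\<pi>' by (simp add: E2_def)
      also have "\<dots> = (y - coord_proj I2 y) \<bullet> \<pi>' c" using c \<pi>\<pi>' by (intro L(3)) auto
      also have "\<dots> = y \<bullet> \<pi>' c" using c' by (simp add: inner_diff_left coord_proj_inner D2(1))
      finally show ?thesis using \<open>y \<in> coord_slab I2\<close> c' by (simp add: coord_slab_def)
    qed
    then show ?thesis by (simp add: coord_slab_def)
  qed
  have slab_h: "h y \<in> coord_slab I2" if "y \<in> E1" "y \<in> coord_slab I1" for y
  proof -
    have "h y \<bullet> c \<in> {0..1}" if c: "c \<in> Basis - I2" for c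
    proof -
      have c': "\<pi> c \<in> Basis" "\<pi> c \<notin> I1" using c \<pi>\<pi>'(3)[of c] \<pi>I[of c] by auto
      have "h y \<bullet> c = (h y - coord_proj I2 (h y)) \<bullet> c"
        using c by (simp add: inner_diff_left coord_proj_inner D2(1))
      also have "\<dots> = L' (y - coord_proj I1 y) \<bullet> \<pi>' (\<pi> c)"
        using H(2) \<open>y \<in> E1\<close> c \<pi>\<pi>' by (simp add: E1_def)
      also have "\<dots> = (y - coord_proj I1 y) \<bullet> \<pi> c" using c \<pi>\<pi>' by (intro L'(3)) auto
      also have "\<dots> = y \<bullet> \<pi> c" using c' by (simp add: inner_diff_left coord_proj_inner D1(1))
      finally show ?thesis using \<open>y \<in> coord_slab I1\<close> c' by (simp add: coord_slab_def)
    qed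
    then show ?thesis by (simp add: coord_slab_def)
  qed
  have open2: "open E2"
  proof -
    have "E2 = coord_proj I2 -` (V2 \<inter> \<Psi>2 -` U1)" by (auto simp: E2_def)
    moreover have "open (V2 \<inter> \<Psi>2 -` U1)" by (rule continuous_open_preimage[OF D2(13) D2(4) D1(3)])
    ultimately show ?thesis
      using open_vimage linear_continuous_on[OF bounded_linear_coord_proj] by metis
  qed
  define S where "S = E2 \<inter> coord_slab I2"
  define T where "T = E1 \<inter> coord_slab I1"
  define f where "f = (\<lambda>z. indicator T z * (indicator B (\<Psi>1 (coord_proj I1 z)) * max 0 (chart_density I1 \<Psi>1 (coord_proj I1 z))))"
  have f0: "f z \<ge> 0" for z by (simp add: f_def)
  note [measurable] = emeasure_chart_volume(2)[OF c1 B(1)] emeasure_chart_volume(2)[OF c2 B(1)]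
  have feq: "ennreal (f z) = indicator (coord_slab I1) z * (indicator {y \<in> V1. \<Psi>1 y \<in> B} (coord_proj I1 z) *
      ennreal (chart_density I1 \<Psi>1 (coord_proj I1 z)))" for z
    using B(3) by (auto simp: f_def T_def E1_def max_def ennreal_neg split: split_indicator)
  have fm: "f \<in> borel_measurable borel"
  proof -
    have "(\<lambda>z. ennreal (f z)) \<in> borel_measurable borel" unfolding feq by measurable
    then have "(\<lambda>z. enn2real (ennreal (f z))) \<in> borel_measurable borel" by measurable
    then show ?thesis by (simp add: f0)
  qed
  have Teq: "T \<in> sets borel"
  proof -
    have "E1 = coord_proj I1 -` (V1 \<inter> \<Psi>1 -` U2)" by (auto simp: E1_def)
    moreover have "open (V1 \<inter> \<Psi>1 -` U2)" by (rule continuous_open_preimage[OF D1(13) D1(4) D2(3)])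
    ultimately have "open E1"
      using open_vimage linear_continuous_on[OF bounded_linear_coord_proj] by metis
    then show ?thesis by (auto simp: T_def)
  qed
  have lhs: "indicator S y * ennreal (\<bar>det (matrix (g' y))\<bar> * f (g y)) =
      indicator (coord_slab I2) y * (indicator {y \<in> V2. \<Psi>2 y \<in> B} (coord_proj I2 y) *
      ennreal (chart_density I2 \<Psi>2 (coord_proj I2 y)))" for y
  proof (cases "y \<in> S")
    case True
    then have y: "y \<in> E2" "y \<in> coord_slab I2" by (auto simp: S_def)
    then have "g y \<in> T" using gE slab_g by (auto simp: T_def)
    then have "\<bar>det (matrix (g' y))\<bar> * f (g y) =
        indicator B (\<Psi>2 (coord_proj I2 y)) * (\<bar>det (matrix (g' y))\<bar> * max 0 (chart_density I1 \<Psi>1 (coord_proj I1 (g y))))"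
      using y(1) G(4)[of y] by (simp add: f_def E2_def)
    also have "\<bar>det (matrix (g' y))\<bar> * max 0 (chart_density I1 \<Psi>1 (coord_proj I1 (g y))) =
        max 0 (chart_density I2 \<Psi>2 (coord_proj I2 y))"
      unfolding dens[OF y(1), symmetric] by (auto simp: max_def mult_le_0_iff zero_le_mult_iff)
    finally show ?thesis using True y by (auto simp: E2_def max_def ennreal_neg split: split_indicator)
  next
    case False
    then show ?thesis using B(2) by (auto simp: S_def E2_def split: split_indicator)
  qed
  have "emeasure (chart_volume I2 V2 \<Psi>2) B = (\<integral>\<^sup>+y. indicator S y * ennreal (\<bar>det (matrix (g' y))\<bar> * f (g y)) \<partial>lborel)"
    unfolding lhs by (rule emeasure_chart_volume(1)[OF c2 B(1)])
  also have "\<dots> \<le> (\<integral>\<^sup>+y. f y \<partial>lborel)"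
  proof (rule nn_integral_change_of_variables[OF Teq fm f0, where h = h and h' = h'])
    show "(g has_derivative g' x) (at x)" if "x \<in> S" for x using that G(7) by (auto simp: S_def E2_def g'_def)
    show dh: "(h has_derivative h' y) (at y)" if "y \<in> T" for y using that H(7) by (auto simp: T_def E1_def h'_def)
    show "g x \<in> T \<and> h (g x) = x" if "x \<in> S" for x using that gE slab_g by (auto simp: S_def T_def)
    show "h y \<in> S \<and> g (h y) = y" if "y \<in> T" for y using that hE slab_h by (auto simp: S_def T_def)
    show "h' y \<circ> g' (h y) = id" if y: "y \<in> T" for y
    proof -
      have hy: "h y \<in> E2" "g (h y) = y" using hE y by (auto simp: T_def)
      have dg: "(g has_derivative g' (h y)) (at (h y))" using hy G(7) by (auto simp: E2_def g'_def)
      have "((\<lambda>x. h (g x)) has_derivative (\<lambda>w. h' y (g' (h y) w))) (at (h y))"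
        using has_derivative_compose[OF dg] dh[OF y] hy(2) by metis
      moreover have "((\<lambda>x. h (g x)) has_derivative (\<lambda>w. w)) (at (h y))"
        by (rule has_derivative_transform_within_open[OF has_derivative_ident open2 hy(1)]) (use gE in auto)
      ultimately have "(\<lambda>w. h' y (g' (h y) w)) = (\<lambda>w. w)" by (rule has_derivative_unique)
      then show ?thesis by (simp add: o_def id_def)
    qed
    show "(\<lambda>x. indicator S x * ennreal (\<bar>det (matrix (g' x))\<bar> * f (g x))) \<in> borel_measurable borel"
      unfolding lhs by measurable
  qed
  also have "(\<integral>\<^sup>+y. f y \<partial>lborel) = emeasure (chart_volume I1 V1 \<Psi>1) B"
    unfolding feq by (rule emeasure_chart_volume(1)[OF c1 B(1), symmetric])
  finally show ?thesis .
qed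

lemma exists_measure_sum:
  assumes "sets M = sets N"
  shows "\<exists>K. sets K = sets M \<and> (\<forall>B\<in>sets M. emeasure K B = emeasure M B + emeasure N B)"
proof -
  define K where "K = measure_of (space M) (sets M) (\<lambda>B. emeasure M B + emeasure N B)"
  have sp: "space M = space N" using assms by (rule sets_eq_imp_space_eq)
  have "emeasure K B = emeasure M B + emeasure N B" if "B \<in> sets M" for B
  proof (rule emeasure_measure_of[OF K_def sets.space_closed])
    show "positive (sets K) (\<lambda>B. emeasure M B + emeasure N B)"
      by (simp add: positive_def)
    show "countably_additive (sets K) (\<lambda>B. emeasure M B + emeasure N B)"
    proof (rule countably_additiveI)
      fix F :: "nat \<Rightarrow> 'a set" assume F: "range F \<subseteq> sets K" "disjoint_family F"
      have "range F \<subseteq> sets M" using F(1) by (simp add: K_def)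
      then show "(\<Sum>i. emeasure M (F i) + emeasure N (F i)) = emeasure M (\<Union>i. F i) + emeasure N (\<Union>i. F i)"
        using F(2) assms by (simp add: suminf_add[symmetric] suminf_emeasure)
    qed
    show "B \<in> sets K" using that by (simp add: K_def)
  qed
  then show ?thesis by (intro exI[of _ K]) (simp add: K_def)
qed

text \<open>
  The volume in a chart, enlarged by infinite mass at every point outside of the chart, dominates the
  volumes in all charts, hence their supremum.
\<close>

lemma emeasure_riemannian_volume:
  fixes X :: "(real^'n) set"
  assumes c: "slice_chart k X I U V \<Phi> \<Psi>" and B: "B \<in> sets borel" "B \<subseteq> U"
  shows "emeasure (riemannian_volume k X) B = emeasure (chart_volume I V \<Psi>) B"
    and "sets (riemannian_volume k X) = sets borel"
proof -
  let ?C = "{chart_volume I V \<Psi> | I U V \<Phi> \<Psi>. slice_chart k X I U V \<Phi> \<Psi>}"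
  have C: "chart_volume I V \<Psi> \<in> ?C" using c by blast
  show s: "sets (riemannian_volume k X) = sets borel"
    unfolding riemannian_volume_def
  proof -
    have "sets M = sets borel" if "M \<in> ?C" for M using that by auto
    moreover have "?C \<noteq> {}" using C by blast
    ultimately have "sets (SUP M\<in>?C. M) = sets borel" by (rule sets_SUP)
    then show "sets (Sup ?C) = sets borel" by (simp only: image_ident)
  qed
  have "chart_volume I V \<Psi> \<le> riemannian_volume k X"
    unfolding riemannian_volume_def using C by (rule Sup_upper)
  then have 1: "emeasure (chart_volume I V \<Psi>) B \<le> emeasure (riemannian_volume k X) B"
    using s by (intro le_measureD3) auto
  have U: "U \<in> sets borel" using slice_chartD(3)[OF c] by simp
  define N where "N = density (distr (count_space UNIV) borel id) (\<lambda>x. if x \<in> U then 0 else \<infinity> :: ennreal)"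
  have Ns: "sets N = sets borel" by (simp add: N_def)
  have N0: "emeasure N D = (\<integral>\<^sup>+x. (if x \<in> U then 0 else \<infinity>) * indicator D x \<partial>count_space UNIV)"
    if [measurable]: "D \<in> sets borel" for D
    unfolding N_def using U by (simp add: emeasure_density nn_integral_distr)
  have NB: "emeasure N D = 0" if "D \<in> sets borel" "D \<subseteq> U" for D
    unfolding N0[OF that(1)] using that(2) by (simp add: nn_integral_0_iff_AE AE_count_space) (auto split: split_indicator)
  have Ninf: "emeasure N D = \<infinity>" if "D \<in> sets borel" "\<not> D \<subseteq> U" for D
  proof -
    obtain x where x: "x \<in> D" "x \<notin> U" using \<open>\<not> D \<subseteq> U\<close> by blast
    have "(\<integral>\<^sup>+z. \<infinity> * indicator {x} z \<partial>count_space UNIV) \<le> (\<integral>\<^sup>+x. (if x \<in> U then 0 else \<infinity>) * indicator D x \<partial>count_space UNIV)"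
      using x by (intro nn_integral_mono) (auto split: split_indicator)
    moreover have "(\<integral>\<^sup>+z. \<infinity> * indicator {x} z \<partial>count_space UNIV) = \<infinity>"
      by (simp add: nn_integral_cmult)
    ultimately show ?thesis unfolding N0[OF that(1)] by (simp add: top_unique)
  qed
  define M where "M = density (chart_volume I V \<Psi>) (indicator U)"
  have M: "emeasure M D = emeasure (chart_volume I V \<Psi>) (D \<inter> U)" if "D \<in> sets borel" for D
  proof -
    have "emeasure M D = (\<integral>\<^sup>+x. indicator U x * indicator D x \<partial>chart_volume I V \<Psi>)"
      unfolding M_def using U that by (intro emeasure_density borel_measurable_indicator) auto
    also have "\<dots> = (\<integral>\<^sup>+x. indicator (D \<inter> U) x \<partial>chart_volume I V \<Psi>)"
      by (intro nn_integral_cong) (auto split: split_indicator)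
    finally show ?thesis using U that by simp
  qed
  obtain K where K: "sets K = sets borel" "\<And>D. D \<in> sets borel \<Longrightarrow> emeasure K D = emeasure M D + emeasure N D"
    using exists_measure_sum[of M N] Ns by (auto simp: M_def)
  have "riemannian_volume k X \<le> K"
    unfolding riemannian_volume_def
  proof (rule Sup_least)
    fix C assume "C \<in> ?C"
    then obtain I' U' V' \<Phi>' \<Psi>' where C: "C = chart_volume I' V' \<Psi>'" and c': "slice_chart k X I' U' V' \<Phi>' \<Psi>'" by blast
    note D' = slice_chartD[OF c']
    show "C \<le> K"
    proof (subst le_measure)
      show "sets C = sets K" by (simp add: C K(1))
      show "\<forall>D\<in>sets C. emeasure C D \<le> emeasure K D"
      proof
        fix D assume "D \<in> sets C"
        then have D: "D \<in> sets borel" by (simp add: C)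
        show "emeasure C D \<le> emeasure K D"
        proof (cases "D \<subseteq> U")
          case True
          have U': "U' \<in> sets borel" using D'(3) by simp
          have null: "emeasure C (D - U') = 0"
          proof -
            have e: "{y \<in> V'. \<Psi>' y \<in> D - U'} = {}" using D'(7) by auto
            have "D - U' \<in> sets borel" using D U' by auto
            from emeasure_chart_volume(1)[OF c' this] show ?thesis unfolding e C by simp
          qed
          have "D = (D \<inter> U') \<union> (D - U')" by auto
          then have "emeasure C D \<le> emeasure C (D \<inter> U') + emeasure C (D - U')"
            using D U' by (metis C emeasure_subadditive sets.Diff sets.Int sets_chart_volume)
          also have "\<dots> = emeasure C (D \<inter> U')" by (simp add: null)
          also have "\<dots> \<le> emeasure (chart_volume I V \<Psi>) (D \<inter> U')"
            unfolding C using D U' True by (intro chart_volume_le[OF c c']) auto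
          also have "\<dots> \<le> emeasure (chart_volume I V \<Psi>) D" using D by (intro emeasure_mono) auto
          also have "\<dots> = emeasure K D" using True D by (simp add: K(2) M NB Int_absorb2)
          finally show ?thesis .
        next
          case False
          then show ?thesis using D by (simp add: K(2) Ninf)
        qed
      qed
    qed
  qed
  then have "emeasure (riemannian_volume k X) B \<le> emeasure K B"
    using s K(1) by (intro le_measureD3) auto
  also have "\<dots> = emeasure (chart_volume I V \<Psi>) B" using B by (simp add: K(2) M NB Int_absorb2)
  finally show "emeasure (riemannian_volume k X) B = emeasure (chart_volume I V \<Psi>) B" using 1 by simp
qed

section \<open>A normal variation supported in a chart\<close>

text \<open>The bump depends on the component in \<open>span I\<close> only. For \<open>e\<close> orthogonal to \<open>I\<close> it is constant along \<open>e\<close>, which makes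
  \<open>chart_shear\<close> invertible with inverse at the time \<open>- s\<close>.\<close>

definition chart_bump :: "'a::euclidean_space set \<Rightarrow> 'a \<Rightarrow> real \<Rightarrow> 'a \<Rightarrow> real" where
  "chart_bump I q r y = flat_exp 0 (r\<^sup>2 - (coord_proj I y - q) \<bullet> (coord_proj I y - q))"

definition chart_shear :: "'a::euclidean_space set \<Rightarrow> 'a \<Rightarrow> real \<Rightarrow> 'a \<Rightarrow> real \<Rightarrow> 'a \<Rightarrow> 'a" where
  "chart_shear I q r e s y = y + (s * chart_bump I q r y) *\<^sub>R e"

lemma chart_bump_smooth: "open S \<Longrightarrow> times_differentiable_on m S (chart_bump I q r)"
  unfolding chart_bump_def [abs_def]
proof -
  assume S: "open S"
  have 1: "times_differentiable_on m S (\<lambda>y. coord_proj I y + (- q))"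
    using S by (intro times_differentiable_on_add times_differentiable_on_const
        times_differentiable_on_bounded_linear bounded_linear_coord_proj)
  have 2: "times_differentiable_on m S (\<lambda>y. r\<^sup>2 + (- 1) * ((coord_proj I y + (- q)) \<bullet> (coord_proj I y + (- q))))"
    using S by (intro times_differentiable_on_add times_differentiable_on_const times_differentiable_on_mult
        times_differentiable_on_inner 1)
  have "times_differentiable_on m S (\<lambda>y. flat_exp 0 (r\<^sup>2 + (- 1) * ((coord_proj I y + (- q)) \<bullet> (coord_proj I y + (- q)))))"
    by (rule times_differentiable_on_compose[OF S _ 2 times_differentiable_on_flat_exp]) simp
  then show "times_differentiable_on m S (\<lambda>y. flat_exp 0 (r\<^sup>2 - (coord_proj I y - q) \<bullet> (coord_proj I y - q)))"
    by simp
qed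

lemma chart_bump_bounds: "0 \<le> chart_bump I q r y" "chart_bump I q r y \<le> 1"
  by (auto simp: chart_bump_def flat_exp_def)

lemma chart_bump_pos_iff:
  assumes "I \<subseteq> Basis" "y \<in> span I" "r > 0"
  shows "chart_bump I q r y > 0 \<longleftrightarrow> y \<in> ball q r"
proof -
  have "chart_bump I q r y > 0 \<longleftrightarrow> (y - q) \<bullet> (y - q) < r\<^sup>2"
    using coord_proj_of_span[OF assms(1,2)] by (auto simp: chart_bump_def flat_exp_def)
  also have "\<dots> \<longleftrightarrow> norm (y - q) < r"
    using assms(3) by (metis abs_of_pos norm_lt_square power2_norm_eq_inner abs_norm_cancel power2_less_imp_less power_strict_mono norm_ge_zero less_imp_le pos2 zero_less_numeral)
  finally show ?thesis by (simp add: dist_norm norm_minus_commute)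
qed

lemma chart_shear_smooth:
  assumes "open S" shows "times_differentiable_on m S (\<lambda>z. chart_shear I q r e (fst z) (snd z))"
proof -
  have "times_differentiable_on m S (\<lambda>z. chart_bump I q r (snd z))"
    by (rule times_differentiable_on_compose[OF assms _ times_differentiable_on_snd[OF assms] chart_bump_smooth[OF open_UNIV]]) simp
  then show ?thesis unfolding chart_shear_def
    by (intro times_differentiable_on_add times_differentiable_on_scaleR times_differentiable_on_mult
        times_differentiable_on_const times_differentiable_on_fst times_differentiable_on_snd assms)
qed

lemma chart_shear_smooth':
  assumes "open S" shows "times_differentiable_on m S (chart_shear I q r e s)"
proof -
  have "times_differentiable_on m S (\<lambda>y. chart_shear I q r e (fst (s, y)) (snd (s, y)))"
    by (rule times_differentiable_on_compose[OF assms _ _ chart_shear_smooth[OF open_UNIV]])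
       (auto intro!: times_differentiable_on_Pair times_differentiable_on_const times_differentiable_on_ident assms simp: assms)
  then show ?thesis by simp
qed

lemma smooth_map_onI_cong:
  assumes "p \<in> N" "smooth_on_open N g" "\<And>x. x \<in> S \<inter> N \<Longrightarrow> f x = g x"
  shows "\<exists>U g. p \<in> U \<and> smooth_on_open U g \<and> (\<forall>x\<in>S \<inter> U. f x = g x)"
  using assms by blast

text \<open>The variation \<open>F\<close> is the shear, conjugated by the chart. The last assumption says that the time interval is so
  short that the disc on which the bump lives stays in the range of the chart.\<close>

locale chart_variation =
  fixes k :: nat and X I U V :: "(real^'n) set" and \<Phi> \<Psi> :: "real^'n \<Rightarrow> real^'n" and q e :: "real^'n" and r \<epsilon> :: real
  assumes chart: "slice_chart k X I U V \<Phi> \<Psi>"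
    and q: "q \<in> span I" and r: "r > 0" and disc: "cball q r \<inter> span I \<subseteq> V"
    and e: "\<And>b. b \<in> I \<Longrightarrow> e \<bullet> b = 0" and \<epsilon>: "\<epsilon> > 0"
    and stays: "\<And>s y. \<bar>s\<bar> \<le> \<epsilon> \<Longrightarrow> y \<in> cball q r \<inter> span I \<Longrightarrow> chart_shear I q r e s y \<in> V"
begin

abbreviation "\<eta> \<equiv> chart_bump I q r"
abbreviation "shear \<equiv> chart_shear I q r e"

definition "disc = cball q r \<inter> span I"
definition "F s x = (if x \<in> U then \<Psi> (shear s (\<Phi> x)) else x)"
definition "K = \<Psi> ` disc"
definition "V' s = {y. shear s y \<in> V}"
definition "\<Phi>' s x = shear (- s) (\<Phi> x)"
definition "\<Psi>' s y = \<Psi> (shear s y)"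

lemmas D = slice_chartD[OF chart]

lemma proj_shear: "coord_proj I (shear s y) = coord_proj I y"
proof -
  have "coord_proj I e = 0" unfolding coord_proj_def using e by simp
  then show ?thesis
    by (simp add: chart_shear_def linear_add[OF linear_coord_proj] linear_scale[OF linear_coord_proj])
qed

lemma bump_shear: "\<eta> (shear s y) = \<eta> y"
  unfolding chart_bump_def proj_shear ..

lemma shear_shear: "shear s (shear (- s) y) = y" "shear (- s) (shear s y) = y"
  using bump_shear[of "- s" y] bump_shear[of s y] by (simp_all add: chart_shear_def[of I q r e s "shear (- s) y"]
      chart_shear_def[of I q r e "- s" "shear s y"]) (simp_all add: chart_shear_def)

lemma shear_0 [simp]: "shear 0 y = y" by (simp add: chart_shear_def)

lemma continuous_shear: "continuous_on S (shear s)"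
  using times_differentiable_on_continuous[OF chart_shear_smooth'[OF open_UNIV, of 0]] continuous_on_subset by blast

lemma compact_disc: "compact disc"
  unfolding disc_def by (intro compact_Int_closed compact_cball closed_subspace subspace_span)

lemma disc_V: "disc \<subseteq> V" using disc by (simp add: disc_def)

lemma bump_outside: "y \<in> span I \<Longrightarrow> y \<notin> disc \<Longrightarrow> \<eta> y = 0"
  using chart_bump_pos_iff[OF D(1) _ r, of y q] chart_bump_bounds(1)[of I q r y] by (fastforce simp: disc_def)

lemma shear_outside: "y \<in> span I \<Longrightarrow> y \<notin> disc \<Longrightarrow> shear s y = y"
  by (simp add: chart_shear_def bump_outside)

lemma shear_in_V: "\<bar>s\<bar> \<le> \<epsilon> \<Longrightarrow> y \<in> span I \<Longrightarrow> y \<in> V \<Longrightarrow> shear s y \<in> V"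
  using stays[of s y] shear_outside[of y s] by (cases "y \<in> disc") (auto simp: disc_def)

lemma \<Phi>_span: "x \<in> U \<Longrightarrow> x \<in> X \<Longrightarrow> \<Phi> x \<in> span I"
  using D(5,6,9) by metis

lemma F_in_U:
  assumes "\<bar>s\<bar> \<le> \<epsilon>" "x \<in> X" "x \<in> U"
  shows "F s x \<in> U" "\<Phi> (F s x) = shear s (\<Phi> x)"
  using shear_in_V[OF assms(1) \<Phi>_span[OF assms(3,2)] D(5)[OF assms(3)]] assms D(7,8) by (auto simp: F_def)

lemma F_outside:
  assumes "x \<in> X" "x \<notin> K"
  shows "F s x = x"
proof (cases "x \<in> U")
  case True
  then have "\<Phi> x \<notin> disc" using assms D(6) unfolding K_def by force
  then show ?thesis using True shear_outside[OF \<Phi>_span[OF True assms(1)]] D(6) by (simp add: F_def)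
qed (simp add: F_def)

lemma K_props: "compact K" "K \<subseteq> X" "K \<subseteq> U"
proof -
  show "compact K" unfolding K_def
    by (intro compact_continuous_image continuous_on_subset[OF D(13)] compact_disc disc_V)
  show "K \<subseteq> X" "K \<subseteq> U" using D(7,9) disc_V by (auto simp: K_def disc_def)
qed

lemma V'_open: "open (V' s)"
proof -
  have "V' s = shear s -` V" by (auto simp: V'_def)
  then show ?thesis using open_vimage[OF D(4) continuous_shear[of UNIV]] by simp
qed

lemma disc_V': "\<bar>s\<bar> \<le> \<epsilon> \<Longrightarrow> disc \<subseteq> V' s"
  using stays by (auto simp: V'_def disc_def)

lemma chart': 
  assumes s: "\<bar>s\<bar> \<le> \<epsilon>"
  shows "slice_chart k (F s ` X) I U (V' s) (\<Phi>' s) (\<Psi>' s)"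
  unfolding slice_chart_def
proof (intro conjI)
  show "I \<subseteq> Basis" "card I = k" using D(1,2) by simp_all
  show smooth1: "smooth_on_open U (\<Phi>' s)"
  proof -
    have "times_differentiable_on m U (\<lambda>x. shear (- s) (\<Phi> x))" for m
      by (rule times_differentiable_on_compose[OF D(3) _ D(10) chart_shear_smooth'[OF open_UNIV]]) simp
    then show ?thesis using D(3) by (simp add: smooth_on_open_def \<Phi>'_def [abs_def])
  qed
  show smooth2: "smooth_on_open (V' s) (\<Psi>' s)"
  proof -
    have "times_differentiable_on m (V' s) (\<lambda>y. \<Psi> (shear s y))" for m
      by (rule times_differentiable_on_compose[OF V'_open _ chart_shear_smooth'[OF V'_open] D(11)]) (auto simp: V'_def)
    then show ?thesis using V'_open by (simp add: smooth_on_open_def \<Psi>'_def [abs_def])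
  qed
  show "homeomorphism U (V' s) (\<Phi>' s) (\<Psi>' s)"
  proof (rule homeomorphismI)
    show "continuous_on U (\<Phi>' s)" "continuous_on (V' s) (\<Psi>' s)"
      using smooth1 smooth2 times_differentiable_on_continuous[of 0 U "\<Phi>' s"]
        times_differentiable_on_continuous[of 0 "V' s" "\<Psi>' s"]
      by (simp_all add: smooth_on_open_def del: times_differentiable_on.simps)
    show "\<Phi>' s ` U \<subseteq> V' s" using D(5) by (auto simp: \<Phi>'_def V'_def shear_shear)
    show "\<Psi>' s ` V' s \<subseteq> U" using D(7) by (auto simp: \<Psi>'_def V'_def)
  qed (use D(6,8) in \<open>auto simp: \<Phi>'_def \<Psi>'_def V'_def shear_shear\<close>)
  show "\<Phi>' s ` (U \<inter> F s ` X) = V' s \<inter> span I"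
  proof
    show "\<Phi>' s ` (U \<inter> F s ` X) \<subseteq> V' s \<inter> span I"
    proof clarify
      fix x assume x: "F s x \<in> U" "x \<in> X"
      then have xU: "x \<in> U" by (auto simp: F_def split: if_splits)
      note f = F_in_U[OF s x(2) xU]
      show "\<Phi>' s (F s x) \<in> V' s \<inter> span I"
        using f D(5)[OF f(1)] \<Phi>_span[OF xU x(2)] by (simp add: \<Phi>'_def V'_def shear_shear)
    qed
    show "V' s \<inter> span I \<subseteq> \<Phi>' s ` (U \<inter> F s ` X)"
    proof
      fix y assume y: "y \<in> V' s \<inter> span I"
      have yV: "y \<in> V"
        using y shear_outside[of y s] disc_V by (cases "y \<in> disc") (auto simp: V'_def)
      then have x: "\<Psi> y \<in> X" "\<Psi> y \<in> U" "\<Phi> (\<Psi> y) = y" using D y by auto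
      then have "F s (\<Psi> y) \<in> U \<inter> F s ` X" "\<Phi>' s (F s (\<Psi> y)) = y"
        using F_in_U[OF s x(1,2)] by (auto simp: \<Phi>'_def shear_shear)
      then show "y \<in> \<Phi>' s ` (U \<inter> F s ` X)" by force
    qed
  qed
qed

lemma F_inj: "\<bar>s\<bar> \<le> \<epsilon> \<Longrightarrow> inj_on (F s) X"
proof (rule inj_onI)
  fix x y assume s: "\<bar>s\<bar> \<le> \<epsilon>" and xy: "x \<in> X" "y \<in> X" "F s x = F s y"
  show "x = y"
  proof (cases "x \<in> U"; cases "y \<in> U")
    assume "x \<in> U" "y \<in> U"
    then have "shear s (\<Phi> x) = shear s (\<Phi> y)" using F_in_U(2)[OF s] xy by metis
    then have "\<Phi> x = \<Phi> y" by (metis shear_shear(2))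
    then show ?thesis using D(6) \<open>x \<in> U\<close> \<open>y \<in> U\<close> by metis
  next
    assume "x \<in> U" "y \<notin> U"
    then show ?thesis using F_in_U(1)[OF s] xy by (metis F_def)
  next
    assume "x \<notin> U" "y \<in> U"
    then show ?thesis using F_in_U(1)[OF s] xy by (metis F_def)
  qed (use xy in \<open>simp add: F_def\<close>)
qed

text \<open>In the chart \<open>U\<close> the sheared coordinates form a slice chart. Points outside of \<open>U\<close> do not move, and any chart
  around such a point remains a slice chart after removal of the compact set on which \<open>X\<close> changes.\<close>

lemma F_embedded:
  assumes X: "embedded_submanifold k X" and s: "\<bar>s\<bar> \<le> \<epsilon>"
  shows "embedded_submanifold k (F s ` X)"
  unfolding embedded_submanifold_def
proof
  fix z assume "z \<in> F s ` X"
  then obtain x where x: "x \<in> X" "z = F s x" by blast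
  show "\<exists>I U V \<Phi> \<Psi>. z \<in> U \<and> slice_chart k (F s ` X) I U V \<Phi> \<Psi>"
  proof (cases "x \<in> U")
    case True
    then show ?thesis using chart'[OF s] F_in_U(1)[OF s x(1)] x(2) by blast
  next
    case False
    then have zx: "z = x" using x by (simp add: F_def)
    define C where "C = K \<union> F s ` K"
    have Fc: "continuous_on K (F s)"
    proof (rule continuous_on_eq)
      show "continuous_on K (\<lambda>x. \<Psi> (shear s (\<Phi> x)))"
      proof (rule continuous_on_compose2[OF D(13)])
        show "continuous_on K (\<lambda>x. shear s (\<Phi> x))"
          by (rule continuous_on_compose2[OF continuous_shear[of UNIV]]) (use continuous_on_subset[OF D(12) K_props(3)] in auto)
        show "(\<lambda>x. shear s (\<Phi> x)) ` K \<subseteq> V"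
          using shear_in_V[OF s] \<Phi>_span D(5) K_props by blast
      qed
    qed (use K_props in \<open>auto simp: F_def\<close>)
    have C: "closed C" "C \<subseteq> U"
      unfolding C_def using K_props Fc F_in_U(1)[OF s] by (auto intro!: compact_imp_closed compact_continuous_image)
    obtain I2 U2 V2 \<Phi>2 \<Psi>2 where c2: "x \<in> U2" "slice_chart k X I2 U2 V2 \<Phi>2 \<Psi>2"
      using X x(1) unfolding embedded_submanifold_def by blast
    note D2 = slice_chartD[OF c2(2)]
    define W where "W = V2 \<inter> \<Psi>2 -` (- C)"
    have oW: "open W" unfolding W_def by (rule continuous_open_preimage[OF D2(13,4)]) (use C in auto)
    have oU: "open (U2 - C)" using D2(3) C by auto
    have eqX: "(U2 - C) \<inter> F s ` X = (U2 - C) \<inter> X"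
    proof -
      have "z' \<in> X" if z': "z' \<in> F s ` X" "z' \<notin> C" for z'
      proof -
        obtain x' where x': "x' \<in> X" "z' = F s x'" using z'(1) by blast
        then have "x' \<notin> K" using z'(2) by (auto simp: C_def)
        then show ?thesis using F_outside[of x' s] x' by simp
      qed
      moreover have "z' \<in> F s ` X" if "z' \<in> X" "z' \<notin> C" for z'
        using that F_outside[of z' s] unfolding C_def by (metis UnCI imageI)
      ultimately show ?thesis by blast
    qed
    have "slice_chart k (F s ` X) I2 (U2 - C) W \<Phi>2 \<Psi>2"
      unfolding slice_chart_def
    proof (intro conjI)
      show "I2 \<subseteq> Basis" "card I2 = k" using D2(1,2) by simp_all
      show "smooth_on_open (U2 - C) \<Phi>2" "smooth_on_open W \<Psi>2"
        unfolding smooth_on_open_def using oU oW times_differentiable_on_subset[OF D2(10)] times_differentiable_on_subset[OF D2(11)]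
        by (auto simp: W_def)
      show "homeomorphism (U2 - C) W \<Phi>2 \<Psi>2"
        by (rule homeomorphismI) (use D2(5-8) continuous_on_subset[OF D2(12)] continuous_on_subset[OF D2(13)] in \<open>auto simp: W_def\<close>)
      show "\<Phi>2 ` ((U2 - C) \<inter> F s ` X) = W \<inter> span I2"
        unfolding eqX
      proof
        show "\<Phi>2 ` ((U2 - C) \<inter> X) \<subseteq> W \<inter> span I2"
          using D2(5,6) D2(9)[OF D2(5)] by (auto simp: W_def)
        show "W \<inter> span I2 \<subseteq> \<Phi>2 ` ((U2 - C) \<inter> X)"
        proof
          fix y assume "y \<in> W \<inter> span I2"
          then have "\<Psi>2 y \<in> (U2 - C) \<inter> X" "\<Phi>2 (\<Psi>2 y) = y" using D2 by (auto simp: W_def)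
          then show "y \<in> \<Phi>2 ` ((U2 - C) \<inter> X)" by force
        qed
      qed
    qed
    moreover have "z \<in> U2 - C" using c2(1) zx False C(2) by auto
    ultimately show ?thesis by blast
  qed
qed

lemma F_smooth: "smooth_map_on ({-\<epsilon><..<\<epsilon>} \<times> X) (\<lambda>(s, x). F s x)"
  unfolding smooth_map_on_def
proof
  fix p assume p: "p \<in> {-\<epsilon><..<\<epsilon>} \<times> X"
  obtain s x where sx: "p = (s, x)" "\<bar>s\<bar> \<le> \<epsilon>" "x \<in> X" using p by auto
  show "\<exists>Ua g. p \<in> Ua \<and> smooth_on_open Ua g \<and> (\<forall>x\<in>({-\<epsilon><..<\<epsilon>} \<times> X) \<inter> Ua. (case x of (s, x) \<Rightarrow> F s x) = g x)"
  proof (cases "x \<in> U")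
    case True
    define G where "G = (\<lambda>z::real \<times> (real^'n). (fst z, \<Phi> (snd z)))"
    define H where "H = (\<lambda>z. chart_shear I q r e (fst (G z)) (snd (G z)))"
    have oS: "open (UNIV \<times> U :: (real \<times> (real^'n)) set)" by (intro open_Times open_UNIV D)
    have G: "times_differentiable_on m (UNIV \<times> U) G" for m
      unfolding G_def
      by (intro times_differentiable_on_Pair[OF oS] times_differentiable_on_fst oS
          times_differentiable_on_compose[OF oS _ times_differentiable_on_snd[OF oS] D(10)]) auto
    have H: "times_differentiable_on m (UNIV \<times> U) H" for m
      unfolding H_def by (rule times_differentiable_on_compose[OF oS _ G chart_shear_smooth[OF open_UNIV]]) simp
    define N where "N = (UNIV \<times> U) \<inter> H -` V"
    have oN: "open N" unfolding N_def
      by (rule continuous_open_preimage[OF times_differentiable_on_continuous[OF H] oS D(4)])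
    have "times_differentiable_on m N (\<lambda>z. \<Psi> (H z))" for m
      by (rule times_differentiable_on_compose[OF oN _ times_differentiable_on_subset[OF H] D(11)]) (auto simp: N_def)
    then have sm: "smooth_on_open N (\<lambda>z. \<Psi> (H z))" using oN by (simp add: smooth_on_open_def)
    have pN: "p \<in> N"
      using sx True shear_in_V[OF sx(2) \<Phi>_span[OF True sx(3)] D(5)[OF True]] by (simp add: N_def H_def G_def)
    show ?thesis
      by (rule smooth_map_onI_cong[OF pN sm]) (auto simp: N_def H_def G_def F_def)
  next
    case False
    have oN: "open (UNIV \<times> (- K) :: (real \<times> (real^'n)) set)"
      using K_props(1) by (intro open_Times open_UNIV) (auto simp: compact_imp_closed)
    have sm: "smooth_on_open (UNIV \<times> (- K) :: (real \<times> (real^'n)) set) snd"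
      using oN times_differentiable_on_snd[OF oN] by (simp add: smooth_on_open_def)
    have pN: "p \<in> UNIV \<times> (- K)" using sx False K_props(3) by auto
    show ?thesis by (rule smooth_map_onI_cong[OF pN sm]) (auto simp: F_outside)
  qed
qed

lemma variation:
  assumes "embedded_submanifold k X"
  shows "compactly_supported_variation k X \<epsilon> K F"
  unfolding compactly_supported_variation_def
proof (intro conjI ballI)
  show "F 0 x = x" for x using D(6) by (simp add: F_def)
  show "smooth_map_on ({-\<epsilon><..<\<epsilon>} \<times> X) (\<lambda>(s, x). F s x)" by (rule F_smooth)
  fix s assume "s \<in> {-\<epsilon><..<\<epsilon>}"
  then have s: "\<bar>s\<bar> \<le> \<epsilon>" by auto
  show "inj_on (F s) X" "embedded_submanifold k (F s ` X)" by (rule F_inj[OF s], rule F_embedded[OF assms s])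
  show "F s x = x" if "x \<in> X - K" for x using that F_outside by simp
qed (use \<epsilon> K_props in auto)

subsection \<open>The weighted area of the varied submanifold\<close>

lemma \<Psi>'_image_iff:
  assumes s: "\<bar>s\<bar> \<le> \<epsilon>" and y: "y \<in> V' s" "y \<in> span I"
  shows "\<Psi>' s y \<in> F s ` K \<longleftrightarrow> y \<in> disc"
proof -
  have F\<Psi>: "F s (\<Psi> z) = \<Psi>' s z" if "z \<in> V" for z
    using D(7,8)[OF that] by (simp add: F_def \<Psi>'_def)
  show ?thesis
  proof
    assume "\<Psi>' s y \<in> F s ` K"
    then obtain z where z: "z \<in> disc" "\<Psi>' s y = F s (\<Psi> z)" by (auto simp: K_def)
    have zV: "z \<in> V" using z(1) disc_V by blast
    have "\<Psi>' s y = \<Psi>' s z" using z F\<Psi>[OF zV] by simp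
    moreover have "z \<in> V' s" using z(1) disc_V'[OF s] by blast
    ultimately have "y = z" using y(1) slice_chartD(8)[OF chart'[OF s]] by metis
    then show "y \<in> disc" using z by simp
  next
    assume "y \<in> disc"
    then show "\<Psi>' s y \<in> F s ` K" using F\<Psi>[of y] disc_V by (auto simp: K_def intro!: image_eqI)
  qed
qed

lemma F_K_borel: "\<bar>s\<bar> \<le> \<epsilon> \<Longrightarrow> F s ` K \<in> sets borel" and F_K_subset: "\<bar>s\<bar> \<le> \<epsilon> \<Longrightarrow> F s ` K \<subseteq> U"
proof -
  assume s: "\<bar>s\<bar> \<le> \<epsilon>"
  show "F s ` K \<subseteq> U" using F_in_U(1)[OF s] K_props by blast
  have "F s ` K = \<Psi>' s ` disc"
    unfolding K_def image_image
  proof (rule image_cong[OF refl])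
    fix y assume "y \<in> disc"
    then have "y \<in> V" using disc_V by blast
    then show "F s (\<Psi> y) = \<Psi>' s y" using D(7,8) by (simp add: F_def \<Psi>'_def)
  qed
  moreover have "compact (\<Psi>' s ` disc)"
    using slice_chartD(13)[OF chart'[OF s]] disc_V'[OF s] compact_disc
    by (intro compact_continuous_image) (auto intro: continuous_on_subset)
  ultimately show "F s ` K \<in> sets borel" by (simp add: compact_imp_closed)
qed

text \<open>The set \<open>F s ` K\<close> lies in the domain of the sheared chart, where the Riemannian volume is the chart volume. The
  maximum with \<open>0\<close> appears because \<^const>\<open>ennreal\<close> truncates negative values of the chart density.\<close>

lemma weighted_area:
  assumes s: "\<bar>s\<bar> \<le> \<epsilon>" and \<rho> [measurable]: "\<rho> \<in> borel_measurable borel"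
  shows "(LINT x:F s ` K|riemannian_volume k (F s ` X). \<rho> x) =
    (LINT y|lborel_on I. indicator disc y * (max 0 (chart_density I (\<Psi>' s) y) * \<rho> (\<Psi>' s y)))"
proof -
  note c = chart'[OF s]
  note D' = slice_chartD[OF c]
  define R where "R = riemannian_volume k (F s ` X)"
  define M where "M = chart_volume I (V' s) (\<Psi>' s)"
  define A where "A = F s ` K"
  have [measurable]: "A \<in> sets borel" unfolding A_def by (rule F_K_borel[OF s])
  have AU: "A \<subseteq> U" unfolding A_def by (rule F_K_subset[OF s])
  have R: "sets R = sets borel" "\<And>B. B \<in> sets borel \<Longrightarrow> B \<subseteq> U \<Longrightarrow> emeasure R B = emeasure M B"
    unfolding R_def M_def using emeasure_riemannian_volume[OF c] by auto
  have Ms: "sets M = sets borel" by (simp add: M_def)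
  note [measurable_cong] = R(1) Ms
  have eq: "density R (\<lambda>x. ennreal (indicator A x)) = density M (\<lambda>x. ennreal (indicator A x))"
  proof (rule measure_eqI)
    fix B assume "B \<in> sets (density R (\<lambda>x. ennreal (indicator A x)))"
    then have [measurable]: "B \<in> sets borel" by (simp add: R(1))
    have *: "emeasure (density N (\<lambda>x. ennreal (indicator A x))) B = emeasure N (A \<inter> B)"
      if N [measurable_cong]: "sets N = sets borel" for N :: "(real^'n) measure"
    proof -
      have "emeasure (density N (\<lambda>x. ennreal (indicator A x))) B = (\<integral>\<^sup>+x. ennreal (indicator A x) * indicator B x \<partial>N)"
        by (rule emeasure_density) measurable
      also have "\<dots> = (\<integral>\<^sup>+x. indicator (A \<inter> B) x \<partial>N)"
        by (intro nn_integral_cong) (auto split: split_indicator)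
      also have "\<dots> = emeasure N (A \<inter> B)" by (rule nn_integral_indicator) measurable
      finally show ?thesis .
    qed
    show "emeasure (density R (\<lambda>x. ennreal (indicator A x))) B = emeasure (density M (\<lambda>x. ennreal (indicator A x))) B"
      unfolding *[OF R(1)] *[OF Ms] using AU by (intro R(2)) auto
  qed (simp add: R(1) Ms)
  have "(LINT x:A|R. \<rho> x) = (LINT x|density R (\<lambda>x. ennreal (indicator A x)). \<rho> x)"
    unfolding set_lebesgue_integral_def by (subst integral_density) (auto intro!: AE_I2)
  also have "\<dots> = (LINT x|M. indicator A x * \<rho> x)"
    unfolding eq by (subst integral_density) (auto intro!: AE_I2)
  also have "\<dots> = (LINT y|density (lborel_on I) (\<lambda>y. indicator (V' s) y * ennreal (chart_density I (\<Psi>' s) y)).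
      indicator A (if y \<in> V' s then \<Psi>' s y else 0) * \<rho> (if y \<in> V' s then \<Psi>' s y else 0))"
    unfolding M_def chart_volume_eq
    by (rule integral_distr) (use chart_map_measurable[OF D'(4,13)] in measurable)
  also have "(\<lambda>y. indicator (V' s) y * ennreal (chart_density I (\<Psi>' s) y)) =
      (\<lambda>y. ennreal (indicator (V' s) y * max 0 (chart_density I (\<Psi>' s) y)))"
    by (auto simp: fun_eq_iff max_def ennreal_neg split: split_indicator)
  also have "(LINT y|density (lborel_on I) (\<lambda>y. ennreal (indicator (V' s) y * max 0 (chart_density I (\<Psi>' s) y))).
      indicator A (if y \<in> V' s then \<Psi>' s y else 0) * \<rho> (if y \<in> V' s then \<Psi>' s y else 0)) =
      (LINT y|lborel_on I. (indicator (V' s) y * max 0 (chart_density I (\<Psi>' s) y)) *\<^sub>R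
        (indicator A (if y \<in> V' s then \<Psi>' s y else 0) * \<rho> (if y \<in> V' s then \<Psi>' s y else 0)))"
  proof (rule integral_density)
    note [measurable] = chart_map_measurable[OF D'(4,13)]
    show "(\<lambda>y. indicator A (if y \<in> V' s then \<Psi>' s y else 0) * \<rho> (if y \<in> V' s then \<Psi>' s y else 0)) \<in> borel_measurable (lborel_on I)"
      by measurable
    have "(\<lambda>y. indicator (V' s) y *\<^sub>R chart_density I (\<Psi>' s) y) \<in> borel_measurable borel"
      using chart_density_continuous[OF D'(11)[of 1]] V'_open by (intro borel_measurable_continuous_on_indicator) auto
    then have "(\<lambda>y. max 0 (indicator (V' s) y *\<^sub>R chart_density I (\<Psi>' s) y)) \<in> borel_measurable borel" by measurable
    also have "(\<lambda>y. max 0 (indicator (V' s) y *\<^sub>R chart_density I (\<Psi>' s) y)) =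
        (\<lambda>y. indicator (V' s) y * max 0 (chart_density I (\<Psi>' s) y))" by (auto split: split_indicator)
    finally show "(\<lambda>y. indicator (V' s) y * max 0 (chart_density I (\<Psi>' s) y)) \<in> borel_measurable (lborel_on I)"
      by (simp cong: measurable_cong_sets)
  qed (auto intro!: AE_I2)
  also have "\<dots> = (LINT y|lborel_on I. indicator disc y * (max 0 (chart_density I (\<Psi>' s) y) * \<rho> (\<Psi>' s y)))"
  proof (rule Bochner_Integration.integral_cong_AE)
    note [measurable] = chart_map_measurable[OF D'(4,13)]
    have dm: "disc \<in> sets borel" using compact_disc by (simp add: compact_imp_closed)
    have "continuous_on disc (\<lambda>y. max 0 (chart_density I (\<Psi>' s) y))"
      using continuous_on_subset[OF chart_density_continuous[OF D'(11)[of 1]] disc_V'[OF s]]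
      by (intro continuous_intros)
    then have m1: "(\<lambda>y. indicator disc y *\<^sub>R max 0 (chart_density I (\<Psi>' s) y)) \<in> borel_measurable borel"
      using dm by (intro borel_measurable_continuous_on_indicator)
    have "(\<lambda>y. (indicator disc y *\<^sub>R max 0 (chart_density I (\<Psi>' s) y)) * \<rho> (if y \<in> V' s then \<Psi>' s y else 0)) \<in> borel_measurable borel"
      using m1 by measurable
    also have "(\<lambda>y. (indicator disc y *\<^sub>R max 0 (chart_density I (\<Psi>' s) y)) * \<rho> (if y \<in> V' s then \<Psi>' s y else 0)) =
        (\<lambda>y. indicator disc y * (max 0 (chart_density I (\<Psi>' s) y) * \<rho> (\<Psi>' s y)))"
      using disc_V'[OF s] by (auto simp: fun_eq_iff split: split_indicator)
    finally show "(\<lambda>y. indicator disc y * (max 0 (chart_density I (\<Psi>' s) y) * \<rho> (\<Psi>' s y))) \<in> borel_measurable (lborel_on I)"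
      by (simp cong: measurable_cong_sets)
    have "(\<lambda>y. indicator (V' s) y *\<^sub>R chart_density I (\<Psi>' s) y) \<in> borel_measurable borel"
      using chart_density_continuous[OF D'(11)[of 1]] V'_open by (intro borel_measurable_continuous_on_indicator) auto
    then have "(\<lambda>y. max 0 (indicator (V' s) y *\<^sub>R chart_density I (\<Psi>' s) y) *
        (indicator A (if y \<in> V' s then \<Psi>' s y else 0) * \<rho> (if y \<in> V' s then \<Psi>' s y else 0))) \<in> borel_measurable borel" by measurable
    also have "(\<lambda>y. max 0 (indicator (V' s) y *\<^sub>R chart_density I (\<Psi>' s) y) *
        (indicator A (if y \<in> V' s then \<Psi>' s y else 0) * \<rho> (if y \<in> V' s then \<Psi>' s y else 0))) =
        (\<lambda>y. (indicator (V' s) y * max 0 (chart_density I (\<Psi>' s) y)) *\<^sub>R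
        (indicator A (if y \<in> V' s then \<Psi>' s y else 0) * \<rho> (if y \<in> V' s then \<Psi>' s y else 0)))"
      by (auto split: split_indicator)
    finally show "(\<lambda>y. (indicator (V' s) y * max 0 (chart_density I (\<Psi>' s) y)) *\<^sub>R
        (indicator A (if y \<in> V' s then \<Psi>' s y else 0) * \<rho> (if y \<in> V' s then \<Psi>' s y else 0))) \<in> borel_measurable (lborel_on I)"
      by (simp cong: measurable_cong_sets)
    show "AE y in lborel_on I. (indicator (V' s) y * max 0 (chart_density I (\<Psi>' s) y)) *\<^sub>R
        (indicator A (if y \<in> V' s then \<Psi>' s y else 0) * \<rho> (if y \<in> V' s then \<Psi>' s y else 0)) =
        indicator disc y * (max 0 (chart_density I (\<Psi>' s) y) * \<rho> (\<Psi>' s y))"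
      using AE_lborel_on_span[OF D(1)]
    proof eventually_elim
      case (elim y)
      then show ?case
        using \<Psi>'_image_iff[OF s _ elim] disc_V'[OF s] unfolding A_def
        by (cases "y \<in> V' s") (auto split: split_indicator)
    qed
  qed
  finally show ?thesis unfolding A_def R_def .
qed

end

section \<open>The first variation\<close>

text \<open>For \<open>i \<in> I\<close> this is the partial derivative of the determinant with respect to the entry \<open>(i, j)\<close>.\<close>

definition index_cofactor :: "'i set \<Rightarrow> ('i \<Rightarrow> 'i \<Rightarrow> real) \<Rightarrow> 'i \<Rightarrow> 'i \<Rightarrow> real" where
  "index_cofactor I G i j = (\<Sum>p | p permutes I \<and> p i = j. of_int (sign p) * (\<Prod>l\<in>I - {i}. G l (p l)))"

lemma index_det_has_derivative:
  assumes I: "finite I"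
    and g: "\<And>i j. i \<in> I \<Longrightarrow> j \<in> I \<Longrightarrow> ((\<lambda>s. g s i j) has_real_derivative g' i j) (at s0)"
  shows "((\<lambda>s. index_det I (g s)) has_real_derivative
     (\<Sum>i\<in>I. \<Sum>j\<in>I. index_cofactor I (g s0) i j * g' i j)) (at s0)"
proof -
  let ?P = "{p. p permutes I}"
  have fP: "finite ?P" using I by (rule finite_permutations)
  have "((\<lambda>s. \<Prod>i\<in>I. g s i (p i)) has_real_derivative (\<Sum>i\<in>I. g' i (p i) * (\<Prod>l\<in>I - {i}. g s0 l (p l)))) (at s0)"
    if p: "p permutes I" for p
    using g p by (intro has_field_derivative_prod) (auto simp: permutes_in_image)
  then have "((\<lambda>s. index_det I (g s)) has_real_derivative
      (\<Sum>p\<in>?P. of_int (sign p) * (\<Sum>i\<in>I. g' i (p i) * (\<Prod>l\<in>I - {i}. g s0 l (p l))))) (at s0)"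
    unfolding index_det_def by (intro DERIV_sum DERIV_cmult) auto
  also have "(\<Sum>p\<in>?P. of_int (sign p) * (\<Sum>i\<in>I. g' i (p i) * (\<Prod>l\<in>I - {i}. g s0 l (p l)))) =
      (\<Sum>i\<in>I. \<Sum>p\<in>?P. of_int (sign p) * (\<Prod>l\<in>I - {i}. g s0 l (p l)) * g' i (p i))"
    unfolding sum_distrib_left by (subst sum.swap) (simp add: mult_ac)
  also have "\<dots> = (\<Sum>i\<in>I. \<Sum>j\<in>I. index_cofactor I (g s0) i j * g' i j)"
  proof (rule sum.cong[OF refl])
    fix i assume i: "i \<in> I"
    have "(\<Sum>p\<in>?P. of_int (sign p) * (\<Prod>l\<in>I - {i}. g s0 l (p l)) * g' i (p i)) =
        (\<Sum>j\<in>I. \<Sum>p\<in>{p \<in> ?P. p i = j}. of_int (sign p) * (\<Prod>l\<in>I - {i}. g s0 l (p l)) * g' i (p i))"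
      using i by (intro sum.group[symmetric] fP I) (auto simp: permutes_in_image)
    also have "\<dots> = (\<Sum>j\<in>I. index_cofactor I (g s0) i j * g' i j)"
      unfolding index_cofactor_def sum_distrib_right by (intro sum.cong) auto
    finally show "(\<Sum>p\<in>?P. of_int (sign p) * (\<Prod>l\<in>I - {i}. g s0 l (p l)) * g' i (p i)) =
        (\<Sum>j\<in>I. index_cofactor I (g s0) i j * g' i j)" .
  qed
  finally show ?thesis .
qed

lemma index_det_identity:
  assumes "finite I" "\<And>i j. i \<in> I \<Longrightarrow> j \<in> I \<Longrightarrow> G i j = (if i = j then 1 else 0)"
  shows "index_det I G = 1"
proof -
  have "index_det I G = index_det I (\<lambda>i j. if i \<in> {} \<and> j \<in> {} then G i j else if i = j then 1 else 0)"
    unfolding index_det_def using assms(2) by (intro sum.cong refl arg_cong2[where f = "(*)"] prod.cong) (auto simp: permutes_in_image)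
  also have "\<dots> = index_det {} G" by (rule index_det_extend[OF assms(1)]) simp
  also have "\<dots> = 1" by (simp add: index_det_def)
  finally show ?thesis .
qed

lemma index_cofactor_identity:
  assumes I: "finite I" and G: "\<And>i j. i \<in> I \<Longrightarrow> j \<in> I \<Longrightarrow> G i j = (if i = j then 1 else 0)"
    and ij: "i \<in> I" "j \<in> I"
  shows "index_cofactor I G i j = (if i = j then 1 else 0)"
proof -
  have "of_int (sign p) * (\<Prod>l\<in>I - {i}. G l (p l)) = (if p = id then 1 else 0)" if p: "p permutes I" for p
  proof (cases "\<forall>l\<in>I - {i}. p l = l")
    case True
    have "p i = i"
    proof (rule ccontr)
      assume ne: "p i \<noteq> i"
      have "p i \<in> I" using p ij by (simp add: permutes_in_image)
      then have "p (p i) = p i" using True ne by auto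
      then show False using ne p by (metis permutes_inj injD)
    qed
    then have "p = id" using True p by (auto simp: fun_eq_iff) (metis permutes_not_in DiffI singletonD)
    then show ?thesis using G by simp
  next
    case False
    then obtain l where l: "l \<in> I - {i}" "p l \<noteq> l" by blast
    then have "G l (p l) = 0" using G p by (auto simp: permutes_in_image)
    then have "(\<Prod>l\<in>I - {i}. G l (p l)) = 0" using l I by (intro prod_zero) auto
    moreover have "p \<noteq> id" using l by auto
    ultimately show ?thesis by simp
  qed
  then have "index_cofactor I G i j = (\<Sum>p | p permutes I \<and> p i = j. if p = id then 1 else 0)"
    unfolding index_cofactor_def by (intro sum.cong) auto
  also have "\<dots> = (if i = j then 1 else 0)"
    using finite_subset[OF _ finite_permutations[OF I]] by (subst sum.delta) (auto simp: permutes_id)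
  finally show ?thesis .
qed

lemma times_differentiable_on_index_det:
  assumes "open S" "\<And>i j. times_differentiable_on m S (\<lambda>x. g x i j)"
  shows "times_differentiable_on m S (\<lambda>x. index_det I (g x))"
    and "times_differentiable_on m S (\<lambda>x. index_cofactor I (g x) i j)"
  unfolding index_det_def index_cofactor_def
  by (intro times_differentiable_on_sum times_differentiable_on_mult times_differentiable_on_const
      times_differentiable_on_prod assms)+

lemma times_differentiable_on_gaussian_density:
  assumes "open S" "times_differentiable_on m S f"
  shows "times_differentiable_on m S (\<lambda>x. gaussian_density c A (f x))"
proof -
  have 1: "times_differentiable_on m S (\<lambda>x. (- A) * (f x \<bullet> f x))"
    by (intro times_differentiable_on_mult times_differentiable_on_const times_differentiable_on_inner assms)
  have "times_differentiable_on m S (\<lambda>x. exp ((- A) * (f x \<bullet> f x)))"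
    by (rule times_differentiable_on_compose[OF assms(1) _ 1 times_differentiable_on_exp[OF open_UNIV]]) simp
  then have "times_differentiable_on m S (\<lambda>x. c * exp ((- A) * (f x \<bullet> f x)))"
    by (intro times_differentiable_on_mult times_differentiable_on_const assms(1))
  then show ?thesis by (simp add: gaussian_density_def power2_norm_eq_inner)
qed

lemma times_differentiable_on_powr_compose:
  fixes f :: "'a::real_normed_vector \<Rightarrow> real"
  assumes "open S" "times_differentiable_on m S f" "\<And>x. x \<in> S \<Longrightarrow> f x > 0"
  shows "times_differentiable_on m S (\<lambda>x. f x powr a)"
  by (rule times_differentiable_on_compose[OF assms(1) _ assms(2) times_differentiable_on_powr]) (use assms(3) in auto)

subsection \<open>Integration by parts on a coordinate subspace\<close>

lemma integrable_indicator_compact: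
  fixes f :: "'a::euclidean_space \<Rightarrow> real"
  assumes I: "I \<subseteq> Basis" and C: "compact C" and f: "continuous_on C f"
  shows "integrable (lborel_on I) (\<lambda>y. indicator C y * f y)"
proof -
  have Cb: "C \<in> sets borel" using C by (simp add: compact_imp_closed)
  have m: "(\<lambda>y. indicator C y *\<^sub>R f y) \<in> borel_measurable borel"
    by (rule borel_measurable_continuous_on_indicator[OF Cb f])
  have "bounded (f ` C)" using C f by (intro compact_imp_bounded compact_continuous_image)
  then obtain M where M: "\<And>y. y \<in> C \<Longrightarrow> \<bar>f y\<bar> \<le> M" unfolding bounded_iff real_norm_def by blast
  have "integrable (lborel_on I) (\<lambda>y. indicator C y *\<^sub>R (indicator C y *\<^sub>R f y))"
  proof (rule integrableI_bounded_set_indicator[where B = M])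
    show "emeasure (lborel_on I) C < \<infinity>" by (rule emeasure_lborel_on_bounded[OF I Cb compact_imp_bounded[OF C]])
    show "(\<lambda>y. indicator C y *\<^sub>R f y) \<in> borel_measurable (lborel_on I)" using m by (simp cong: measurable_cong_sets)
    show "AE y\<in>C in lborel_on I. norm (indicator C y *\<^sub>R f y) \<le> M" using M by (intro AE_I2) auto
  qed (use Cb in simp)
  also have "(\<lambda>y. indicator C y *\<^sub>R (indicator C y *\<^sub>R f y)) = (\<lambda>y. indicator C y * f y)"
    by (auto split: split_indicator)
  finally show ?thesis .
qed

text \<open>Difference quotients of the product in the direction \<open>b\<close> have integral \<open>0\<close> by translation invariance.\<close>

lemma integral_derivative_bump_zero:
  fixes w :: "'a::euclidean_space \<Rightarrow> real"
  assumes I: "I \<subseteq> Basis" and q: "q \<in> span I" and r: "r > 0" and b: "b \<in> I"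
    and W: "open W" "cball q r \<inter> span I \<subseteq> W" and w: "times_differentiable_on 1 W w"
  defines "C \<equiv> cball q r \<inter> span I" and "\<eta> \<equiv> chart_bump I q r"
  shows "(LINT y|lborel_on I. indicator C y * (frechet_derivative \<eta> (at y) b * w y + \<eta> y * frechet_derivative w (at y) b)) = 0"
proof -
  define \<phi> where "\<phi> = (\<lambda>y. indicator C y * (\<eta> y * w y))"
  define d where "d = (\<lambda>y. frechet_derivative \<eta> (at y) b * w y + \<eta> y * frechet_derivative w (at y) b)"
  define \<phi>' where "\<phi>' = (\<lambda>y. indicator C y * d y)"
  have C: "compact C" "C \<subseteq> W" "closed C" "C \<subseteq> span I" unfolding C_def using W
    by (simp_all add: compact_Int_closed closed_Int closed_subspace subspace_span)
  have bs: "b \<in> span I" using b by (rule span_base)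
  have \<eta>1: "times_differentiable_on 2 UNIV \<eta>" unfolding \<eta>_def by (rule chart_bump_smooth) simp
  have d\<eta>: "(\<eta> has_derivative frechet_derivative \<eta> (at y)) (at y)" for y
    by (rule times_differentiable_on_has_derivative[OF \<eta>1]) auto
  have dw: "(w has_derivative frechet_derivative w (at y)) (at y)" if "y \<in> W" for y
    by (rule times_differentiable_on_has_derivative[OF w _ that]) auto
  have \<eta>0: "\<eta> y = 0" if "y \<in> span I" "y \<notin> C" for y
    using chart_bump_pos_iff[OF I that(1) r, of q] chart_bump_bounds(1)[of I q r y] that
    unfolding \<eta>_def C_def by (fastforce simp: subset_eq)
  have line: "((\<lambda>t. \<phi> (z + t *\<^sub>R b)) has_real_derivative \<phi>' (z + t *\<^sub>R b)) (at t)" if z: "z \<in> span I" for z t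
  proof -
    have zt: "z + t *\<^sub>R b \<in> span I" for t using z bs by (intro span_add span_scale)
    show ?thesis
    proof (cases "z + t *\<^sub>R b \<in> C")
      case True
      then have zW: "z + t *\<^sub>R b \<in> W" using C by auto
      have l: "((\<lambda>t. z + t *\<^sub>R b) has_derivative (\<lambda>t. t *\<^sub>R b)) (at t)"
        by (auto intro!: derivative_eq_intros)
      have "((\<lambda>t. \<eta> (z + t *\<^sub>R b) * w (z + t *\<^sub>R b)) has_derivative
          (\<lambda>x. \<eta> (z + t *\<^sub>R b) * frechet_derivative w (at (z + t *\<^sub>R b)) (x *\<^sub>R b) +
            frechet_derivative \<eta> (at (z + t *\<^sub>R b)) (x *\<^sub>R b) * w (z + t *\<^sub>R b))) (at t)"
        by (intro has_derivative_mult has_derivative_compose[OF l] d\<eta> dw zW)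
      moreover have "frechet_derivative w (at (z + t *\<^sub>R b)) (x *\<^sub>R b) = x * frechet_derivative w (at (z + t *\<^sub>R b)) b"
        "frechet_derivative \<eta> (at (z + t *\<^sub>R b)) (x *\<^sub>R b) = x * frechet_derivative \<eta> (at (z + t *\<^sub>R b)) b" for x
        using linear_scale[OF has_derivative_linear[OF dw[OF zW]]] linear_scale[OF has_derivative_linear[OF d\<eta>]] by auto
      ultimately have "((\<lambda>t. \<eta> (z + t *\<^sub>R b) * w (z + t *\<^sub>R b)) has_real_derivative d (z + t *\<^sub>R b)) (at t)"
        unfolding has_field_derivative_def d_def by (elim has_derivative_eq_rhs) (auto simp: algebra_simps)
      then have "((\<lambda>t. \<phi> (z + t *\<^sub>R b)) has_real_derivative d (z + t *\<^sub>R b)) (at t)"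
      proof (rule has_field_derivative_transform_within_open)
        show "open ((\<lambda>t. z + t *\<^sub>R b) -` W)" by (intro open_vimage W continuous_intros)
        show "\<eta> (z + t *\<^sub>R b) * w (z + t *\<^sub>R b) = \<phi> (z + t *\<^sub>R b)" for t
          using \<eta>0[OF zt[of t]] by (auto simp: \<phi>_def split: split_indicator)
      qed (use zW in auto)
      then show ?thesis using True by (simp add: \<phi>'_def)
    next
      case False
      have "open ((\<lambda>t. z + t *\<^sub>R b) -` (- C))" using C by (intro open_vimage continuous_intros) auto
      then have "((\<lambda>t. \<phi> (z + t *\<^sub>R b)) has_real_derivative 0) (at t)"
        using False by (intro has_derivative_zero_of_locally_zero[of "(\<lambda>t. z + t *\<^sub>R b) -` (- C)" t _ 0]) (auto simp: \<phi>_def)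
      then show ?thesis using False by (simp add: \<phi>'_def)
    qed
  qed
  have dc: "continuous_on C d"
    unfolding d_def using w times_differentiable_on_derivative[OF \<eta>1, of 0 b] times_differentiable_on_derivative[OF w, of 0 b] C
      times_differentiable_on_continuous[OF w] times_differentiable_on_continuous[OF \<eta>1]
    by (intro continuous_intros) (auto intro: continuous_on_subset)
  have "bounded (d ` C)" using C dc by (intro compact_imp_bounded compact_continuous_image)
  then obtain M0 where M0: "\<And>y. y \<in> C \<Longrightarrow> \<bar>d y\<bar> \<le> M0" unfolding bounded_iff real_norm_def by blast
  define M where "M = max M0 0"
  have M: "\<bar>\<phi>' y\<bar> \<le> M" for y using M0[of y] by (auto simp: \<phi>'_def M_def split: split_indicator)
  have lip: "\<bar>\<phi> (z + t *\<^sub>R b) - \<phi> z\<bar> \<le> M * \<bar>t\<bar>" if "z \<in> span I" for z t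
    using field_differentiable_bound[of UNIV "\<lambda>t. \<phi> (z + t *\<^sub>R b)" "\<lambda>t. \<phi>' (z + t *\<^sub>R b)" M t 0] line[OF that] M by simp
  define \<tau> where "\<tau> = (\<lambda>n. 1 / real (Suc n))"
  have \<tau>: "0 < \<tau> n" "\<tau> n \<le> 1" for n by (auto simp: \<tau>_def)
  have \<tau>0: "\<tau> \<longlonglongrightarrow> 0" unfolding \<tau>_def using LIMSEQ_Suc[OF lim_1_over_n[where 'a = real]] by simp
  have wc: "continuous_on C (\<lambda>y. \<eta> y * w y)"
    using times_differentiable_on_continuous[OF w] times_differentiable_on_continuous[OF \<eta>1] C
    by (intro continuous_intros) (auto intro: continuous_on_subset)
  have \<phi>int: "integrable (lborel_on I) \<phi>" unfolding \<phi>_def by (rule integrable_indicator_compact[OF I C(1) wc])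
  have \<phi>m [measurable]: "\<phi> \<in> borel_measurable borel"
    using borel_measurable_integrable[OF \<phi>int] by (simp cong: measurable_cong_sets)
  have shift: "integrable (lborel_on I) (\<lambda>y. \<phi> (y + t *\<^sub>R b))" "(LINT y|lborel_on I. \<phi> (y + t *\<^sub>R b)) = (LINT y|lborel_on I. \<phi> y)" for t
  proof -
    have tr: "distr (lborel_on I) borel (\<lambda>y. y + t *\<^sub>R b) = lborel_on I" by (rule lborel_on_translate[OF I span_scale[OF bs]])
    have mt: "(\<lambda>y. y + t *\<^sub>R b) \<in> measurable (lborel_on I) borel" by measurable
    show "integrable (lborel_on I) (\<lambda>y. \<phi> (y + t *\<^sub>R b))"
      using integrable_distr_eq[OF mt \<phi>m] \<phi>int unfolding tr by simp
    show "(LINT y|lborel_on I. \<phi> (y + t *\<^sub>R b)) = (LINT y|lborel_on I. \<phi> y)"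
      using integral_distr[OF mt \<phi>m] unfolding tr by simp
  qed
  define Q where "Q = (\<lambda>n y. (\<phi> (y + \<tau> n *\<^sub>R b) - \<phi> y) / \<tau> n)"
  have Q0: "(LINT y|lborel_on I. Q n y) = 0" for n
    unfolding Q_def using shift \<phi>int by simp
  have Qm: "Q n \<in> borel_measurable (lborel_on I)" for n unfolding Q_def by measurable
  have "(\<lambda>n. LINT y|lborel_on I. Q n y) \<longlonglongrightarrow> (LINT y|lborel_on I. \<phi>' y)"
  proof (rule integral_dominated_convergence[where w = "\<lambda>y. indicator (cball q (r + norm b)) y * M"])
    show "\<phi>' \<in> borel_measurable (lborel_on I)"
      using borel_measurable_integrable[OF integrable_indicator_compact[OF I C(1) dc]] by (simp add: \<phi>'_def)
    show "integrable (lborel_on I) (\<lambda>y. indicator (cball q (r + norm b)) y * M)"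
      by (rule integrable_indicator_compact[OF I]) auto
    show "AE y in lborel_on I. (\<lambda>n. Q n y) \<longlonglongrightarrow> \<phi>' y"
      using AE_lborel_on_span[OF I]
    proof eventually_elim
      case (elim y)
      have "((\<lambda>h. (\<phi> (y + (0 + h) *\<^sub>R b) - \<phi> (y + 0 *\<^sub>R b)) / h) \<longlongrightarrow> \<phi>' (y + 0 *\<^sub>R b)) (at 0)"
        using line[OF elim, of 0] unfolding DERIV_def .
      then have l: "((\<lambda>h. (\<phi> (y + h *\<^sub>R b) - \<phi> y) / h) \<longlongrightarrow> \<phi>' y) (at 0)" by simp
      have "filterlim \<tau> (at 0) sequentially" using \<tau>0 \<tau>(1) by (auto simp: filterlim_at less_imp_neq[symmetric])
      from filterlim_compose[OF l this] show ?case by (simp add: Q_def)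
    qed
    show "AE y in lborel_on I. norm (Q n y) \<le> indicator (cball q (r + norm b)) y * M" for n
      using AE_lborel_on_span[OF I]
    proof eventually_elim
      case (elim y)
      show ?case
      proof (cases "y \<in> cball q (r + norm b)")
        case True
        have "norm (Q n y) = \<bar>\<phi> (y + \<tau> n *\<^sub>R b) - \<phi> y\<bar> / \<tau> n" using \<tau>(1)[of n] by (simp add: Q_def)
        also have "\<dots> \<le> M" using lip[OF elim, of "\<tau> n"] \<tau>(1)[of n] by (simp add: divide_le_eq)
        finally show ?thesis using True by simp
      next
        case False
        then have far: "dist q y > r + norm b" by simp
        have "norm (\<tau> n *\<^sub>R b) \<le> norm b" using \<tau>[of n] by (simp add: mult_left_le_one_le)
        then have "dist q (y + \<tau> n *\<^sub>R b) > r"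
          using far norm_triangle_ineq4[of "q - (y + \<tau> n *\<^sub>R b)" "- (\<tau> n *\<^sub>R b)"] by (simp add: dist_norm algebra_simps)
        moreover have "dist q y > r" using far norm_ge_zero[of b] by linarith
        ultimately have "\<phi> (y + \<tau> n *\<^sub>R b) = 0" "\<phi> y = 0" by (auto simp: \<phi>_def C_def)
        then show ?thesis using False by (simp add: Q_def)
      qed
    qed
  qed (rule Qm)
  then have "(LINT y|lborel_on I. \<phi>' y) = 0" unfolding Q0 by (simp add: LIMSEQ_const_iff)
  then show ?thesis by (simp add: \<phi>'_def d_def)
qed

subsection \<open>The Euler-Lagrange equation in a chart\<close>

text \<open>  The derivative at time \<open>0\<close> of the area integrand of the variation with bump \<open>\<eta>\<close> is
  \<open>\<eta> * source + (\<Sum>b\<in>I. \<partial>\<^sub>b \<eta> * flux b)\<close>: the factor \<open>source\<close> collects the derivatives of the metric and of the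
  weight along \<open>e\<close>, and \<open>flux\<close> comes from the tilting of the tangent space by the derivative of the bump. The
  expression \<open>euler\<close> is left after integration by parts.\<close>

locale chart_frame =
  fixes k :: nat and X I U V :: "(real^'n) set" and \<Phi> \<Psi> :: "real^'n \<Rightarrow> real^'n" and e :: "real^'n" and c A :: real
  assumes chart: "slice_chart k X I U V \<Phi> \<Psi>" and c: "c > 0"
begin

definition "frame b y = frechet_derivative \<Psi> (at y) b"
definition "gram y i j = frame i y \<bullet> frame j y"
definition "dens y = index_det I (gram y)"
definition "wt y = gaussian_density c A (\<Psi> y)"
definition "dframe v b y = frechet_derivative (frame b) (at y) v"
definition "coef b j y = wt y * ((1 / 2) * dens y powr (- (1 / 2)) * (index_cofactor I (gram y) b j + index_cofactor I (gram y) j b))"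
definition "flux b y = (\<Sum>j\<in>I. coef b j y * (frame e y \<bullet> frame j y))"
definition "source y = wt y * ((1 / 2) * dens y powr (- (1 / 2)) *
    (\<Sum>i\<in>I. \<Sum>j\<in>I. index_cofactor I (gram y) i j * (dframe e i y \<bullet> frame j y + frame i y \<bullet> dframe e j y))
    + dens y powr (1 / 2) * (- 2 * A * (\<Psi> y \<bullet> frame e y)))"
definition "euler y = source y - (\<Sum>b\<in>I. frechet_derivative (flux b) (at y) b)"
definition "V0 = {y \<in> V. dens y > 0}"

lemmas C = slice_chartD[OF chart]

lemma finite_I: "finite I" using C(1) finite_Basis finite_subset by blast

lemma frame_smooth: "times_differentiable_on m V (frame b)"
  unfolding frame_def [abs_def] by (rule times_differentiable_on_derivative[OF C(11)[of "Suc m"]]) simp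

lemma dframe_smooth: "times_differentiable_on m V (dframe v b)"
  unfolding dframe_def [abs_def] by (rule times_differentiable_on_derivative[OF frame_smooth[of "Suc m"]]) simp

lemma gram_smooth: "times_differentiable_on m V (\<lambda>y. gram y i j)"
  unfolding gram_def by (intro times_differentiable_on_inner frame_smooth C(4))

lemma dens_smooth: "times_differentiable_on m V dens"
  unfolding dens_def [abs_def] by (rule times_differentiable_on_index_det(1)[OF C(4) gram_smooth])

lemma V0: "open V0" "V0 \<subseteq> V"
proof -
  have "V0 = V \<inter> dens -` {0<..}" by (auto simp: V0_def)
  then show "open V0" using continuous_open_preimage[OF times_differentiable_on_continuous[OF dens_smooth] C(4)] by simp
qed (auto simp: V0_def)

lemma wt_smooth: "times_differentiable_on m V wt"
  unfolding wt_def [abs_def] by (rule times_differentiable_on_gaussian_density[OF C(4) C(11)])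

lemma dens_powr_smooth: "times_differentiable_on m V0 (\<lambda>y. dens y powr a)"
  by (rule times_differentiable_on_powr_compose[OF V0(1) times_differentiable_on_subset[OF dens_smooth V0(2)]]) (simp add: V0_def)

lemma cofactor_smooth: "times_differentiable_on m V (\<lambda>y. index_cofactor I (gram y) i j)"
  by (rule times_differentiable_on_index_det(2)[OF C(4) gram_smooth])

lemmas on_V0 = times_differentiable_on_subset[OF _ V0(2)]

lemma coef_smooth: "times_differentiable_on m V0 (coef b j)"
  unfolding coef_def [abs_def]
  by (intro times_differentiable_on_mult times_differentiable_on_add times_differentiable_on_const dens_powr_smooth
      on_V0[OF wt_smooth] on_V0[OF cofactor_smooth] V0(1))

lemma flux_smooth: "times_differentiable_on m V0 (flux b)"
  unfolding flux_def [abs_def]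
  by (intro times_differentiable_on_mult times_differentiable_on_sum times_differentiable_on_inner coef_smooth
      on_V0[OF frame_smooth] V0(1))

lemma source_smooth: "times_differentiable_on m V0 source"
  unfolding source_def [abs_def]
  by (intro times_differentiable_on_mult times_differentiable_on_add times_differentiable_on_sum times_differentiable_on_inner
      times_differentiable_on_const dens_powr_smooth on_V0[OF wt_smooth] on_V0[OF cofactor_smooth] on_V0[OF frame_smooth]
      on_V0[OF dframe_smooth] on_V0[OF C(11)] V0(1))

lemma euler_continuous: "continuous_on V0 euler"
proof -
  have "continuous_on V0 (\<lambda>y. frechet_derivative (flux b) (at y) b)" for b
    using times_differentiable_on_derivative[OF flux_smooth[of 1], of 0] by simp
  then show ?thesis unfolding euler_def [abs_def]
    using times_differentiable_on_continuous[OF source_smooth] by (intro continuous_intros) auto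
qed

lemma frame_linear: "y \<in> V \<Longrightarrow> linear (\<lambda>b. frame b y)"
  unfolding frame_def using has_derivative_linear[OF C(15)] by simp

lemma frame_has_derivative: "y \<in> V \<Longrightarrow> (frame b has_derivative (\<lambda>v. dframe v b y)) (at y)"
  unfolding dframe_def by (rule times_differentiable_on_has_derivative[OF frame_smooth[of 1]]) auto

lemma dframe_linear: "y \<in> V \<Longrightarrow> linear (\<lambda>v. dframe v b y)"
  using has_derivative_linear[OF frame_has_derivative] .

lemma dframe_symmetric: "y \<in> V \<Longrightarrow> dframe v b y = dframe b v y"
  unfolding dframe_def frame_def [abs_def] using second_derivative_symmetric[OF C(4) _ C(11)] .

text \<open>At a point where the coordinate frame is orthonormal and \<open>e\<close> is mapped to a normal vector, only the
  derivative of the vanishing factor \<open>frame e y \<bullet> frame j y\<close> of the flux survives.\<close>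

lemma euler_at_orthonormal:
  assumes q: "q \<in> V" and on: "\<And>i j. i \<in> I \<Longrightarrow> j \<in> I \<Longrightarrow> frame i q \<bullet> frame j q = (if i = j then 1 else 0)"
    and normal: "\<And>j. j \<in> I \<Longrightarrow> frame e q \<bullet> frame j q = 0"
  shows "q \<in> V0" and "euler q = - wt q * (2 * A * (\<Psi> q \<bullet> frame e q) + (\<Sum>b\<in>I. dframe b b q \<bullet> frame e q))"
proof -
  have gq: "gram q i j = (if i = j then 1 else 0)" if "i \<in> I" "j \<in> I" for i j
    using on[OF that] by (simp add: gram_def)
  have d1: "dens q = 1" unfolding dens_def by (rule index_det_identity[OF finite_I gq])
  then show qV0: "q \<in> V0" using q by (simp add: V0_def)
  have cof: "index_cofactor I (gram q) i j = (if i = j then 1 else 0)" if "i \<in> I" "j \<in> I" for i j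
    by (rule index_cofactor_identity[OF finite_I gq that])
  have coefq: "coef b j q = (if b = j then wt q else 0)" if "b \<in> I" "j \<in> I" for b j
    using cof[OF that] cof[OF that(2,1)] by (simp add: coef_def d1)
  have src: "source q = wt q * ((\<Sum>i\<in>I. dframe e i q \<bullet> frame i q) - 2 * A * (\<Psi> q \<bullet> frame e q))"
  proof -
    have "(\<Sum>i\<in>I. \<Sum>j\<in>I. index_cofactor I (gram q) i j * (dframe e i q \<bullet> frame j q + frame i q \<bullet> dframe e j q)) =
        (\<Sum>i\<in>I. \<Sum>j\<in>I. if i = j then 2 * (dframe e i q \<bullet> frame i q) else 0)"
      by (intro sum.cong refl) (auto simp: cof inner_commute)
    also have "\<dots> = 2 * (\<Sum>i\<in>I. dframe e i q \<bullet> frame i q)"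
      using finite_I by (simp add: sum_distrib_left)
    finally show ?thesis by (simp add: source_def d1 algebra_simps)
  qed
  have flux': "frechet_derivative (flux b) (at q) b = wt q * (dframe b e q \<bullet> frame b q + frame e q \<bullet> dframe b b q)"
    if b: "b \<in> I" for b
  proof -
    have dc: "(coef b j has_derivative frechet_derivative (coef b j) (at q)) (at q)" for j
      by (rule times_differentiable_on_has_derivative[OF coef_smooth[of 1] _ qV0]) simp
    have di: "((\<lambda>y. frame e y \<bullet> frame j y) has_derivative (\<lambda>v. frame e q \<bullet> dframe v j q + dframe v e q \<bullet> frame j q)) (at q)" for j
      by (intro has_derivative_inner frame_has_derivative q)
    have "(flux b has_derivative (\<lambda>v. \<Sum>j\<in>I. coef b j q * (frame e q \<bullet> dframe v j q + dframe v e q \<bullet> frame j q) +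
        frechet_derivative (coef b j) (at q) v * (frame e q \<bullet> frame j q))) (at q)"
      unfolding flux_def [abs_def] by (intro has_derivative_sum has_derivative_mult dc di)
    then have "frechet_derivative (flux b) (at q) = (\<lambda>v. \<Sum>j\<in>I. coef b j q * (frame e q \<bullet> dframe v j q + dframe v e q \<bullet> frame j q) +
        frechet_derivative (coef b j) (at q) v * (frame e q \<bullet> frame j q))"
      by (rule frechet_derivative_at[symmetric])
    then have "frechet_derivative (flux b) (at q) b = (\<Sum>j\<in>I. if b = j then wt q * (frame e q \<bullet> dframe b j q + dframe b e q \<bullet> frame j q) else 0)"
      using b by (auto simp: normal coefq intro!: sum.cong)
    also have "\<dots> = wt q * (dframe b e q \<bullet> frame b q + frame e q \<bullet> dframe b b q)"
      using b finite_I by (simp add: algebra_simps)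
    finally show ?thesis .
  qed
  have "euler q = source q - (\<Sum>b\<in>I. wt q * (dframe e b q \<bullet> frame b q + frame e q \<bullet> dframe b b q))"
    unfolding euler_def using flux' dframe_symmetric[OF q, of _ e] by simp
  also have "\<dots> = - wt q * (2 * A * (\<Psi> q \<bullet> frame e q) + (\<Sum>b\<in>I. dframe b b q \<bullet> frame e q))"
    unfolding src by (simp add: sum.distrib sum_distrib_left[symmetric] algebra_simps inner_commute)
  finally show "euler q = - wt q * (2 * A * (\<Psi> q \<bullet> frame e q) + (\<Sum>b\<in>I. dframe b b q \<bullet> frame e q))" .
qed

text \<open>The area integrand \<open>vint\<close> of the varied submanifold, as a function of the pair of time and coordinate. The
  vectors \<open>vframe q r b\<close> are the derivatives of the sheared parametrization.\<close>

definition "Sh q r z = chart_shear I q r e (fst z) (snd z)"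
definition "vframe q r b z = frame b (Sh q r z) +
   (fst z * frechet_derivative (chart_bump I q r) (at (snd z)) b) *\<^sub>R frame e (Sh q r z)"
definition "vdens q r z = index_det I (\<lambda>i j. vframe q r i z \<bullet> vframe q r j z)"
definition "vint q r z = vdens q r z powr (1 / 2) * wt (Sh q r z)"
definition "vdom q r = {z. Sh q r z \<in> V \<and> vdens q r z > 0}"

lemma Sh_smooth: "open S \<Longrightarrow> times_differentiable_on m S (Sh q r)"
  unfolding Sh_def [abs_def] by (rule chart_shear_smooth)

lemma vdom1_open: "open {z. Sh q r z \<in> V}"
proof -
  have "{z. Sh q r z \<in> V} = Sh q r -` V" by auto
  then show ?thesis using open_vimage[OF C(4) times_differentiable_on_continuous[OF Sh_smooth[OF open_UNIV]]] by simp
qed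

lemma vframe_smooth: "times_differentiable_on m {z. Sh q r z \<in> V} (vframe q r b)"
proof -
  note o = vdom1_open[of q r]
  have t: "times_differentiable_on m {z. Sh q r z \<in> V} (\<lambda>z. frame b (Sh q r z))" for b
    by (rule times_differentiable_on_compose[OF o _ Sh_smooth[OF o] frame_smooth]) auto
  have bump: "times_differentiable_on m UNIV (\<lambda>y. frechet_derivative (chart_bump I q r) (at y) b)"
    by (rule times_differentiable_on_derivative[OF chart_bump_smooth[OF open_UNIV, of "Suc m"]]) simp
  have "times_differentiable_on m {z. Sh q r z \<in> V} (\<lambda>z. frechet_derivative (chart_bump I q r) (at (snd z)) b)"
    by (rule times_differentiable_on_compose[OF o _ times_differentiable_on_snd[OF o] bump]) simp
  then show ?thesis unfolding vframe_def [abs_def]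
    by (intro times_differentiable_on_add times_differentiable_on_scaleR times_differentiable_on_mult
        times_differentiable_on_fst t o)
qed

lemma vdens_smooth: "times_differentiable_on m {z. Sh q r z \<in> V} (vdens q r)"
  unfolding vdens_def [abs_def]
  by (intro times_differentiable_on_index_det times_differentiable_on_inner vframe_smooth vdom1_open)

lemma vdom_open: "open (vdom q r)" "vdom q r \<subseteq> {z. Sh q r z \<in> V}"
proof -
  have "vdom q r = {z. Sh q r z \<in> V} \<inter> vdens q r -` {0<..}" by (auto simp: vdom_def)
  then show "open (vdom q r)"
    using continuous_open_preimage[OF times_differentiable_on_continuous[OF vdens_smooth] vdom1_open] by simp
qed (auto simp: vdom_def)

lemma vint_smooth: "times_differentiable_on m (vdom q r) (vint q r)"
proof -
  have "times_differentiable_on m (vdom q r) (\<lambda>z. wt (Sh q r z))"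
    by (rule times_differentiable_on_compose[OF vdom_open(1) _ Sh_smooth[OF vdom_open(1)] wt_smooth]) (auto simp: vdom_def)
  moreover have "times_differentiable_on m (vdom q r) (\<lambda>z. vdens q r z powr (1 / 2))"
    by (rule times_differentiable_on_powr_compose[OF vdom_open(1) times_differentiable_on_subset[OF vdens_smooth vdom_open(2)]])
       (simp add: vdom_def)
  ultimately show ?thesis unfolding vint_def [abs_def]
    by (intro times_differentiable_on_mult vdom_open(1))
qed

lemma vint_line:
  assumes "(s, y) \<in> vdom q r"
  shows "((\<lambda>s. vint q r (s, y)) has_real_derivative frechet_derivative (vint q r) (at (s, y)) (1, 0)) (at s)"
proof -
  have d: "(vint q r has_derivative frechet_derivative (vint q r) (at (s, y))) (at (s, y))"
    by (rule times_differentiable_on_has_derivative[OF vint_smooth[of 1] _ assms]) simp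
  have l: "((\<lambda>s. (s, y)) has_derivative (\<lambda>t. (t, 0))) (at s)"
    by (intro has_derivative_Pair has_derivative_ident has_derivative_const)
  have eq: "(\<lambda>t. frechet_derivative (vint q r) (at (s, y)) (t, 0)) = (*) (frechet_derivative (vint q r) (at (s, y)) (1, 0))"
  proof
    fix t
    show "frechet_derivative (vint q r) (at (s, y)) (t, 0) = frechet_derivative (vint q r) (at (s, y)) (1, 0) * t"
      using linear_scale[OF has_derivative_linear[OF d], of t "(1, 0)"] by (simp add: mult.commute)
  qed
  show ?thesis
    using has_derivative_compose[OF l d] unfolding has_field_derivative_def eq .
qed

lemma vint_initial_derivative:
  assumes y: "y \<in> V0"
  shows "((\<lambda>s. vint q r (s, y)) has_real_derivative
     (chart_bump I q r y * source y + (\<Sum>b\<in>I. frechet_derivative (chart_bump I q r) (at y) b * flux b y))) (at 0)"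
proof -
  let ?\<eta> = "chart_bump I q r y" and ?\<eta>' = "\<lambda>b. frechet_derivative (chart_bump I q r) (at y) b"
  have yV: "y \<in> V" and dpos: "dens y > 0" using y by (auto simp: V0_def)
  have Sh0: "Sh q r (0, y) = y" by (simp add: Sh_def chart_shear_def)
  have vt0: "vframe q r b (0, y) = frame b y" for b by (simp add: vframe_def Sh0)
  have vd0: "vdens q r (0, y) = dens y" by (simp add: vdens_def vt0 dens_def gram_def [abs_def])
  have dSh: "((\<lambda>s. Sh q r (s, y)) has_derivative (\<lambda>t. t *\<^sub>R (?\<eta> *\<^sub>R e))) (at 0)"
    unfolding Sh_def chart_shear_def by (auto intro!: derivative_eq_intros)
  have dtanSh: "((\<lambda>s. frame b (Sh q r (s, y))) has_vector_derivative ?\<eta> *\<^sub>R dframe e b y) (at 0)" for b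
  proof -
    have "((\<lambda>s. frame b (Sh q r (s, y))) has_derivative (\<lambda>t. dframe (t *\<^sub>R (?\<eta> *\<^sub>R e)) b y)) (at 0)"
      by (rule has_derivative_compose[OF dSh]) (use frame_has_derivative[OF yV] Sh0 in simp)
    then show ?thesis unfolding has_vector_derivative_def
      by (simp only: linear_scale[OF dframe_linear[OF yV]])
  qed
  have dvtan: "((\<lambda>s. vframe q r b (s, y)) has_vector_derivative ?\<eta> *\<^sub>R dframe e b y + ?\<eta>' b *\<^sub>R frame e y) (at 0)" for b
  proof -
    have "((\<lambda>s. (s * ?\<eta>' b) *\<^sub>R frame e (Sh q r (s, y))) has_vector_derivative ((0 * ?\<eta>' b) *\<^sub>R (?\<eta> *\<^sub>R dframe e e y) + (?\<eta>' b) *\<^sub>R frame e (Sh q r (0, y)))) (at 0)"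
      by (intro has_vector_derivative_scaleR dtanSh) (auto intro!: derivative_eq_intros)
    from has_vector_derivative_add[OF dtanSh[of b] this] show ?thesis by (simp add: vframe_def Sh0)
  qed
  define dg where "dg = (\<lambda>i j. frame i y \<bullet> (?\<eta> *\<^sub>R dframe e j y + ?\<eta>' j *\<^sub>R frame e y) + (?\<eta> *\<^sub>R dframe e i y + ?\<eta>' i *\<^sub>R frame e y) \<bullet> frame j y)"
  have dgram: "((\<lambda>s. vframe q r i (s, y) \<bullet> vframe q r j (s, y)) has_real_derivative dg i j) (at 0)" for i j
  proof -
    have "((\<lambda>s. vframe q r i (s, y) \<bullet> vframe q r j (s, y)) has_derivative
       (\<lambda>t. vframe q r i (0, y) \<bullet> (t *\<^sub>R (?\<eta> *\<^sub>R dframe e j y + ?\<eta>' j *\<^sub>R frame e y)) + (t *\<^sub>R (?\<eta> *\<^sub>R dframe e i y + ?\<eta>' i *\<^sub>R frame e y)) \<bullet> vframe q r j (0, y))) (at 0)"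
      using dvtan by (intro has_derivative_inner) (simp_all add: has_vector_derivative_def)
    then show ?thesis
      unfolding has_field_derivative_def vt0 by (rule has_derivative_eq_rhs) (simp add: fun_eq_iff dg_def algebra_simps)
  qed
  define D where "D = (\<Sum>i\<in>I. \<Sum>j\<in>I. index_cofactor I (gram y) i j * dg i j)"
  have dvd: "((\<lambda>s. vdens q r (s, y)) has_real_derivative D) (at 0)"
  proof -
    have "((\<lambda>s. index_det I (\<lambda>i j. vframe q r i (s, y) \<bullet> vframe q r j (s, y))) has_real_derivative
        (\<Sum>i\<in>I. \<Sum>j\<in>I. index_cofactor I (\<lambda>i j. vframe q r i (0, y) \<bullet> vframe q r j (0, y)) i j * dg i j)) (at 0)"
      by (rule index_det_has_derivative[OF finite_I dgram])
    then show ?thesis by (simp add: vdens_def vt0 D_def gram_def [abs_def])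
  qed
  have dsq: "((\<lambda>s. vdens q r (s, y) powr (1 / 2)) has_real_derivative (1 / 2) * dens y powr (- (1 / 2)) * D) (at 0)"
    using dvd dpos vd0 by (auto intro!: derivative_eq_intros)
  have dwt: "((\<lambda>s. wt (Sh q r (s, y))) has_real_derivative wt y * (- 2 * A * (?\<eta> * (\<Psi> y \<bullet> frame e y)))) (at 0)"
  proof -
    have "((\<lambda>s. \<Psi> (Sh q r (s, y))) has_derivative (\<lambda>t. frame (t *\<^sub>R (?\<eta> *\<^sub>R e)) y)) (at 0)"
      unfolding frame_def by (rule has_derivative_compose[OF dSh]) (use C(15)[OF yV] Sh0 in simp)
    then have d\<Psi>: "((\<lambda>s. \<Psi> (Sh q r (s, y))) has_derivative (\<lambda>t. t *\<^sub>R (?\<eta> *\<^sub>R frame e y))) (at 0)"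
      by (simp only: linear_scale[OF frame_linear[OF yV]])
    have "((\<lambda>s. \<Psi> (Sh q r (s, y)) \<bullet> \<Psi> (Sh q r (s, y))) has_real_derivative 2 * (?\<eta> * (\<Psi> y \<bullet> frame e y))) (at 0)"
      unfolding has_field_derivative_def
      by (rule has_derivative_eq_rhs[OF has_derivative_inner[OF d\<Psi> d\<Psi>]])
         (simp add: fun_eq_iff Sh0 inner_commute algebra_simps)
    then show ?thesis
      unfolding wt_def gaussian_density_def power2_norm_eq_inner
      by (auto intro!: derivative_eq_intros simp: Sh0)
  qed
  have "((\<lambda>s. vint q r (s, y)) has_real_derivative
      dens y powr (1 / 2) * (wt y * (- 2 * A * (?\<eta> * (\<Psi> y \<bullet> frame e y)))) + (1 / 2) * dens y powr (- (1 / 2)) * D * wt y) (at 0)"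
    unfolding vint_def using DERIV_mult[OF dsq dwt] by (simp add: Sh0 vd0 algebra_simps)
  also have "D = ?\<eta> * (\<Sum>i\<in>I. \<Sum>j\<in>I. index_cofactor I (gram y) i j * (dframe e i y \<bullet> frame j y + frame i y \<bullet> dframe e j y)) +
      (\<Sum>b\<in>I. ?\<eta>' b * (\<Sum>j\<in>I. (index_cofactor I (gram y) b j + index_cofactor I (gram y) j b) * (frame e y \<bullet> frame j y)))"
  proof -
    have "D = (\<Sum>i\<in>I. \<Sum>j\<in>I. ?\<eta> * (index_cofactor I (gram y) i j * (dframe e i y \<bullet> frame j y + frame i y \<bullet> dframe e j y)) +
        (?\<eta>' i * (index_cofactor I (gram y) i j * (frame e y \<bullet> frame j y)) + ?\<eta>' j * (index_cofactor I (gram y) i j * (frame e y \<bullet> frame i y))))"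
      unfolding D_def dg_def by (intro sum.cong refl) (simp add: inner_add_left inner_add_right inner_commute algebra_simps)
    also have "\<dots> = ?\<eta> * (\<Sum>i\<in>I. \<Sum>j\<in>I. index_cofactor I (gram y) i j * (dframe e i y \<bullet> frame j y + frame i y \<bullet> dframe e j y)) +
        ((\<Sum>i\<in>I. \<Sum>j\<in>I. ?\<eta>' i * (index_cofactor I (gram y) i j * (frame e y \<bullet> frame j y))) +
         (\<Sum>i\<in>I. \<Sum>j\<in>I. ?\<eta>' j * (index_cofactor I (gram y) i j * (frame e y \<bullet> frame i y))))"
      by (simp add: sum.distrib sum_distrib_left)
    also have "(\<Sum>i\<in>I. \<Sum>j\<in>I. ?\<eta>' j * (index_cofactor I (gram y) i j * (frame e y \<bullet> frame i y))) =
        (\<Sum>i\<in>I. \<Sum>j\<in>I. ?\<eta>' i * (index_cofactor I (gram y) j i * (frame e y \<bullet> frame j y)))"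
      by (rule sum.swap)
    finally show ?thesis
      by (simp add: sum.distrib[symmetric] sum_distrib_left[symmetric] distrib_left[symmetric] distrib_right[symmetric])
  qed
  also have "dens y powr (1 / 2) * (wt y * (- 2 * A * (?\<eta> * (\<Psi> y \<bullet> frame e y)))) + (1 / 2) * dens y powr (- (1 / 2)) *
     (?\<eta> * (\<Sum>i\<in>I. \<Sum>j\<in>I. index_cofactor I (gram y) i j * (dframe e i y \<bullet> frame j y + frame i y \<bullet> dframe e j y)) +
      (\<Sum>b\<in>I. ?\<eta>' b * (\<Sum>j\<in>I. (index_cofactor I (gram y) b j + index_cofactor I (gram y) j b) * (frame e y \<bullet> frame j y)))) * wt y =
     ?\<eta> * source y + (\<Sum>b\<in>I. ?\<eta>' b * flux b y)"
    by (simp add: source_def flux_def coef_def algebra_simps sum_distrib_left sum_distrib_right add_divide_distrib)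
  finally show ?thesis .
qed

lemma varied_density:
  assumes "(s, y) \<in> vdom q r"
  shows "max 0 (chart_density I (\<lambda>y. \<Psi> (chart_shear I q r e s y)) y) * gaussian_density c A (\<Psi> (chart_shear I q r e s y)) = vint q r (s, y)"
proof -
  let ?\<eta>' = "frechet_derivative (chart_bump I q r) (at y)"
  have Sh: "Sh q r (s, y) = chart_shear I q r e s y" by (simp add: Sh_def)
  have yV: "chart_shear I q r e s y \<in> V" and pos: "vdens q r (s, y) > 0" using assms by (auto simp: vdom_def Sh)
  have d\<eta>: "(chart_bump I q r has_derivative ?\<eta>') (at y)"
    by (rule times_differentiable_on_has_derivative[OF chart_bump_smooth[OF open_UNIV, of 1]]) auto
  have dSh: "(chart_shear I q r e s has_derivative (\<lambda>v. v + (s * ?\<eta>' v) *\<^sub>R e)) (at y)"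
    unfolding chart_shear_def [abs_def] by (auto intro!: derivative_eq_intros d\<eta>)
  have "((\<lambda>y. \<Psi> (chart_shear I q r e s y)) has_derivative (\<lambda>v. frame (v + (s * ?\<eta>' v) *\<^sub>R e) (chart_shear I q r e s y))) (at y)"
    unfolding frame_def by (rule has_derivative_compose[OF dSh C(15)[OF yV]])
  also have "(\<lambda>v. frame (v + (s * ?\<eta>' v) *\<^sub>R e) (chart_shear I q r e s y)) = (\<lambda>v. vframe q r v (s, y))"
    using linear_add[OF frame_linear[OF yV]] linear_scale[OF frame_linear[OF yV]] by (simp add: vframe_def Sh fun_eq_iff)
  finally have "frechet_derivative (\<lambda>y. \<Psi> (chart_shear I q r e s y)) (at y) = (\<lambda>v. vframe q r v (s, y))"
    by (rule frechet_derivative_at[symmetric])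
  then have "chart_density I (\<lambda>y. \<Psi> (chart_shear I q r e s y)) y = sqrt (vdens q r (s, y))"
    by (simp add: chart_density_def gram_det_eq_index_det vdens_def)
  then show ?thesis using pos by (simp add: vint_def wt_def Sh powr_half_sqrt)
qed

text \<open>Criticality, the derivative of the integrand, and integration by parts.\<close>

lemma bump_integral_zero:
  assumes X: "embedded_submanifold k X" and crit: "weighted_critical k (gaussian_density c A) X"
    and e: "\<And>b. b \<in> I \<Longrightarrow> e \<bullet> b = 0" and q: "q \<in> span I" and r: "r > 0" and disc: "cball q r \<subseteq> V0"
  shows "(LINT y|lborel_on I. indicator (cball q r \<inter> span I) y * (chart_bump I q r y * euler y)) = 0"
proof -
  define Dc where "Dc = cball q r \<inter> span I"
  have Dc: "compact Dc" "Dc \<subseteq> V0" unfolding Dc_def using disc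
    by (auto intro!: compact_Int_closed closed_subspace subspace_span simp del: subspace_span)
  have sub0: "{0} \<times> Dc \<subseteq> vdom q r"
  proof clarify
    fix y assume y: "y \<in> Dc"
    then have "y \<in> V0" using Dc by auto
    moreover have "Sh q r (0, y) = y" by (simp add: Sh_def chart_shear_def)
    moreover have "vdens q r (0, y) = dens y"
      by (simp add: vdens_def vframe_def Sh_def chart_shear_def dens_def gram_def [abs_def])
    ultimately show "(0, y) \<in> vdom q r" by (auto simp: vdom_def V0_def)
  qed
  \<comment> \<open>By compactness the integrand is smooth on the whole disc for a uniform time.\<close>
  obtain \<epsilon> where \<epsilon>: "\<epsilon> > 0" "(\<Union>z\<in>{0} \<times> Dc. cball z \<epsilon>) \<subseteq> vdom q r"
    using compact_subset_open_imp_ball_epsilon_subset[OF compact_Times[OF compact_sing Dc(1)] vdom_open(1) sub0]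
    by (metis compact_Times compact_sing compact_subset_open_imp_cball_epsilon_subset Dc(1) vdom_open(1) sub0)
  have in_dom: "(s, y) \<in> vdom q r" if "\<bar>s\<bar> \<le> \<epsilon>" "y \<in> Dc" for s y
    using \<epsilon>(2) that by (force simp: dist_Pair_Pair)
  interpret v: chart_variation k X I U V \<Phi> \<Psi> q e r \<epsilon>
  proof
    show "cball q r \<inter> span I \<subseteq> V" using disc V0(2) by auto
    show "chart_shear I q r e s y \<in> V" if "\<bar>s\<bar> \<le> \<epsilon>" "y \<in> cball q r \<inter> span I" for s y
      using in_dom[of s y] that by (auto simp: Dc_def vdom_def Sh_def)
  qed (use chart q r e \<epsilon>(1) in auto)
  have vD: "v.disc = Dc" by (simp add: v.disc_def Dc_def)
  define J where "J = (\<lambda>s. LINT y|lborel_on I. indicator Dc y * vint q r (s, y))"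
  have J: "(LINT x:v.F s ` v.K|riemannian_volume k (v.F s ` X). gaussian_density c A x) = J s" if s: "\<bar>s\<bar> \<le> \<epsilon>" for s
    unfolding v.weighted_area[OF s gaussian_density_borel] J_def vD
  proof (rule Bochner_Integration.integral_cong[OF refl])
    fix y
    show "indicator Dc y * (max 0 (chart_density I (v.\<Psi>' s) y) * gaussian_density c A (v.\<Psi>' s y)) = indicator Dc y * vint q r (s, y)"
      using varied_density[OF in_dom[OF s, of y]] by (auto simp: v.\<Psi>'_def [abs_def] split: split_indicator)
  qed
  have "((\<lambda>s. LINT x:v.F s ` v.K|riemannian_volume k (v.F s ` X). gaussian_density c A x) has_real_derivative 0) (at 0)"
    using crit v.variation[OF X] unfolding weighted_critical_def by blast
  then have "(J has_real_derivative 0) (at 0)"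
    by (rule has_field_derivative_transform_within_open[where S = "{-\<epsilon><..<\<epsilon>}"]) (use \<epsilon>(1) J in auto)
  then have dJ: "((\<lambda>h. (J h - J 0) / h) \<longlongrightarrow> 0) (at 0)" by (simp add: DERIV_def)
  define D where "D = (\<lambda>y. chart_bump I q r y * source y + (\<Sum>b\<in>I. frechet_derivative (chart_bump I q r) (at y) b * flux b y))"
  define j' where "j' = (\<lambda>z. frechet_derivative (vint q r) (at z) (1, 0))"
  have "continuous_on (vdom q r) j'"
    unfolding j'_def using times_differentiable_on_derivative[OF vint_smooth[of 1], of 0] by simp
  then have "continuous_on ({-\<epsilon>..\<epsilon>} \<times> Dc) j'"
    by (rule continuous_on_subset) (use in_dom in auto)
  then have "bounded (j' ` ({-\<epsilon>..\<epsilon>} \<times> Dc))"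
    using Dc(1) by (intro compact_imp_bounded compact_continuous_image compact_Times) auto
  then obtain M where M: "\<And>s y. s \<in> {-\<epsilon>..\<epsilon>} \<Longrightarrow> y \<in> Dc \<Longrightarrow> \<bar>j' (s, y)\<bar> \<le> M"
    unfolding bounded_iff real_norm_def by blast
  have lip: "\<bar>vint q r (s, y) - vint q r (0, y)\<bar> \<le> M * \<bar>s\<bar>" if s: "\<bar>s\<bar> \<le> \<epsilon>" and y: "y \<in> Dc" for s y
  proof -
    have "\<bar>vint q r (s, y) - vint q r (0, y)\<bar> \<le> M * \<bar>s - 0\<bar>"
    proof (rule field_differentiable_bound[of "{-\<epsilon>..\<epsilon>}" "\<lambda>s. vint q r (s, y)" "\<lambda>s. j' (s, y)", unfolded real_norm_def])
      fix t assume t: "t \<in> {-\<epsilon>..\<epsilon>}"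
      have "(t, y) \<in> vdom q r" using t y by (intro in_dom) auto
      from vint_line[OF this] show "((\<lambda>s. vint q r (s, y)) has_real_derivative j' (t, y)) (at t within {-\<epsilon>..\<epsilon>})"
        unfolding j'_def by (rule has_field_derivative_at_within)
    qed (use M y s \<epsilon>(1) in auto)
    then show ?thesis by simp
  qed
  have cont: "continuous_on Dc (\<lambda>y. vint q r (s, y))" if "\<bar>s\<bar> \<le> \<epsilon>" for s
    by (rule continuous_on_compose2[OF times_differentiable_on_continuous[OF vint_smooth]])
       (use in_dom that in \<open>auto intro!: continuous_intros\<close>)
  have int: "integrable (lborel_on I) (\<lambda>y. indicator Dc y * vint q r (s, y))" if "\<bar>s\<bar> \<le> \<epsilon>" for s
    by (rule integrable_indicator_compact[OF C(1) Dc(1) cont[OF that]])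
  have \<eta>1: "times_differentiable_on 2 UNIV (chart_bump I q r)" by (rule chart_bump_smooth) simp
  have bc: "continuous_on Dc (\<lambda>y. frechet_derivative (chart_bump I q r) (at y) b)" "continuous_on Dc (chart_bump I q r)" for b
    using times_differentiable_on_derivative[OF \<eta>1, of 0 b] times_differentiable_on_continuous[OF \<eta>1]
    by (auto intro: continuous_on_subset)
  have fc: "continuous_on Dc (flux b)" "continuous_on Dc source" "continuous_on Dc euler"
    "continuous_on Dc (\<lambda>y. frechet_derivative (flux b) (at y) b)" for b
    using times_differentiable_on_continuous[OF flux_smooth] times_differentiable_on_continuous[OF source_smooth] euler_continuous
      times_differentiable_on_derivative[OF flux_smooth[of 1], of 0 b] Dc(2)
    by (auto intro: continuous_on_subset)
  define \<tau> where "\<tau> = (\<lambda>n. \<epsilon> / real (Suc n))"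
  have \<tau>: "0 < \<tau> n" "\<tau> n \<le> \<epsilon>" for n using \<epsilon>(1) by (auto simp: \<tau>_def divide_le_eq mult_le_cancel_left1)
  have "(\<lambda>n. \<epsilon> * (1 / real (Suc n))) \<longlonglongrightarrow> \<epsilon> * 0"
    using LIMSEQ_Suc[OF lim_1_over_n[where 'a = real]] by (intro tendsto_mult tendsto_const) simp
  then have "\<tau> \<longlonglongrightarrow> 0" by (simp add: \<tau>_def)
  then have \<tau>0: "filterlim \<tau> (at 0) sequentially" using \<tau>(1) by (auto simp: filterlim_at less_imp_neq[symmetric])
  have "(\<lambda>n. LINT y|lborel_on I. (indicator Dc y * vint q r (\<tau> n, y) - indicator Dc y * vint q r (0, y)) / \<tau> n) \<longlonglongrightarrow>
      (LINT y|lborel_on I. indicator Dc y * D y)"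
  proof (rule integral_dominated_convergence[where w = "\<lambda>y. indicator Dc y * M"])
    have "continuous_on Dc D" unfolding D_def by (intro continuous_intros bc fc)
    then show "(\<lambda>y. indicator Dc y * D y) \<in> borel_measurable (lborel_on I)"
      by (intro borel_measurable_integrable integrable_indicator_compact C(1) Dc(1))
    show "(\<lambda>y. (indicator Dc y * vint q r (\<tau> n, y) - indicator Dc y * vint q r (0, y)) / \<tau> n) \<in> borel_measurable (lborel_on I)" for n
      using \<tau>[of n] \<epsilon>(1)
      by (intro borel_measurable_divide borel_measurable_diff borel_measurable_integrable[OF int] borel_measurable_const) auto
    show "integrable (lborel_on I) (\<lambda>y. indicator Dc y * M)"
      by (rule integrable_indicator_compact[OF C(1) Dc(1)]) auto
    show "AE y in lborel_on I. (\<lambda>n. (indicator Dc y * vint q r (\<tau> n, y) - indicator Dc y * vint q r (0, y)) / \<tau> n) \<longlonglongrightarrow> indicator Dc y * D y"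
    proof (rule AE_I2)
      fix y
      show "(\<lambda>n. (indicator Dc y * vint q r (\<tau> n, y) - indicator Dc y * vint q r (0, y)) / \<tau> n) \<longlonglongrightarrow> indicator Dc y * D y"
      proof (cases "y \<in> Dc")
        case True
        then have "((\<lambda>h. (vint q r (h, y) - vint q r (0, y)) / h) \<longlongrightarrow> D y) (at 0)"
          using vint_initial_derivative[of y q r] Dc(2) unfolding D_def DERIV_def by auto
        from filterlim_compose[OF this \<tau>0] show ?thesis using True by simp
      qed simp
    qed
    show "AE y in lborel_on I. norm ((indicator Dc y * vint q r (\<tau> n, y) - indicator Dc y * vint q r (0, y)) / \<tau> n) \<le> indicator Dc y * M" for n
    proof (rule AE_I2)
      fix y
      show "norm ((indicator Dc y * vint q r (\<tau> n, y) - indicator Dc y * vint q r (0, y)) / \<tau> n) \<le> indicator Dc y * M"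
        using lip[of "\<tau> n" y] \<tau>[of n] by (cases "y \<in> Dc") (auto simp: divide_le_eq)
    qed
  qed
  also have "(\<lambda>n. LINT y|lborel_on I. (indicator Dc y * vint q r (\<tau> n, y) - indicator Dc y * vint q r (0, y)) / \<tau> n) = (\<lambda>n. (J (\<tau> n) - J 0) / \<tau> n)"
  proof
    fix n
    have "\<bar>\<tau> n\<bar> \<le> \<epsilon>" "\<bar>0\<bar> \<le> \<epsilon>" using \<tau>[of n] \<epsilon>(1) by auto
    then show "(LINT y|lborel_on I. (indicator Dc y * vint q r (\<tau> n, y) - indicator Dc y * vint q r (0, y)) / \<tau> n) = (J (\<tau> n) - J 0) / \<tau> n"
      unfolding J_def integral_divide_zero by (subst Bochner_Integration.integral_diff[OF int int]) auto
  qed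
  finally have "(\<lambda>n. (J (\<tau> n) - J 0) / \<tau> n) \<longlonglongrightarrow> (LINT y|lborel_on I. indicator Dc y * D y)" .
  then have zero: "(LINT y|lborel_on I. indicator Dc y * D y) = 0"
    using filterlim_compose[OF dJ \<tau>0] LIMSEQ_unique by blast
  \<comment> \<open>move the derivatives from the bump to the flux\<close>
  define P where "P = (\<lambda>b y. frechet_derivative (chart_bump I q r) (at y) b * flux b y + chart_bump I q r y * frechet_derivative (flux b) (at y) b)"
  have Pc: "continuous_on Dc (P b)" for b unfolding P_def by (intro continuous_intros bc fc)
  have Pint: "integrable (lborel_on I) (\<lambda>y. indicator Dc y * P b y)" for b
    by (rule integrable_indicator_compact[OF C(1) Dc(1) Pc])
  have P0: "(LINT y|lborel_on I. indicator Dc y * P b y) = 0" if b: "b \<in> I" for b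
    using integral_derivative_bump_zero[OF C(1) q r b V0(1) _ flux_smooth[of 1]] disc unfolding P_def Dc_def by auto
  have Dint: "integrable (lborel_on I) (\<lambda>y. indicator Dc y * D y)"
    by (rule integrable_indicator_compact[OF C(1) Dc(1)]) (auto simp: D_def intro!: continuous_intros bc fc)
  have "indicator Dc y * (chart_bump I q r y * euler y) = indicator Dc y * D y - (\<Sum>b\<in>I. indicator Dc y * P b y)" for y
    by (simp add: euler_def D_def P_def sum.distrib sum_distrib_left algebra_simps)
  then have "(LINT y|lborel_on I. indicator Dc y * (chart_bump I q r y * euler y)) =
      (LINT y|lborel_on I. indicator Dc y * D y) - (\<Sum>b\<in>I. LINT y|lborel_on I. indicator Dc y * P b y)"
    using Dint Pint by (simp add: Bochner_Integration.integral_diff Bochner_Integration.integral_sum)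
  also have "\<dots> = 0" using zero P0 by simp
  finally show ?thesis by (simp add: Dc_def)
qed

text \<open>Otherwise \<open>euler\<close> is positive on a small ball, and so is its integral against a bump supported there.\<close>

lemma euler_nonpos:
  assumes X: "embedded_submanifold k X" and crit: "weighted_critical k (gaussian_density c A) X"
    and e: "\<And>b. b \<in> I \<Longrightarrow> e \<bullet> b = 0" and q: "q \<in> span I" "q \<in> V0"
  shows "euler q \<le> 0"
proof (rule ccontr)
  assume "\<not> euler q \<le> 0"
  then have q': "q \<in> V0 \<inter> euler -` {0<..}" using q by auto
  have "open (V0 \<inter> euler -` {0<..})" by (rule continuous_open_preimage[OF euler_continuous V0(1)]) simp
  then obtain r where r: "r > 0" "cball q r \<subseteq> V0 \<inter> euler -` {0<..}" using q' open_contains_cball by blast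
  let ?f = "\<lambda>y. indicator (cball q r \<inter> span I) y * (chart_bump I q r y * euler y)"
  have Dc: "compact (cball q r \<inter> span I)" by (simp add: compact_Int_closed closed_subspace)
  have "continuous_on (cball q r \<inter> span I) (\<lambda>y. chart_bump I q r y * euler y)"
    using times_differentiable_on_continuous[OF chart_bump_smooth[OF open_UNIV, of 0 I q r]] r(2)
    by (intro continuous_intros) (auto intro: continuous_on_subset[OF euler_continuous] continuous_on_subset)
  then have int: "integrable (lborel_on I) ?f" by (rule integrable_indicator_compact[OF C(1) Dc])
  have nn: "?f y \<ge> 0" for y
  proof (cases "y \<in> cball q r")
    case True
    then have "euler y > 0" using r(2) by auto
    then have "0 \<le> chart_bump I q r y * euler y"
      by (intro mult_nonneg_nonneg chart_bump_bounds(1)) simp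
    then show ?thesis by (auto split: split_indicator)
  qed simp
  have "(LINT y|lborel_on I. ?f y) = 0"
    using bump_integral_zero[OF X crit e q(1) r(1)] r(2) by auto
  then have "AE y in lborel_on I. ?f y = 0"
    using integral_nonneg_eq_0_iff_AE[OF int] nn by simp
  then have "AE y in lborel_on I. y \<notin> ball q r"
    using AE_lborel_on_span[OF C(1)]
  proof eventually_elim
    case (elim y)
    show ?case
    proof
      assume y: "y \<in> ball q r"
      then have "chart_bump I q r y > 0" using chart_bump_pos_iff[OF C(1) elim(2) r(1)] by simp
      moreover have "euler y > 0" using y r(2) by (auto simp: subset_eq)
      ultimately show False using elim y by auto
    qed
  qed
  then have "emeasure (lborel_on I) (ball q r) = 0"
    by (subst (asm) AE_iff_measurable[of "ball q r"]) auto
  then show False using emeasure_lborel_on_ball_pos[OF C(1) q(1) r(1)] by simp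
qed

end

text \<open>The inequality \<open>euler_nonpos\<close> for \<open>e\<close> and \<open>- e\<close> gives an equation: the mean curvature vector of a critical
  submanifold is \<open>- 2 A\<close> times the normal part of the position vector.\<close>

lemma critical_mean_curvature:
  fixes X :: "(real^'n) set"
  assumes chart: "slice_chart k X I U V \<Phi> \<Psi>" and c: "c > 0"
    and X: "embedded_submanifold k X" and crit: "weighted_critical k (gaussian_density c A) X"
    and q: "q \<in> V" "q \<in> span I" and e: "\<And>b. b \<in> I \<Longrightarrow> e \<bullet> b = 0"
    and iso: "\<And>v w. frechet_derivative \<Psi> (at q) v \<bullet> frechet_derivative \<Psi> (at q) w = v \<bullet> w"
  shows "(\<Sum>b\<in>I. frechet_derivative (\<lambda>y. frechet_derivative \<Psi> (at y) b) (at q) b) \<bullet> frechet_derivative \<Psi> (at q) e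
     = - 2 * A * (\<Psi> q \<bullet> frechet_derivative \<Psi> (at q) e)"
proof -
  define T where "T = (\<lambda>e. 2 * A * (\<Psi> q \<bullet> frechet_derivative \<Psi> (at q) e) +
    (\<Sum>b\<in>I. frechet_derivative (\<lambda>y. frechet_derivative \<Psi> (at y) b) (at q) b \<bullet> frechet_derivative \<Psi> (at q) e))"
  have I: "I \<subseteq> Basis" using slice_chartD(1)[OF chart] .
  have T: "T e \<ge> 0" if e: "\<And>b. b \<in> I \<Longrightarrow> e \<bullet> b = 0" for e
  proof -
    interpret f: chart_frame k X I U V \<Phi> \<Psi> e c A by standard (fact chart c)+
    have "f.frame i q \<bullet> f.frame j q = (if i = j then 1 else 0)" if "i \<in> I" "j \<in> I" for i j
      using inner_Basis[OF subsetD[OF I that(1)] subsetD[OF I that(2)]] by (simp add: f.frame_def iso)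
    moreover have "f.frame e q \<bullet> f.frame j q = 0" if "j \<in> I" for j
      using e that by (simp add: f.frame_def iso)
    ultimately have E: "q \<in> f.V0" "f.euler q = - f.wt q * T e"
      using f.euler_at_orthonormal[OF q(1)] by (auto simp: T_def f.frame_def [abs_def] f.dframe_def)
    have "f.euler q \<le> 0" by (rule f.euler_nonpos[OF X crit e q(2) E(1)])
    moreover have "f.wt q > 0" using c by (simp add: f.wt_def gaussian_density_def)
    ultimately show ?thesis unfolding E by (simp add: zero_le_mult_iff)
  qed
  have "T (- e) = - T e"
  proof -
    have "frechet_derivative \<Psi> (at q) (- e) = - frechet_derivative \<Psi> (at q) e"
      using linear_neg[OF has_derivative_linear[OF slice_chartD(15)[OF chart q(1)]]] .
    then show ?thesis by (simp add: T_def sum_negf)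
  qed
  then have "T e = 0" using T[of e] T[of "- e"] e by (simp add: inner_minus_left)
  then show ?thesis by (simp add: T_def inner_sum_left)
qed

section \<open>Half the squared distance to a closed set\<close>

text \<open>The function is an infimum of functions \<open>(norm (y - p))\<^sup>2 / 2\<close> whose second derivative is the identity; the one
  belonging to a nearest point of \<open>y\<close> bounds the second difference at \<open>y\<close>.\<close>

lemma drift_growth_infdist:
  fixes X :: "'a::euclidean_space set"
  assumes X: "closed X" "X \<noteq> {}"
  shows "drift_growth (\<lambda>y. (infdist y X)\<^sup>2 / 2)"
proof -
  let ?d = "\<lambda>y. infdist y X"
  have lip: "\<bar>?d (y + w) - ?d y\<bar> \<le> norm w" for y w
    using infdist_triangle[of "y + w" X y] infdist_triangle[of y X "y + w"] by (simp add: dist_norm)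
  have d0: "?d y \<le> ?d 0 + norm y" for y using lip[of 0 y] by simp
  show ?thesis
    unfolding drift_growth_def
  proof (intro conjI exI allI impI)
    show "continuous_on UNIV (\<lambda>y. (?d y)\<^sup>2 / 2)" by (intro continuous_intros) simp
    show "(?d y)\<^sup>2 / 2 \<ge> 0" for y by simp
    show "?d 0 + 1 \<ge> 0" using infdist_nonneg[of 0 X] by linarith
    show "\<bar>(?d (y + w))\<^sup>2 / 2 - (?d y)\<^sup>2 / 2\<bar> \<le> (?d 0 + 1) * (1 + norm y) * norm w" if w: "norm w \<le> 1" for y w
    proof -
      have s: "(?d (y + w) + ?d y) / 2 \<le> (?d 0 + 1) * (1 + norm y)"
      proof -
        have "?d (y + w) \<le> ?d y + 1" using lip[of y w] w by linarith
        then have "?d (y + w) + ?d y \<le> 2 * (?d 0 + norm y + 1)" using d0[of y] by simp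
        then have "(?d (y + w) + ?d y) / 2 \<le> ?d 0 + norm y + 1" by simp
        moreover have "0 \<le> ?d 0 * norm y" by (simp add: infdist_nonneg)
        ultimately show ?thesis by (simp add: algebra_simps)
      qed
      have "\<bar>(?d (y + w))\<^sup>2 / 2 - (?d y)\<^sup>2 / 2\<bar> = (?d (y + w) + ?d y) / 2 * \<bar>?d (y + w) - ?d y\<bar>"
      proof -
        have "(?d (y + w))\<^sup>2 / 2 - (?d y)\<^sup>2 / 2 = (?d (y + w) + ?d y) / 2 * (?d (y + w) - ?d y)"
          by (simp add: power2_eq_square field_simps)
        moreover have "(?d (y + w) + ?d y) / 2 \<ge> 0" by (simp add: infdist_nonneg)
        ultimately show ?thesis by (simp only: abs_mult abs_of_nonneg)
      qed
      also have "\<dots> \<le> (?d 0 + 1) * (1 + norm y) * norm w"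
        using infdist_nonneg[of 0 X] by (intro mult_mono s lip) simp_all
      finally show ?thesis .
    qed
    show "(?d (y + w))\<^sup>2 / 2 + (?d (y - w))\<^sup>2 / 2 - 2 * ((?d y)\<^sup>2 / 2) \<le> (norm w)\<^sup>2" for y w
    proof -
      obtain p where p: "p \<in> X" "?d y = dist y p" using infdist_attains_inf[OF X] by blast
      have "(?d (y + w))\<^sup>2 \<le> (norm ((y - p) + w))\<^sup>2" "(?d (y - w))\<^sup>2 \<le> (norm ((y - p) - w))\<^sup>2"
        using infdist_le[OF p(1), of "y + w"] infdist_le[OF p(1), of "y - w"]
        by (auto intro!: power_mono simp: infdist_nonneg dist_norm algebra_simps)
      moreover have "(norm ((y - p) + w))\<^sup>2 + (norm ((y - p) - w))\<^sup>2 = 2 * (norm (y - p))\<^sup>2 + 2 * (norm w)\<^sup>2"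
        by (simp add: power2_norm_eq_inner algebra_simps inner_commute)
      ultimately show ?thesis using p(2) by (simp add: dist_norm)
    qed
  qed
qed

lemma emeasure_neighborhood:
  fixes Y :: "'a::euclidean_space set"
  assumes "A > 0" "c > 0" "t \<ge> 0"
  shows "emeasure (gaussian_measure c A) (neighborhood Y t) =
    ennreal (LINT y|lborel. indicator {..t\<^sup>2 / 2} ((infdist y Y)\<^sup>2 / 2) * gaussian_density c A y)"
proof -
  have eq: "indicator (neighborhood Y t) y = (indicator {..t\<^sup>2 / 2} ((infdist y Y)\<^sup>2 / 2) :: real)" for y
    using assms(3) infdist_nonneg[of y Y] by (auto simp: neighborhood_def abs_le_square_iff[symmetric] split: split_indicator)
  have cl: "closed (neighborhood Y t)"
    unfolding neighborhood_def by (intro closed_Collect_le continuous_intros)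
  then have m: "neighborhood Y t \<in> sets lborel" by simp
  have "emeasure (gaussian_measure c A) (neighborhood Y t) =
      (\<integral>\<^sup>+y. ennreal (indicator (neighborhood Y t) y * gaussian_density c A y) \<partial>lborel)"
    unfolding gaussian_measure_def using m
    by (subst emeasure_density) (auto simp: gaussian_density_borel intro!: nn_integral_cong split: split_indicator)
  also have "\<dots> = ennreal (LINT y|lborel. indicator (neighborhood Y t) y * gaussian_density c A y)"
  proof (rule nn_integral_eq_integral)
    show "integrable lborel (\<lambda>y. indicator (neighborhood Y t) y * gaussian_density c A y)"
      using integrable_mult_indicator[OF m gaussian_density_integrable[OF assms(1)]] by simp
    show "AE y in lborel. 0 \<le> indicator (neighborhood Y t) y * gaussian_density c A y"
      using assms(2) by (simp add: gaussian_density_def)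
  qed
  finally show ?thesis by (simp only: eq)
qed

section \<open>The distance to a linear subspace\<close>

text \<open>With the orthogonal projection \<open>P\<close> onto \<open>S\<close> the function is \<open>(norm (y - P y))\<^sup>2 / 2\<close>, a quadratic polynomial with
  gradient \<open>y - P y\<close>. Its Hessian is the projection onto the orthogonal complement, whose trace is the codimension.\<close>

lemma infdist_subspace_solution:
  fixes S :: "'a::euclidean_space set"
  assumes S: "subspace S"
  shows "drift_solution A (real DIM('a) - real (dim S)) (\<lambda>y. (infdist y S)\<^sup>2 / 2)"
proof -
  obtain B where B: "B \<subseteq> S" "pairwise orthogonal B" "\<And>x. x \<in> B \<Longrightarrow> norm x = 1"
    "independent B" "card B = dim S" "span B = S"
    using orthonormal_basis_subspace[OF S] by metis
  have fin: "finite B" using B(4) by (rule independent_imp_finite)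
  define P where "P = (\<lambda>y. \<Sum>b\<in>B. (y \<bullet> b) *\<^sub>R b)"
  have PS: "P y \<in> S" for y
    unfolding P_def using B(1) by (intro subspace_sum S subspace_scale) auto
  have Pb: "P y \<bullet> b = y \<bullet> b" if b: "b \<in> B" for y b
  proof -
    have "P y \<bullet> b = (\<Sum>c\<in>B. if c = b then y \<bullet> b else 0)"
      unfolding P_def inner_sum_left
      using b B(2) B(3)[OF b] by (intro sum.cong) (auto simp: pairwise_def orthogonal_def norm_eq_1)
    then show ?thesis using b fin by simp
  qed
  have orth: "(y - P y) \<bullet> z = 0" if "z \<in> S" for y z
  proof -
    have "z \<in> span B" using that B(6) by simp
    moreover have "subspace {z. (y - P y) \<bullet> z = 0}" by (rule subspace_hyperplane)
    moreover have "B \<subseteq> {z. (y - P y) \<bullet> z = 0}" using Pb by (auto simp: inner_diff_left)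
    ultimately show ?thesis using span_minimal by blast
  qed
  have d: "infdist y S = norm (y - P y)" for y
  proof (rule antisym)
    show "infdist y S \<le> norm (y - P y)" using infdist_le[OF PS, of y y] by (simp add: dist_norm)
    obtain z where z: "z \<in> S" "infdist y S = dist y z"
      using infdist_attains_inf[OF closed_subspace[OF S], of y] subspace_0[OF S] by auto
    have "P y - z \<in> S" using PS z(1) S by (simp add: subspace_diff)
    then have "orthogonal (y - P y) (P y - z)" using orth by (simp add: orthogonal_def)
    then have "(norm (y - P y + (P y - z)))\<^sup>2 = (norm (y - P y))\<^sup>2 + (norm (P y - z))\<^sup>2" by (rule norm_add_Pythagorean)
    then have "(norm (y - P y))\<^sup>2 \<le> (norm (y - z))\<^sup>2" by simp
    then show "norm (y - P y) \<le> infdist y S" by (simp add: z(2) dist_norm)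
  qed
  let ?u = "\<lambda>y. (infdist y S)\<^sup>2 / 2"
  have u: "?u y = (y \<bullet> y - (\<Sum>b\<in>B. (y \<bullet> b)\<^sup>2)) / 2" for y
  proof -
    have "(norm (y - P y))\<^sup>2 = (y - P y) \<bullet> y - (y - P y) \<bullet> P y"
      by (simp add: power2_norm_eq_inner inner_diff_right)
    also have "\<dots> = y \<bullet> y - P y \<bullet> y" using orth[OF PS] by (simp add: inner_diff_left)
    also have "P y \<bullet> y = (\<Sum>b\<in>B. (y \<bullet> b)\<^sup>2)"
      unfolding P_def inner_sum_left by (intro sum.cong) (simp_all add: power2_eq_square inner_commute)
    finally show ?thesis by (simp add: d)
  qed
  define a where "a = (\<lambda>y c. (y - P y) \<bullet> c)"
  define q where "q = (\<lambda>(y::'a) c. 1 - (\<Sum>b\<in>B. (c \<bullet> b)\<^sup>2))"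
  have line: "?u (y + \<epsilon> *\<^sub>R w) = ?u y + ((y - P y) \<bullet> w) * \<epsilon> + (w \<bullet> w - (\<Sum>b\<in>B. (w \<bullet> b)\<^sup>2)) / 2 * \<epsilon>\<^sup>2" for y \<epsilon> w
  proof -
    have "(\<Sum>b\<in>B. ((y + \<epsilon> *\<^sub>R w) \<bullet> b)\<^sup>2) =
        (\<Sum>b\<in>B. (y \<bullet> b)\<^sup>2 + 2 * \<epsilon> * ((y \<bullet> b) * (b \<bullet> w)) + \<epsilon>\<^sup>2 * (w \<bullet> b)\<^sup>2)"
      by (intro sum.cong) (simp_all add: inner_add_left power2_eq_square algebra_simps inner_commute)
    also have "\<dots> = (\<Sum>b\<in>B. (y \<bullet> b)\<^sup>2) + 2 * \<epsilon> * (P y \<bullet> w) + \<epsilon>\<^sup>2 * (\<Sum>b\<in>B. (w \<bullet> b)\<^sup>2)"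
      by (simp add: sum.distrib sum_distrib_left P_def inner_sum_left)
    finally have 1: "(\<Sum>b\<in>B. ((y + \<epsilon> *\<^sub>R w) \<bullet> b)\<^sup>2) = \<dots>" .
    show ?thesis unfolding u 1 by (simp add: inner_add_left inner_add_right inner_diff_left inner_diff_right power2_eq_square inner_commute field_simps)
  qed
  show ?thesis
    unfolding drift_solution_def
  proof (intro conjI exI allI ballI)
    show "drift_growth ?u" using drift_growth_infdist[OF closed_subspace[OF S]] subspace_0[OF S] by auto
    show "?u (y + w) + ?u (y - w) - 2 * ?u y \<ge> 0" for y w
    proof -
      have "w \<bullet> w - (\<Sum>b\<in>B. (w \<bullet> b)\<^sup>2) = 2 * ?u w" by (simp add: u)
      then have "w \<bullet> w - (\<Sum>b\<in>B. (w \<bullet> b)\<^sup>2) \<ge> 0" by simp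
      then show ?thesis using line[of y 1 w] line[of y "-1" w] by (simp add: field_simps)
    qed
    show "?u (y + \<epsilon> *\<^sub>R b) = ?u y + a y b * \<epsilon> + q y b / 2 * \<epsilon>\<^sup>2" if "b \<in> Basis" for y \<epsilon> b
      using line[of y \<epsilon> b] that by (simp add: a_def q_def)
    show g: "(\<Sum>b\<in>Basis. (a y b)\<^sup>2) = 2 * ?u y" for y
    proof -
      have "(norm (y - P y))\<^sup>2 = (\<Sum>b\<in>Basis. ((y - P y) \<bullet> b)\<^sup>2)"
        by (subst power2_norm_eq_inner, subst euclidean_inner) (simp add: power2_eq_square)
      then show ?thesis by (simp add: a_def d)
    qed
    show "(\<Sum>b\<in>Basis. q y b - 2 * A * (y \<bullet> b) * a y b) = real DIM('a) - real (dim S) - 4 * A * ?u y" for y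
    proof -
      have "(\<Sum>c\<in>Basis. \<Sum>b\<in>B. (c \<bullet> b)\<^sup>2) = (\<Sum>b\<in>B. \<Sum>c\<in>Basis. (c \<bullet> b)\<^sup>2)" by (rule sum.swap)
      also have "\<dots> = (\<Sum>b\<in>B. 1)"
      proof (rule sum.cong)
        fix b assume "b \<in> B"
        then have "b \<bullet> b = 1" using B(3) by (simp add: norm_eq_1)
        then show "(\<Sum>c\<in>Basis. (c \<bullet> b)\<^sup>2) = 1"
          using euclidean_inner[of b b] by (simp add: power2_eq_square inner_commute)
      qed simp
      finally have 1: "(\<Sum>c\<in>Basis. q y c) = real DIM('a) - real (dim S)"
        using B(5) by (simp add: q_def sum_subtractf)
      have "(\<Sum>b\<in>Basis. (y \<bullet> b) * a y b) = y \<bullet> (y - P y)" by (simp add: a_def euclidean_inner[of y "y - P y"])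
      also have "\<dots> = 2 * ?u y"
      proof -
        have "(y - P y) \<bullet> (y - P y) = (y - P y) \<bullet> y" using orth[OF PS, of y y] by (simp add: inner_diff_right)
        then show ?thesis by (simp add: d power2_norm_eq_inner inner_commute)
      qed
      finally have 2: "(\<Sum>b\<in>Basis. (y \<bullet> b) * a y b) = 2 * ?u y" .
      have "(\<Sum>b\<in>Basis. q y b - 2 * A * (y \<bullet> b) * a y b) =
          (\<Sum>b\<in>Basis. q y b) - 2 * A * (\<Sum>b\<in>Basis. (y \<bullet> b) * a y b)"
        by (simp add: sum_subtractf sum_distrib_left mult.assoc)
      then show ?thesis using 1 2 by simp
    qed
  qed
qed

lemma AE_infdist_subspace_nonzero:
  fixes S :: "'a::euclidean_space set"
  assumes "subspace S" "dim S < DIM('a)"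
  shows "AE y in lborel. (infdist y S)\<^sup>2 / 2 \<noteq> 0"
proof -
  have "negligible S" by (rule negligible_lowdim[OF assms(2)])
  moreover have "S \<in> sets borel" using closed_subspace[OF assms(1)] by simp
  ultimately have "S \<in> null_sets lborel" by (simp add: negligible_iff_null_sets null_sets_completion_iff)
  then have "AE y in lborel. y \<notin> S" by (rule AE_not_in)
  then show ?thesis
  proof eventually_elim
    case (elim y)
    then have "infdist y S \<noteq> 0"
      using in_closed_iff_infdist_zero[OF closed_subspace[OF assms(1)]] subspace_0[OF assms(1)] by auto
    then show ?case by simp
  qed
qed

section \<open>Charts that are isometric at a point\<close>

text \<open>Send \<open>I\<close> to an orthonormal basis of \<open>T\<close>, and the other basis vectors to one of the orthogonal complement.\<close>

lemma exists_isometry_onto_subspace: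
  fixes T :: "'a::euclidean_space set"
  assumes T: "subspace T" "dim T = card I" and I: "I \<subseteq> (Basis :: 'a set)"
  shows "\<exists>R. linear R \<and> (\<forall>x y. R x \<bullet> R y = x \<bullet> y) \<and> R ` span I = T"
proof -
  define T' where "T' = {y. \<forall>x\<in>T. orthogonal x y}"
  have T': "subspace T'" "dim T' + dim T = DIM('a)"
    using dim_subspace_orthogonal_to_vectors[OF T(1) subspace_UNIV]
    by (auto simp: T'_def subspace_orthogonal_to_vectors)
  obtain B where B: "B \<subseteq> T" "pairwise orthogonal B" "\<And>x. x \<in> B \<Longrightarrow> norm x = 1"
    "independent B" "card B = dim T" "span B = T"
    using orthonormal_basis_subspace[OF T(1)] by metis
  obtain B' where B': "B' \<subseteq> T'" "pairwise orthogonal B'" "\<And>x. x \<in> B' \<Longrightarrow> norm x = 1"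
    "independent B'" "card B' = dim T'"
    using orthonormal_basis_subspace[OF T'(1)] by metis
  have fI: "finite I" using I finite_subset finite_Basis by blast
  have "card (Basis - I) = card B'"
    using I T T'(2) B'(5) fI by (simp add: card_Diff_subset)
  then obtain g where g: "bij_betw g (Basis - I) B'"
    using finite_same_card_bij[of "Basis - I" B'] independent_imp_finite[OF B'(4)] by auto
  obtain f where f: "bij_betw f I B"
    using finite_same_card_bij[OF fI independent_imp_finite[OF B(4)]] B(5) T(2) by auto
  define \<pi> where "\<pi> = (\<lambda>b. if b \<in> I then f b else g b)"
  have fB: "f b \<in> B" if "b \<in> I" for b using f that by (auto simp: bij_betw_def)
  have gB: "g b \<in> B'" if "b \<in> Basis - I" for b using g that by (auto simp: bij_betw_def)
  have ff: "f b \<bullet> f c = (if b = c then 1 else 0)" if "b \<in> I" "c \<in> I" for b c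
  proof -
    have "f b = f c \<longleftrightarrow> b = c" using f that by (auto simp: bij_betw_def inj_on_def)
    then show ?thesis using B(2) B(3)[OF fB[OF that(1)]] fB[OF that(1)] fB[OF that(2)]
      by (auto simp: pairwise_def orthogonal_def norm_eq_1)
  qed
  have gg: "g b \<bullet> g c = (if b = c then 1 else 0)" if "b \<in> Basis - I" "c \<in> Basis - I" for b c
  proof -
    have "g b = g c \<longleftrightarrow> b = c" using g that by (auto simp: bij_betw_def inj_on_def)
    then show ?thesis using B'(2) B'(3)[OF gB[OF that(1)]] gB[OF that(1)] gB[OF that(2)]
      by (auto simp: pairwise_def orthogonal_def norm_eq_1)
  qed
  have fg: "f b \<bullet> g c = 0" if "b \<in> I" "c \<in> Basis - I" for b c
    using fB[OF that(1)] gB[OF that(2)] B(1) B'(1) by (auto simp: T'_def orthogonal_def)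
  have \<pi>: "\<forall>b\<in>Basis. \<forall>c\<in>Basis. \<pi> b \<bullet> \<pi> c = (if b = c then 1 else 0)"
  proof (intro ballI)
    fix b c :: 'a assume "b \<in> Basis" "c \<in> Basis"
    then show "\<pi> b \<bullet> \<pi> c = (if b = c then 1 else 0)"
      using ff gg fg[of b c] fg[of c b] by (auto simp: \<pi>_def inner_commute)
  qed
  note R = basis_map_isometry[OF \<pi>]
  have Rb: "basis_map \<pi> b = \<pi> b" if "b \<in> Basis" for b
    unfolding basis_map_def using that
    by (subst sum.cong[OF refl, of _ _ "\<lambda>c. if c = b then \<pi> b else 0"]) (auto simp: inner_Basis)
  have "basis_map \<pi> ` span I = span (basis_map \<pi> ` I)" by (rule linear_span_image[OF R(1), symmetric])
  also have "basis_map \<pi> ` I = f ` I" using I Rb by (intro image_cong) (auto simp: \<pi>_def)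
  also have "\<dots> = B" using f by (simp add: bij_betw_def)
  finally show ?thesis using R B(6) by blast
qed

text \<open>Precompose any parametrization around \<open>p\<close> with an isometry that takes \<open>span I\<close> to the tangent space, followed
  by the inverse of the derivative. This is a linear change of coordinates that preserves \<open>span I\<close>.\<close>

lemma exists_isometric_chart:
  assumes "embedded_submanifold k X" "p \<in> (X :: 'a::euclidean_space set)"
  obtains I U V \<Phi> \<Psi> q where "slice_chart k X I U V \<Phi> \<Psi>" "q \<in> V" "q \<in> span I" "\<Psi> q = p"
    "\<And>v w. frechet_derivative \<Psi> (at q) v \<bullet> frechet_derivative \<Psi> (at q) w = v \<bullet> w"
proof -
  obtain I U V0 \<Phi>0 \<Psi>0 where p: "p \<in> U" and chart: "slice_chart k X I U V0 \<Phi>0 \<Psi>0"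
    using assms by (auto simp: embedded_submanifold_def)
  note C = slice_chartD[OF chart]
  define q0 where "q0 = \<Phi>0 p"
  have q0: "q0 \<in> V0" "\<Psi>0 q0 = p" "q0 \<in> span I"
    using C(5,6)[OF p] C(9)[OF C(5)[OF p]] assms(2) by (auto simp: q0_def)
  define D where "D = frechet_derivative \<Psi>0 (at q0)"
  define E where "E = frechet_derivative \<Phi>0 (at p)"
  have D: "(\<Psi>0 has_derivative D) (at q0)" using C(15)[OF q0(1)] by (simp add: D_def)
  have E: "(\<Phi>0 has_derivative E) (at p)" using C(14)[OF p] by (simp add: E_def)
  have lin: "linear D" "linear E" using D E by (auto intro: has_derivative_linear)
  have DE: "D (E v) = v" for v
  proof -
    have "((\<lambda>x. \<Psi>0 (\<Phi>0 x)) has_derivative (\<lambda>v. D (E v))) (at p)"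
      by (rule has_derivative_compose[OF E]) (use D in \<open>simp add: q0_def\<close>)
    moreover have "((\<lambda>x. \<Psi>0 (\<Phi>0 x)) has_derivative (\<lambda>v. v)) (at p)"
      by (rule has_derivative_transform_within_open[OF has_derivative_ident C(3) p]) (simp add: C(6))
    ultimately show ?thesis by (metis has_derivative_unique)
  qed
  have ED: "E (D v) = v" for v
  proof -
    have "((\<lambda>x. \<Phi>0 (\<Psi>0 x)) has_derivative (\<lambda>v. E (D v))) (at q0)"
      by (rule has_derivative_compose[OF D]) (use E q0 in simp)
    moreover have "((\<lambda>x. \<Phi>0 (\<Psi>0 x)) has_derivative (\<lambda>v. v)) (at q0)"
      by (rule has_derivative_transform_within_open[OF has_derivative_ident C(4) q0(1)]) (simp add: C(8))
    ultimately show ?thesis by (metis has_derivative_unique)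
  qed
  have "inj D" using ED by (metis injI)
  then have "dim (D ` span I) = dim I"
    using dim_image_eq[OF lin(1), of "span I"] by (auto intro: inj_on_subset)
  moreover have "dim I = card I" using independent_substdbasis dim_eq_card_independent C(1)
    by (metis independent_mono independent_Basis)
  ultimately obtain R where R: "linear R" "\<And>x y. R x \<bullet> R y = x \<bullet> y" "R ` span I = D ` span I"
    using exists_isometry_onto_subspace[OF linear_subspace_image[OF lin(1) subspace_span], of I I] C(1) by auto
  have "inj R"
  proof (rule injI)
    fix x y assume "R x = R y"
    then have "(x - y) \<bullet> (x - y) = 0" using R(2)[of "x - y" "x - y"] linear_diff[OF R(1), of x y] by simp
    then show "x = y" by simp
  qed
  then obtain R' where R': "linear R'" "\<And>x. R' (R x) = x" "\<And>x. R (R' x) = x"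
    using linear_injective_isomorphism[OF R(1)] by auto
  define M where "M = (\<lambda>w. E (R w))"
  define M' where "M' = (\<lambda>w. R' (D w))"
  have blin: "bounded_linear M" "bounded_linear M'"
    using linear_compose[OF R(1) lin(2)] linear_compose[OF lin(1) R'(1)]
    by (simp_all add: M_def M'_def o_def linear_conv_bounded_linear)
  have MM': "M (M' w) = w" "M' (M w) = w" for w by (simp_all add: M_def M'_def R' DE ED)
  have Mspan: "M w \<in> span I \<longleftrightarrow> w \<in> span I" for w
  proof
    assume "M w \<in> span I"
    then have "D (M w) \<in> R ` span I" using R(3) by auto
    then show "w \<in> span I" using R'(2) by (auto simp: M_def DE dest!: injD[OF \<open>inj R\<close>])
  next
    assume "w \<in> span I"
    then have "R w \<in> D ` span I" using R(3) by auto
    then show "M w \<in> span I" by (auto simp: M_def ED)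
  qed
  define V where "V = M -` V0"
  define \<Psi> where "\<Psi> = (\<lambda>w. \<Psi>0 (M w))"
  define \<Phi> where "\<Phi> = (\<lambda>x. M' (\<Phi>0 x))"
  have oV: "open V"
    unfolding V_def by (rule open_vimage[OF C(4)]) (rule bounded_linear.continuous_on[OF blin(1) continuous_on_id])
  have s1: "times_differentiable_on m U \<Phi>" for m
    unfolding \<Phi>_def by (rule times_differentiable_on_compose[OF C(3) subset_UNIV C(10) times_differentiable_on_bounded_linear[OF open_UNIV blin(2)]])
  have s2: "times_differentiable_on m V \<Psi>" for m
    unfolding \<Psi>_def by (rule times_differentiable_on_compose[OF oV _ times_differentiable_on_bounded_linear[OF oV blin(1)] C(11)]) (auto simp: V_def)
  have f: "\<Phi> x \<in> V" "\<Psi> (\<Phi> x) = x" if "x \<in> U" for x using that C(5,6) by (auto simp: V_def \<Phi>_def \<Psi>_def MM')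
  have g: "\<Psi> y \<in> U" "\<Phi> (\<Psi> y) = y" if "y \<in> V" for y using that C(7,8) by (auto simp: V_def \<Phi>_def \<Psi>_def MM')
  have "homeomorphism U V \<Phi> \<Psi>"
    by (rule homeomorphismI)
       (use f g times_differentiable_on_continuous[OF s1] times_differentiable_on_continuous[OF s2] in auto)
  moreover have "\<Phi> ` (U \<inter> X) = V \<inter> span I"
  proof (intro equalityI subsetI)
    fix y assume "y \<in> \<Phi> ` (U \<inter> X)"
    then obtain x where x: "x \<in> U" "x \<in> X" "y = \<Phi> x" by auto
    then have "\<Phi>0 x \<in> span I" using C(9)[OF C(5)] C(6) by simp
    then show "y \<in> V \<inter> span I" using x f Mspan[of y] by (auto simp: \<Phi>_def MM')
  next
    fix y assume y: "y \<in> V \<inter> span I"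
    then have "\<Psi> y \<in> X" using C(9)[of "M y"] Mspan[of y] by (auto simp: V_def \<Psi>_def)
    then show "y \<in> \<Phi> ` (U \<inter> X)" using y g[of y] by (auto intro!: image_eqI[of _ \<Phi> "\<Psi> y"])
  qed
  ultimately have sc: "slice_chart k X I U V \<Phi> \<Psi>"
    using C(1-3) s1 s2 oV by (simp add: slice_chart_def smooth_on_open_def)
  have "(M has_derivative M) (at (M' q0))" using blin(1) by (rule bounded_linear_imp_has_derivative)
  from has_derivative_compose[OF this, of \<Psi>0 D] D have "(\<Psi> has_derivative (\<lambda>v. D (M v))) (at (M' q0))"
    by (simp add: MM' \<Psi>_def)
  then have "frechet_derivative \<Psi> (at (M' q0)) = (\<lambda>v. D (M v))" by (rule frechet_derivative_at[symmetric])
  then have "frechet_derivative \<Psi> (at (M' q0)) = R" by (simp add: M_def DE)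
  then show thesis
    using R(2) q0 Mspan[of "M' q0"] by (intro that[OF sc, of "M' q0"]) (simp_all add: V_def \<Psi>_def MM')
qed

section \<open>The distance to a critical submanifold\<close>

lemma half_square_distance_has_derivative:
  fixes \<Psi> :: "'a::euclidean_space \<Rightarrow> 'a"
  assumes d: "(\<Psi> has_derivative frechet_derivative \<Psi> (at (q + s *\<^sub>R z))) (at (q + s *\<^sub>R z))"
  shows "((\<lambda>s. (norm (y + s *\<^sub>R w - \<Psi> (q + s *\<^sub>R z)))\<^sup>2 / 2) has_real_derivative
    (y + s *\<^sub>R w - \<Psi> (q + s *\<^sub>R z)) \<bullet> (w - frechet_derivative \<Psi> (at (q + s *\<^sub>R z)) z)) (at s)"
proof -
  let ?D = "frechet_derivative \<Psi> (at (q + s *\<^sub>R z))"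
  let ?g = "\<lambda>s. y + s *\<^sub>R w - \<Psi> (q + s *\<^sub>R z)"
  have "((\<lambda>s. q + s *\<^sub>R z) has_derivative (\<lambda>t. t *\<^sub>R z)) (at s)"
    by (auto intro!: derivative_eq_intros)
  from has_derivative_compose[OF this d]
  have "((\<lambda>s. \<Psi> (q + s *\<^sub>R z)) has_derivative (\<lambda>t. t *\<^sub>R ?D z)) (at s)"
    using linear_scale[OF has_derivative_linear[OF d]] by simp
  then have g: "(?g has_derivative (\<lambda>t. t *\<^sub>R (w - ?D z))) (at s)"
    by (auto intro!: derivative_eq_intros simp: scaleR_diff_right)
  have "((\<lambda>s. ?g s \<bullet> ?g s) has_derivative (\<lambda>t. ?g s \<bullet> (t *\<^sub>R (w - ?D z)) + (t *\<^sub>R (w - ?D z)) \<bullet> ?g s)) (at s)"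
    by (rule has_derivative_inner[OF g g])
  moreover have "(\<lambda>t. ?g s \<bullet> (t *\<^sub>R (w - ?D z)) + (t *\<^sub>R (w - ?D z)) \<bullet> ?g s) = (*) (2 * (?g s \<bullet> (w - ?D z)))"
    by (rule ext) (simp add: inner_commute)
  ultimately have "((\<lambda>s. ?g s \<bullet> ?g s) has_real_derivative 2 * (?g s \<bullet> (w - ?D z))) (at s)"
    by (simp only: has_field_derivative_def)
  from DERIV_cdivide[OF this, of 2] show ?thesis by (simp add: power2_norm_eq_inner)
qed

text \<open>  The barrier in the direction \<open>x\<close> is half the squared distance from \<open>y + \<epsilon> x\<close> to \<open>\<Psi> (q + \<epsilon> B x)\<close>, where \<open>Q (B x)\<close> is the
  tangential part of \<open>x\<close>. Its second derivative at \<open>0\<close> is the squared length of the normal part of \<open>x\<close>, which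
  sums up to the codimension over an orthonormal basis, minus the pairing of \<open>v\<close> with the second derivative of
  \<open>\<Psi>\<close>, which sums up to the mean curvature in the direction \<open>v\<close>.\<close>

lemma infdist_critical_expansion:
  fixes X :: "(real^'n) set"
  assumes A: "A > 0" "c > 0" and X: "closed X" "X \<noteq> {}" "embedded_submanifold k X"
    and crit: "weighted_critical k (gaussian_density c A) X"
  shows "\<exists>a q. (\<forall>b\<in>Basis. upper_expansion (\<lambda>\<epsilon>. (infdist (y + \<epsilon> *\<^sub>R b) X)\<^sup>2 / 2) (a b) (q b)) \<and>
    (\<Sum>b\<in>Basis. (a b)\<^sup>2) = 2 * ((infdist y X)\<^sup>2 / 2) \<and>
    (\<Sum>b\<in>Basis. q b - 2 * A * (y \<bullet> b) * a b) = real CARD('n) - real k - 4 * A * ((infdist y X)\<^sup>2 / 2)"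
proof -
  obtain p where p: "p \<in> X" "infdist y X = dist y p" using infdist_attains_inf[OF X(1,2)] by blast
  obtain I U V \<Phi> \<Psi> q where chart: "slice_chart k X I U V \<Phi> \<Psi>" and q: "q \<in> V" "q \<in> span I" "\<Psi> q = p"
    and iso: "\<And>v w. frechet_derivative \<Psi> (at q) v \<bullet> frechet_derivative \<Psi> (at q) w = v \<bullet> w"
    using exists_isometric_chart[OF X(3) p(1)] by metis
  note C = slice_chartD[OF chart]
  have finI: "finite I" using C(1) finite_subset finite_Basis by blast
  define Q where "Q = frechet_derivative \<Psi> (at q)"
  have linQ: "linear Q" unfolding Q_def by (rule has_derivative_linear[OF C(15)[OF q(1)]])
  have isoQ: "Q v \<bullet> Q w = v \<bullet> w" for v w by (simp add: Q_def iso)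
  define K where "K = (\<lambda>w z. frechet_derivative (\<lambda>y. frechet_derivative \<Psi> (at y) w) (at q) z)"
  have K: "((\<lambda>y. frechet_derivative \<Psi> (at y) w) has_derivative K w) (at q)" for w
    unfolding K_def
    using times_differentiable_on_has_derivative[OF times_differentiable_on_derivative[OF C(11)[of 2], of 1 w] _ q(1)]
    by simp
  define v where "v = y - p"
  have u: "(infdist y X)\<^sup>2 = v \<bullet> v" by (simp add: p(2) v_def dist_norm power2_norm_eq_inner)
  have line_in_V: "\<forall>\<^sub>F s in nhds (0::real). q + s *\<^sub>R z \<in> V" for z
  proof -
    have "((\<lambda>s::real. q + s *\<^sub>R z) \<longlongrightarrow> q + 0 *\<^sub>R z) (nhds 0)"
      by (intro tendsto_intros) (simp add: tendsto_ident_at filterlim_ident)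
    then show ?thesis using topological_tendstoD[OF _ C(4)] q(1) by auto
  qed
  have barrier: "(infdist x X)\<^sup>2 / 2 \<le> (norm (x - \<Psi> z))\<^sup>2 / 2" if "z \<in> V" "z \<in> span I" for x z
    using infdist_le[of "\<Psi> z" X x] C(9)[OF that(1)] that(2)
    by (auto simp: dist_norm infdist_nonneg intro!: power_mono)
  \<comment> \<open>The segment from the nearest point to \<open>y\<close> is normal to \<open>X\<close>.\<close>
  have normal: "v \<bullet> Q b = 0" if b: "b \<in> I" for b
  proof -
    let ?g = "\<lambda>s. (norm (y + s *\<^sub>R 0 - \<Psi> (q + s *\<^sub>R b)))\<^sup>2 / 2"
    have d: "(?g has_real_derivative v \<bullet> (0 - Q b)) (at 0)"
      using half_square_distance_has_derivative[of \<Psi> q 0 b y 0] C(15)[OF q(1)] by (simp add: q(3) v_def Q_def)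
    obtain e where e: "e > 0" "\<And>s. \<bar>s\<bar> < e \<Longrightarrow> q + s *\<^sub>R b \<in> V"
      using line_in_V[of b] by (auto simp: eventually_nhds_metric dist_real_def)
    have "\<forall>s. \<bar>0 - s\<bar> < e \<longrightarrow> ?g 0 \<le> ?g s"
    proof (intro allI impI)
      fix s :: real assume "\<bar>0 - s\<bar> < e"
      then have "q + s *\<^sub>R b \<in> V" using e by simp
      moreover have "q + s *\<^sub>R b \<in> span I" using q(2) b by (simp add: span_add span_scale span_base)
      ultimately show "?g 0 \<le> ?g s" using barrier[of "q + s *\<^sub>R b" y] p(2) q(3) by (simp add: dist_norm)
    qed
    from DERIV_local_min[OF d e(1) this] show ?thesis by simp
  qed
  have "inj Q"
  proof (rule injI)
    fix x y assume "Q x = Q y"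
    then have "(x - y) \<bullet> (x - y) = 0" using isoQ[of "x - y" "x - y"] linear_diff[OF linQ, of x y] by simp
    then show "x = y" by simp
  qed
  then obtain e where e: "Q e = v" using linear_injective_imp_surjective[OF linQ] by (metis surjD)
  have eI: "e \<bullet> b = 0" if "b \<in> I" for b using isoQ[of e b] normal[OF that] by (simp add: e)
  have curv: "(\<Sum>b\<in>I. K b b) \<bullet> v = - 2 * A * (p \<bullet> v)"
    using critical_mean_curvature[OF chart A(2) X(3) crit q(1,2) eI iso] e by (simp add: K_def Q_def q(3))
  define B where "B = (\<lambda>x. \<Sum>b\<in>I. (x \<bullet> Q b) *\<^sub>R b)"
  have BI: "B x \<in> span I" for x unfolding B_def by (intro span_sum span_scale span_base)
  have QB: "Q (B x) = (\<Sum>b\<in>I. (x \<bullet> Q b) *\<^sub>R Q b)" for x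
    by (simp add: B_def linear_sum[OF linQ] linear_scale[OF linQ])
  define a where "a = (\<lambda>b. v \<bullet> b)"
  define h where "h = (\<lambda>b. (b - Q (B b)) \<bullet> (b - Q (B b)) - v \<bullet> K (B b) (B b))"
  have exp: "upper_expansion (\<lambda>\<epsilon>. (infdist (y + \<epsilon> *\<^sub>R b) X)\<^sup>2 / 2) (a b) (h b)" for b
  proof (rule upper_expansion_le)
    let ?z = "B b"
    let ?D = "\<lambda>s. frechet_derivative \<Psi> (at (q + s *\<^sub>R ?z)) ?z"
    let ?f = "\<lambda>s. (norm (y + s *\<^sub>R b - \<Psi> (q + s *\<^sub>R ?z)))\<^sup>2 / 2"
    let ?f' = "\<lambda>s. (y + s *\<^sub>R b - \<Psi> (q + s *\<^sub>R ?z)) \<bullet> (b - ?D s)"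
    have d1: "\<forall>\<^sub>F s in nhds 0. (?f has_real_derivative ?f' s) (at s)"
      using line_in_V[of ?z]
    proof (rule eventually_mono)
      fix s :: real assume "q + s *\<^sub>R ?z \<in> V"
      from half_square_distance_has_derivative[OF C(15)[OF this]]
      show "(?f has_real_derivative ?f' s) (at s)" .
    qed
    have l: "((\<lambda>s. q + s *\<^sub>R ?z) has_derivative (\<lambda>t. t *\<^sub>R ?z)) (at 0)"
      by (auto intro!: derivative_eq_intros)
    have "((\<lambda>s. \<Psi> (q + s *\<^sub>R ?z)) has_derivative (\<lambda>t. Q (t *\<^sub>R ?z))) (at 0)"
      by (rule has_derivative_compose[OF l]) (use C(15)[OF q(1)] in \<open>simp add: Q_def\<close>)
    then have g1: "((\<lambda>s. y + s *\<^sub>R b - \<Psi> (q + s *\<^sub>R ?z)) has_derivative (\<lambda>t. t *\<^sub>R (b - Q ?z))) (at 0)"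
      by (auto intro!: derivative_eq_intros simp: scaleR_diff_right linear_scale[OF linQ])
    have "(?D has_derivative (\<lambda>t. K ?z (t *\<^sub>R ?z))) (at 0)"
      by (rule has_derivative_compose[OF l]) (use K in simp)
    then have g2: "((\<lambda>s. b - ?D s) has_derivative (\<lambda>t. - (t *\<^sub>R K ?z ?z))) (at 0)"
      by (auto intro!: derivative_eq_intros simp: linear_scale[OF has_derivative_linear[OF K]])
    have "(?f' has_derivative (\<lambda>t. (y + 0 *\<^sub>R b - \<Psi> (q + 0 *\<^sub>R ?z)) \<bullet> (- (t *\<^sub>R K ?z ?z)) + (t *\<^sub>R (b - Q ?z)) \<bullet> (b - ?D 0))) (at 0)"
      by (rule has_derivative_inner[OF g1 g2])
    moreover have "(\<lambda>t. (y + 0 *\<^sub>R b - \<Psi> (q + 0 *\<^sub>R ?z)) \<bullet> (- (t *\<^sub>R K ?z ?z)) + (t *\<^sub>R (b - Q ?z)) \<bullet> (b - ?D 0)) = (*) (h b)"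
      by (rule ext) (simp add: h_def q(3) v_def Q_def algebra_simps)
    ultimately have d2: "(?f' has_real_derivative h b) (at 0)" by (simp only: has_field_derivative_def)
    have "v \<bullet> Q (B b) = 0" by (simp add: QB inner_sum_right normal)
    then have "?f' 0 = a b" by (simp add: a_def q(3) v_def Q_def inner_diff_right)
    then show "upper_expansion ?f (a b) (h b)" using upper_expansion_second_derivative[OF d1 d2] by simp
    have "\<forall>\<^sub>F s in nhds 0. (infdist (y + s *\<^sub>R b) X)\<^sup>2 / 2 \<le> ?f s"
      using line_in_V[of ?z] by (rule eventually_mono) (intro barrier span_add span_scale BI q(2))
    then show "\<forall>\<^sub>F s in at 0. (infdist (y + s *\<^sub>R b) X)\<^sup>2 / 2 \<le> ?f s"
      by (simp add: eventually_at_filter eventually_mono)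
    show "(infdist (y + 0 *\<^sub>R b) X)\<^sup>2 / 2 = ?f 0" using p(2) by (simp add: q(3) dist_norm)
  qed
  have parseval: "(\<Sum>i\<in>Basis. (i \<bullet> x) * (i \<bullet> z)) = x \<bullet> z" for x z :: "real^'n"
    using euclidean_inner[of x z] by (simp add: inner_commute)
  have n: "(\<Sum>i\<in>Basis. (i - Q (B i)) \<bullet> (i - Q (B i))) = real CARD('n) - real k"
  proof -
    have 1: "(i - Q (B i)) \<bullet> (i - Q (B i)) = 1 - (\<Sum>b\<in>I. (i \<bullet> Q b)\<^sup>2)" if "i \<in> Basis" for i
    proof -
      have "i \<bullet> Q (B i) = (\<Sum>b\<in>I. (i \<bullet> Q b)\<^sup>2)" by (simp add: QB inner_sum_right power2_eq_square)
      moreover have "Q (B i) \<bullet> Q (B i) = (\<Sum>b\<in>I. (i \<bullet> Q b)\<^sup>2)"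
      proof -
        have "B i \<bullet> b = i \<bullet> Q b" if b: "b \<in> I" for b
        proof -
          have "B i \<bullet> b = (\<Sum>c\<in>I. if c = b then i \<bullet> Q b else 0)"
            unfolding B_def inner_sum_left using C(1) b
            by (intro sum.cong) (auto simp: inner_Basis subset_iff)
          then show ?thesis using b finI by simp
        qed
        then have "B i \<bullet> B i = (\<Sum>b\<in>I. (i \<bullet> Q b)\<^sup>2)"
          by (subst (2) B_def) (simp add: inner_sum_right power2_eq_square)
        then show ?thesis by (simp add: isoQ)
      qed
      ultimately show ?thesis using that by (simp add: inner_diff_left inner_diff_right inner_commute)
    qed
    have "(\<Sum>i\<in>Basis. \<Sum>b\<in>I. (i \<bullet> Q b)\<^sup>2) = (\<Sum>b\<in>I. \<Sum>i\<in>Basis. (i \<bullet> Q b)\<^sup>2)" by (rule sum.swap)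
    also have "\<dots> = (\<Sum>b\<in>I. 1)"
    proof (rule sum.cong)
      fix b assume "b \<in> I"
      then show "(\<Sum>i\<in>Basis. (i \<bullet> Q b)\<^sup>2) = 1"
        using parseval[of "Q b" "Q b"] C(1) by (auto simp: isoQ power2_eq_square subset_iff)
    qed simp
    finally have "(\<Sum>i\<in>Basis. \<Sum>b\<in>I. (i \<bullet> Q b)\<^sup>2) = real k" using C(2) by simp
    then show ?thesis by (simp add: 1 sum_subtractf)
  qed
  have KB: "K (B i) z = (\<Sum>b\<in>I. (i \<bullet> Q b) *\<^sub>R K b z)" for i z
  proof -
    have "((\<lambda>y. \<Sum>b\<in>I. (i \<bullet> Q b) *\<^sub>R frechet_derivative \<Psi> (at y) b) has_derivative (\<lambda>z. \<Sum>b\<in>I. (i \<bullet> Q b) *\<^sub>R K b z)) (at q)"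
      by (intro has_derivative_sum has_derivative_scaleR_right K)
    then have "((\<lambda>y. frechet_derivative \<Psi> (at y) (B i)) has_derivative (\<lambda>z. \<Sum>b\<in>I. (i \<bullet> Q b) *\<^sub>R K b z)) (at q)"
    proof (rule has_derivative_transform_within_open[OF _ C(4) q(1)])
      fix y assume "y \<in> V"
      note l = has_derivative_linear[OF C(15)[OF this]]
      show "(\<Sum>b\<in>I. (i \<bullet> Q b) *\<^sub>R frechet_derivative \<Psi> (at y) b) = frechet_derivative \<Psi> (at y) (B i)"
        by (simp add: B_def linear_sum[OF l] linear_scale[OF l])
    qed
    from has_derivative_unique[OF K this] show ?thesis by simp
  qed
  \<comment> \<open>The trace of a bilinear form is the same in all orthonormal bases of the tangent space.\<close>
  have tr: "(\<Sum>i\<in>Basis. K (B i) (B i)) = (\<Sum>b\<in>I. K b b)"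
  proof -
    have KBB: "K (B i) (B i) = (\<Sum>b\<in>I. \<Sum>c\<in>I. ((i \<bullet> Q b) * (i \<bullet> Q c)) *\<^sub>R K b c)" for i
    proof -
      have "K b (B i) = (\<Sum>c\<in>I. (i \<bullet> Q c) *\<^sub>R K b c)" for b
        unfolding B_def by (simp add: linear_sum[OF has_derivative_linear[OF K]] linear_scale[OF has_derivative_linear[OF K]])
      then show ?thesis unfolding KB[of i "B i"] by (simp add: scaleR_sum_right)
    qed
    have "(\<Sum>i\<in>Basis. K (B i) (B i)) = (\<Sum>b\<in>I. \<Sum>i\<in>Basis. \<Sum>c\<in>I. ((i \<bullet> Q b) * (i \<bullet> Q c)) *\<^sub>R K b c)"
      unfolding KBB by (rule sum.swap)
    also have "\<dots> = (\<Sum>b\<in>I. \<Sum>c\<in>I. \<Sum>i\<in>Basis. ((i \<bullet> Q b) * (i \<bullet> Q c)) *\<^sub>R K b c)"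
      by (intro sum.cong refl sum.swap)
    also have "\<dots> = (\<Sum>b\<in>I. \<Sum>c\<in>I. (b \<bullet> c) *\<^sub>R K b c)"
      by (simp add: parseval isoQ flip: scaleR_sum_left)
    also have "\<dots> = (\<Sum>b\<in>I. K b b)"
    proof (rule sum.cong)
      fix b assume b: "b \<in> I"
      have "(\<Sum>c\<in>I. (b \<bullet> c) *\<^sub>R K b c) = (\<Sum>c\<in>I. if c = b then K b b else 0)"
        using C(1) b by (intro sum.cong) (auto simp: inner_Basis subset_iff)
      then show "(\<Sum>c\<in>I. (b \<bullet> c) *\<^sub>R K b c) = K b b" using b finI by simp
    qed simp
    finally show ?thesis .
  qed
  have h: "(\<Sum>i\<in>Basis. h i) = real CARD('n) - real k + 2 * A * (p \<bullet> v)"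
  proof -
    have "(\<Sum>i\<in>Basis. h i) = (\<Sum>i\<in>Basis. (i - Q (B i)) \<bullet> (i - Q (B i))) - v \<bullet> (\<Sum>i\<in>Basis. K (B i) (B i))"
      by (simp add: h_def sum_subtractf inner_sum_right)
    also have "\<dots> = real CARD('n) - real k - v \<bullet> (\<Sum>b\<in>I. K b b)" by (simp only: n tr)
    finally show ?thesis using curv by (simp add: inner_commute)
  qed
  have va: "(\<Sum>b\<in>Basis. (z \<bullet> b) * a b) = z \<bullet> v" for z
    unfolding a_def by (rule euclidean_inner[symmetric])
  have "(\<Sum>b\<in>Basis. (a b)\<^sup>2) = 2 * ((infdist y X)\<^sup>2 / 2)"
  proof -
    have "(\<Sum>b\<in>Basis. (a b)\<^sup>2) = v \<bullet> v" using va[of v] by (simp add: a_def power2_eq_square)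
    then show ?thesis by (simp add: u)
  qed
  moreover have "(\<Sum>b\<in>Basis. h b - 2 * A * (y \<bullet> b) * a b) = real CARD('n) - real k - 4 * A * ((infdist y X)\<^sup>2 / 2)"
  proof -
    have "(\<Sum>b\<in>Basis. h b - 2 * A * (y \<bullet> b) * a b) = (\<Sum>b\<in>Basis. h b) - 2 * A * (\<Sum>b\<in>Basis. (y \<bullet> b) * a b)"
      by (simp add: sum_subtractf sum_distrib_left mult.assoc)
    also have "\<dots> = real CARD('n) - real k - 2 * A * (v \<bullet> v)"
      unfolding h va by (subst (3) v_def) (simp add: inner_diff_left algebra_simps)
    finally show ?thesis by (simp add: u)
  qed
  ultimately show ?thesis using exp by blast
qed

lemma infdist_critical_supersolution:
  fixes X :: "(real^'n) set"
  assumes "A > 0" "c > 0" and X: "closed X" "X \<noteq> {}" "embedded_submanifold k X"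
    and "weighted_critical k (gaussian_density c A) X"
  shows "drift_supersolution A (real CARD('n) - real k) (\<lambda>y. (infdist y X)\<^sup>2 / 2)"
proof -
  have "\<forall>y. \<exists>a q. (\<forall>b\<in>Basis. upper_expansion (\<lambda>\<epsilon>. (infdist (y + \<epsilon> *\<^sub>R b) X)\<^sup>2 / 2) (a b) (q b)) \<and>
    (\<Sum>b\<in>Basis. (a b)\<^sup>2) = 2 * ((infdist y X)\<^sup>2 / 2) \<and>
    (\<Sum>b\<in>Basis. q b - 2 * A * (y \<bullet> b) * a b) = real CARD('n) - real k - 4 * A * ((infdist y X)\<^sup>2 / 2)"
    using infdist_critical_expansion[OF assms] by blast
  then obtain a q where
    "\<And>y. (\<forall>b\<in>Basis. upper_expansion (\<lambda>\<epsilon>. (infdist (y + \<epsilon> *\<^sub>R b) X)\<^sup>2 / 2) (a y b) (q y b)) \<and>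
    (\<Sum>b\<in>Basis. (a y b)\<^sup>2) = 2 * ((infdist y X)\<^sup>2 / 2) \<and>
    (\<Sum>b\<in>Basis. q y b - 2 * A * (y \<bullet> b) * a y b) = real CARD('n) - real k - 4 * A * ((infdist y X)\<^sup>2 / 2)"
    by (auto dest!: choice)
  then show ?thesis
    unfolding drift_supersolution_def using drift_growth_infdist[OF X(1,2)] by (intro conjI exI[of _ a] exI[of _ q]) auto
qed

section \<open>Comparison with a subspace\<close>

text \<open>A slice chart with \<open>I = Basis\<close> has its whole domain in \<open>X\<close>, so \<open>X\<close> is open as well as closed.\<close>

lemma full_dimensional_submanifold:
  fixes X :: "'a::euclidean_space set"
  assumes X: "embedded_submanifold DIM('a) X" "closed X" "X \<noteq> {}"
  shows "X = UNIV"
proof -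
  have "open X"
  proof (subst open_subopen, intro ballI)
    fix p assume "p \<in> X"
    then obtain I U V \<Phi> \<Psi> where p: "p \<in> U" and chart: "slice_chart DIM('a) X I U V \<Phi> \<Psi>"
      using X(1) by (auto simp: embedded_submanifold_def)
    note C = slice_chartD[OF chart]
    have "I = Basis" using C(1,2) by (simp add: card_subset_eq)
    then have "x \<in> X" if "x \<in> U" for x using C(9)[OF C(5)[OF that]] C(6)[OF that] by simp
    then show "\<exists>T. open T \<and> p \<in> T \<and> T \<subseteq> X" using C(3) p by blast
  qed
  then show ?thesis using X(2,3) clopen by blast
qed

theorem proposition5p1:
  fixes X :: "(real ^ 'n) set" and S :: "(real ^ 'n) set" and k :: nat and A c t :: real
  assumes "k \<le> CARD('n)"
    and "A > 0" and "c > 0"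
    and "X \<noteq> {}"
    and "properly_embedded_submanifold k X"
    and "weighted_critical k (gaussian_density c A) X"
    and "subspace S" and "dim S = k"
    and "t > 0"
  shows "emeasure (gaussian_measure c A) (neighborhood X t)
       \<ge> emeasure (gaussian_measure c A) (neighborhood S t)"
proof (cases "k = CARD('n)")
  case True
  then have "X = UNIV"
    using assms(4,5) full_dimensional_submanifold[of X] by (simp add: properly_embedded_submanifold_def)
  then have "neighborhood X t = UNIV" using assms(9) by (simp add: neighborhood_def)
  then show ?thesis by (intro emeasure_mono) (simp_all add: gaussian_measure_def)
next
  case False
  note A = assms(2,3)
  have X: "closed X" "X \<noteq> {}" "embedded_submanifold k X"
    using assms(4,5) by (simp_all add: properly_embedded_submanifold_def)
  have "drift_supersolution A (real CARD('n) - real k) (\<lambda>y. (infdist y X)\<^sup>2 / 2)"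
    by (rule infdist_critical_supersolution[OF A X assms(6)])
  moreover have "drift_solution A (real CARD('n) - real k) (\<lambda>y. (infdist y S)\<^sup>2 / 2)"
    using infdist_subspace_solution[OF assms(7), of A] by (simp add: assms(8))
  moreover have "AE y in lborel. (infdist y S)\<^sup>2 / 2 \<noteq> 0"
    using AE_infdist_subspace_nonzero[OF assms(7)] False assms(1,8) by simp
  moreover have "t\<^sup>2 / 2 > 0" using assms(9) by simp
  ultimately have "(LINT y|lborel. indicator {..t\<^sup>2 / 2} ((infdist y S)\<^sup>2 / 2) * gaussian_density c A y) \<le>
      (LINT y|lborel. indicator {..t\<^sup>2 / 2} ((infdist y X)\<^sup>2 / 2) * gaussian_density c A y)"
    by (rule sublevel_comparison[OF A])
  then show ?thesis using A assms(9) by (simp add: emeasure_neighborhood ennreal_leI)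
qed

end
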